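(* Given a tree decomposition of width $w$ of an $n$-vertex undirected graph $G$ whose treewidth is $w$, there is an algorithm that finds a maximum-sized binary tree in $G$ in time $w^{O(w)}n$.
   Context: For an undirected graph $G$, a subgraph $T$ is a binary tree in $G$ if $T$ is connected, acyclic, and $\deg_T(v)\le 3$ for every $v\in V(T)$; its size is its number of vertices. A tree decomposition of $G$ is a tree $T$ with a bag $X_i\subseteq V(G)$ for every node $i$ such that the bags cover $V(G)$, every edge of $G$ has both endpoints in some bag, and for every vertex the tree nodes whose bags contain it form a connected subtree; its width is $\max_i |X_i|-1$, and the treewidth of $G$ is the minimum width of a tree decomposition.
   Formalization: The given tree decomposition is assumed to have at most w^{O(w)} n nodes, so that it can be read within the claimed time, and G is assumed to have at least one vertex; the algorithm is a fixed unit-cost RAM program with words bounded by w^{O(w)} n. *)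

theory Defs
  imports Main
begin

section \<open>Undirected graphs\<close>

text \<open>
  Symmetric digraphs are not used here, because on them the closed walk
  \<open>u, v, u\<close> counts as a cycle, so no graph with an edge would be acyclic.
\<close>

record 'a ugraph =
  uverts :: "'a set"
  uedges :: "'a set set"

definition ugraph :: "'a ugraph \<Rightarrow> bool" where
  "ugraph G \<longleftrightarrow> finite (uverts G) \<and> (\<forall>e\<in>uedges G. e \<subseteq> uverts G \<and> card e = 2)"

definition usubgraph :: "'a ugraph \<Rightarrow> 'a ugraph \<Rightarrow> bool" where
  "usubgraph H G \<longleftrightarrow> ugraph H \<and> uverts H \<subseteq> uverts G \<and> uedges H \<subseteq> uedges G"

definition uinduced :: "'a ugraph \<Rightarrow> 'a set \<Rightarrow> 'a ugraph" where
  "uinduced G S = \<lparr>uverts = uverts G \<inter> S, uedges = {e \<in> uedges G. e \<subseteq> S}\<rparr>"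

definition uwalk :: "'a ugraph \<Rightarrow> 'a list \<Rightarrow> bool" where
  "uwalk G xs \<longleftrightarrow> xs \<noteq> [] \<and> set xs \<subseteq> uverts G \<and>
     (\<forall>i. Suc i < length xs \<longrightarrow> {xs ! i, xs ! Suc i} \<in> uedges G)"

definition uconnected :: "'a ugraph \<Rightarrow> bool" where
  "uconnected G \<longleftrightarrow> uverts G \<noteq> {} \<and>
     (\<forall>u\<in>uverts G. \<forall>v\<in>uverts G. \<exists>xs. uwalk G xs \<and> hd xs = u \<and> last xs = v)"

definition ucycle :: "'a ugraph \<Rightarrow> 'a list \<Rightarrow> bool" where
  "ucycle G xs \<longleftrightarrow> uwalk G xs \<and> distinct xs \<and> length xs \<ge> 3 \<and> {last xs, hd xs} \<in> uedges G"

definition uacyclic :: "'a ugraph \<Rightarrow> bool" where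
  "uacyclic G \<longleftrightarrow> (\<nexists>xs. ucycle G xs)"

definition udegree :: "'a ugraph \<Rightarrow> 'a \<Rightarrow> nat" where
  "udegree G v = card {e \<in> uedges G. v \<in> e}"

definition utree :: "'a ugraph \<Rightarrow> bool" where
  "utree T \<longleftrightarrow> ugraph T \<and> uconnected T \<and> uacyclic T"

definition binary_tree_in :: "'a ugraph \<Rightarrow> 'a ugraph \<Rightarrow> bool" where
  "binary_tree_in G T \<longleftrightarrow> usubgraph T G \<and> uconnected T \<and> uacyclic T \<and>
     (\<forall>v\<in>uverts T. udegree T v \<le> 3)"

definition max_binary_tree_in :: "'a ugraph \<Rightarrow> 'a ugraph \<Rightarrow> bool" where
  "max_binary_tree_in G T \<longleftrightarrow> binary_tree_in G T \<and>
     (\<forall>T'. binary_tree_in G T' \<longrightarrow> card (uverts T') \<le> card (uverts T))"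


section \<open>Tree decompositions\<close>

definition tree_decomposition :: "'a ugraph \<Rightarrow> 'b ugraph \<Rightarrow> ('b \<Rightarrow> 'a set) \<Rightarrow> bool" where
  "tree_decomposition G T X \<longleftrightarrow> utree T \<and>
     (\<Union>i\<in>uverts T. X i) = uverts G \<and>
     (\<forall>e\<in>uedges G. \<exists>i\<in>uverts T. e \<subseteq> X i) \<and>
     (\<forall>v\<in>uverts G. uconnected (uinduced T {i. v \<in> X i}))"

text \<open>
  On natural numbers the subtraction truncates, which only matters for the graph
  without vertices.
\<close>

definition width :: "'b ugraph \<Rightarrow> ('b \<Rightarrow> 'a set) \<Rightarrow> nat" where
  "width T X = Max ((\<lambda>i. card (X i)) ` uverts T) - 1"

text \<open>
  Decomposition trees are finite, so it is no restriction to take their nodes from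
  \<^typ>\<open>nat\<close>.
\<close>

definition treewidth :: "'a ugraph \<Rightarrow> nat" where
  "treewidth G = (LEAST k. \<exists>(T :: nat ugraph) X. tree_decomposition G T X \<and> width T X = k)"


section \<open>Random access machines\<close>

text \<open>
  Algorithms are while programs of a word RAM. The memory consists of arrays of
  natural numbers; as array names occur in a program only literally, a program
  accesses a fixed finite number of arrays. Every operation in an expression, every
  assignment and every test costs one unit of time.

  Unit cost is justified by the parameter \<open>B\<close> of the semantics: a run that writes a
  value above \<open>B\<close>, or writes at an index above \<open>B\<close>, is not an execution. So the machine
  has words of about \<open>log B\<close> bits, and the intermediate values in the expressions of a
  fixed program fit into a constant number of words. A test succeeds if the value
  is not 0; in particular \<open>Sub y x\<close> tests \<open>x < y\<close>.
\<close>

datatype expr =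
    Num nat
  | Read nat expr
  | Add expr expr
  | Sub expr expr
  | Mul expr expr
  | Div expr expr

datatype prog =
    Skip
  | Write nat expr expr
  | Seq prog prog
  | Cond expr prog prog
  | While expr prog

type_synonym memory = "nat \<Rightarrow> nat \<Rightarrow> nat"

fun eval_expr :: "expr \<Rightarrow> memory \<Rightarrow> nat" where
  "eval_expr (Num k) s = k"
| "eval_expr (Read a e) s = s a (eval_expr e s)"
| "eval_expr (Add e f) s = eval_expr e s + eval_expr f s"
| "eval_expr (Sub e f) s = eval_expr e s - eval_expr f s"
| "eval_expr (Mul e f) s = eval_expr e s * eval_expr f s"
| "eval_expr (Div e f) s = eval_expr e s div eval_expr f s"

fun cost_expr :: "expr \<Rightarrow> nat" where
  "cost_expr (Num k) = 1"
| "cost_expr (Read a e) = 1 + cost_expr e"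
| "cost_expr (Add e f) = 1 + cost_expr e + cost_expr f"
| "cost_expr (Sub e f) = 1 + cost_expr e + cost_expr f"
| "cost_expr (Mul e f) = 1 + cost_expr e + cost_expr f"
| "cost_expr (Div e f) = 1 + cost_expr e + cost_expr f"

text \<open>
  \<open>exec B P s t s'\<close>: with words bounded by \<open>B\<close>, program \<open>P\<close> started in memory \<open>s\<close>
  terminates after exactly \<open>t\<close> units of time in memory \<open>s'\<close>.
\<close>

inductive exec :: "nat \<Rightarrow> prog \<Rightarrow> memory \<Rightarrow> nat \<Rightarrow> memory \<Rightarrow> bool" for B where
  Skip: "exec B Skip s 1 s"
| Write: "eval_expr e s \<le> B \<Longrightarrow> eval_expr f s \<le> B \<Longrightarrow>
    exec B (Write a e f) s (1 + cost_expr e + cost_expr f)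
      (s(a := (s a)(eval_expr e s := eval_expr f s)))"
| Seq: "exec B P s t s' \<Longrightarrow> exec B Q s' u s'' \<Longrightarrow> exec B (Seq P Q) s (t + u) s''"
| CondTrue: "eval_expr e s \<noteq> 0 \<Longrightarrow> exec B P s t s' \<Longrightarrow>
    exec B (Cond e P Q) s (1 + cost_expr e + t) s'"
| CondFalse: "eval_expr e s = 0 \<Longrightarrow> exec B Q s t s' \<Longrightarrow>
    exec B (Cond e P Q) s (1 + cost_expr e + t) s'"
| WhileTrue: "eval_expr e s \<noteq> 0 \<Longrightarrow> exec B P s t s' \<Longrightarrow> exec B (While e P) s' u s'' \<Longrightarrow>
    exec B (While e P) s (1 + cost_expr e + t + u) s''"
| WhileFalse: "eval_expr e s = 0 \<Longrightarrow> exec B (While e P) s (1 + cost_expr e) s"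

lemma exec_deterministic:
  "exec B P s t s' \<Longrightarrow> exec B P s u s'' \<Longrightarrow> t = u \<and> s' = s''"
proof (induction arbitrary: u s'' rule: exec.induct)
  case (Skip s)
  from Skip.prems show ?case by cases simp
next
  case (Write e s f a)
  from Write.prems show ?case by cases simp
next
  case (Seq P s t s' Q v r)
  from Seq.prems show ?case by cases (metis Seq.IH)
next
  case (CondTrue e s P t s' Q)
  from CondTrue.prems show ?case by cases (simp_all add: CondTrue.hyps CondTrue.IH)
next
  case (CondFalse e s Q t s' P)
  from CondFalse.prems show ?case by cases (simp_all add: CondFalse.hyps CondFalse.IH)
next
  case (WhileTrue e s P t s' v r)
  from WhileTrue.prems show ?case
  proof cases
    case (WhileTrue t' s1 u')
    with \<open>\<And>u s''. exec B P s u s'' \<Longrightarrow> t = u \<and> s' = s''\<close>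
      \<open>\<And>u s''. exec B (While e P) s' u s'' \<Longrightarrow> v = u \<and> r = s''\<close>
    show ?thesis by metis
  next
    case WhileFalse
    with \<open>eval_expr e s \<noteq> 0\<close> show ?thesis by simp
  qed
next
  case (WhileFalse e s P)
  from WhileFalse.prems show ?case by cases (simp_all add: WhileFalse.hyps)
qed

definition input_memory :: "nat list \<Rightarrow> memory" where
  "input_memory xs = (\<lambda>a i. if a = 0 \<and> i < length xs then xs ! i else 0)"

definition has_output :: "memory \<Rightarrow> nat list \<Rightarrow> bool" where
  "has_output s xs \<longleftrightarrow> (\<forall>i < length xs. s 1 i = xs ! i)"


section \<open>Encoding of graphs and tree decompositions\<close>

definition edge_of :: "nat \<times> nat \<Rightarrow> nat set" where
  "edge_of p = {fst p, snd p}"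

definition graph_of :: "nat list \<Rightarrow> (nat \<times> nat) list \<Rightarrow> nat ugraph" where
  "graph_of vs es = \<lparr>uverts = set vs, uedges = edge_of ` set es\<rparr>"

definition valid_graph_lists :: "nat list \<Rightarrow> (nat \<times> nat) list \<Rightarrow> bool" where
  "valid_graph_lists vs es \<longleftrightarrow>
     distinct vs \<and> distinct (map edge_of es) \<and> ugraph (graph_of vs es)"

definition encode_list :: "nat list \<Rightarrow> nat list" where
  "encode_list xs = length xs # xs"

definition encode_edges :: "(nat \<times> nat) list \<Rightarrow> nat list" where
  "encode_edges es = length es # concat (map (\<lambda>(u, v). [u, v]) es)"

text \<open>
  The input consists of the number \<open>n\<close> of vertices and the edge list of a graph on
  \<open>{0..<n}\<close>, the number of nodes and the edge list of a tree on \<open>{0..<length bs}\<close>,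
  and the bag \<open>bs ! i\<close> of every node \<open>i\<close>. The width is not part of the input.
\<close>

definition encode_input ::
  "nat \<Rightarrow> (nat \<times> nat) list \<Rightarrow> (nat \<times> nat) list \<Rightarrow> nat list list \<Rightarrow> nat list" where
  "encode_input n es ts bs =
     n # encode_edges es @ length bs # encode_edges ts @ concat (map encode_list bs)"

definition encode_graph :: "nat list \<Rightarrow> (nat \<times> nat) list \<Rightarrow> nat list" where
  "encode_graph vs es = encode_list vs @ encode_edges es"

text \<open>
  The functions \<open>w\<^bsup>O(w)\<^esup> n\<close> are those bounded by \<open>fpt_bound c w n\<close> for some constant \<open>c\<close>.
  The factor \<open>c\<close> is absorbed by the power for \<open>w \<ge> 2\<close>; for \<open>w \<le> 1\<close>, where the power
  is 1, it gives the bound \<open>O(n)\<close>.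
\<close>

definition fpt_bound :: "nat \<Rightarrow> nat \<Rightarrow> nat \<Rightarrow> nat" where
  "fpt_bound c w n = c * w ^ (c * w) * n"

end

theory Submission
  imports Defs
begin

text \<open>
  A tree with an edge set \<open>F \<noteq> {}\<close> has \<open>|F| + 1\<close> vertices, so it suffices to maximise \<open>|F|\<close> over the
  connected forests \<open>F\<close> of maximum degree 3.  Stripping leaves turns the decomposition tree into a
  sequence of bags in which every node precedes its parent and a vertex that occurs in a bag and
  in some later bag also occurs in the bag of the parent.  Every edge of the graph becomes a further leaf,
  attached to a bag that contains both ends; then the only operation of the dynamic program
  is to merge the table of a node into the table of its parent.

  A partial solution at a node is a forest \<open>F\<close> of maximum degree 3 among the edges below the node
  all of whose components meet the bag.  Its state consists of the degrees of the bag vertices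
  and the partition of the bag into components, and states of disjoint forests that share bag vertices only
  determine whether the union is a partial solution, and its state.  There are \<open>w\<^bsup>O(w)\<^esup>\<close> states.
  A table maps states to cells; a cell is a single edge or refers to the two cells whose union it is, so
  an optimal tree can be read off.  It appears at the first node below which all of its edges lie,
  as a state with one component.
\<close>

section \<open>Multigraphs of labelled edges\<close>

text \<open>The obstacle is that a merge has to be decided from degrees and labels alone, although
  the forests behind the two states are unknown. The merge loop carries out such a replacement by
  auxiliary links between shared bag vertices, and each link is one union-find operation on labels.
  A link may be parallel to a real edge, which is why edges are triples with a number in the first
  component.

  For the running time, edge nodes are affordable because every edge is a pair of positions in some
  bag, so there are at most \<open>N * (W * W)\<close> of them. A merge tries all pairs of the
  \<open>(4 * W) ^ W\<close> codes and spends time of order \<open>W * W\<close> on each, so the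
  total is linear in the number of nodes. Cells are only ever appended, so merging never copies a
  solution.\<close>

type_synonym edge = "nat \<times> nat \<times> nat"

abbreviation src :: "edge \<Rightarrow> nat" where "src e \<equiv> fst (snd e)"
abbreviation dst :: "edge \<Rightarrow> nat" where "dst e \<equiv> snd (snd e)"

definition adj :: "edge set \<Rightarrow> nat \<Rightarrow> nat \<Rightarrow> bool" where
  "adj F u v \<longleftrightarrow> (\<exists>e\<in>F. src e = u \<and> dst e = v \<or> src e = v \<and> dst e = u)"

definition con :: "edge set \<Rightarrow> nat \<Rightarrow> nat \<Rightarrow> bool" where
  "con F = (adj F)\<^sup>*\<^sup>*"

definition ends :: "edge set \<Rightarrow> nat set" where
  "ends F = src ` F \<union> dst ` F"

definition deg :: "edge set \<Rightarrow> nat \<Rightarrow> nat" where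
  "deg F v = card {e \<in> F. src e = v \<or> dst e = v}"

definition forest :: "edge set \<Rightarrow> bool" where
  "forest F \<longleftrightarrow> (\<forall>e\<in>F. \<not> con (F - {e}) (src e) (dst e))"

lemma adj_sym: "adj F u v \<Longrightarrow> adj F v u"
  unfolding adj_def by blast

lemma adj_mono: "adj F u v \<Longrightarrow> F \<subseteq> F' \<Longrightarrow> adj F' u v"
  unfolding adj_def by blast

lemma adj_ends: "adj F u v \<Longrightarrow> u \<in> ends F \<and> v \<in> ends F"
  unfolding adj_def ends_def by blast

lemma adj_Un: "adj (F \<union> F') u v \<longleftrightarrow> adj F u v \<or> adj F' u v"
  unfolding adj_def by blast

lemma adj_edge: "e \<in> F \<Longrightarrow> adj F (src e) (dst e)"
  unfolding adj_def by blast

lemma con_refl [simp, intro]: "con F u u"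
  unfolding con_def by simp

lemma con_sym: "con F u v \<Longrightarrow> con F v u"
  unfolding con_def
  by (induction rule: rtranclp_induct) (auto intro: converse_rtranclp_into_rtranclp adj_sym)

lemma con_trans: "con F u v \<Longrightarrow> con F v w \<Longrightarrow> con F u w"
  unfolding con_def by simp

lemma con_adj: "adj F u v \<Longrightarrow> con F u v"
  unfolding con_def by simp

lemma con_edge: "e \<in> F \<Longrightarrow> con F (src e) (dst e)"
  by (rule con_adj[OF adj_edge])

lemma con_mono: "con F u v \<Longrightarrow> F \<subseteq> F' \<Longrightarrow> con F' u v"
  unfolding con_def
  by (induction rule: rtranclp_induct)
    (auto intro: rtranclp.rtrancl_into_rtrancl dest: adj_mono)

lemma con_ends: "con F u v \<Longrightarrow> u = v \<or> u \<in> ends F \<and> v \<in> ends F"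
  unfolding con_def
  by (induction rule: rtranclp_induct) (auto dest: adj_ends)

lemma con_empty [simp]: "con {} u v \<longleftrightarrow> u = v"
  using con_ends[of "{}" u v] by (auto simp: ends_def)

lemma ends_mono: "F \<subseteq> F' \<Longrightarrow> ends F \<subseteq> ends F'"
  unfolding ends_def by blast

lemma ends_insert: "ends (insert e F) = {src e, dst e} \<union> ends F"
  unfolding ends_def by blast

lemma con_induct [consumes 1, case_names refl step]:
  assumes "con F u v" and "P u"
    and "\<And>x y. con F u x \<Longrightarrow> adj F x y \<Longrightarrow> P x \<Longrightarrow> P y"
  shows "P v"
  using assms(1) unfolding con_def
proof (induction rule: rtranclp_induct)
  case base
  show ?case by (rule assms(2))
next
  case (step x y)
  then show ?case using assms(3)[of x y] by (simp add: con_def)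
qed

text \<open>A walk through the new edge can be shortened until it uses it once, in one of the two
  directions. Read on classes this is the union step of union-find; \<open>relabel\<close> realises
  it on labels.\<close>

lemma con_insert:
  "con (insert (k, p, q) H) a b \<longleftrightarrow>
     con H a b \<or> con H a p \<and> con H q b \<or> con H a q \<and> con H p b"
proof
  assume "con (insert (k, p, q) H) a b"
  then show "con H a b \<or> con H a p \<and> con H q b \<or> con H a q \<and> con H p b"
  proof (induction rule: con_induct)
    case (step x y)
    from step(2) consider "adj H x y" | "x = p" "y = q" | "x = q" "y = p"
      unfolding adj_def by auto
    then show ?case
      using step(3) by cases (auto intro: con_trans con_adj)
  qed simp
next
  have m: "con H x y \<Longrightarrow> con (insert (k, p, q) H) x y" for x y
    by (rule con_mono) auto
  have e: "con (insert (k, p, q) H) p q"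
    using con_edge[of "(k, p, q)" "insert (k, p, q) H"] by simp
  assume "con H a b \<or> con H a p \<and> con H q b \<or> con H a q \<and> con H p b"
  then show "con (insert (k, p, q) H) a b"
    by (metis m e con_trans con_sym)
qed

lemma con_insert': "con (insert e H) a b \<longleftrightarrow>
     con H a b \<or> con H a (src e) \<and> con H (dst e) b \<or> con H a (dst e) \<and> con H (src e) b"
  using con_insert[of "fst e" "src e" "dst e" H a b] by simp

text \<open>The connection between the ends of \<open>k\<close> must pass through \<open>e\<close>.
  Closed up by \<open>k\<close> it is a cycle through both edges, and going around it the other way
  connects the ends of \<open>e\<close>.\<close>

lemma con_exchange:
  assumes "con (insert e H) (src k) (dst k)" "\<not> con H (src k) (dst k)"
  shows "con (insert k H) (src e) (dst e)"
  using assms con_sym unfolding con_insert' by blast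

lemma forest_mono: "forest F \<Longrightarrow> F' \<subseteq> F \<Longrightarrow> forest F'"
  unfolding forest_def by (meson Diff_mono con_mono subset_iff subset_refl)

lemma forest_empty [simp]: "forest {}"
  unfolding forest_def by simp

text \<open>If adding \<open>e\<close> made an old edge \<open>k\<close> lie on a cycle,
  \<open>con_exchange\<close> would connect the ends of \<open>e\<close> inside \<open>H\<close>
  already. So acyclicity is a test at the new edge only, and this is the test that the merge loop
  performs.\<close>

lemma forest_insert:
  assumes "e \<notin> H"
  shows "forest (insert e H) \<longleftrightarrow> forest H \<and> \<not> con H (src e) (dst e)"
proof
  assume f: "forest (insert e H)"
  then have "\<not> con (insert e H - {e}) (src e) (dst e)"
    unfolding forest_def by blast
  with assms forest_mono[OF f] show "forest H \<and> \<not> con H (src e) (dst e)"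
    by auto
next
  assume h: "forest H \<and> \<not> con H (src e) (dst e)"
  show "forest (insert e H)"
    unfolding forest_def
  proof
    fix k assume k: "k \<in> insert e H"
    show "\<not> con (insert e H - {k}) (src k) (dst k)"
    proof (cases "k = e")
      case True
      then show ?thesis using assms h by simp
    next
      case False
      with k have kH: "k \<in> H" by simp
      have n: "\<not> con (H - {k}) (src k) (dst k)"
        using h kH unfolding forest_def by blast
      have eq: "insert e H - {k} = insert e (H - {k})" using False by auto
      show ?thesis
      proof
        assume "con (insert e H - {k}) (src k) (dst k)"
        then have "con (insert k (H - {k})) (src e) (dst e)"
          using con_exchange n unfolding eq by blast
        then show False using h kH by (simp add: insert_absorb)
      qed
    qed
  qed
qed

text \<open>Cut the connection into stretches inside \<open>F1\<close> and stretches inside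
  \<open>F2\<close>. A nonempty stretch inside \<open>F1\<close> starts and ends in
  \<open>X\<close>, either at a vertex shared with \<open>F2\<close> or at \<open>u\<close> or
  \<open>v\<close>, and there \<open>F1'\<close> offers the same connection.\<close>

lemma con_replace:
  assumes sep: "ends F1 \<inter> ends F2 \<subseteq> X"
    and sub: "\<And>x y. x \<in> X \<Longrightarrow> y \<in> X \<Longrightarrow> con F1 x y \<Longrightarrow> con F1' x y"
    and u: "u \<in> ends F1 \<Longrightarrow> u \<in> X" and v: "v \<in> ends F1 \<Longrightarrow> v \<in> X"
    and c: "con (F1 \<union> F2) u v"
  shows "con (F1' \<union> F2) u v"
proof -
  \<comment> \<open>\<open>y\<close> is the vertex where the current stretch inside
    \<open>F1\<close> began. The connection up to \<open>y\<close> is already simulated; the stretch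
    is translated only when it is left through \<open>F2\<close> or when the walk ends. The case
    \<open>y = z\<close> is an empty stretch, which may lie outside \<open>X\<close>.\<close>
  let ?P = "\<lambda>z. \<exists>y. con (F1' \<union> F2) u y \<and> con F1 y z \<and> (y \<in> X \<or> y = z) \<and> (y \<in> ends F1 \<longrightarrow> y \<in> X)"
  have "?P v" using c
  proof (induction rule: con_induct)
    case refl
    then show ?case using u con_refl by blast
  next
    case (step z z')
    then obtain y where y: "con (F1' \<union> F2) u y" "con F1 y z" "y \<in> X \<or> y = z"
      "y \<in> ends F1 \<longrightarrow> y \<in> X" by blast
    from step(2) consider "adj F1 z z'" | "adj F2 z z'" by (auto simp: adj_Un)
    then show ?case
    proof cases
      case 1
      then have "y \<in> X" using y adj_ends by blast
      moreover have "con F1 y z'" using y(2) 1 con_adj con_trans by blast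
      ultimately show ?thesis using y(1) by blast
    next
      case 2
      have "con F1' y z"
      proof (cases "y = z")
        case False
        then have "z \<in> ends F1" using y con_ends by blast
        moreover have "z \<in> ends F2" using adj_ends[OF 2] by blast
        ultimately have "z \<in> X" using sep by blast
        with False y sub show ?thesis by blast
      qed simp
      then have "con (F1' \<union> F2) y z" by (rule con_mono) simp
      moreover have "con (F1' \<union> F2) z z'" using con_adj[OF 2] by (rule con_mono) simp
      ultimately have "con (F1' \<union> F2) u z'" using y(1) con_trans by blast
      moreover have "z' \<in> ends F1 \<longrightarrow> z' \<in> X" using adj_ends[OF 2] sep by blast
      ultimately show ?thesis using con_refl by blast
    qed
  qed
  then obtain y where y: "con (F1' \<union> F2) u y" "con F1 y v" "y \<in> X \<or> y = v" by blast
  have "con F1' y v"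
  proof (cases "y = v")
    case False
    then have "v \<in> ends F1" using y con_ends by blast
    with False y sub v show ?thesis by blast
  qed simp
  then have "con (F1' \<union> F2) y v" by (rule con_mono) simp
  with y(1) show ?thesis by (rule con_trans)
qed

text \<open>If an edge \<open>k\<close> of \<open>F1'\<close> closed a cycle, a minimal \<open>D \<subseteq> F2\<close> witnessing this would
  contain an edge that already closes a cycle with \<open>F1'\<close>, and such cycles are seen by
  connectivity on \<open>X\<close> alone.\<close>

lemma forest_replace:
  assumes fin: "finite F2" and dj': "F1' \<inter> F2 = {}" and dj: "F1 \<inter> F2 = {}"
    and sep': "ends F1' \<inter> ends F2 \<subseteq> X"
    and sub: "\<And>x y. x \<in> X \<Longrightarrow> y \<in> X \<Longrightarrow> con F1' x y \<Longrightarrow> con F1 x y"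
    and f1': "forest F1'" and f: "forest (F1 \<union> F2)"
  shows "forest (F1' \<union> F2)"
proof -
  have F2: "\<not> con (F1' \<union> (F2 - {e})) (src e) (dst e)" if e: "e \<in> F2" for e
  proof
    assume c: "con (F1' \<union> (F2 - {e})) (src e) (dst e)"
    have "src e \<in> ends F2" "dst e \<in> ends F2" using e unfolding ends_def by blast+
    moreover have "ends (F2 - {e}) \<subseteq> ends F2" by (rule ends_mono) auto
    ultimately have "con (F1 \<union> (F2 - {e})) (src e) (dst e)"
      using sep' by (intro con_replace[of F1' "F2 - {e}" X, OF _ sub _ _ c]) blast+
    moreover have "F1 \<union> (F2 - {e}) = F1 \<union> F2 - {e}" using e dj by auto
    ultimately show False using f e unfolding forest_def by auto
  qed
  show ?thesis
    unfolding forest_def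
  proof
    fix k assume k: "k \<in> F1' \<union> F2"
    show "\<not> con (F1' \<union> F2 - {k}) (src k) (dst k)"
    proof (cases "k \<in> F2")
      case True
      then have "F1' \<union> F2 - {k} = F1' \<union> (F2 - {k})" using dj' by auto
      with F2[OF True] show ?thesis by simp
    next
      case False
      with k have k1: "k \<in> F1'" by simp
      let ?C = "\<lambda>D. con ((F1' - {k}) \<union> D) (src k) (dst k)"
      have "\<not> ?C D" if "D \<subseteq> F2" for D
        using finite_subset[OF that fin] that
      proof (induction D rule: finite_induct)
        case empty
        then show ?case using f1' k1 unfolding forest_def by simp
      next
        case (insert e D)
        show ?case
        proof
          assume "?C (insert e D)"
          then have "con (insert e (F1' - {k} \<union> D)) (src k) (dst k)" by simp
          then have "con (insert k (F1' - {k} \<union> D)) (src e) (dst e)"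
            using con_exchange insert by blast
          moreover have "insert k (F1' - {k} \<union> D) \<subseteq> F1' \<union> (F2 - {e})"
            using k1 insert by auto
          ultimately have "con (F1' \<union> (F2 - {e})) (src e) (dst e)" by (rule con_mono)
          then show False using F2 insert by blast
        qed
      qed
      then have "\<not> ?C F2" by blast
      moreover have "F1' \<union> F2 - {k} = (F1' - {k}) \<union> F2" using False by auto
      ultimately show ?thesis by simp
    qed
  qed
qed

text \<open>A walk can leave \<open>F1\<close> only at a vertex that is also an end of
  \<open>F2\<close>, hence in \<open>X\<close>. This carries the condition that every component
  meets the bag from a union to its parts.\<close>

lemma con_part_reaches:
  assumes sep: "ends F1 \<inter> ends F2 \<subseteq> X" and a: "a \<in> ends F1" and c: "con (F1 \<union> F2) a z"
  shows "con F1 a z \<or> (\<exists>y\<in>X. con F1 a y)"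
  using c
proof (induction rule: con_induct)
  case (step x y)
  from step(2) consider "adj F1 x y" | "adj F2 x y" by (auto simp: adj_Un)
  then show ?case
  proof cases
    case 1
    then show ?thesis using step(3) con_adj con_trans by blast
  next
    case 2
    show ?thesis
    proof (cases "con F1 a x")
      case True
      then have "x \<in> ends F1" using a con_ends by blast
      then have "x \<in> X" using adj_ends[OF 2] sep by blast
      then show ?thesis using True by blast
    qed (use step(3) in blast)
  qed
qed simp

lemma deg_Un:
  assumes "finite F1" "finite F2" "F1 \<inter> F2 = {}"
  shows "deg (F1 \<union> F2) v = deg F1 v + deg F2 v"
proof -
  have "{e \<in> F1 \<union> F2. src e = v \<or> dst e = v} =
    {e \<in> F1. src e = v \<or> dst e = v} \<union> {e \<in> F2. src e = v \<or> dst e = v}" by auto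
  then show ?thesis
    unfolding deg_def using assms by (simp add: card_Un_disjoint disjoint_iff)
qed

lemma deg_pos: "finite F \<Longrightarrow> deg F v > 0 \<longleftrightarrow> v \<in> ends F"
proof -
  assume "finite F"
  moreover have "{e \<in> F. src e = v \<or> dst e = v} \<noteq> {} \<longleftrightarrow> v \<in> ends F"
    unfolding ends_def by blast
  ultimately show ?thesis unfolding deg_def card_gt_0_iff by simp
qed


section \<open>States of partial solutions\<close>

text \<open>Together the conditions force \<open>L p\<close> to be the least position of its class,
  so a partition has only one labelling on the positions. A label is itself a position and therefore
  fits into a bounded digit.\<close>

definition labelling :: "nat \<Rightarrow> (nat \<Rightarrow> nat) \<Rightarrow> edge set \<Rightarrow> (nat \<Rightarrow> nat) \<Rightarrow> bool" where
  "labelling W v F L \<longleftrightarrow> (\<forall>p<W. L p \<le> p \<and> L (L p) = L p \<and>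
     (\<forall>q<W. L p = L q \<longleftrightarrow> con F (v p) (v q)))"

text \<open>The smaller label survives, which keeps labels minimal in their classes. If the two
  labels agree already, nothing changes.\<close>

definition relabel :: "(nat \<Rightarrow> nat) \<Rightarrow> nat \<Rightarrow> nat \<Rightarrow> nat \<Rightarrow> nat" where
  "relabel L i j r = (if L r = max (L i) (L j) then min (L i) (L j) else L r)"

lemma labellingD:
  assumes "labelling W v F L" "p < W"
  shows "L p \<le> p" "L (L p) = L p" "L p < W" "q < W \<Longrightarrow> L p = L q \<longleftrightarrow> con F (v p) (v q)"
  using assms unfolding labelling_def by (auto intro: le_less_trans)

lemma labelling_relabel:
  assumes l: "labelling W v F L" and i: "i < W" and j: "j < W"
  shows "labelling W v (insert (k, v i, v j) F) (relabel L i j)"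
  unfolding labelling_def
proof (intro allI impI conjI)
  fix p assume p: "p < W"
  note d = labellingD[OF l p] labellingD[OF l i] labellingD[OF l j]
  show "relabel L i j p \<le> p"
    using d unfolding relabel_def by (auto simp: min_def max_def)
  show "relabel L i j (relabel L i j p) = relabel L i j p"
    using d unfolding relabel_def by (auto simp: min_def max_def)
  fix q assume q: "q < W"
  have c: "con F (v a) (v b) \<longleftrightarrow> L a = L b" if "a < W" "b < W" for a b
    using labellingD(4)[OF l that(1) that(2)] by simp
  show "relabel L i j p = relabel L i j q \<longleftrightarrow> con (insert (k, v i, v j) F) (v p) (v q)"
    unfolding con_insert c[OF p q] c[OF p i] c[OF p j] c[OF i q] c[OF j q]
    unfolding relabel_def by (auto simp: min_def max_def)
qed

lemma labelling_id:
  assumes "inj_on v {..<W}"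
  shows "labelling W v {} (\<lambda>p. p)"
  using assms unfolding labelling_def by (auto simp: inj_on_def)

lemma labelling_cong:
  assumes "labelling W v F L" "\<And>p q. p < W \<Longrightarrow> q < W \<Longrightarrow> con F (v p) (v q) \<longleftrightarrow> con F' (v p) (v q)"
  shows "labelling W v F' L"
  using assms unfolding labelling_def by simp

text \<open>A component that has lost contact with the bag can never be joined to later edges, so
  forests with such a component are dropped. A finished tree is not lost by this: it still meets the
  bag at the node where it is completed (\<open>tree_has_node\<close>).\<close>

definition good :: "nat \<Rightarrow> (nat \<Rightarrow> nat) \<Rightarrow> edge set \<Rightarrow> bool" where
  "good W v F \<longleftrightarrow> forest F \<and> (\<forall>z. deg F z \<le> 3) \<and> (\<forall>e\<in>F. \<exists>p<W. con F (src e) (v p))"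

definition state :: "nat \<Rightarrow> (nat \<Rightarrow> nat) \<Rightarrow> edge set \<Rightarrow> (nat \<Rightarrow> nat) \<Rightarrow> (nat \<Rightarrow> nat) \<Rightarrow> bool" where
  "state W v F L D \<longleftrightarrow> labelling W v F L \<and> (\<forall>p<W. D p = deg F (v p))"

text \<open>Positions are shifted by one so that 0 can stand for absence.\<close>

primrec find_pos :: "(nat \<Rightarrow> nat) \<Rightarrow> nat \<Rightarrow> nat \<Rightarrow> nat" where
  "find_pos v z 0 = 0"
| "find_pos v z (Suc q) = (if v q = z then Suc q else find_pos v z q)"

lemma find_pos_0: "find_pos v z W = 0 \<longleftrightarrow> (\<forall>q<W. v q \<noteq> z)"
  by (induction W) (auto simp: less_Suc_eq)

lemma find_pos_nz: "find_pos v z W \<noteq> 0 \<Longrightarrow> find_pos v z W - 1 < W \<and> v (find_pos v z W - 1) = z"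
  by (induction W) (auto simp: less_Suc_eq split: if_splits)

lemma find_pos_le: "find_pos v z W \<le> W"
  by (induction W) auto

section \<open>The merge of two states, computed position by position\<close>

context
  fixes tg L1 D1 L2 D2 :: "nat \<Rightarrow> nat"
begin

text \<open>\<open>tg p\<close> is meant to be the shifted position in the parent bag of the vertex
  at position \<open>p\<close> of the child bag, and 0 if the vertex is absent there. Remembering
  the last shared vertex of every label chains the shared vertices of a component: each one is
  linked to its predecessor.\<close>

primrec rep_fun :: "nat \<Rightarrow> nat \<Rightarrow> nat" where
  "rep_fun 0 = (\<lambda>_. 0)"
| "rep_fun (Suc p) = (if tg p = 0 then rep_fun p else (rep_fun p)(L1 p := tg p))"

primrec deg_fun :: "nat \<Rightarrow> nat \<Rightarrow> nat" where
  "deg_fun 0 = D2"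
| "deg_fun (Suc p) = (if tg p = 0 then deg_fun p
     else (deg_fun p)(tg p - 1 := deg_fun p (tg p - 1) + D1 p))"

primrec lab_fun :: "nat \<Rightarrow> nat \<Rightarrow> nat" where
  "lab_fun 0 = L2"
| "lab_fun (Suc p) = (if tg p = 0 \<or> rep_fun p (L1 p) = 0 then lab_fun p
     else relabel (lab_fun p) (rep_fun p (L1 p) - 1) (tg p - 1))"

text \<open>A link between two positions that already carry the same label would close a
  cycle.\<close>

primrec ok_fun :: "nat \<Rightarrow> bool" where
  "ok_fun 0 = True"
| "ok_fun (Suc p) = (ok_fun p \<and> (tg p = 0 \<or> rep_fun p (L1 p) = 0 \<or>
     lab_fun p (rep_fun p (L1 p) - 1) \<noteq> lab_fun p (tg p - 1)))"

text \<open>The condition on \<open>rep_fun\<close> lets every component of the child that has edges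
  keep a vertex in the parent bag. A bag vertex of degree 0 carries no edge and may be
  forgotten.\<close>

definition comb_ok :: "nat \<Rightarrow> bool" where
  "comb_ok W \<longleftrightarrow> ok_fun W \<and> (\<forall>p<W. (D1 p > 0 \<longrightarrow> rep_fun W (L1 p) \<noteq> 0) \<and> deg_fun W p \<le> 3)"

lemma rep_fun_0: "rep_fun p l = 0 \<longleftrightarrow> (\<forall>i<p. tg i \<noteq> 0 \<longrightarrow> L1 i \<noteq> l)"
  by (induction p) (auto simp: less_Suc_eq)

lemma rep_fun_nz: "rep_fun p l \<noteq> 0 \<Longrightarrow> \<exists>i<p. tg i \<noteq> 0 \<and> L1 i = l \<and> rep_fun p l = tg i"
  by (induction p) (auto simp: less_Suc_eq split: if_splits)

lemma deg_fun_eq: "deg_fun p q = D2 q + (\<Sum>i<p. if tg i = Suc q then D1 i else 0)"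
  by (induction p) auto

end

text \<open>\<open>sep\<close> and \<open>old\<close> are what a tree decomposition provides: the
  forests touch only in vertices of both bags, and \<open>F1\<close> has no vertex in the parent bag
  that the child bag does not show. Hence the two states contain everything about the interaction of
  \<open>F1\<close> and \<open>F2\<close>.\<close>

locale merge =
  fixes W :: nat and vx vy :: "nat \<Rightarrow> nat" and F1 F2 :: "edge set" and L1 D1 L2 D2 :: "nat \<Rightarrow> nat"
  assumes injx: "inj_on vx {..<W}" and injy: "inj_on vy {..<W}"
    and fin1: "finite F1" and fin2: "finite F2" and dj: "F1 \<inter> F2 = {}"
    and sep: "ends F1 \<inter> ends F2 \<subseteq> vx ` {..<W} \<inter> vy ` {..<W}"
    and old: "ends F1 \<inter> vy ` {..<W} \<subseteq> vx ` {..<W}"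
    and good1: "good W vx F1" and good2: "good W vy F2"
    and state1: "state W vx F1 L1 D1" and state2: "state W vy F2 L2 D2"
begin

definition tg :: "nat \<Rightarrow> nat" where "tg p = find_pos vy (vx p) W"

abbreviation "rep \<equiv> rep_fun tg L1"
abbreviation "lab \<equiv> lab_fun tg L1 L2"
abbreviation "ok \<equiv> ok_fun tg L1 L2"

lemma tg_nz: "tg p \<noteq> 0 \<Longrightarrow> tg p - 1 < W \<and> vy (tg p - 1) = vx p"
  unfolding tg_def by (rule find_pos_nz)

lemma tg_0: "tg p = 0 \<longleftrightarrow> vx p \<notin> vy ` {..<W}"
  unfolding tg_def find_pos_0 image_iff lessThan_iff Bex_def by metis

lemma lab1: "labelling W vx F1 L1" and lab2: "labelling W vy F2 L2"
  using state1 state2 unfolding state_def by auto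

lemma deg1: "p < W \<Longrightarrow> D1 p = deg F1 (vx p)" and deg2: "p < W \<Longrightarrow> D2 p = deg F2 (vy p)"
  using state1 state2 unfolding state_def by auto

text \<open>Relabelling adds a set \<open>K\<close> of auxiliary links that connects the same shared vertices as
  \<open>F1\<close>; the links get edge numbers that \<open>F1\<close> and \<open>F2\<close> do not use.\<close>

definition link_set :: "nat \<Rightarrow> nat \<Rightarrow> edge set \<Rightarrow> bool" where
  "link_set m p K \<longleftrightarrow> finite K \<and> (\<forall>e\<in>K. m \<le> fst e \<and> fst e < m + p) \<and>
    ends K \<subseteq> vx ` {i. i < p \<and> tg i \<noteq> 0} \<and> forest K \<and>
    (\<forall>i<p. \<forall>j<p. tg i \<noteq> 0 \<longrightarrow> tg j \<noteq> 0 \<longrightarrow> (L1 i = L1 j \<longleftrightarrow> con K (vx i) (vx j))) \<and>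
    labelling W vy (F2 \<union> K) (lab p) \<and> (ok p \<longleftrightarrow> forest (F2 \<union> K))"

text \<open>An iteration leaves \<open>K\<close> alone or adds a link from the current shared vertex
  to its predecessor in the same class. The current vertex is new to \<open>K\<close>, so
  \<open>K\<close> stays a forest; whether \<open>F2 \<union> K\<close> stays one is the label
  comparison of \<open>ok_fun\<close>.\<close>

lemma link_set_exists:
  assumes b: "\<And>e. e \<in> F1 \<union> F2 \<Longrightarrow> fst e < m" and p: "p \<le> W"
  shows "\<exists>K. link_set m p K"
  using p
proof (induction p)
  case 0
  show ?case
    using lab2 good2 by (intro exI[of _ "{}"]) (auto simp: ends_def good_def link_set_def)
next
  case (Suc p)
  from Suc obtain K where "link_set m p K" by auto
  then have K: "finite K" "\<And>e. e \<in> K \<Longrightarrow> m \<le> fst e \<and> fst e < m + p"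
    "ends K \<subseteq> vx ` {i. i < p \<and> tg i \<noteq> 0}" "forest K"
    "\<And>i j. i < p \<Longrightarrow> j < p \<Longrightarrow> tg i \<noteq> 0 \<Longrightarrow> tg j \<noteq> 0 \<Longrightarrow> L1 i = L1 j \<longleftrightarrow> con K (vx i) (vx j)"
    "labelling W vy (F2 \<union> K) (lab p)" "ok p \<longleftrightarrow> forest (F2 \<union> K)"
    unfolding link_set_def by blast+
  have pW: "p < W" using Suc by simp
  have neq: "vx i \<noteq> vx p" if "i < p" for i
    using inj_onD[OF injx, of i p] pW that by auto
  have new: "vx p \<notin> ends K"
    using K(3) neq by fastforce
  have newc: "\<not> con K (vx i) (vx p)" if "i < p" for i
    using con_ends[of K "vx i" "vx p"] new neq[OF that] by blast
  have ends': "ends K \<subseteq> vx ` {i. i < Suc p \<and> tg i \<noteq> 0}" using K(3) by auto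
  consider "tg p = 0" | "tg p \<noteq> 0" "rep p (L1 p) = 0" | "tg p \<noteq> 0" "rep p (L1 p) \<noteq> 0" by blast
  then show ?case
  proof cases
    case 1
    then show ?thesis
      using K ends' by (intro exI[of _ K]) (auto simp: less_Suc_eq link_set_def)
  next
    case 2
    then have n: "L1 i \<noteq> L1 p" if "i < p" "tg i \<noteq> 0" for i
      using that unfolding rep_fun_0 by blast
    have "L1 i = L1 j \<longleftrightarrow> con K (vx i) (vx j)"
      if "i < Suc p" "j < Suc p" "tg i \<noteq> 0" "tg j \<noteq> 0" for i j
    proof (cases "i = p \<or> j = p")
      case True
      then show ?thesis using that n newc con_sym by (auto simp: less_Suc_eq) metis+
    qed (use that K(5) in auto)
    then show ?thesis
      using K ends' 2 unfolding link_set_def by (intro exI[of _ K]) (auto simp: less_SucI)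
  next
    case 3
    obtain r where r: "r < p" "tg r \<noteq> 0" "L1 r = L1 p" "rep p (L1 p) = tg r"
      using rep_fun_nz[of tg L1 p "L1 p"] 3 by auto
    \<comment> \<open>The number \<open>m + p\<close> occurs neither in \<open>F2\<close>, whose
      numbers lie below \<open>m\<close>, nor in an earlier link, so \<open>e\<close> is new even if
      it is parallel to an existing edge.\<close>
    define e where "e = (m + p, vx r, vx p)"
    let ?K = "insert e K"
    have tr: "tg r - 1 < W" "vy (tg r - 1) = vx r" and tp: "tg p - 1 < W" "vy (tg p - 1) = vx p"
      using tg_nz r(2) 3 by auto
    have eK: "e \<notin> K" "e \<notin> F2" using K(2) b unfolding e_def by fastforce+
    have "forest ?K"
      using forest_insert[OF eK(1)] K(4) newc[OF r(1)] by (simp add: e_def)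
    moreover have "labelling W vy (F2 \<union> ?K) (lab (Suc p))"
      using labelling_relabel[OF K(6) tr(1) tp(1), of "m + p"] 3 r(4) tr(2) tp(2)
      by (simp add: e_def)
    moreover have "ok (Suc p) \<longleftrightarrow> forest (F2 \<union> ?K)"
      using forest_insert[of e "F2 \<union> K"] eK K(7) 3 r(4) tr tp
        labellingD(4)[OF K(6) tr(1) tp(1)] by (auto simp: e_def)
    moreover have "L1 i = L1 j \<longleftrightarrow> con ?K (vx i) (vx j)"
      if "i < Suc p" "j < Suc p" "tg i \<noteq> 0" "tg j \<noteq> 0" for i j
    proof -
      have *: "con ?K (vx i) (vx p) \<longleftrightarrow> L1 i = L1 p" if "i < p" "tg i \<noteq> 0" for i
        using K(5)[of i r] that r newc unfolding e_def con_insert by auto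
      have "con ?K (vx i) (vx j) \<longleftrightarrow> con K (vx i) (vx j)" if "i < p" "j < p" for i j
        using newc[OF that(1)] newc[OF that(2)] con_sym unfolding e_def con_insert by metis
      with * K(5) that show ?thesis
        by (auto simp: less_Suc_eq dest: con_sym) (metis con_sym)+
    qed
    moreover have "ends ?K \<subseteq> vx ` {i. i < Suc p \<and> tg i \<noteq> 0}"
      using ends' r 3 unfolding ends_insert e_def by auto
    moreover have "\<forall>e\<in>?K. m \<le> fst e \<and> fst e < m + Suc p" using K(2) unfolding e_def
      by (auto simp: less_SucI)
    ultimately show ?thesis using K(1) unfolding link_set_def by (intro exI[of _ ?K]) blast
  qed
qed

text \<open>\<open>K\<close> and \<open>F1\<close> are forests that connect the same shared
  vertices. So \<open>forest_replace\<close> exchanges them next to \<open>F2\<close> in both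
  directions, \<open>con_replace\<close> does so for connectivity, and for \<open>K\<close> the loop
  has computed the answer.\<close>

lemma comb:
  shows "ok W \<longleftrightarrow> forest (F1 \<union> F2)" and "labelling W vy (F1 \<union> F2) (lab W)"
proof -
  obtain m where m: "\<And>e. e \<in> F1 \<union> F2 \<Longrightarrow> fst e < m"
    using finite_imageI[of "F1 \<union> F2" fst] fin1 fin2 finite_nat_set_iff_bounded
    by (metis finite_Un imageI)
  obtain K where "link_set m W K" using link_set_exists[OF m order_refl] by blast
  then have K: "finite K" "\<And>e. e \<in> K \<Longrightarrow> m \<le> fst e"
    "ends K \<subseteq> vx ` {i. i < W \<and> tg i \<noteq> 0}" "forest K"
    "\<And>i j. i < W \<Longrightarrow> j < W \<Longrightarrow> tg i \<noteq> 0 \<Longrightarrow> tg j \<noteq> 0 \<Longrightarrow> L1 i = L1 j \<longleftrightarrow> con K (vx i) (vx j)"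
    "labelling W vy (F2 \<union> K) (lab W)" "ok W \<longleftrightarrow> forest (F2 \<union> K)"
    unfolding link_set_def by blast+
  let ?X = "vx ` {..<W} \<inter> vy ` {..<W}"
  have X: "\<exists>i<W. x = vx i \<and> tg i \<noteq> 0" if "x \<in> ?X" for x
    using that tg_0 by auto
  have KX: "ends K \<subseteq> ?X" using K(3) tg_0 by auto
  have eq: "con F1 x y \<longleftrightarrow> con K x y" if "x \<in> ?X" "y \<in> ?X" for x y
    using X[OF that(1)] X[OF that(2)] K(5) labellingD(4)[OF lab1] by auto
  have djK: "K \<inter> F2 = {}" using K(2) m by fastforce
  have KX2: "ends K \<inter> ends F2 \<subseteq> ?X" using KX by blast
  have "forest (F1 \<union> F2) \<longleftrightarrow> forest (K \<union> F2)"
    using forest_replace[OF fin2 djK dj KX2 _ K(4)]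
      forest_replace[OF fin2 dj djK sep] eq good1 unfolding good_def by blast
  then show "ok W \<longleftrightarrow> forest (F1 \<union> F2)" using K(7) by (simp add: Un_commute)
  have "con (F2 \<union> K) (vy p) (vy q) \<longleftrightarrow> con (F1 \<union> F2) (vy p) (vy q)" if "p < W" "q < W" for p q
  proof
    assume "con (F2 \<union> K) (vy p) (vy q)"
    then show "con (F1 \<union> F2) (vy p) (vy q)"
      using con_replace[OF KX2, of F1 "vy p" "vy q"] eq KX by (simp add: Un_commute subset_iff)
  next
    have *: "vy p \<in> ends F1 \<longrightarrow> vy p \<in> ?X" if "p < W" for p
      using old that by auto
    assume "con (F1 \<union> F2) (vy p) (vy q)"
    then show "con (F2 \<union> K) (vy p) (vy q)"
      using con_replace[OF sep, of K "vy p" "vy q"] eq *[OF that(1)] *[OF that(2)]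
      by (simp add: Un_commute)
  qed
  then show "labelling W vy (F1 \<union> F2) (lab W)" by (rule labelling_cong[OF K(6)])
qed

text \<open>Bags are injective, so at most one position of the child bag contributes to the sum. If
  there is none, \<open>old\<close> shows that the vertex has degree 0 in \<open>F1\<close>.\<close>

lemma comb_deg:
  assumes "q < W"
  shows "deg_fun tg D1 D2 W q = deg (F1 \<union> F2) (vy q)"
proof -
  have e: "tg i = Suc q \<longleftrightarrow> vx i = vy q" for i
  proof -
    have "tg i - 1 = q" if "vx i = vy q"
      using that tg_nz[of i] tg_0[of i] assms injy unfolding inj_on_def by auto
    then show ?thesis using tg_nz[of i] tg_0[of i] assms by fastforce
  qed
  have "(\<Sum>i<W. if tg i = Suc q then D1 i else 0) = deg F1 (vy q)"
  proof (cases "\<exists>i<W. vx i = vy q")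
    case True
    then obtain i where i: "i < W" "vx i = vy q" by blast
    have "(\<Sum>j<W. if tg j = Suc q then D1 j else 0) = (\<Sum>j<W. if j = i then D1 j else 0)"
      using i injx unfolding e inj_on_def by (intro sum.cong refl) (metis lessThan_iff)
    then show ?thesis using i deg1 by simp
  next
    case False
    then have "vy q \<notin> ends F1" using old assms by (force simp: image_iff)
    then have "deg F1 (vy q) = 0" using deg_pos[OF fin1] by blast
    then show ?thesis using False unfolding e by (auto intro!: sum.neutral)
  qed
  then show ?thesis
    using deg_fun_eq[of tg D1 D2 W q] deg2[OF assms] deg_Un[OF fin1 fin2 dj] by simp
qed

text \<open>Since \<open>F1\<close> is good, each of its components shows up in the child bag at a
  position of positive degree, so a test on positions covers all edges. By \<open>old\<close>, a
  vertex of the parent bag that \<open>F1\<close> reaches is visible in the child bag.\<close>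

lemma rep_reaches:
  "(\<forall>p<W. D1 p > 0 \<longrightarrow> rep W (L1 p) \<noteq> 0) \<longleftrightarrow> (\<forall>e\<in>F1. \<exists>q<W. con F1 (src e) (vy q))"
proof -
  have rep: "rep W (L1 p) \<noteq> 0 \<longleftrightarrow> (\<exists>i<W. vx i \<in> vy ` {..<W} \<and> con F1 (vx i) (vx p))" if "p < W" for p
    using tg_0 labellingD(4)[OF lab1 _ that] unfolding rep_fun_0 by auto
  have pos: "D1 p > 0 \<longleftrightarrow> vx p \<in> ends F1" if "p < W" for p
    using deg1[OF that] deg_pos[OF fin1] by simp
  show ?thesis
  proof (intro iffI ballI allI impI)
    fix e assume r: "\<forall>p<W. D1 p > 0 \<longrightarrow> rep W (L1 p) \<noteq> 0" and e: "e \<in> F1"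
    obtain p where p: "p < W" "con F1 (src e) (vx p)"
      using good1 e unfolding good_def by blast
    have "src e \<in> ends F1" using e unfolding ends_def by blast
    then have "vx p \<in> ends F1" using con_ends[OF p(2)] by auto
    then obtain i where i: "vx i \<in> vy ` {..<W}" "con F1 (vx i) (vx p)"
      using r p(1) pos rep by blast
    then have "con F1 (src e) (vx i)" using p(2) con_sym con_trans by metis
    then show "\<exists>q<W. con F1 (src e) (vy q)" using i(1) by auto
  next
    fix p assume r: "\<forall>e\<in>F1. \<exists>q<W. con F1 (src e) (vy q)" and p: "p < W" "D1 p > 0"
    then obtain e where e: "e \<in> F1" "vx p = src e \<or> vx p = dst e"
      using pos unfolding ends_def by blast
    then have c: "con F1 (vx p) (src e)" using con_edge con_sym con_refl by metis
    obtain q where q: "q < W" "con F1 (src e) (vy q)" using r e by blast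
    have "src e \<in> ends F1" using e unfolding ends_def by blast
    then have "vy q \<in> ends F1" using con_ends[OF q(2)] by auto
    then obtain i where i: "i < W" "vy q = vx i" using old q by auto
    then have "con F1 (vx i) (vx p)" using c q con_sym con_trans by metis
    moreover have "vx i \<in> vy ` {..<W}" using q(1) i(2)[symmetric] by auto
    ultimately show "rep W (L1 p) \<noteq> 0" using rep[OF p(1)] i(1) by blast
  qed
qed

text \<open>A vertex outside the parent bag is an end of at most one of the two forests, so its
  degree is bounded already. \<open>F2\<close> is good for the parent bag, so only components of
  \<open>F1\<close> can lose contact with it.\<close>

lemma good_comb: "comb_ok tg L1 D1 L2 D2 W \<longleftrightarrow> good W vy (F1 \<union> F2)"
proof -
  have d: "(\<forall>p<W. deg_fun tg D1 D2 W p \<le> 3) \<longleftrightarrow> (\<forall>z. deg (F1 \<union> F2) z \<le> 3)"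
  proof (intro iffI allI impI)
    fix z assume a: "\<forall>p<W. deg_fun tg D1 D2 W p \<le> 3"
    show "deg (F1 \<union> F2) z \<le> 3"
    proof (cases "z \<in> vy ` {..<W}")
      case True
      then show ?thesis using a comb_deg by auto
    next
      case False
      then have "z \<notin> ends F1 \<or> z \<notin> ends F2" using sep by auto
      then have "deg F1 z = 0 \<or> deg F2 z = 0" using deg_pos fin1 fin2 by blast
      then show ?thesis
        using good1 good2 deg_Un[OF fin1 fin2 dj] unfolding good_def by auto
    qed
  qed (simp add: comb_deg)
  have r: "(\<forall>e\<in>F1. \<exists>q<W. con F1 (src e) (vy q)) \<longleftrightarrow>
    (\<forall>e\<in>F1 \<union> F2. \<exists>q<W. con (F1 \<union> F2) (src e) (vy q))" (is "?l = ?r")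
  proof
    assume ?l
    then show ?r using good2 unfolding good_def
      by (metis Un_iff con_mono sup_ge1 sup_ge2)
  next
    assume r: ?r
    show ?l
    proof
      fix e assume e: "e \<in> F1"
      then obtain q where q: "q < W" "con (F1 \<union> F2) (src e) (vy q)" using r by blast
      have "src e \<in> ends F1" using e unfolding ends_def by blast
      from con_part_reaches[OF _ this q(2), of "vy ` {..<W}"] sep
      show "\<exists>q<W. con F1 (src e) (vy q)" using q(1) by blast
    qed
  qed
  have "comb_ok tg L1 D1 L2 D2 W \<longleftrightarrow> ok W \<and> (\<forall>p<W. D1 p > 0 \<longrightarrow> rep W (L1 p) \<noteq> 0) \<and>
    (\<forall>p<W. deg_fun tg D1 D2 W p \<le> 3)"
    unfolding comb_ok_def by blast
  also have "\<dots> \<longleftrightarrow> good W vy (F1 \<union> F2)"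
    unfolding d rep_reaches r comb(1) good_def by blast
  finally show ?thesis .
qed

lemma state_comb: "state W vy (F1 \<union> F2) (lab W) (deg_fun tg D1 D2 W)"
  unfolding state_def using comb(2) comb_deg by simp

end

text \<open>Needed for completeness: a partial solution of the union restricts to partial solutions
  of both sides. A walk from an edge to the bag either stays within its side or leaves it in the
  interface, and both bags contain the interface.\<close>

lemma good_split:
  assumes g: "good W vy (F1 \<union> F2)"
    and sep: "ends F1 \<inter> ends F2 \<subseteq> vx ` {..<W} \<inter> vy ` {..<W}"
    and old: "ends F1 \<inter> vy ` {..<W} \<subseteq> vx ` {..<W}"
    and fin: "finite F1" "finite F2"
  shows "good W vx F1" "good W vy F2"
proof -
  have r: "\<exists>y\<in>vy ` {..<W}. con F (src e) y"
    if e: "e \<in> F" and FF: "F \<union> F' = F1 \<union> F2" and sep': "ends F \<inter> ends F' \<subseteq> vy ` {..<W}" for e F F'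
  proof -
    have "e \<in> F1 \<union> F2" using e FF by blast
    then obtain q where q: "q < W" "con (F \<union> F') (src e) (vy q)"
      using g unfolding good_def FF by blast
    have "src e \<in> ends F" using e unfolding ends_def by blast
    from con_part_reaches[OF sep' this q(2)] q(1) show ?thesis by blast
  qed
  have d: "deg F z \<le> 3" if "F \<subseteq> F1 \<union> F2" for F z
  proof -
    have "deg F z \<le> deg (F1 \<union> F2) z"
      unfolding deg_def using that fin by (intro card_mono) auto
    then show ?thesis using g unfolding good_def by (meson order_trans)
  qed
  have f: "forest F" if "F \<subseteq> F1 \<union> F2" for F
    using g forest_mono that unfolding good_def by blast
  have "\<exists>p<W. con F1 (src e) (vx p)" if e: "e \<in> F1" for e
  proof -
    obtain y where y: "y \<in> vy ` {..<W}" "con F1 (src e) y" using r[OF e refl] sep by blast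
    have "src e \<in> ends F1" using e unfolding ends_def by blast
    then have "y \<in> ends F1" using con_ends[OF y(2)] by auto
    then have "y \<in> vx ` {..<W}" using y(1) old by blast
    then show ?thesis using y(2) by auto
  qed
  then show "good W vx F1" using f d unfolding good_def by simp
  have "\<exists>p<W. con F2 (src e) (vy p)" if e: "e \<in> F2" for e
    using r[OF e Un_commute] sep by blast
  then show "good W vy F2" using f d unfolding good_def by simp
qed

subsection \<open>Numerical codes of states\<close>

text \<open>A state is a number with \<open>W\<close> digits in base \<open>4 * W\<close>, with
  digit \<open>4 * L p + D p\<close> at position \<open>p\<close>; this is unambiguous because
  degrees are at most 3.\<close>

definition digL :: "nat \<Rightarrow> nat \<Rightarrow> nat \<Rightarrow> nat" where
  "digL W a p = a div (4 * W) ^ p mod (4 * W) div 4"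

definition digD :: "nat \<Rightarrow> nat \<Rightarrow> nat \<Rightarrow> nat" where
  "digD W a p = a div (4 * W) ^ p mod (4 * W) mod 4"

definition code :: "nat \<Rightarrow> (nat \<Rightarrow> nat) \<Rightarrow> (nat \<Rightarrow> nat) \<Rightarrow> nat" where
  "code W L D = (\<Sum>p<W. (4 * L p + D p) * (4 * W) ^ p)"

definition ncodes :: "nat \<Rightarrow> nat" where
  "ncodes W = (4 * W) ^ W"

lemma digit_sum_less:
  fixes d :: "nat \<Rightarrow> nat"
  assumes "\<And>p. p < n \<Longrightarrow> d p < b"
  shows "(\<Sum>p<n. d p * b ^ p) < b ^ n"
  using assms
proof (induction n)
  case (Suc n)
  have "d n * b ^ n + b ^ n \<le> b * b ^ n"
    using Suc.prems[of n] mult_le_mono1[of "Suc (d n)" b "b ^ n"] by simp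
  moreover have "(\<Sum>p<n. d p * b ^ p) < b ^ n" using Suc by simp
  ultimately show ?case by simp
qed simp

lemma digit_sum_nth:
  fixes d :: "nat \<Rightarrow> nat"
  assumes d: "\<And>p. p < n \<Longrightarrow> d p < b" and q: "q < n"
  shows "(\<Sum>p<n. d p * b ^ p) div b ^ q mod b = d q"
proof -
  have b: "b > 0" using d[OF q] by simp
  have "(\<Sum>p<n. d p * b ^ p) = (\<Sum>p<q. d p * b ^ p) + (\<Sum>p=q..<n. d p * b ^ p)"
    using q sum.atLeastLessThan_concat[of 0 q n "\<lambda>p. d p * b ^ p"]
    by (simp add: lessThan_atLeast0)
  also have "(\<Sum>p=q..<n. d p * b ^ p) = b ^ q * (\<Sum>p=q..<n. d p * b ^ (p - q))"
    unfolding sum_distrib_left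
    by (intro sum.cong refl) (auto simp: power_add[symmetric] mult.left_commute)
  also have "(\<Sum>p=q..<n. d p * b ^ (p - q)) = d q + (\<Sum>p=Suc q..<n. d p * b ^ (p - q))"
    using q by (simp add: sum.atLeast_Suc_lessThan)
  also have "(\<Sum>p=Suc q..<n. d p * b ^ (p - q)) = b * (\<Sum>p=Suc q..<n. d p * b ^ (p - Suc q))"
    unfolding sum_distrib_left
    by (intro sum.cong refl) (auto simp: power_Suc[symmetric] Suc_diff_Suc mult.left_commute simp del: power_Suc)
  finally have eq: "(\<Sum>p<n. d p * b ^ p) = (\<Sum>p<q. d p * b ^ p) +
    b ^ q * (d q + b * (\<Sum>p=Suc q..<n. d p * b ^ (p - Suc q)))" .
  have "(\<Sum>p<q. d p * b ^ p) < b ^ q" using d q by (intro digit_sum_less) auto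
  then have "(\<Sum>p<n. d p * b ^ p) div b ^ q = d q + b * (\<Sum>p=Suc q..<n. d p * b ^ (p - Suc q))"
    unfolding eq using b by simp
  then show ?thesis using d[OF q] by simp
qed

lemma code_less:
  assumes "\<And>p. p < W \<Longrightarrow> L p < W \<and> D p \<le> 3"
  shows "code W L D < ncodes W"
  unfolding code_def ncodes_def using assms by (intro digit_sum_less) fastforce

lemma dig_code:
  assumes "\<And>p. p < W \<Longrightarrow> L p < W \<and> D p \<le> 3" and "q < W"
  shows "digL W (code W L D) q = L q" "digD W (code W L D) q = D q"
proof -
  have "code W L D div (4 * W) ^ q mod (4 * W) = 4 * L q + D q"
    unfolding code_def using assms by (intro digit_sum_nth) fastforce+
  moreover have "D q < 4" using assms(1)[OF assms(2)] by simp
  ultimately show "digL W (code W L D) q = L q" "digD W (code W L D) q = D q"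
    unfolding digL_def digD_def by auto
qed

definition has_code :: "nat \<Rightarrow> (nat \<Rightarrow> nat) \<Rightarrow> edge set \<Rightarrow> nat \<Rightarrow> bool" where
  "has_code W v F a \<longleftrightarrow> state W v F (digL W a) (digD W a)"

lemma state_cong:
  assumes "state W v F L D" "\<And>p. p < W \<Longrightarrow> L' p = L p \<and> D' p = D p"
  shows "state W v F L' D'"
proof -
  have "labelling W v F L'"
    using assms labellingD(3)[of W v F L] unfolding state_def labelling_def by auto
  then show ?thesis using assms unfolding state_def by simp
qed

lemma has_code_code:
  assumes "state W v F L D" "good W v F"
  shows "has_code W v F (code W L D)" "code W L D < ncodes W"
proof -
  have *: "L p < W \<and> D p \<le> 3" if "p < W" for p
    using assms labellingD(3)[of W v F L p] that unfolding state_def good_def by auto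
  show "has_code W v F (code W L D)"
    unfolding has_code_def using dig_code[OF *] by (intro state_cong[OF assms(1)]) auto
  show "code W L D < ncodes W" using code_less * by blast
qed

definition merge_ok :: "nat \<Rightarrow> (nat \<Rightarrow> nat) \<Rightarrow> (nat \<Rightarrow> nat) \<Rightarrow> nat \<Rightarrow> nat \<Rightarrow> bool" where
  "merge_ok W vx vy a b \<longleftrightarrow>
     comb_ok (\<lambda>p. find_pos vy (vx p) W) (digL W a) (digD W a) (digL W b) (digD W b) W"

definition merge_code :: "nat \<Rightarrow> (nat \<Rightarrow> nat) \<Rightarrow> (nat \<Rightarrow> nat) \<Rightarrow> nat \<Rightarrow> nat \<Rightarrow> nat" where
  "merge_code W vx vy a b = code W
     (lab_fun (\<lambda>p. find_pos vy (vx p) W) (digL W a) (digL W b) W)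
     (deg_fun (\<lambda>p. find_pos vy (vx p) W) (digD W a) (digD W b) W)"


section \<open>Dynamic programming along a tree decomposition\<close>

text \<open>Nodes are numbered such that parents come after their children, and the edge with number
  \<open>k\<close> has a node \<open>k\<close> of its own.  \<open>own i k\<close> is the node that is responsible for
  edge \<open>k\<close> after the nodes below \<open>i\<close> have been merged into their parents.\<close>

locale node_order =
  fixes W m M :: nat and E :: "nat \<Rightarrow> edge" and bag :: "nat \<Rightarrow> nat \<Rightarrow> nat" and par :: "nat \<Rightarrow> nat"
  assumes mM: "m < M"
    and bag_inj: "x < M \<Longrightarrow> inj_on (bag x) {..<W}"
    and E_id: "k < m \<Longrightarrow> fst (E k) = k"
    and E_bag: "k < m \<Longrightarrow> 1 < W \<and> bag k 0 = src (E k) \<and> bag k 1 = dst (E k)"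
    and par: "x < M - 1 \<Longrightarrow> x < par x \<and> par x < M"
    and rip: "x < M - 1 \<Longrightarrow> x < y \<Longrightarrow> y < M \<Longrightarrow> z \<in> ends (E ` {..<m}) \<Longrightarrow>
      z \<in> bag x ` {..<W} \<Longrightarrow> z \<in> bag y ` {..<W} \<Longrightarrow> z \<in> bag (par x) ` {..<W}"
begin

abbreviation "X x \<equiv> bag x ` {..<W}"

primrec own :: "nat \<Rightarrow> nat \<Rightarrow> nat" where
  "own 0 k = k"
| "own (Suc i) k = (if own i k = i then par i else own i k)"

definition part :: "nat \<Rightarrow> nat \<Rightarrow> edge set" where
  "part i x = E ` {k. k < m \<and> own i k = x}"

lemma own_range: "k < m \<Longrightarrow> i < M \<Longrightarrow> i \<le> own i k \<and> own i k < M"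
proof (induction i)
  case 0
  then show ?case using mM by simp
next
  case (Suc i)
  then have "i < par i" "par i < M" "i \<le> own i k" "own i k < M" using par[of i] by auto
  then show ?case by auto
qed

text \<open>An edge changes its owner only at the moment when this owner is merged.\<close>

lemma own_stable: "own i k = x \<Longrightarrow> i \<le> j \<Longrightarrow> j \<le> x \<Longrightarrow> own j k = x"
  by (induction j) (auto simp: le_Suc_eq)

lemma edge_ends: "k < m \<Longrightarrow> z \<in> ends {E k} \<Longrightarrow> z \<in> ends (E ` {..<m})"
  unfolding ends_def by auto

lemma edge_bag: "k < m \<Longrightarrow> z \<in> ends {E k} \<Longrightarrow> z \<in> X k"
  using E_bag[of k] unfolding ends_def
  by (auto intro: image_eqI[of _ "bag k" 0] image_eqI[of _ "bag k" 1])

text \<open>When an owner \<open>i\<close> hands the edge to its parent, the vertex lies in bag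
  \<open>i\<close> and in the later bag \<open>y\<close>, so \<open>rip\<close> puts it into the bag
  of the parent. \<open>rip\<close> speaks of ends of edges only, because the numbers that pad the
  bags need not have this property.\<close>

lemma own_bag:
  "k < m \<Longrightarrow> i < M \<Longrightarrow> z \<in> ends {E k} \<Longrightarrow> i \<le> y \<Longrightarrow> y < M \<Longrightarrow> z \<in> X y \<Longrightarrow> z \<in> X (own i k)"
proof (induction i arbitrary: y)
  case 0
  then show ?case using edge_bag by simp
next
  case (Suc i)
  show ?case
  proof (cases "own i k = i")
    case True
    then have "z \<in> X i" using Suc.IH[of y] Suc.prems by simp
    then show ?thesis using rip[of i y z] Suc.prems edge_ends True by simp
  next
    case False
    then show ?thesis using Suc.IH[of y] Suc.prems by simp
  qed
qed

text \<open>At most one of the two edges moves in a step; the bag of the other owner is then the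
  later bag that \<open>rip\<close> asks for.\<close>

lemma own_sep:
  "k < m \<Longrightarrow> k' < m \<Longrightarrow> i < M \<Longrightarrow> z \<in> ends {E k} \<Longrightarrow> z \<in> ends {E k'} \<Longrightarrow> own i k \<noteq> own i k' \<Longrightarrow>
    z \<in> X (own i k) \<and> z \<in> X (own i k')"
proof (induction i)
  case 0
  then show ?case using edge_bag by simp
next
  case (Suc i)
  have r: "own i k < M" "own i k' < M" "i \<le> own i k" "i \<le> own i k'"
    using own_range[of k i] own_range[of k' i] Suc.prems by auto
  have "own i k \<noteq> own i k'" using Suc.prems(6) by (metis own.simps(2))
  then have "z \<in> X (own i k) \<and> z \<in> X (own i k')" using Suc by simp
  moreover have "z \<in> X (par i)" if "z \<in> X i" "z \<in> X y" "i < y" "y < M" for y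
    using rip[of i y z] that Suc.prems edge_ends[of k z] by simp
  ultimately show ?case
    using r Suc.prems(6) by (simp add: le_less split: if_splits)
qed

lemma part_finite: "finite (part i x)"
  unfolding part_def by simp

lemma part_disjoint: "x \<noteq> y \<Longrightarrow> part i x \<inter> part i y = {}"
  unfolding part_def by (auto dest!: arg_cong[of "E _" "E _" fst] simp: E_id)

lemma part_ends: "z \<in> ends (part i x) \<Longrightarrow> \<exists>k<m. own i k = x \<and> z \<in> ends {E k}"
  unfolding part_def ends_def by auto

text \<open>\<open>part_sep\<close> and \<open>part_old\<close> supply the assumptions
  \<open>sep\<close> and \<open>old\<close> of the locale \<open>merge\<close>.\<close>

lemma part_sep: "i < M \<Longrightarrow> x \<noteq> y \<Longrightarrow> ends (part i x) \<inter> ends (part i y) \<subseteq> X x \<inter> X y"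
  using own_sep by (auto dest!: part_ends simp del: image_iff)

lemma part_old: "i < M \<Longrightarrow> i \<le> y \<Longrightarrow> y < M \<Longrightarrow> ends (part i x) \<inter> X y \<subseteq> X x"
  by (auto dest!: part_ends intro: own_bag)

lemma part_Suc_par: "i < M - 1 \<Longrightarrow> part (Suc i) (par i) = part i i \<union> part i (par i)"
  using par[of i] unfolding part_def by auto

lemma part_Suc_other: "i < x \<Longrightarrow> x \<noteq> par i \<Longrightarrow> part (Suc i) x = part i x"
  unfolding part_def by auto

section \<open>Connected forests and the node at which they are complete\<close>

definition conn :: "edge set \<Rightarrow> bool" where
  "conn F \<longleftrightarrow> (\<forall>e\<in>F. \<forall>e'\<in>F. con F (src e) (src e'))"

lemma conn_iff_ends: "conn F \<longleftrightarrow> (\<forall>u\<in>ends F. \<forall>v\<in>ends F. con F u v)"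
proof
  have *: "\<exists>e\<in>F. con F u (src e)" if u: "u \<in> ends F" for u
  proof -
    obtain e where "e \<in> F" "u = src e \<or> u = dst e" using u unfolding ends_def by blast
    then show ?thesis using con_sym[OF con_edge[of e F]] by auto
  qed
  assume c: "conn F"
  show "\<forall>u\<in>ends F. \<forall>v\<in>ends F. con F u v"
  proof (intro ballI)
    fix u v assume u: "u \<in> ends F" "v \<in> ends F"
    obtain e e' where "e \<in> F" "con F u (src e)" "e' \<in> F" "con F v (src e')"
      using *[OF u(1)] *[OF u(2)] by blast
    then show "con F u v" using c unfolding conn_def by (meson con_trans con_sym)
  qed
qed (auto simp: conn_def ends_def)

lemma con_no_crossing:
  assumes "con (F1 \<union> F2) a z" "a \<in> ends F1" "ends F1 \<inter> ends F2 = {}"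
  shows "z \<in> ends F1"
  using assms(1)
proof (induction rule: con_induct)
  case (step x y)
  then show ?case using assms(3) adj_ends unfolding adj_Un by blast
qed (rule assms(2))

lemma own_last: "k < m \<Longrightarrow> own (M - 1) k = M - 1"
  using own_range[of k "M - 1"] mM by linarith

text \<open>Take the first stage \<open>i\<close> at which one node owns all of \<open>F\<close>.
  For \<open>i = 0\<close> the forest is one edge in the bag of its own node. Otherwise the last
  merge joined two nonempty pieces of \<open>F\<close>; as \<open>F\<close> is connected they share
  a vertex, which lies in the bag of \<open>x\<close> by \<open>part_sep\<close>, and connectedness
  extends the contact to all edges.\<close>

lemma tree_has_node:
  assumes F: "F \<subseteq> E ` {..<m}" "F \<noteq> {}" "forest F" "\<And>z. deg F z \<le> 3" "conn F"
  shows "\<exists>x<M. F \<subseteq> part x x \<and> good W (bag x) F"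
proof -
  let ?P = "\<lambda>i. i < M \<and> (\<exists>x. F \<subseteq> part i x)"
  have "?P (M - 1)"
    using F(1) own_last mM unfolding part_def by (auto intro!: exI[of _ "M - 1"])
  then obtain i where i: "?P i" "\<And>j. j < i \<Longrightarrow> \<not> ?P j"
    using exists_least_iff[of ?P] by blast
  then obtain x where x: "F \<subseteq> part i x" by blast
  have iM: "i < M" using i by simp
  have xM: "i \<le> x" "x < M"
    using x F(2) own_range[of _ i] iM unfolding part_def by fastforce+
  have "F \<subseteq> part x x"
    using x own_stable[OF _ xM(1) order_refl] unfolding part_def by blast
  moreover have "\<exists>e\<in>F. \<exists>u\<in>X x. con F (src e) u"
  proof (cases i)
    case 0
    obtain e where e: "e \<in> F" using F(2) by blast
    then have "e = E x" "x < m" using x 0 unfolding part_def by auto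
    then have "src e \<in> X x" using edge_bag[of x "src e"] by (simp add: ends_def)
    then show ?thesis using e by blast
  next
    case (Suc j)
    let ?F1 = "F \<inter> part j j" and ?F2 = "F - part j j"
    have jM: "j < M - 1" using iM Suc by simp
    have nj: "\<not> F \<subseteq> part j x'" for x' using i(2)[of j] Suc jM by auto
    \<comment> \<open>Among the later nodes only the parent gained edges in step \<open>j\<close>;
      any other owner would have held \<open>F\<close> one stage earlier, against
      minimality.\<close>
    have "x = par j"
    proof (rule ccontr)
      assume "x \<noteq> par j"
      then have "part i x = part j x" using part_Suc_other[of j x] xM Suc by simp
      then show False using nj x by blast
    qed
    then have F2: "?F2 \<subseteq> part j x" using x part_Suc_par[OF jM] Suc by auto
    have n1: "?F1 \<noteq> {}" using nj F2 by blast
    have n2: "?F2 \<noteq> {}" using nj by blast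
    obtain e e' where e: "e \<in> ?F1" "e' \<in> ?F2" using n1 n2 by blast
    have c: "con (?F1 \<union> ?F2) (src e) (src e')"
      using F(5) e unfolding conn_def by (simp add: Int_Diff_Un)
    have "ends ?F1 \<inter> ends ?F2 \<noteq> {}"
    proof
      assume no: "ends ?F1 \<inter> ends ?F2 = {}"
      have "src e \<in> ends ?F1" "src e' \<in> ends ?F2" using e unfolding ends_def by blast+
      then show False using con_no_crossing[OF c _ no] no by blast
    qed
    then obtain u where u: "u \<in> ends ?F1" "u \<in> ends ?F2" by blast
    have "u \<in> ends (part j j)" "u \<in> ends (part j x)"
      using u F2 ends_mono[of ?F1 "part j j"] ends_mono[of ?F2 "part j x"] by blast+
    then have uX: "u \<in> X x" using part_sep[of j j x] jM xM Suc by auto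
    obtain f where f: "f \<in> F" "u = src f \<or> u = dst f" using u unfolding ends_def by blast
    then have "con F (src f) u" using con_edge con_refl by metis
    then show ?thesis using f uX by blast
  qed
  then have "\<forall>e\<in>F. \<exists>p<W. con F (src e) (bag x p)"
    using F(5) con_trans unfolding conn_def by (metis imageE lessThan_iff)
  ultimately show ?thesis using F xM unfolding good_def by blast
qed

text \<open>An entry 0 of a table means that the state is absent.  The value of a cell is one more than the number of
  its edges, so that with \<open>val 0 = 0\<close> an absent state loses against every other one.\<close>

definition represents ::
  "nat \<Rightarrow> nat \<Rightarrow> (nat \<Rightarrow> nat) \<Rightarrow> (nat \<Rightarrow> nat) \<Rightarrow> (nat \<Rightarrow> nat set) \<Rightarrow> bool" where
  "represents i x T val sol \<longleftrightarrow>
     (\<forall>a<ncodes W. T a \<noteq> 0 \<longrightarrow> E ` sol (T a) \<subseteq> part i x \<and> sol (T a) \<subseteq> {..<m} \<and>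
        good W (bag x) (E ` sol (T a)) \<and>
        has_code W (bag x) (E ` sol (T a)) a \<and> val (T a) = Suc (card (E ` sol (T a)))) \<and>
     (\<forall>F. F \<subseteq> part i x \<longrightarrow> good W (bag x) F \<longrightarrow>
        (\<exists>a<ncodes W. T a \<noteq> 0 \<and> has_code W (bag x) F a \<and> Suc (card F) \<le> val (T a)))"

lemma represents_cong:
  assumes "represents i x T val sol" "part i x = part i' x"
    "\<And>a. a < ncodes W \<Longrightarrow> T' a = T a"
    "\<And>a. a < ncodes W \<Longrightarrow> T a \<noteq> 0 \<Longrightarrow> val' (T a) = val (T a) \<and> sol' (T a) = sol (T a)"
  shows "represents i' x T' val' sol'"
proof -
  have 1: "\<forall>a<ncodes W. T a \<noteq> 0 \<longrightarrow> E ` sol (T a) \<subseteq> part i' x \<and> sol (T a) \<subseteq> {..<m} \<and>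
      good W (bag x) (E ` sol (T a)) \<and>
      has_code W (bag x) (E ` sol (T a)) a \<and> val (T a) = Suc (card (E ` sol (T a)))"
    and 2: "\<forall>F. F \<subseteq> part i' x \<longrightarrow> good W (bag x) F \<longrightarrow>
      (\<exists>a<ncodes W. T a \<noteq> 0 \<and> has_code W (bag x) F a \<and> Suc (card F) \<le> val (T a))"
    using assms(1) unfolding represents_def assms(2) by blast+
  show ?thesis
    unfolding represents_def
  proof (intro conjI allI impI)
    fix F assume "F \<subseteq> part i' x" "good W (bag x) F"
    then obtain a where "a < ncodes W" "T a \<noteq> 0" "has_code W (bag x) F a" "Suc (card F) \<le> val (T a)"
      using 2 by blast
    then show "\<exists>a<ncodes W. T' a \<noteq> 0 \<and> has_code W (bag x) F a \<and> Suc (card F) \<le> val' (T' a)"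
      using assms(3,4) by (intro exI[of _ a]) simp
  qed (use 1 assms(3,4) in simp_all)
qed

text \<open>Completeness splits an arbitrary \<open>F\<close> into its two sides and passes to the
  table entries with the same states: by \<open>ok\<close>, compatibility and the resulting code
  depend on the states only, so these entries can be merged and are at least as large. The terms
  \<open>+ 1\<close> are there because a value exceeds the number of edges by one.\<close>

lemma represents_merge:
  assumes i: "i < M - 1"
    and T1: "represents i i T1 val sol" and T2: "represents i (par i) T2 val sol"
    and sound: "\<And>d. d < ncodes W \<Longrightarrow> T3 d \<noteq> 0 \<Longrightarrow> \<exists>a<ncodes W. \<exists>b<ncodes W.
      T1 a \<noteq> 0 \<and> T2 b \<noteq> 0 \<and> merge_ok W (bag i) (bag (par i)) a b \<and>
      d = merge_code W (bag i) (bag (par i)) a b \<and>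
      sol (T3 d) = sol (T1 a) \<union> sol (T2 b) \<and> val (T3 d) + 1 = val (T1 a) + val (T2 b)"
    and complete: "\<And>a b. a < ncodes W \<Longrightarrow> b < ncodes W \<Longrightarrow> T1 a \<noteq> 0 \<Longrightarrow> T2 b \<noteq> 0 \<Longrightarrow>
      merge_ok W (bag i) (bag (par i)) a b \<Longrightarrow>
      T3 (merge_code W (bag i) (bag (par i)) a b) \<noteq> 0 \<and>
      val (T1 a) + val (T2 b) \<le> val (T3 (merge_code W (bag i) (bag (par i)) a b)) + 1"
  shows "represents (Suc i) (par i) T3 val sol"
proof -
  let ?y = "par i" and ?S = "ncodes W"
  note y = par[OF i]
  have sep: "ends (part i i) \<inter> ends (part i ?y) \<subseteq> X i \<inter> X ?y"
    using part_sep[of i i ?y] i y by auto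
  have old: "ends (part i i) \<inter> X ?y \<subseteq> X i"
    using part_old[of i ?y i] i y by auto
  have merge: "merge W (bag i) (bag ?y) F1 F2 (digL W a) (digD W a) (digL W b) (digD W b)"
    if "F1 \<subseteq> part i i" "F2 \<subseteq> part i ?y" "good W (bag i) F1" "good W (bag ?y) F2"
      "has_code W (bag i) F1 a" "has_code W (bag ?y) F2 b" for F1 F2 a b
  proof
    show "inj_on (bag i) {..<W}" "inj_on (bag ?y) {..<W}" using bag_inj i y by auto
    show "finite F1" "finite F2" using that part_finite finite_subset by blast+
    show "F1 \<inter> F2 = {}" using that(1,2) part_disjoint[of i ?y i] y by auto
    show "ends F1 \<inter> ends F2 \<subseteq> X i \<inter> X ?y"
      using sep ends_mono[OF that(1)] ends_mono[OF that(2)] by blast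
    show "ends F1 \<inter> X ?y \<subseteq> X i" using old ends_mono[OF that(1)] by blast
  qed (use that in \<open>auto simp: has_code_def\<close>)
  have ok: "merge_ok W (bag i) (bag ?y) a b \<longleftrightarrow> good W (bag ?y) (F1 \<union> F2)"
    "state W (bag ?y) (F1 \<union> F2) (lab_fun (\<lambda>p. find_pos (bag ?y) (bag i p) W) (digL W a) (digL W b) W)
     (deg_fun (\<lambda>p. find_pos (bag ?y) (bag i p) W) (digD W a) (digD W b) W)"
    if "F1 \<subseteq> part i i" "F2 \<subseteq> part i ?y" "good W (bag i) F1" "good W (bag ?y) F2"
      "has_code W (bag i) F1 a" "has_code W (bag ?y) F2 b" for F1 F2 a b
  proof -
    interpret merge W "bag i" "bag ?y" F1 F2 "digL W a" "digD W a" "digL W b" "digD W b"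
      using merge[OF that] .
    have "tg = (\<lambda>p. find_pos (bag ?y) (bag i p) W)" unfolding tg_def by simp
    with good_comb state_comb
    show "merge_ok W (bag i) (bag ?y) a b \<longleftrightarrow> good W (bag ?y) (F1 \<union> F2)"
    "state W (bag ?y) (F1 \<union> F2) (lab_fun (\<lambda>p. find_pos (bag ?y) (bag i p) W) (digL W a) (digL W b) W)
     (deg_fun (\<lambda>p. find_pos (bag ?y) (bag i p) W) (digD W a) (digD W b) W)"
      unfolding merge_ok_def by auto
  qed
  have part: "part (Suc i) ?y = part i i \<union> part i ?y" by (rule part_Suc_par[OF i])
  have cd: "card (F1 \<union> F2) = card F1 + card F2" if "F1 \<subseteq> part i i" "F2 \<subseteq> part i ?y" for F1 F2
  proof -
    have "F1 \<inter> F2 = {}" using that(1,2) part_disjoint[of i ?y i] y by auto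
    then show ?thesis using that part_finite finite_subset by (intro card_Un_disjoint) blast+
  qed
  have S: "E ` sol (T3 d) \<subseteq> part (Suc i) ?y \<and> sol (T3 d) \<subseteq> {..<m} \<and> good W (bag ?y) (E ` sol (T3 d)) \<and>
        has_code W (bag ?y) (E ` sol (T3 d)) d \<and> val (T3 d) = Suc (card (E ` sol (T3 d)))"
    if d: "d < ?S" "T3 d \<noteq> 0" for d
  proof -
    obtain a b where ab: "a < ?S" "b < ?S" "T1 a \<noteq> 0" "T2 b \<noteq> 0"
      "merge_ok W (bag i) (bag ?y) a b" "d = merge_code W (bag i) (bag ?y) a b"
      "sol (T3 d) = sol (T1 a) \<union> sol (T2 b)" "val (T3 d) + 1 = val (T1 a) + val (T2 b)"
      using sound[OF d] by blast
    define F1 F2 where "F1 = E ` sol (T1 a)" and "F2 = E ` sol (T2 b)"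
    have F: "F1 \<subseteq> part i i" "F2 \<subseteq> part i ?y" "good W (bag i) F1" "good W (bag ?y) F2"
      "has_code W (bag i) F1 a" "has_code W (bag ?y) F2 b"
      and v: "val (T1 a) = Suc (card F1)" "val (T2 b) = Suc (card F2)"
      and m: "sol (T1 a) \<subseteq> {..<m}" "sol (T2 b) \<subseteq> {..<m}"
      using T1 T2 ab unfolding represents_def F1_def F2_def by auto
    have U: "E ` sol (T3 d) = F1 \<union> F2" unfolding ab(7) F1_def F2_def by blast
    have g: "good W (bag ?y) (F1 \<union> F2)" using ok(1)[OF F] ab by blast
    show ?thesis
      unfolding U part
      using F(1,2) g has_code_code(1)[OF ok(2)[OF F] g] ab(6,7,8) v cd[OF F(1,2)] m
      unfolding merge_code_def by auto
  qed
  have C: "\<exists>d<?S. T3 d \<noteq> 0 \<and> has_code W (bag ?y) F d \<and> Suc (card F) \<le> val (T3 d)"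
    if F: "F \<subseteq> part (Suc i) ?y" "good W (bag ?y) F" for F
  proof -
    define F1 F2 where "F1 = F \<inter> part i i" and "F2 = F \<inter> part i ?y"
    have U: "F = F1 \<union> F2" using F(1) part unfolding F1_def F2_def by blast
    have sub: "F1 \<subseteq> part i i" "F2 \<subseteq> part i ?y" unfolding F1_def F2_def by auto
    have g: "good W (bag i) F1" "good W (bag ?y) F2"
      using good_split[of W "bag ?y" F1 F2 "bag i"] F(2) sep old ends_mono[OF sub(1)] ends_mono[OF sub(2)]
        finite_subset[OF sub(1) part_finite] finite_subset[OF sub(2) part_finite]
      unfolding U by blast+
    obtain a where a: "a < ?S" "T1 a \<noteq> 0" "has_code W (bag i) F1 a" "Suc (card F1) \<le> val (T1 a)"
      using T1 sub g unfolding represents_def by blast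
    obtain b where b: "b < ?S" "T2 b \<noteq> 0" "has_code W (bag ?y) F2 b" "Suc (card F2) \<le> val (T2 b)"
      using T2 sub g unfolding represents_def by blast
    note okF = ok[OF sub g a(3) b(3)]
    have g': "good W (bag ?y) (F1 \<union> F2)" using F U by simp
    have mo: "merge_ok W (bag i) (bag ?y) a b" using okF(1) g' by simp
    show ?thesis
      using complete[OF a(1) b(1) a(2) b(2) mo] has_code_code[OF okF(2) g'] a(4) b(4) cd[OF sub]
      unfolding U merge_code_def by (intro exI[of _ "merge_code W (bag i) (bag ?y) a b"]) (auto simp: merge_code_def)
  qed
  show ?thesis unfolding represents_def using S C by blast
qed

definition single :: "nat \<Rightarrow> bool" where
  "single a \<longleftrightarrow> (\<forall>p<W. \<forall>q<W. digD W a p > 0 \<longrightarrow> digD W a q > 0 \<longrightarrow> digL W a p = digL W a q)"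

text \<open>All components of a good forest meet the bag, so comparing the labels of the bag
  vertices of positive degree decides connectedness of the whole forest.\<close>

lemma single_conn:
  assumes g: "good W (bag x) F" and c: "has_code W (bag x) F a" and fin: "finite F"
  shows "single a \<longleftrightarrow> conn F"
proof -
  have pos: "digD W a p > 0 \<longleftrightarrow> bag x p \<in> ends F" if "p < W" for p
    using c that deg_pos[OF fin] unfolding has_code_def state_def by simp
  have eq: "digL W a p = digL W a q \<longleftrightarrow> con F (bag x p) (bag x q)" if "p < W" "q < W" for p q
    using c that labellingD(4) unfolding has_code_def state_def by blast
  have s: "single a \<longleftrightarrow> (\<forall>p<W. \<forall>q<W. bag x p \<in> ends F \<longrightarrow> bag x q \<in> ends F \<longrightarrow> con F (bag x p) (bag x q))"
    unfolding single_def using pos eq by auto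
  show ?thesis
  proof
    assume s': "single a"
    show "conn F" unfolding conn_def
    proof (intro ballI)
      fix e e' assume e: "e \<in> F" "e' \<in> F"
      then obtain p q where pq: "p < W" "con F (src e) (bag x p)" "q < W" "con F (src e') (bag x q)"
        using g unfolding good_def by blast
      have "src e \<in> ends F" "src e' \<in> ends F" using e unfolding ends_def by blast+
      then have "bag x p \<in> ends F" "bag x q \<in> ends F"
        using con_ends[OF pq(2)] con_ends[OF pq(4)] by auto
      then show "con F (src e) (src e')" using s' s pq con_trans con_sym by metis
    qed
  next
    assume conn: "conn F"
    then show "single a" using s conn_iff_ends by blast
  qed
qed

text \<open>A nonempty competitor is good at some node by \<open>tree_has_node\<close>. The table of
  this node has an entry of the same state that is at least as large; since \<open>single\<close>
  depends on the state only, this entry took part in the search for the maximum.\<close>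

lemma best_is_optimal:
  assumes T: "\<And>x. x < M \<Longrightarrow> represents x x (T x) val sol"
    and best: "\<exists>x<M. \<exists>a<ncodes W. T x a \<noteq> 0 \<and> single a \<and> best = T x a"
    and max: "\<And>x a. x < M \<Longrightarrow> a < ncodes W \<Longrightarrow> T x a \<noteq> 0 \<Longrightarrow> single a \<Longrightarrow> val (T x a) \<le> val best"
  shows "sol best \<subseteq> {..<m}" "forest (E ` sol best)" "deg (E ` sol best) z \<le> 3" "conn (E ` sol best)"
    "val best = Suc (card (sol best))"
    "F \<subseteq> E ` {..<m} \<Longrightarrow> forest F \<Longrightarrow> (\<And>z. deg F z \<le> 3) \<Longrightarrow> conn F \<Longrightarrow> card F \<le> card (sol best)"
proof -
  obtain x a where xa: "x < M" "a < ncodes W" "T x a \<noteq> 0" "single a" "best = T x a"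
    using best by blast
  have r: "E ` sol best \<subseteq> part x x" and 1: "sol best \<subseteq> {..<m}" and g: "good W (bag x) (E ` sol best)"
    and c: "has_code W (bag x) (E ` sol best) a" and v: "val best = Suc (card (E ` sol best))"
    using T[OF xa(1)] xa unfolding represents_def by auto
  have "inj_on E {..<m}" using E_id by (intro inj_onI) (metis lessThan_iff)
  then have 2: "card (E ` sol best) = card (sol best)" using 1 by (meson card_image inj_on_subset)
  show "sol best \<subseteq> {..<m}" "forest (E ` sol best)" "deg (E ` sol best) z \<le> 3" "val best = Suc (card (sol best))"
    using 1 2 g v unfolding good_def by auto
  have "finite (E ` sol best)" using r part_finite finite_subset by blast
  then show "conn (E ` sol best)" using single_conn[OF g c] xa(4) by blast
  assume F: "F \<subseteq> E ` {..<m}" "forest F" "\<And>z. deg F z \<le> 3" "conn F"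
  show "card F \<le> card (sol best)"
  proof (cases "F = {}")
    case False
    obtain y where y: "y < M" "F \<subseteq> part y y" "good W (bag y) F"
      using tree_has_node[OF F(1) False F(2-4)] by blast
    obtain b where b: "b < ncodes W" "T y b \<noteq> 0" "has_code W (bag y) F b" "Suc (card F) \<le> val (T y b)"
      using T[OF y(1)] y unfolding represents_def by blast
    have "finite F" using y part_finite finite_subset by blast
    then have "single b" using single_conn[OF y(3) b(3)] F(4) by blast
    then show ?thesis using max[OF y(1) b(1,2)] b(4) v 2 by simp
  qed simp
qed

end

section \<open>Initial tables: the empty forest and single edges\<close>

context node_order
begin

definition empty_code :: nat where
  "empty_code = code W (\<lambda>p. p) (\<lambda>p. 0)"

definition edge_code :: nat where
  "edge_code = code W (relabel (\<lambda>p. p) 0 1) (\<lambda>p. if p < 2 then 1 else 0)"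

text \<open>The empty forest has the digits \<open>4 * p\<close>. An edge between the positions 0
  and 1 turns digit 0 from 0 into 1 (degree 1) and digit 1 from 4 into 1 (label 0, degree 1), which
  is a loss of 3 at weight \<open>4 * W\<close>. The program computes the code of an edge this
  way.\<close>

lemma edge_code_eq:
  assumes "1 < W"
  shows "edge_code = empty_code + 1 - 3 * (4 * W)"
proof -
  have split: "(\<Sum>p<W. f p) = f 0 + (f 1 + (\<Sum>p=2..<W. f p))" for f :: "nat \<Rightarrow> nat"
    using assms by (simp add: lessThan_atLeast0 sum.atLeast_Suc_lessThan numeral_2_eq_2)
  have "(\<Sum>p=2..<W. (4 * relabel (\<lambda>p. p) 0 1 p + (if p < 2 then 1 else 0)) * (4 * W) ^ p) =
    (\<Sum>p=2..<W. 4 * p * (4 * W) ^ p)"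
    by (intro sum.cong) (auto simp: relabel_def)
  then show ?thesis
    unfolding edge_code_def empty_code_def code_def split by (simp add: relabel_def)
qed

lemma codes_differ:
  assumes "1 < W"
  shows "edge_code \<noteq> empty_code"
proof -
  have "digD W edge_code 0 = 1" "digD W empty_code 0 = 0"
    unfolding edge_code_def empty_code_def
    using assms by (subst dig_code; auto simp: relabel_def)+
  then show ?thesis by auto
qed

text \<open>Cell 1 stands for the empty forest and cell \<open>x + 2\<close> for edge
  \<open>x\<close>; 0 is reserved for absent entries.\<close>

lemma represents_init:
  assumes x: "x < M"
    and T: "\<And>a. a < ncodes W \<Longrightarrow>
      T a = (if a = empty_code then 1 else if x < m \<and> a = edge_code then Suc (Suc x) else 0)"
    and sol: "sol 1 = {}" "x < m \<Longrightarrow> sol (Suc (Suc x)) = {x}" and val: "val 1 = 1" "x < m \<Longrightarrow> val (Suc (Suc x)) = 2"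
  shows "represents 0 x T val sol"
proof -
  have part: "part 0 x = (if x < m then {E x} else {})"
    unfolding part_def by auto
  have s0: "state W (bag x) {} (\<lambda>p. p) (\<lambda>p. 0)"
    using labelling_id[OF bag_inj[OF x]] unfolding state_def by (simp add: deg_def)
  have g0: "good W (bag x) {}" unfolding good_def by (simp add: deg_def)
  note c0 = has_code_code[OF s0 g0, folded empty_code_def]
  have edge: "good W (bag x) {E x}" "state W (bag x) {E x} (relabel (\<lambda>p. p) 0 1) (\<lambda>p. if p < 2 then 1 else 0)"
    if m: "x < m"
  proof -
    note b = E_bag[OF m]
    have inj: "bag x p = bag x q \<longleftrightarrow> p = q" if "p < W" "q < W" for p q
      using inj_onD[OF bag_inj[OF x]] that by auto
    have ne: "src (E x) \<noteq> dst (E x)" using inj[of 0 1] b by auto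
    have "deg {E x} z \<le> 3" for z
    proof -
      have "deg {E x} z \<le> card {E x}" unfolding deg_def by (rule card_mono) auto
      then show ?thesis by simp
    qed
    moreover have "forest {E x}" using forest_insert[of "E x" "{}"] ne by simp
    moreover have "\<exists>p<W. con {E x} (src (E x)) (bag x p)"
      using b by (intro exI[of _ 0]) (simp)
    ultimately show "good W (bag x) {E x}" unfolding good_def by simp
    have "labelling W (bag x) {E x} (relabel (\<lambda>p. p) 0 1)"
      using labelling_relabel[OF labelling_id[OF bag_inj[OF x]], of 0 1 "fst (E x)"] b by simp
    moreover have "(if p < 2 then 1 else 0) = deg {E x} (bag x p)" if p: "p < W" for p
    proof -
      have "src (E x) = bag x p \<longleftrightarrow> 0 = p" "dst (E x) = bag x p \<longleftrightarrow> 1 = p"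
        using b inj[of 0 p] inj[of 1 p] p by (metis less_trans zero_less_one)+
      then have "src (E x) = bag x p \<or> dst (E x) = bag x p \<longleftrightarrow> p < 2" by arith
      then have "{e \<in> {E x}. src e = bag x p \<or> dst e = bag x p} = (if p < 2 then {E x} else {})"
        by auto
      then show ?thesis unfolding deg_def by simp
    qed
    ultimately show "state W (bag x) {E x} (relabel (\<lambda>p. p) 0 1) (\<lambda>p. if p < 2 then 1 else 0)"
      unfolding state_def by simp
  qed
  have c1: "has_code W (bag x) {E x} edge_code" "edge_code < ncodes W" if "x < m"
    using has_code_code[OF edge(2) edge(1)] that unfolding edge_code_def by auto
  have ne: "edge_code \<noteq> empty_code" if "x < m" using codes_differ E_bag[OF that] by simp
  show ?thesis
    unfolding represents_def
  proof (intro conjI allI impI)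
    fix F assume F: "F \<subseteq> part 0 x" "good W (bag x) F"
    then consider "F = {}" | "x < m" "F = {E x}" unfolding part by (auto split: if_splits)
    then show "\<exists>a<ncodes W. T a \<noteq> 0 \<and> has_code W (bag x) F a \<and> Suc (card F) \<le> val (T a)"
    proof cases
      case 1
      then show ?thesis using c0 val T by (intro exI[of _ empty_code]) auto
    next
      case 2
      then show ?thesis using c1 ne val T by (intro exI[of _ edge_code]) auto
    qed
  qed (use T sol val c0 g0 edge(1) c1 part in \<open>auto split: if_splits\<close>)
qed

end


section \<open>Labelled edges and graphs\<close>

definition edge_sets :: "edge set \<Rightarrow> nat set set" where
  "edge_sets F = (\<lambda>e. {src e, dst e}) ` F"

text \<open>The conditions make the passage from labelled edges to \<open>edge_sets\<close> a
  bijection onto sets of size two, so cardinalities and degrees carry over.\<close>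

definition simple :: "edge set \<Rightarrow> bool" where
  "simple F \<longleftrightarrow> finite F \<and> inj_on (\<lambda>e. {src e, dst e}) F \<and> (\<forall>e\<in>F. src e \<noteq> dst e)"

lemma simple_mono: "simple F \<Longrightarrow> F' \<subseteq> F \<Longrightarrow> simple F'"
  unfolding simple_def by (meson finite_subset inj_on_subset subset_iff)

lemma edge_sets_adj: "{u, v} \<in> edge_sets F \<longleftrightarrow> adj F u v"
  unfolding edge_sets_def adj_def image_iff doubleton_eq_iff by blast

lemma walk_con:
  assumes "uwalk H xs" "uedges H = edge_sets F"
  shows "con F (hd xs) (last xs)"
proof -
  have "i < length xs \<Longrightarrow> con F (hd xs) (xs ! i)" for i
  proof (induction i)
    case 0
    then show ?case by (cases xs) auto
  next
    case (Suc i)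
    then have "adj F (xs ! i) (xs ! Suc i)"
      using assms edge_sets_adj unfolding uwalk_def by metis
    then show ?case using Suc con_adj con_trans Suc_lessD by blast
  qed
  then show ?thesis using assms(1) unfolding uwalk_def by (simp add: last_conv_nth)
qed

text \<open>The walk is cut back whenever it returns to one of its vertices, so it stays free of
  repetitions, as \<open>ucycle\<close> requires.\<close>

lemma con_walk:
  assumes "con F u v" "uedges H = edge_sets F" "ugraph H" "u \<in> uverts H"
  shows "\<exists>xs. uwalk H xs \<and> distinct xs \<and> hd xs = u \<and> last xs = v"
  using assms(1)
proof (induction rule: con_induct)
  case refl
  then show ?case using assms by (intro exI[of _ "[u]"]) (auto simp: uwalk_def)
next
  case (step x y)
  then obtain xs where xs: "uwalk H xs" "distinct xs" "hd xs = u" "last xs = x" by blast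
  have ne: "xs \<noteq> []" using xs unfolding uwalk_def by simp
  have e: "{x, y} \<in> uedges H" using step(2) assms(2) edge_sets_adj by blast
  show ?case
  proof (cases "y \<in> set xs")
    case True
    then obtain i where i: "i < length xs" "xs ! i = y" by (auto simp: in_set_conv_nth)
    let ?ys = "take (Suc i) xs"
    have "uwalk H ?ys" using xs(1) i set_take_subset[of "Suc i" xs] unfolding uwalk_def by auto
    moreover have "last ?ys = y" using i by (simp add: last_conv_nth take_Suc_conv_app_nth)
    moreover have "hd ?ys = u" using xs(3) ne by (cases xs) auto
    ultimately show ?thesis using xs(2) by (intro exI[of _ ?ys]) auto
  next
    case False
    have "y \<in> uverts H" using e assms(3) unfolding ugraph_def by blast
    moreover have "{(xs @ [y]) ! j, (xs @ [y]) ! Suc j} \<in> uedges H" if "Suc j < length (xs @ [y])" for j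
    proof (cases "Suc j = length xs")
      case True
      then have "xs ! j = x" using xs(4) ne by (metis diff_Suc_1 last_conv_nth)
      then show ?thesis using True e by (simp add: nth_append)
    next
      case False
      then show ?thesis using that xs(1) unfolding uwalk_def by (auto simp: nth_append)
    qed
    ultimately have "uwalk H (xs @ [y])" using xs(1) unfolding uwalk_def by auto
    then show ?thesis using xs ne False by (intro exI[of _ "xs @ [y]"]) auto
  qed
qed

lemma uconnected_iff_con:
  assumes "uedges H = edge_sets F" "ugraph H"
  shows "uconnected H \<longleftrightarrow> uverts H \<noteq> {} \<and> (\<forall>u\<in>uverts H. \<forall>v\<in>uverts H. con F u v)"
proof -
  have "(\<exists>xs. uwalk H xs \<and> hd xs = u \<and> last xs = v) \<longleftrightarrow> con F u v" if "u \<in> uverts H" for u v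
  proof
    assume "\<exists>xs. uwalk H xs \<and> hd xs = u \<and> last xs = v"
    then obtain xs where "uwalk H xs" "hd xs = u" "last xs = v" by blast
    then show "con F u v" using walk_con[OF _ assms(1)] by auto
  next
    assume "con F u v"
    from con_walk[OF this assms that] show "\<exists>xs. uwalk H xs \<and> hd xs = u \<and> last xs = v" by blast
  qed
  then show ?thesis unfolding uconnected_def by simp
qed

text \<open>If \<open>e\<close> is not a bridge, a path between its ends that avoids
  \<open>e\<close> is closed by \<open>e\<close> to a cycle.\<close>

lemma acyclic_forest:
  assumes H: "uedges H = edge_sets F" "ugraph H" and s: "simple F" and a: "uacyclic H"
  shows "forest F"
  unfolding forest_def
proof (intro ballI notI)
  fix e assume e: "e \<in> F" and c: "con (F - {e}) (src e) (dst e)"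
  let ?H = "H\<lparr>uedges := edge_sets (F - {e})\<rparr>"
  have sub: "edge_sets (F - {e}) \<subseteq> uedges H" unfolding H edge_sets_def by blast
  then have H': "ugraph ?H" using H(2) unfolding ugraph_def by auto
  have eH: "{src e, dst e} \<in> uedges H" using e H unfolding edge_sets_def by blast
  then have "src e \<in> uverts ?H" using H(2) unfolding ugraph_def by auto
  with con_walk[OF c _ H'] obtain xs where
    xs: "uwalk ?H xs" "distinct xs" "hd xs = src e" "last xs = dst e" by auto
  have w: "uwalk H xs" using xs(1) sub unfolding uwalk_def by auto
  have ne: "src e \<noteq> dst e" using s e unfolding simple_def by blast
  \<comment> \<open>One vertex would make \<open>e\<close> a loop, two would give an edge parallel
    to \<open>e\<close>; both contradict \<open>simple F\<close>.\<close>
  have "length xs \<ge> 3"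
  proof (rule ccontr)
    assume "\<not> length xs \<ge> 3"
    then consider "length xs = 0" | "length xs = 1" | "length xs = 2" by linarith
    then show False
    proof cases
      case 1
      then show False using w unfolding uwalk_def by simp
    next
      case 2
      then show False using xs ne by (auto simp: length_Suc_conv)
    next
      case 3
      then obtain a b where ab: "xs = [a, b]" by (auto simp: numeral_2_eq_2 length_Suc_conv)
      then have "{src e, dst e} \<in> edge_sets (F - {e})" using xs unfolding uwalk_def by auto
      then show False using s e unfolding simple_def edge_sets_def by (auto dest: inj_onD)
    qed
  qed
  then have "ucycle H xs" using w xs eH unfolding ucycle_def by (simp add: insert_commute)
  then show False using a unfolding uacyclic_def by blast
qed

text \<open>The path around a cycle connects the ends of its closing edge, which is therefore not a
  bridge.\<close>

lemma forest_acyclic: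
  assumes H: "uedges H = edge_sets F" and f: "forest F"
  shows "uacyclic H"
  unfolding uacyclic_def
proof
  assume "\<exists>xs. ucycle H xs"
  then obtain xs where w: "uwalk H xs" and d: "distinct xs" and l: "length xs \<ge> 3"
    and c: "{last xs, hd xs} \<in> uedges H" unfolding ucycle_def by blast
  obtain e where e: "e \<in> F" "{last xs, hd xs} = {src e, dst e}"
    using c unfolding H edge_sets_def by blast
  let ?H = "H\<lparr>uedges := edge_sets (F - {e})\<rparr>"
  have ne: "xs \<noteq> []" using l by auto
  have "{xs ! i, xs ! Suc i} \<in> edge_sets (F - {e})" if i: "Suc i < length xs" for i
  proof -
    \<comment> \<open>With at least three distinct vertices, no consecutive pair coincides with the
      closing pair.\<close>
    have "{xs ! i, xs ! Suc i} \<noteq> {last xs, hd xs}"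
      using d l i ne by (auto simp: doubleton_eq_iff last_conv_nth hd_conv_nth nth_eq_iff_index_eq)
    moreover obtain f where "f \<in> F" "{xs ! i, xs ! Suc i} = {src f, dst f}"
      using w i unfolding uwalk_def H edge_sets_def by blast
    ultimately show ?thesis using e(2) unfolding edge_sets_def by auto
  qed
  then have "uwalk ?H xs" using w unfolding uwalk_def by simp
  then have "con (F - {e}) (hd xs) (last xs)" by (rule walk_con) simp
  then have "con (F - {e}) (src e) (dst e)"
    using e(2) con_sym by (auto simp: doubleton_eq_iff)
  then show False using f e unfolding forest_def by blast
qed

lemma udegree_eq:
  assumes "uedges H = edge_sets F" "simple F"
  shows "udegree H v = deg F v"
proof -
  have "{e \<in> uedges H. v \<in> e} = (\<lambda>e. {src e, dst e}) ` {e \<in> F. src e = v \<or> dst e = v}"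
    unfolding assms(1) edge_sets_def by auto
  moreover have "inj_on (\<lambda>e. {src e, dst e}) {e \<in> F. src e = v \<or> dst e = v}"
    using assms(2) unfolding simple_def by (auto intro: inj_on_subset)
  ultimately show ?thesis unfolding udegree_def deg_def by (simp add: card_image)
qed

text \<open>Here the vertices themselves are the positions. The ends of a new edge of a forest carry
  different labels, so \<open>relabel\<close> loses exactly one label per edge; the labels that
  remain count the components.\<close>

lemma forest_labelling:
  assumes "finite F" "forest F" "ends F \<subseteq> {..<n}"
  shows "\<exists>L. labelling n (\<lambda>p. p) F L \<and> card (L ` {..<n}) + card F = n"
  using assms
proof (induction F rule: finite_induct)
  case empty
  then show ?case using labelling_id[of "\<lambda>p. p" n] by (intro exI[of _ "\<lambda>p. p"]) auto
next
  case (insert e F)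
  have f: "forest F" "\<not> con F (src e) (dst e)" using insert forest_insert by blast+
  have b: "src e < n" "dst e < n" "ends F \<subseteq> {..<n}" using insert.prems(2) unfolding ends_insert by auto
  obtain L where L: "labelling n (\<lambda>p. p) F L" "card (L ` {..<n}) + card F = n"
    using insert.IH[OF f(1) b(3)] by blast
  let ?L = "relabel L (src e) (dst e)"
  let ?h = "max (L (src e)) (L (dst e))"
  have ne: "L (src e) \<noteq> L (dst e)" using labellingD(4)[OF L(1) b(1,2)] f(2) by simp
  have hi: "?h \<in> L ` {..<n}" using b by (auto simp: max_def)
  have lo: "min (L (src e)) (L (dst e)) \<in> L ` {..<n} - {?h}" using b ne by (auto simp: min_def max_def)
  have "?L ` {..<n} = L ` {..<n} - {?h}"
  proof
    show "?L ` {..<n} \<subseteq> L ` {..<n} - {?h}"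
    proof
      fix y assume "y \<in> ?L ` {..<n}"
      then obtain r where "r < n" "y = ?L r" by auto
      then show "y \<in> L ` {..<n} - {?h}" using lo unfolding relabel_def by auto
    qed
    show "L ` {..<n} - {?h} \<subseteq> ?L ` {..<n}"
      unfolding relabel_def by (auto simp: image_iff)
  qed
  then have "card (?L ` {..<n}) = card (L ` {..<n}) - 1" using hi by (simp add: card_Diff_singleton)
  moreover have "card (L ` {..<n}) > 0" using hi by (auto simp: card_gt_0_iff)
  moreover have "labelling n (\<lambda>p. p) (insert e F) ?L"
    using labelling_relabel[OF L(1) b(1,2), of "fst e"] by simp
  ultimately show ?case using L(2) insert.hyps by (intro exI[of _ ?L]) simp
qed

text \<open>Count the components on \<open>{..<n}\<close>: \<open>V\<close> is one of them and every
  other vertex is isolated, which gives \<open>1 + (n - card V)\<close>. By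
  \<open>forest_labelling\<close> the number is also \<open>n - card F\<close>.\<close>

lemma tree_card:
  assumes F: "finite F" "forest F" "ends F \<subseteq> V" and V: "V \<subseteq> {..<n}" "V \<noteq> {}"
    and c: "\<And>u v. u \<in> V \<Longrightarrow> v \<in> V \<Longrightarrow> con F u v"
  shows "card V = Suc (card F)"
proof -
  obtain L where L: "labelling n (\<lambda>p. p) F L" "card (L ` {..<n}) + card F = n"
    using forest_labelling[OF F(1,2), of n] F(3) V(1) by blast
  obtain u where u: "u \<in> V" using V by blast
  have eq: "L p = L q \<longleftrightarrow> con F p q" if "p < n" "q < n" for p q
    using labellingD(4)[OF L(1)] that by simp
  have "L v = L u" if "v \<in> V" for v using eq[of v u] c[OF that u] u that V(1) by auto
  then have LV: "L ` V = {L u}" using u by blast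
  have far: "con F p q \<longleftrightarrow> p = q" if "p \<notin> V" for p q
    using con_ends[of F p q] that F(3) by auto
  have inj: "inj_on L ({..<n} - V)" using eq far by (intro inj_onI) auto
  have "L u \<notin> L ` ({..<n} - V)"
  proof
    assume "L u \<in> L ` ({..<n} - V)"
    then obtain p where p: "p < n" "p \<notin> V" "L p = L u" by auto
    then have "p = u" using eq[OF p(1), of u] far[OF p(2)] u V(1) by auto
    then show False using p u by blast
  qed
  moreover have "L ` {..<n} = insert (L u) (L ` ({..<n} - V))"
    using LV V(1) by (metis Diff_partition Un_commute image_Un insert_is_Un)
  ultimately have "card (L ` {..<n}) = Suc (card ({..<n} - V))"
    using card_image[OF inj] by simp
  moreover have "card ({..<n} - V) = n - card V" "card V \<le> n"
    using V(1) card_Diff_subset[of V "{..<n}"] card_mono[of "{..<n}" V] finite_subset[of V "{..<n}"] by auto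
  ultimately show ?thesis using L(2) u finite_subset[OF V(1)] card_gt_0_iff[of V] by fastforce
qed

definition edge_at :: "(nat \<times> nat) list \<Rightarrow> nat \<Rightarrow> edge" where
  "edge_at es k = (k, es ! k)"

lemma edge_at_sel [simp]: "fst (edge_at es k) = k" "src (edge_at es k) = fst (es ! k)"
    "dst (edge_at es k) = snd (es ! k)"
  unfolding edge_at_def by auto

lemma edge_at_sets: "edge_sets (edge_at es ` K) = (\<lambda>k. edge_of (es ! k)) ` K"
  unfolding edge_sets_def edge_of_def by (simp add: image_image)

lemma edge_of_nth: "edge_of ` set es = (\<lambda>k. edge_of (es ! k)) ` {..<length es}"
  by (auto simp: set_conv_nth)

section \<open>Binary trees of the input graph as index sets of its edge list\<close>

context
  fixes n :: nat and es :: "(nat \<times> nat) list"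
  assumes valid: "valid_graph_lists [0..<n] es"
begin

lemma valid_edge:
  assumes "k < length es"
  shows "fst (es ! k) < n" "snd (es ! k) < n" "fst (es ! k) \<noteq> snd (es ! k)"
proof -
  have "edge_of (es ! k) \<in> uedges (graph_of [0..<n] es)"
    using assms unfolding graph_of_def by simp
  then have "edge_of (es ! k) \<subseteq> {0..<n} \<and> card (edge_of (es ! k)) = 2"
    using valid unfolding valid_graph_lists_def ugraph_def by (auto simp: graph_of_def)
  then show "fst (es ! k) < n" "snd (es ! k) < n" "fst (es ! k) \<noteq> snd (es ! k)"
    unfolding edge_of_def by auto
qed

lemma valid_simple:
  assumes "K \<subseteq> {..<length es}"
  shows "simple (edge_at es ` K)"
proof -
  have "simple (edge_at es ` {..<length es})"
    unfolding simple_def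
  proof (intro conjI)
    show "inj_on (\<lambda>e. {src e, dst e}) (edge_at es ` {..<length es})"
    proof (intro inj_onI, elim imageE, simp)
      fix k k' assume k: "k < length es" "k' < length es"
        and "{fst (es ! k), snd (es ! k)} = {fst (es ! k'), snd (es ! k')}"
      then have "map edge_of es ! k = map edge_of es ! k'" by (simp add: edge_of_def)
      then have "k = k'"
        using valid k nth_eq_iff_index_eq unfolding valid_graph_lists_def by (metis length_map)
      then show "edge_at es k = edge_at es k'" by simp
    qed
  qed (use valid_edge in auto)
  then show ?thesis by (rule simple_mono) (use assms in auto)
qed

lemma valid_ends: "K \<subseteq> {..<length es} \<Longrightarrow> ends (edge_at es ` K) \<subseteq> {..<n}"
  using valid_edge unfolding ends_def by auto

lemma graph_of_edges: "uedges (graph_of [0..<n] es) = edge_sets (edge_at es ` {..<length es})"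
  unfolding edge_at_sets graph_of_def by (simp add: edge_of_nth)

text \<open>Turns every competitor into an index set, so that optimality has to be shown among index
  sets only.\<close>

lemma binary_tree_forest:
  assumes T: "binary_tree_in (graph_of [0..<n] es) T"
  obtains K where "K \<subseteq> {..<length es}" "forest (edge_at es ` K)" "\<And>z. deg (edge_at es ` K) z \<le> 3"
    "\<And>u v. u \<in> ends (edge_at es ` K) \<Longrightarrow> v \<in> ends (edge_at es ` K) \<Longrightarrow> con (edge_at es ` K) u v"
    "card (uverts T) = Suc (card K)"
proof
  let ?K = "{k. k < length es \<and> edge_of (es ! k) \<in> uedges T}"
  let ?F = "edge_at es ` ?K"
  have sub: "uverts T \<subseteq> {..<n}" "uedges T \<subseteq> edge_of ` set es" and gT: "ugraph T" and cT: "uconnected T"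
    and aT: "uacyclic T" and dT: "\<And>v. v \<in> uverts T \<Longrightarrow> udegree T v \<le> 3"
    using T unfolding binary_tree_in_def usubgraph_def graph_of_def by auto
  have eT: "uedges T = edge_sets ?F"
    unfolding edge_at_sets using sub(2) unfolding edge_of_nth by blast
  show K: "?K \<subseteq> {..<length es}" by auto
  have s: "simple ?F" by (rule valid_simple[OF K])
  show f: "forest ?F" by (rule acyclic_forest[OF eT gT s aT])
  have en: "ends ?F \<subseteq> uverts T"
  proof -
    have "{src e, dst e} \<subseteq> uverts T" if "e \<in> ?F" for e
    proof -
      have "{src e, dst e} \<in> edge_sets ?F" unfolding edge_sets_def using that by blast
      then have "{src e, dst e} \<in> uedges T" by (subst eT)
      then show ?thesis using gT unfolding ugraph_def by blast
    qed
    then show ?thesis unfolding ends_def by blast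
  qed
  show "deg ?F z \<le> 3" for z
  proof (cases "z \<in> uverts T")
    case True
    then show ?thesis using dT udegree_eq[OF eT s] by simp
  next
    case False
    then have "deg ?F z = 0" using en deg_pos[of ?F z] s unfolding simple_def by auto
    then show ?thesis by simp
  qed
  have c: "con ?F u v" if "u \<in> uverts T" "v \<in> uverts T" for u v
    using that cT uconnected_iff_con[OF eT gT] by blast
  then show "con ?F u v" if "u \<in> ends ?F" "v \<in> ends ?F" for u v using that en by blast
  have "card (uverts T) = Suc (card ?F)"
    using s cT by (intro tree_card[OF _ f en sub(1) _ c]) (auto simp: simple_def uconnected_def)
  moreover have "card ?F = card ?K" by (intro card_image inj_onI) (metis edge_at_sel(1))
  ultimately show "card (uverts T) = Suc (card ?K)" by simp
qed

text \<open>The empty edge set does not name a vertex; the tree is then the vertex 0, which exists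
  because \<open>n > 0\<close>. By \<open>tree_card\<close> the output and every competitor have one
  vertex more than edges, so comparing edges suffices.\<close>

lemma max_binary_treeI:
  assumes n: "n > 0" and K: "K \<subseteq> {..<length es}" and f: "forest (edge_at es ` K)"
    and d: "\<And>z. deg (edge_at es ` K) z \<le> 3"
    and c: "\<And>u v. u \<in> ends (edge_at es ` K) \<Longrightarrow> v \<in> ends (edge_at es ` K) \<Longrightarrow> con (edge_at es ` K) u v"
    and max: "\<And>K'. K' \<subseteq> {..<length es} \<Longrightarrow> forest (edge_at es ` K') \<Longrightarrow>
      (\<And>z. deg (edge_at es ` K') z \<le> 3) \<Longrightarrow>
      (\<And>u v. u \<in> ends (edge_at es ` K') \<Longrightarrow> v \<in> ends (edge_at es ` K') \<Longrightarrow> con (edge_at es ` K') u v) \<Longrightarrow>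
      card K' \<le> card K"
    and vs: "distinct vs" "set vs = (if K = {} then {0} else ends (edge_at es ` K))"
    and ks: "distinct ks" "set ks = K"
  shows "valid_graph_lists vs (map ((!) es) ks)"
    "max_binary_tree_in (graph_of [0..<n] es) (graph_of vs (map ((!) es) ks))"
proof -
  let ?F = "edge_at es ` K" and ?H = "graph_of vs (map ((!) es) ks)"
  have s: "simple ?F" by (rule valid_simple[OF K])
  have eH: "uedges ?H = edge_sets ?F" unfolding edge_at_sets graph_of_def using ks by (auto simp: image_image)
  have en: "ends ?F \<subseteq> uverts ?H" unfolding graph_of_def using vs by (auto simp: ends_def)
  have vn: "uverts ?H \<subseteq> {..<n}" using valid_ends[OF K] n vs unfolding graph_of_def by auto
  have "e \<subseteq> ends ?F \<and> card e = 2" if e: "e \<in> edge_sets ?F" for e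
  proof -
    obtain k where k: "k \<in> K" "e = {fst (es ! k), snd (es ! k)}"
      using e unfolding edge_at_sets edge_of_def by blast
    then have "src (edge_at es k) \<in> ends ?F" "dst (edge_at es k) \<in> ends ?F"
      unfolding ends_def by blast+
    then show ?thesis using k K valid_edge(3)[of k] by auto
  qed
  then have gH: "ugraph ?H" using en eH unfolding ugraph_def by (auto simp: graph_of_def)
  have cH: "con ?F u v" if "u \<in> uverts ?H" "v \<in> uverts ?H" for u v
    using that c vs unfolding graph_of_def by (cases "K = {}") auto
  have ne: "uverts ?H \<noteq> {}" unfolding graph_of_def using vs by (auto simp: ends_def)
  have conH: "uconnected ?H" using uconnected_iff_con[OF eH gH] cH ne by blast
  have "inj_on (\<lambda>e. {src e, dst e}) ?F" using s unfolding simple_def by simp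
  moreover have "inj_on (edge_at es) K" by (intro inj_onI) (metis edge_at_sel(1))
  ultimately have "inj_on ((\<lambda>e. {src e, dst e}) \<circ> edge_at es) K" by (rule comp_inj_on[rotated])
  then have inj: "inj_on (\<lambda>k. edge_of (es ! k)) K"
    unfolding edge_of_def by (simp add: comp_def)
  then have "distinct (map edge_of (map ((!) es) ks))"
    using ks by (simp add: distinct_map comp_def)
  then show "valid_graph_lists vs (map ((!) es) ks)"
    unfolding valid_graph_lists_def using vs gH by simp
  have "uedges ?H \<subseteq> uedges (graph_of [0..<n] es)"
    unfolding eH graph_of_edges using K unfolding edge_sets_def by blast
  then have bH: "binary_tree_in (graph_of [0..<n] es) ?H"
    unfolding binary_tree_in_def usubgraph_def
    using gH vn conH forest_acyclic[OF eH f] udegree_eq[OF eH s] d by (auto simp: graph_of_def)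
  have cardF: "card ?F = card K" by (intro card_image inj_onI) (metis edge_at_sel(1))
  have "card (uverts ?H) = Suc (card ?F)"
    using s by (intro tree_card[OF _ f en vn ne cH]) (auto simp: simple_def)
  moreover have "card (uverts T) \<le> Suc (card K)" if "binary_tree_in (graph_of [0..<n] es) T" for T
    using binary_tree_forest[OF that] max by (metis Suc_le_mono)
  ultimately show "max_binary_tree_in (graph_of [0..<n] es) ?H"
    unfolding max_binary_tree_in_def using bH cardF by simp
qed

end

section \<open>Stripping leaves of the decomposition tree\<close>

definition restr :: "edge set \<Rightarrow> nat set \<Rightarrow> edge set" where
  "restr F R = {e \<in> F. src e \<in> R \<and> dst e \<in> R}"

definition nbrs :: "edge set \<Rightarrow> nat \<Rightarrow> nat set" where
  "nbrs F j = {k. adj F j k}"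

lemma restr_sub: "restr F R \<subseteq> F"
  unfolding restr_def by blast

lemma nbrs_ends: "nbrs F j \<subseteq> ends F"
  unfolding nbrs_def using adj_ends by blast

lemma adj_restr: "adj (restr F R) u v \<longleftrightarrow> adj F u v \<and> u \<in> R \<and> v \<in> R"
  unfolding adj_def restr_def by blast

lemma nbrs_restr: "j \<in> R \<Longrightarrow> nbrs (restr F R) j = nbrs F j \<inter> R"
  unfolding nbrs_def adj_restr by blast

lemma nbrs_sym: "k \<in> nbrs F j \<longleftrightarrow> j \<in> nbrs F k"
  unfolding nbrs_def using adj_sym by blast

lemma simple_nbrs_irrefl: "simple F \<Longrightarrow> j \<notin> nbrs F j"
  unfolding nbrs_def adj_def simple_def by auto

lemma nbrs_insert:
  "nbrs (insert e F) j = nbrs F j \<union> (if j = src e then {dst e} else {}) \<union> (if j = dst e then {src e} else {})"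
  unfolding nbrs_def adj_def by auto

lemma simple_insert_new:
  assumes "simple (insert e F)" "e \<notin> F"
  shows "\<not> adj F (src e) (dst e)" "src e \<noteq> dst e"
proof -
  show "\<not> adj F (src e) (dst e)"
  proof
    assume "adj F (src e) (dst e)"
    then obtain f where f: "f \<in> F" "src f = src e \<and> dst f = dst e \<or> src f = dst e \<and> dst f = src e"
      unfolding adj_def by blast
    then have "{src f, dst f} = {src e, dst e}" by auto
    with f(1) have "f = e" using assms(1) unfolding simple_def inj_on_def by blast
    then show False using f assms(2) by blast
  qed
  show "src e \<noteq> dst e" using assms(1) unfolding simple_def by blast
qed

lemma finite_nbrs: "simple F \<Longrightarrow> finite (nbrs F j)"
  using nbrs_ends[of F j] unfolding simple_def ends_def by (auto intro: finite_subset)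

lemma handshake:
  assumes "finite F" "simple F" "finite V" "ends F \<subseteq> V"
  shows "(\<Sum>v\<in>V. card (nbrs F v)) = 2 * card F"
  using assms
proof (induction F rule: finite_induct)
  case empty
  then show ?case by (simp add: nbrs_def adj_def)
next
  case (insert e F)
  note new = simple_insert_new[OF insert.prems(1) insert.hyps(2)]
  have s: "simple F" using insert.prems(1) by (rule simple_mono) auto
  have e: "src e \<in> V" "dst e \<in> V" "ends F \<subseteq> V" using insert.prems(3) unfolding ends_insert by auto
  have "card (nbrs (insert e F) v) = card (nbrs F v) + ((if v = src e then 1 else 0) + (if v = dst e then 1 else 0))" for v
    using new adj_sym[of F "dst e" "src e"] finite_nbrs[OF s, of v] unfolding nbrs_insert
    by (auto simp: nbrs_def card_insert_if)
  then have "(\<Sum>v\<in>V. card (nbrs (insert e F) v)) = (\<Sum>v\<in>V. card (nbrs F v)) + 2"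
    using e insert.prems(2) by (simp add: sum.distrib)
  then show ?case using insert s e by simp
qed

text \<open>A walk that enters a leaf has to return to the neighbour it came from, so the detour can
  be cut out.\<close>

lemma con_remove_leaf:
  assumes leaf: "nbrs F j \<subseteq> {p}" and c: "con F u v" and u: "u \<noteq> j" and v: "v \<noteq> j"
  shows "con {e \<in> F. src e \<noteq> j \<and> dst e \<noteq> j} u v"
proof -
  let ?F = "{e \<in> F. src e \<noteq> j \<and> dst e \<noteq> j}"
  have adj: "adj ?F x y \<longleftrightarrow> adj F x y \<and> x \<noteq> j \<and> y \<noteq> j" for x y
    unfolding adj_def by blast
  \<comment> \<open>While the walk stands at the leaf \<open>j\<close>, the simulation waits at its
    only neighbour \<open>p\<close>.\<close>
  have "if v = j then con ?F u p else con ?F u v" using c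
  proof (induction rule: con_induct)
    case refl
    then show ?case using u by simp
  next
    case (step x y)
    show ?case
    proof (cases "x = j \<or> y = j")
      case False
      then have "con ?F u x" "adj ?F x y" using step(2,3) adj by auto
      then have "con ?F u y" using con_trans[OF _ con_adj] by blast
      then show ?thesis using False by simp
    next
      case True
      then have "x = j \<and> y = p \<or> y = j \<and> x = p"
        using step(2) adj_sym[OF step(2)] leaf unfolding nbrs_def by blast
      then show ?thesis using step(3) by (auto split: if_splits)
    qed
  qed
  then show ?thesis using v by simp
qed

lemma restr_remove: "restr F (R - {j}) = {e \<in> restr F R. src e \<noteq> j \<and> dst e \<noteq> j}"
  unfolding restr_def by blast

definition connected_in :: "edge set \<Rightarrow> nat set \<Rightarrow> bool" where
  "connected_in F R \<longleftrightarrow> (\<forall>a\<in>R. \<forall>b\<in>R. con (restr F R) a b)"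

text \<open>The leaf condition refers to a larger set \<open>R'\<close>, so that one leaf of the
  remaining tree can be removed from all the connected node sets inside it.\<close>

lemma connected_in_remove:
  assumes c: "connected_in F R" and leaf: "nbrs F j \<inter> R' \<subseteq> {p}" and R': "R \<subseteq> R'"
  shows "connected_in F (R - {j})"
  unfolding connected_in_def
proof (intro ballI)
  fix a b assume ab: "a \<in> R - {j}" "b \<in> R - {j}"
  have "nbrs (restr F R) j \<subseteq> {p}" using leaf R' unfolding nbrs_def adj_restr by blast
  moreover have "con (restr F R) a b" using c ab unfolding connected_in_def by blast
  ultimately show "con (restr F (R - {j})) a b"
    unfolding restr_remove using ab by (intro con_remove_leaf[of _ j p]) auto
qed

text \<open>Source of the running intersection property: with \<open>R\<close> the remaining nodes
  whose bags contain a given vertex, the leaf \<open>j\<close> is connected to another such node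
  only through its neighbour \<open>p\<close>.\<close>

lemma connected_in_leaf:
  assumes c: "connected_in F R" and leaf: "nbrs F j \<inter> R' \<subseteq> {p}" and R': "R \<subseteq> R'"
    and j: "j \<in> R" and b: "b \<in> R" "b \<noteq> j"
  shows "p \<in> R"
proof -
  have "j \<in> ends (restr F R)" using c j b con_ends unfolding connected_in_def by blast
  then obtain k where "adj (restr F R) j k" unfolding ends_def adj_def by blast
  then show ?thesis using leaf R' unfolding adj_restr nbrs_def by blast
qed

text \<open>If all degrees were at least 2, their sum would be at least \<open>2 * card R\<close>,
  but a tree has degree sum \<open>2 * (card R - 1)\<close>.\<close>

lemma leaf_exists:
  assumes s: "simple F" and f: "forest F" and c: "connected_in F R" and R: "R \<subseteq> {..<n}" "card R \<ge> 2"
  shows "\<exists>j\<in>R. card (nbrs F j \<inter> R) \<le> 1"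
proof (rule ccontr)
  assume no: "\<not> (\<exists>j\<in>R. card (nbrs F j \<inter> R) \<le> 1)"
  let ?F = "restr F R"
  have fin: "finite R" using R finite_subset by blast
  have sF: "simple ?F" by (rule simple_mono[OF s restr_sub])
  then have finF: "finite ?F" unfolding simple_def by blast
  have e: "ends ?F \<subseteq> R" unfolding ends_def restr_def by auto
  have "card R = Suc (card ?F)"
    using R(2) c by (intro tree_card[OF finF forest_mono[OF f restr_sub] e R(1)]) (auto simp: connected_in_def)
  moreover have "2 * card R \<le> (\<Sum>j\<in>R. card (nbrs ?F j))"
    using sum_bounded_below[of R 2 "\<lambda>j. card (nbrs ?F j)"] no by (force simp: nbrs_restr mult.commute)
  ultimately show False using handshake[OF finF sF fin e] by simp
qed

lemma nbr_exists:
  assumes c: "connected_in F R" and R: "finite R" "card R \<ge> 2" "j \<in> R"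
  shows "nbrs F j \<inter> R \<noteq> {}"
proof -
  have "\<not> R \<subseteq> {j}" using R card_mono[of "{j}" R] by auto
  then obtain b where "b \<in> R" "b \<noteq> j" by blast
  then have "j \<in> ends (restr F R)" using c R con_ends unfolding connected_in_def by blast
  then show ?thesis unfolding ends_def nbrs_def adj_def restr_def by fastforce
qed

section \<open>The decomposition tree and the order in which its nodes are removed\<close>

locale decomposition =
  fixes n :: nat and es ts :: "(nat \<times> nat) list" and bs :: "nat list list" and w :: nat
  assumes n: "n > 0"
    and valid_es: "valid_graph_lists [0..<n] es"
    and valid_ts: "valid_graph_lists [0..<length bs] ts"
    and distinct_bs: "b \<in> set bs \<Longrightarrow> distinct b"
    and td: "tree_decomposition (graph_of [0..<n] es) (graph_of [0..<length bs] ts) (\<lambda>i. set (bs ! i))"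
    and width: "width (graph_of [0..<length bs] ts) (\<lambda>i. set (bs ! i)) = w"
begin

abbreviation "N \<equiv> length bs"
abbreviation "m \<equiv> length es"
abbreviation "q \<equiv> length ts"
abbreviation "TE \<equiv> edge_at ts ` {..<q}"

definition holders :: "nat \<Rightarrow> nat set" where
  "holders z = {i. i < N \<and> z \<in> set (bs ! i)}"

lemma tree: "utree (graph_of [0..<N] ts)"
  using td unfolding tree_decomposition_def by blast

lemma TE_edges: "uedges (graph_of [0..<N] ts) = edge_sets TE"
  by (rule graph_of_edges[OF valid_ts])

lemma TE_simple: "simple TE"
  by (rule valid_simple[OF valid_ts]) simp

lemma TE_ends: "ends TE \<subseteq> {..<N}"
  by (rule valid_ends[OF valid_ts]) simp

lemma TE_forest: "forest TE"
  using tree acyclic_forest[OF TE_edges _ TE_simple] unfolding utree_def by blast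

lemma restr_all: "restr TE {..<N} = TE"
  using TE_ends unfolding restr_def ends_def by auto

lemma TE_connected: "connected_in TE {..<N}"
proof -
  have "\<forall>u\<in>{0..<N}. \<forall>v\<in>{0..<N}. con TE u v"
    using tree uconnected_iff_con[OF TE_edges] unfolding utree_def by (simp add: graph_of_def)
  then show ?thesis unfolding connected_in_def restr_all by (simp add: atLeast0LessThan)
qed

lemma N_pos: "0 < N"
  using tree unfolding utree_def uconnected_def graph_of_def by auto

lemma q_eq: "Suc q = N"
proof -
  have "card {..<N} = Suc (card TE)"
    using TE_connected N_pos unfolding connected_in_def restr_all
    by (intro tree_card[OF _ TE_forest TE_ends]) auto
  moreover have "card TE = q" by (subst card_image) (auto intro!: inj_onI dest: arg_cong[of _ _ fst])
  ultimately show ?thesis by simp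
qed

lemma cover: "z < n \<longleftrightarrow> (\<exists>i<N. z \<in> set (bs ! i))"
proof -
  have "(\<Union>i\<in>{0..<N}. set (bs ! i)) = {0..<n}"
    using td unfolding tree_decomposition_def graph_of_def by simp
  then have "z \<in> {0..<n} \<longleftrightarrow> z \<in> (\<Union>i\<in>{0..<N}. set (bs ! i))" by simp
  then show ?thesis by auto
qed

lemma bag_less: "i < N \<Longrightarrow> z \<in> set (bs ! i) \<Longrightarrow> z < n"
  using cover by blast

lemma edge_cover: "k < m \<Longrightarrow> \<exists>i<N. fst (es ! k) \<in> set (bs ! i) \<and> snd (es ! k) \<in> set (bs ! i)"
proof -
  assume k: "k < m"
  then have "edge_of (es ! k) \<in> uedges (graph_of [0..<n] es)" unfolding graph_of_def by simp
  then obtain i where "i \<in> uverts (graph_of [0..<N] ts)" "edge_of (es ! k) \<subseteq> set (bs ! i)"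
    using td unfolding tree_decomposition_def by blast
  then show ?thesis unfolding graph_of_def edge_of_def by auto
qed

lemma holders_connected: "z < n \<Longrightarrow> connected_in TE (holders z)"
proof -
  assume z: "z < n"
  let ?Y = "{i. z \<in> set (bs ! i)}"
  let ?H = "uinduced (graph_of [0..<N] ts) ?Y"
  have c: "uconnected ?H" using td z unfolding tree_decomposition_def graph_of_def by auto
  have v: "uverts ?H = holders z" unfolding uinduced_def graph_of_def holders_def by auto
  have g: "ugraph (graph_of [0..<N] ts)" using tree unfolding utree_def by blast
  have "uedges ?H = {e \<in> edge_sets TE. e \<subseteq> ?Y}"
    unfolding uinduced_def using TE_edges by simp
  also have "\<dots> = edge_sets (restr TE (holders z))"
  proof -
    have N: "src e < N" "dst e < N" if "e \<in> TE" for e using TE_ends that unfolding ends_def by auto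
    show ?thesis
    proof (intro subset_antisym subsetI)
      fix d assume "d \<in> {e \<in> edge_sets TE. e \<subseteq> ?Y}"
      then obtain e where e: "e \<in> TE" "d = {src e, dst e}" "d \<subseteq> ?Y" unfolding edge_sets_def by blast
      then have "e \<in> restr TE (holders z)" using N[OF e(1)] unfolding restr_def holders_def by auto
      then show "d \<in> edge_sets (restr TE (holders z))" using e unfolding edge_sets_def by blast
    qed (auto simp: edge_sets_def restr_def holders_def)
  qed
  finally have e: "uedges ?H = edge_sets (restr TE (holders z))" .
  have "ugraph ?H" using g unfolding ugraph_def uinduced_def by auto
  then show ?thesis using c uconnected_iff_con[OF e] v unfolding connected_in_def by auto
qed

definition rest :: "(nat \<Rightarrow> nat) \<Rightarrow> nat \<Rightarrow> nat set" where
  "rest ord i = {..<N} - ord ` {..<i}"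

text \<open>\<open>ord\<close> is both the removal order and a queue: the entries below
  \<open>i\<close> are removed, those in \<open>{i..<te}\<close> are the current leaves. The bound
  \<open><= 1\<close> on the number of neighbours, in place of equality, includes the last node,
  which has none. The final clause is the running intersection property, expressed by the nodes that
  remain.\<close>

definition strip_inv :: "nat \<Rightarrow> nat \<Rightarrow> (nat \<Rightarrow> nat) \<Rightarrow> (nat \<Rightarrow> nat) \<Rightarrow> (nat \<Rightarrow> nat) \<Rightarrow> (nat \<Rightarrow> nat) \<Rightarrow> bool" where
  "strip_inv i te ord dg nb prn \<longleftrightarrow>
     i \<le> te \<and> te \<le> N \<and> inj_on ord {..<te} \<and> ord ` {..<te} \<subseteq> {..<N} \<and>
     (\<forall>j\<in>rest ord i. dg j = card (nbrs TE j \<inter> rest ord i) \<and> nb j = \<Sum>(nbrs TE j \<inter> rest ord i) mod N) \<and>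
     (\<forall>j\<in>rest ord i. card (nbrs TE j \<inter> rest ord i) \<le> 1 \<longleftrightarrow> j \<in> ord ` {i..<te}) \<and>
     connected_in TE (rest ord i) \<and> (\<forall>z<n. connected_in TE (rest ord i \<inter> holders z)) \<and>
     (\<forall>i'<i. prn (ord i') \<in> rest ord (Suc i') \<and>
        (\<forall>z<n. \<forall>b\<in>rest ord (Suc i'). z \<in> set (bs ! ord i') \<longrightarrow> z \<in> set (bs ! b) \<longrightarrow> z \<in> set (bs ! prn (ord i'))))"

lemma card_rest:
  assumes "inj_on ord {..<te}" "ord ` {..<te} \<subseteq> {..<N}" "i \<le> te"
  shows "card (rest ord i) = N - i"
proof -
  have "inj_on ord {..<i}" "ord ` {..<i} \<subseteq> {..<N}" using assms by (force intro: inj_on_subset)+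
  then show ?thesis unfolding rest_def by (simp add: card_Diff_subset card_image)
qed

text \<open>At least two nodes remain, so the remaining tree has a leaf and the queue is not empty.
  The leaf has one neighbour left, and the stored sum names it. This neighbour is queued exactly
  when its degree drops to 1; if it drops to 0, it was queued before.\<close>

lemma strip_step:
  assumes inv: "strip_inv i te ord dg nb prn" and i: "Suc i < N"
  shows "i < te" "ord i < N" "nb (ord i) < N" "nb (ord i) \<noteq> ord i" "dg (nb (ord i)) > 0"
    "dg (nb (ord i)) - 1 = 1 \<Longrightarrow> te < N"
    "strip_inv (Suc i) (if dg (nb (ord i)) - 1 = 1 then Suc te else te)
      (if dg (nb (ord i)) - 1 = 1 then ord(te := nb (ord i)) else ord)
      (dg(nb (ord i) := dg (nb (ord i)) - 1))
      (nb(nb (ord i) := (nb (nb (ord i)) + (N - ord i)) mod N)) (prn(ord i := nb (ord i)))"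
proof -
  let ?R = "rest ord i"
  let ?Nb = "\<lambda>j. nbrs TE j \<inter> ?R"
  define j where "j = ord i"
  define p where "p = nb j"
  have te: "i \<le> te" "te \<le> N" "inj_on ord {..<te}" "ord ` {..<te} \<subseteq> {..<N}"
    and arr: "\<And>k. k \<in> ?R \<Longrightarrow> dg k = card (?Nb k) \<and> nb k = \<Sum>(?Nb k) mod N"
    and queue: "\<And>k. k \<in> ?R \<Longrightarrow> card (?Nb k) \<le> 1 \<longleftrightarrow> k \<in> ord ` {i..<te}"
    and con: "connected_in TE ?R" "\<And>z. z < n \<Longrightarrow> connected_in TE (?R \<inter> holders z)"
    and old: "\<And>i'. i' < i \<Longrightarrow> prn (ord i') \<in> rest ord (Suc i') \<and>
        (\<forall>z<n. \<forall>b\<in>rest ord (Suc i'). z \<in> set (bs ! ord i') \<longrightarrow> z \<in> set (bs ! b) \<longrightarrow> z \<in> set (bs ! prn (ord i')))"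
    using inv unfolding strip_inv_def by blast+
  have RN: "?R \<subseteq> {..<N}" and finR: "finite ?R" unfolding rest_def by auto
  have cR: "card ?R = N - i" using card_rest te by blast
  then have R2: "card ?R \<ge> 2" using i by simp
  obtain l where l: "l \<in> ?R" "card (?Nb l) \<le> 1"
    using leaf_exists[OF TE_simple TE_forest con(1) RN R2] by blast
  then have "l \<in> ord ` {i..<te}" using queue by blast
  then show itl: "i < te" by auto
  have jR: "j \<in> ?R"
    using itl te(3,4) unfolding rest_def j_def by (auto dest: inj_onD)
  then show jN: "ord i < N" using RN unfolding j_def by blast
  have "card (?Nb j) \<le> 1" using queue[OF jR] itl unfolding j_def by auto
  moreover have "card (?Nb j) > 0"
    using nbr_exists[OF con(1) finR R2 jR] finR by (auto simp: card_gt_0_iff)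
  ultimately have "card (?Nb j) = 1" by simp
  then obtain p' where p': "?Nb j = {p'}" by (auto simp: card_1_singleton_iff)
  then have p'R: "p' \<in> ?R" by blast
  then have "p = p'" using arr[OF jR] p' RN unfolding p_def by auto
  with p' p'R have Nj: "?Nb j = {p}" and pR: "p \<in> ?R" by auto
  have pj: "p \<noteq> j" using Nj simple_nbrs_irrefl[OF TE_simple, of j] by auto
  have pN: "p < N" using pR RN by blast
  show "nb (ord i) < N" "nb (ord i) \<noteq> ord i" using pN pj unfolding p_def j_def by auto
  have jp: "j \<in> ?Nb p" using Nj nbrs_sym jR by blast
  have dgp: "dg p = card (?Nb p)" using arr pR by blast
  then have dp: "dg p > 0" using jp finR by (auto simp: card_gt_0_iff)
  then show "dg (nb (ord i)) > 0" unfolding p_def j_def .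
  let ?c = "dg p - 1 = 1"
  let ?ord = "if ?c then ord(te := p) else ord"
  let ?te = "if ?c then Suc te else te"
  \<comment> \<open>The degree of \<open>p\<close> was 2 before the step, so \<open>p\<close> was
    not a leaf and is not yet in the queue.\<close>
  have pq: "p \<notin> ord ` {i..<te}" if ?c using queue[OF pR] that dgp by auto
  have pnew: "p \<notin> ord ` {..<te}" if ?c
    using pq[OF that] pR unfolding rest_def by (auto simp: not_less) (metis atLeastLessThan_iff image_eqI not_less lessThan_iff)
  have tlN: "te < N" if ?c
  proof -
    have "card (insert p (ord ` {..<te})) \<le> card {..<N}"
      using te(4) pN by (intro card_mono) auto
    then show ?thesis using pnew[OF that] card_image[OF te(3)] by simp
  qed
  then show "dg (nb (ord i)) - 1 = 1 \<Longrightarrow> te < N" unfolding p_def j_def by blast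
  have same: "?ord k = ord k" if "k < te" for k using that by simp
  have rest': "rest ?ord k = rest ord k" if "k \<le> te" for k
    using that unfolding rest_def by (auto simp: image_iff)
  let ?R' = "rest ord (Suc i)"
  have R': "?R' = ?R - {j}" unfolding rest_def j_def by (auto simp: less_Suc_eq)
  have Nb': "nbrs TE k \<inter> ?R' = ?Nb k - {j}" for k unfolding R' by blast
  have Nbk: "nbrs TE k \<inter> ?R' = ?Nb k" if "k \<in> ?R'" "k \<noteq> p" for k
  proof -
    have "k \<notin> ?Nb j" using Nj that by blast
    then have "j \<notin> nbrs TE k" using that nbrs_sym unfolding R' by blast
    then show ?thesis unfolding Nb' by blast
  qed
  have cp: "card (nbrs TE p \<inter> ?R') = dg p - 1"
    unfolding Nb' dgp using jp finR by (simp add: card_Diff_singleton)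
  \<comment> \<open>Adding \<open>N - j\<close> subtracts \<open>j\<close> modulo \<open>N\<close>
    without running into truncated subtraction.\<close>
  have sp: "\<Sum>(nbrs TE p \<inter> ?R') mod N = (nb p + (N - j)) mod N"
  proof -
    have "\<Sum>(?Nb p) = j + \<Sum>(nbrs TE p \<inter> ?R')"
      unfolding Nb' using jp finR by (simp add: sum.remove)
    then have "(nb p + (N - j)) mod N = (j + \<Sum>(nbrs TE p \<inter> ?R') + (N - j)) mod N"
      using arr[OF pR] by (simp add: mod_add_left_eq)
    also have "j + \<Sum>(nbrs TE p \<inter> ?R') + (N - j) = \<Sum>(nbrs TE p \<inter> ?R') + N"
      using jN unfolding j_def by simp
    finally show ?thesis by simp
  qed
  have "strip_inv (Suc i) ?te ?ord (dg(p := dg p - 1)) (nb(p := (nb p + (N - j)) mod N)) (prn(j := p))"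
    unfolding strip_inv_def
  proof (intro conjI)
    show "Suc i \<le> ?te" using itl by simp
    show "?te \<le> N" using tlN te by (simp add: Suc_le_eq)
    show "inj_on ?ord {..<?te}"
      using te(3) pnew by (auto simp: lessThan_Suc inj_on_def)
    show "?ord ` {..<?te} \<subseteq> {..<N}"
      using te(4) pN by (auto simp: lessThan_Suc)
    have rS: "rest ?ord (Suc i) = ?R'" using rest'[of "Suc i"] itl by simp
    show "\<forall>k\<in>rest ?ord (Suc i). (dg(p := dg p - 1)) k = card (nbrs TE k \<inter> rest ?ord (Suc i)) \<and>
      (nb(p := (nb p + (N - j)) mod N)) k = \<Sum>(nbrs TE k \<inter> rest ?ord (Suc i)) mod N"
      unfolding rS
    proof
      fix k assume k: "k \<in> ?R'"
      show "(dg(p := dg p - 1)) k = card (nbrs TE k \<inter> ?R') \<and>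
        (nb(p := (nb p + (N - j)) mod N)) k = \<Sum>(nbrs TE k \<inter> ?R') mod N"
      proof (cases "k = p")
        case True
        then show ?thesis using cp sp by simp
      next
        case False
        then show ?thesis using Nbk[OF k False] arr[of k] k unfolding R' by auto
      qed
    qed
    show "\<forall>k\<in>rest ?ord (Suc i). (card (nbrs TE k \<inter> rest ?ord (Suc i)) \<le> 1) = (k \<in> ?ord ` {Suc i..<?te})"
      unfolding rS
    proof
      fix k assume k: "k \<in> ?R'"
      have kR: "k \<in> ?R" "k \<noteq> j" using k unfolding R' by auto
      have "{i..<te} = insert i {Suc i..<te}" using itl by auto
      then have Q: "k \<in> ord ` {i..<te} \<longleftrightarrow> k \<in> ord ` {Suc i..<te}" using kR(2) unfolding j_def by auto
      have "?ord ` {Suc i..<te} = ord ` {Suc i..<te}" by (intro image_cong) auto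
      moreover have "{Suc i..<Suc te} = insert te {Suc i..<te}" using itl by auto
      ultimately have Q': "k \<in> ?ord ` {Suc i..<?te} \<longleftrightarrow> k \<in> ord ` {Suc i..<te} \<or> ?c \<and> k = p"
        by auto
      show "(card (nbrs TE k \<inter> ?R') \<le> 1) = (k \<in> ?ord ` {Suc i..<?te})"
      proof (cases "k = p")
        case True
        then show ?thesis unfolding Q' using cp queue[OF pR] dgp dp unfolding True Q[unfolded True] by auto
      next
        case False
        then show ?thesis unfolding Q' using Nbk[OF k False] queue[OF kR(1)] Q by simp
      qed
    qed
    show "connected_in TE (rest ?ord (Suc i))"
      unfolding rS R' using connected_in_remove[OF con(1) _ order_refl, of j p] Nj by blast
    show "\<forall>z<n. connected_in TE (rest ?ord (Suc i) \<inter> holders z)"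
    proof (intro allI impI)
      fix z assume z: "z < n"
      have "connected_in TE (?R \<inter> holders z - {j})"
        using connected_in_remove[OF con(2)[OF z], of j ?R p] Nj by blast
      moreover have "?R' \<inter> holders z = ?R \<inter> holders z - {j}" unfolding R' by blast
      ultimately show "connected_in TE (rest ?ord (Suc i) \<inter> holders z)" unfolding rS by simp
    qed
    show "\<forall>i'<Suc i. (prn(j := p)) (?ord i') \<in> rest ?ord (Suc i') \<and>
      (\<forall>z<n. \<forall>b\<in>rest ?ord (Suc i'). z \<in> set (bs ! ?ord i') \<longrightarrow> z \<in> set (bs ! b) \<longrightarrow>
        z \<in> set (bs ! (prn(j := p)) (?ord i')))"
    proof (intro allI impI)
      fix i' assume i': "i' < Suc i"
      have r: "rest ?ord (Suc i') = rest ord (Suc i')" using i' itl by (intro rest') simp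
      have o: "?ord i' = ord i'" using i' itl by simp
      show "(prn(j := p)) (?ord i') \<in> rest ?ord (Suc i') \<and>
      (\<forall>z<n. \<forall>b\<in>rest ?ord (Suc i'). z \<in> set (bs ! ?ord i') \<longrightarrow> z \<in> set (bs ! b) \<longrightarrow>
        z \<in> set (bs ! (prn(j := p)) (?ord i')))"
      proof (cases "i' = i")
        case True
        have "p \<in> holders z" if z: "z < n" "b \<in> ?R'" "z \<in> set (bs ! j)" "z \<in> set (bs ! b)" for z b
        proof -
          have "p \<in> ?R \<inter> holders z"
          proof (rule connected_in_leaf[OF con(2)[OF z(1)], of j ?R])
            show "nbrs TE j \<inter> ?R \<subseteq> {p}" using Nj by blast
            show "j \<in> ?R \<inter> holders z" using jR RN z unfolding holders_def by auto
            show "b \<in> ?R \<inter> holders z" "b \<noteq> j" using z RN unfolding R' holders_def by auto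
          qed auto
          then show ?thesis by blast
        qed
        then show ?thesis
          unfolding r o unfolding True using pR pj R' unfolding j_def[symmetric] holders_def by auto
      next
        case False
        then have "i' < i" using i' by simp
        moreover have "ord i' \<noteq> j"
          using \<open>i' < i\<close> itl te(3) unfolding j_def by (auto dest: inj_onD)
        ultimately show ?thesis unfolding r o using old[of i'] by simp
      qed
    qed
  qed
  then show "strip_inv (Suc i) (if dg (nb (ord i)) - 1 = 1 then Suc te else te)
      (if dg (nb (ord i)) - 1 = 1 then ord(te := nb (ord i)) else ord)
      (dg(nb (ord i) := dg (nb (ord i)) - 1))
      (nb(nb (ord i) := (nb (nb (ord i)) + (N - ord i)) mod N)) (prn(ord i := nb (ord i)))"
    unfolding p_def j_def .
qed

lemma strip_init:
  assumes te: "te \<le> N" "inj_on ord {..<te}"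
    and queue: "ord ` {..<te} = {j. j < N \<and> card (nbrs TE j) \<le> 1}"
    and arr: "\<And>j. j < N \<Longrightarrow> dg j = card (nbrs TE j) \<and> nb j = \<Sum>(nbrs TE j) mod N"
  shows "strip_inv 0 te ord dg nb prn"
proof -
  have r: "rest ord 0 = {..<N}" unfolding rest_def by simp
  have "nbrs TE j \<inter> {..<N} = nbrs TE j" for j using nbrs_ends TE_ends by blast
  moreover have "{..<N} \<inter> holders z = holders z" for z unfolding holders_def by auto
  ultimately show ?thesis
    unfolding strip_inv_def r using assms TE_connected holders_connected
    by (auto simp: lessThan_atLeast0)
qed

text \<open>The last remaining node has no neighbour left and is therefore in the queue, so the
  queue has reached full length and \<open>ord\<close> is a permutation.\<close>

lemma strip_final:
  assumes inv: "strip_inv (N - 1) te ord dg nb prn"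
  shows "inj_on ord {..<N}" "ord ` {..<N} = {..<N}"
proof -
  let ?R = "rest ord (N - 1)"
  have te: "N - 1 \<le> te" "te \<le> N" "inj_on ord {..<te}" "ord ` {..<te} \<subseteq> {..<N}"
    and queue: "\<And>k. k \<in> ?R \<Longrightarrow> card (nbrs TE k \<inter> ?R) \<le> 1 \<longleftrightarrow> k \<in> ord ` {N - 1..<te}"
    using inv unfolding strip_inv_def by blast+
  have "card ?R = 1" using card_rest[OF te(3,4,1)] N_pos by simp
  then obtain k where k: "?R = {k}" by (auto simp: card_1_singleton_iff)
  have "card (nbrs TE k \<inter> ?R) \<le> 1" unfolding k using card_mono[of "{k}" "nbrs TE k \<inter> {k}"] by simp
  then have "k \<in> ord ` {N - 1..<te}" using queue[of k] k by simp
  then have "te = N" using te by auto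
  then show 1: "inj_on ord {..<N}" using te by simp
  then show "ord ` {..<N} = {..<N}" using \<open>te = N\<close> te(4) by (simp add: card_image card_subset_eq)
qed

end

section \<open>From the removal order to a node order that includes the edges of the graph\<close>

context decomposition
begin

abbreviation "W \<equiv> Suc w"

lemma card_bag: "i < N \<Longrightarrow> card (set (bs ! i)) = length (bs ! i)"
  using distinct_bs by (simp add: distinct_card)

text \<open>Vertex 0 lies in some bag, so the largest bag is not empty and the truncated subtraction
  in \<open>width\<close> loses nothing.\<close>

lemma Max_bag: "Max ((\<lambda>i. length (bs ! i)) ` {..<N}) = W"
proof -
  have eq: "(\<lambda>i. card (set (bs ! i))) ` {..<N} = (\<lambda>i. length (bs ! i)) ` {..<N}"
    using card_bag by (intro image_cong) auto
  have "width (graph_of [0..<N] ts) (\<lambda>i. set (bs ! i)) = Max ((\<lambda>i. card (set (bs ! i))) ` {..<N}) - 1"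
    unfolding width_def graph_of_def by (simp add: atLeast0LessThan)
  then have w: "Max ((\<lambda>i. length (bs ! i)) ` {..<N}) - 1 = w" using width unfolding eq by simp
  obtain i where i: "i < N" "0 \<in> set (bs ! i)" using cover[of 0] n by blast
  then have "length (bs ! i) > 0" by (cases "bs ! i") auto
  moreover have "length (bs ! i) \<le> Max ((\<lambda>i. length (bs ! i)) ` {..<N})"
    using i by (intro Max_ge) auto
  ultimately show ?thesis using w by linarith
qed

lemma bag_size: "i < N \<Longrightarrow> length (bs ! i) \<le> W"
  using Max_ge[of "(\<lambda>i. length (bs ! i)) ` {..<N}" "length (bs ! i)"] unfolding Max_bag by auto

lemma two_le_W: "k < m \<Longrightarrow> 2 \<le> W"
proof -
  assume k: "k < m"
  then obtain i where i: "i < N" "fst (es ! k) \<in> set (bs ! i)" "snd (es ! k) \<in> set (bs ! i)"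
    using edge_cover by blast
  have "card {fst (es ! k), snd (es ! k)} \<le> card (set (bs ! i))" using i by (intro card_mono) auto
  then show ?thesis using valid_edge(3)[OF valid_es k] card_bag[OF i(1)] bag_size[OF i(1)] by simp
qed

text \<open>An edge is determined by a bag that contains it and two positions there. This is why a
  node of its own for every edge keeps the total time linear in the number of bags.\<close>

lemma m_bound: "m \<le> N * (W * W)"
proof -
  have inj: "inj_on (\<lambda>k. edge_of (es ! k)) {..<m}"
    using valid_es unfolding valid_graph_lists_def
    by (intro inj_onI) (metis length_map lessThan_iff nth_eq_iff_index_eq nth_map)
  have "(\<lambda>k. edge_of (es ! k)) ` {..<m} \<subseteq>
    (\<lambda>(i, p, r). {bs ! i ! p, bs ! i ! r}) ` ({..<N} \<times> {..<W} \<times> {..<W})"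
  proof
    fix d assume "d \<in> (\<lambda>k. edge_of (es ! k)) ` {..<m}"
    then obtain k where k: "k < m" "d = edge_of (es ! k)" by auto
    obtain i where i: "i < N" "fst (es ! k) \<in> set (bs ! i)" "snd (es ! k) \<in> set (bs ! i)"
      using edge_cover[OF k(1)] by blast
    obtain p r where pr: "p < length (bs ! i)" "bs ! i ! p = fst (es ! k)"
      "r < length (bs ! i)" "bs ! i ! r = snd (es ! k)" using i(2,3) by (auto simp: in_set_conv_nth)
    then have "(i, p, r) \<in> {..<N} \<times> {..<W} \<times> {..<W}" "d = (\<lambda>(i, p, r). {bs ! i ! p, bs ! i ! r}) (i, p, r)"
      using bag_size[OF i(1)] i(1) k(2) unfolding edge_of_def by auto
    then show "d \<in> (\<lambda>(i, p, r). {bs ! i ! p, bs ! i ! r}) ` ({..<N} \<times> {..<W} \<times> {..<W})" by (rule rev_image_eqI)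
  qed
  then have "card ((\<lambda>k. edge_of (es ! k)) ` {..<m}) \<le> card ({..<N} \<times> {..<W} \<times> {..<W})"
    by (intro surj_card_le) auto
  then show ?thesis using card_image[OF inj] by simp
qed

text \<open>All bags get \<open>W\<close> positions: they are padded with the numbers \<open>n + p\<close>, which are not vertices.\<close>

definition bagf :: "(nat \<Rightarrow> nat) \<Rightarrow> nat \<Rightarrow> nat \<Rightarrow> nat" where
  "bagf ord x p = (if x < m then (if p = 0 then fst (es ! x) else if p = 1 then snd (es ! x) else n + p)
     else (if p < length (bs ! ord (x - m)) then bs ! ord (x - m) ! p else n + p))"

text \<open>\<open>topn\<close> gives the last bag in which a vertex occurs. The earlier of the two
  last bags of the ends contains both ends, which makes it a suitable parent for the edge and avoids
  a search.\<close>

definition parf :: "(nat \<Rightarrow> nat) \<Rightarrow> (nat \<Rightarrow> nat) \<Rightarrow> (nat \<Rightarrow> nat) \<Rightarrow> (nat \<Rightarrow> nat) \<Rightarrow> nat \<Rightarrow> nat" where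
  "parf ord prn pos topn x = m + (if x < m then min (topn (fst (es ! x))) (topn (snd (es ! x)))
     else pos (prn (ord (x - m))))"

definition ordered :: "(nat \<Rightarrow> nat) \<Rightarrow> (nat \<Rightarrow> nat) \<Rightarrow> (nat \<Rightarrow> nat) \<Rightarrow> (nat \<Rightarrow> nat) \<Rightarrow> bool" where
  "ordered ord prn pos topn \<longleftrightarrow> inj_on ord {..<N} \<and> ord ` {..<N} = {..<N} \<and>
     (\<forall>i<N - 1. prn (ord i) \<in> rest ord (Suc i) \<and>
        (\<forall>z<n. \<forall>b\<in>rest ord (Suc i). z \<in> set (bs ! ord i) \<longrightarrow> z \<in> set (bs ! b) \<longrightarrow> z \<in> set (bs ! prn (ord i)))) \<and>
     (\<forall>i<N. pos (ord i) = i) \<and>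
     (\<forall>z<n. topn z < N \<and> z \<in> set (bs ! ord (topn z)) \<and> (\<forall>i<N. z \<in> set (bs ! ord i) \<longrightarrow> i \<le> topn z))"

lemma bagf_edge_image:
  assumes "x < m" "z < n"
  shows "z \<in> bagf ord x ` {..<W} \<longleftrightarrow> z = fst (es ! x) \<or> z = snd (es ! x)"
proof
  assume "z \<in> bagf ord x ` {..<W}"
  then show "z = fst (es ! x) \<or> z = snd (es ! x)"
    using assms unfolding bagf_def by (auto split: if_splits)
next
  have "1 < W" using two_le_W[OF assms(1)] by simp
  then have "bagf ord x 0 \<in> bagf ord x ` {..<W}" "bagf ord x 1 \<in> bagf ord x ` {..<W}" by auto
  moreover assume "z = fst (es ! x) \<or> z = snd (es ! x)"
  ultimately show "z \<in> bagf ord x ` {..<W}" using assms(1) unfolding bagf_def by auto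
qed

lemma bagf_node_image:
  assumes "i < N" "ord i < N" "z < n"
  shows "z \<in> bagf ord (m + i) ` {..<W} \<longleftrightarrow> z \<in> set (bs ! ord i)"
proof
  assume "z \<in> bagf ord (m + i) ` {..<W}"
  then show "z \<in> set (bs ! ord i)" using assms unfolding bagf_def by (auto split: if_splits)
next
  assume "z \<in> set (bs ! ord i)"
  then obtain p where "p < length (bs ! ord i)" "z = bs ! ord i ! p" by (auto simp: in_set_conv_nth)
  then have "p < W" "z = bagf ord (m + i) p" using bag_size[OF assms(2)] unfolding bagf_def by auto
  then show "z \<in> bagf ord (m + i) ` {..<W}" by simp
qed

lemma bagf_inj:
  assumes "x < m + N" and "x \<ge> m \<Longrightarrow> ord (x - m) < N"
  shows "inj_on (bagf ord x) {..<W}"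
proof (rule inj_onI)
  fix p r assume eq: "bagf ord x p = bagf ord x r"
  show "p = r"
  proof (cases "x < m")
    case True
    then show ?thesis using eq valid_edge[OF valid_es True] unfolding bagf_def by (auto split: if_splits)
  next
    case False
    then have o: "ord (x - m) < N" using assms by simp
    have lt: "bs ! ord (x - m) ! p < n" if "p < length (bs ! ord (x - m))" for p
      using bag_less[OF o] that by simp
    have "distinct (bs ! ord (x - m))" using distinct_bs o by simp
    then show ?thesis using eq lt[of p] lt[of r] False unfolding bagf_def
      by (auto simp: nth_eq_iff_index_eq split: if_splits)
  qed
qed

lemma ordered_node_order:
  assumes "ordered ord prn pos topn"
  shows "node_order W m (m + N) (edge_at es) (bagf ord) (parf ord prn pos topn)"
proof -
  have inj: "inj_on ord {..<N}" and im: "ord ` {..<N} = {..<N}"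
    and prn: "\<And>i. i < N - 1 \<Longrightarrow> prn (ord i) \<in> rest ord (Suc i)"
    and rip: "\<And>i z b. i < N - 1 \<Longrightarrow> z < n \<Longrightarrow> b \<in> rest ord (Suc i) \<Longrightarrow> z \<in> set (bs ! ord i) \<Longrightarrow>
        z \<in> set (bs ! b) \<Longrightarrow> z \<in> set (bs ! prn (ord i))"
    and pos: "\<And>i. i < N \<Longrightarrow> pos (ord i) = i"
    and topn: "\<And>z. z < n \<Longrightarrow> topn z < N \<and> z \<in> set (bs ! ord (topn z))"
    and topn_max: "\<And>z i. z < n \<Longrightarrow> i < N \<Longrightarrow> z \<in> set (bs ! ord i) \<Longrightarrow> i \<le> topn z"
    using assms unfolding ordered_def by blast+
  have ordN: "ord i < N" if "i < N" for i using im that by blast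
  let ?par = "\<lambda>i. pos (prn (ord i))"
  have par: "i < ?par i \<and> ?par i < N \<and> ord (?par i) = prn (ord i)" if i: "i < N - 1" for i
  proof -
    have "prn (ord i) \<in> ord ` {..<N}" "prn (ord i) \<notin> ord ` {..<Suc i}"
      using prn[OF i] im unfolding rest_def by auto
    then obtain j where "j < N" "prn (ord i) = ord j" "\<not> j < Suc i" by blast
    then show ?thesis using pos[of j] by simp
  qed
  have rip': "z \<in> set (bs ! ord (?par i))"
    if "i < N - 1" "i < j" "j < N" "z < n" "z \<in> set (bs ! ord i)" "z \<in> set (bs ! ord j)" for i j z
  proof -
    have "ord j \<in> rest ord (Suc i)"
      using that ordN[OF that(3)] inj unfolding rest_def by (auto dest!: inj_onD)
    then show ?thesis using rip[OF that(1,4) _ that(5,6)] par[OF that(1)] by simp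
  qed
  \<comment> \<open>Start at any bag with both ends and move to the parent. As long as the position
    lies below both last occurrences, \<open>rip'\<close> carries both vertices along, and
    \<open>topn_max\<close> prevents overshooting; the distance to the minimum decreases.\<close>
  have climb: "u \<in> set (bs ! ord (min (topn u) (topn v))) \<and> v \<in> set (bs ! ord (min (topn u) (topn v)))"
    if "i < N" "u < n" "v < n" "u \<in> set (bs ! ord i)" "v \<in> set (bs ! ord i)" for i u v
    using that(1,4,5)
  proof (induction "min (topn u) (topn v) - i" arbitrary: i rule: less_induct)
    case less
    have le: "i \<le> min (topn u) (topn v)" using topn_max less.prems that(2,3) by simp
    show ?case
    proof (cases "i = min (topn u) (topn v)")
      case True
      then show ?thesis using less.prems by simp
    next
      case False
      then have lt: "i < topn u" "i < topn v" using le by auto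
      have tN: "topn u < N" "topn v < N" using topn that(2,3) by auto
      have iN: "i < N - 1" using lt tN by simp
      have "u \<in> set (bs ! ord (?par i))" "v \<in> set (bs ! ord (?par i))"
        using rip'[OF iN lt(1) tN(1) that(2)] rip'[OF iN lt(2) tN(2) that(3)] less.prems topn that(2,3) by auto
      then show ?thesis using less.hyps[of "?par i"] par[OF iN] lt by auto
    qed
  qed
  have edge: "fst (es ! k) \<in> set (bs ! ord (min (topn (fst (es ! k))) (topn (snd (es ! k))))) \<and>
    snd (es ! k) \<in> set (bs ! ord (min (topn (fst (es ! k))) (topn (snd (es ! k)))))" if k: "k < m" for k
  proof -
    obtain i where "i < N" "fst (es ! k) \<in> set (bs ! i)" "snd (es ! k) \<in> set (bs ! i)"
      using edge_cover[OF k] by blast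
    moreover from this obtain j where "j < N" "i = ord j" using im by blast
    ultimately show ?thesis using climb[of j] valid_edge[OF valid_es k] by blast
  qed
  have topN: "min (topn (fst (es ! k))) (topn (snd (es ! k))) < N" if "k < m" for k
    using topn valid_edge[OF valid_es that] by (simp add: min_def)
  show ?thesis
  proof
    show "m < m + N" using N_pos by simp
    show "inj_on (bagf ord x) {..<W}" if "x < m + N" for x
      using bagf_inj[of x ord] that ordN by simp
    show "fst (edge_at es k) = k" for k by simp
    show "1 < W \<and> bagf ord k 0 = src (edge_at es k) \<and> bagf ord k 1 = dst (edge_at es k)" if "k < m" for k
      using two_le_W[OF that] that unfolding bagf_def by simp
    show "x < parf ord prn pos topn x \<and> parf ord prn pos topn x < m + N" if x: "x < m + N - 1" for x
    proof (cases "x < m")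
      case True
      then show ?thesis using topN[OF True] unfolding parf_def by simp
    next
      case False
      then have "x - m < N - 1" using x by simp
      then show ?thesis using par[of "x - m"] False unfolding parf_def by auto
    qed
    fix x y z
    assume x: "x < m + N - 1" and xy: "x < y" "y < m + N" and z: "z \<in> ends (edge_at es ` {..<m})"
      and zx: "z \<in> bagf ord x ` {..<W}" and zy: "z \<in> bagf ord y ` {..<W}"
    have zn: "z < n" using z valid_ends[OF valid_es, of "{..<m}"] by auto
    show "z \<in> bagf ord (parf ord prn pos topn x) ` {..<W}"
    proof (cases "x < m")
      case True
      then have "z = fst (es ! x) \<or> z = snd (es ! x)" using zx bagf_edge_image[OF True zn] by simp
      then show ?thesis
        using edge[OF True] topN[OF True] True bagf_node_image[of _ ord, OF topN[OF True] ordN[OF topN[OF True]] zn]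
        unfolding parf_def by auto
    next
      case False
      define i j where "i = x - m" and "j = y - m"
      have ij: "x = m + i" "y = m + j" "i < N - 1" "i < j" "j < N"
        using False x xy N_pos unfolding i_def j_def by auto
      have "z \<in> set (bs ! ord i)" "z \<in> set (bs ! ord j)"
        using zx zy bagf_node_image[of i ord z] bagf_node_image[of j ord z] ordN zn ij by auto
      then have "z \<in> set (bs ! ord (?par i))" using rip' ij zn by blast
      then show ?thesis
        using bagf_node_image[of "?par i" ord z] ordN[of "?par i"] zn par[OF ij(3)] ij(1) unfolding parf_def by simp
    qed
  qed
qed

end

section \<open>Total correctness with time bounds\<close>

text \<open>\<open>T\<close> is only an upper bound, so times may be rounded up, whereas
  \<open>exec\<close> counts exactly. Since \<open>exec\<close> is deterministic, the existence of
  one such run is total correctness.\<close>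

definition tri :: "nat \<Rightarrow> prog \<Rightarrow> memory \<Rightarrow> nat \<Rightarrow> (memory \<Rightarrow> bool) \<Rightarrow> bool" where
  "tri B P s T Q \<longleftrightarrow> (\<exists>t s'. exec B P s t s' \<and> t \<le> T \<and> Q s')"

fun writes :: "prog \<Rightarrow> nat set" where
  "writes Skip = {}"
| "writes (Write a e f) = {a}"
| "writes (Seq P Q) = writes P \<union> writes Q"
| "writes (Cond e P Q) = writes P \<union> writes Q"
| "writes (While e P) = writes P"

text \<open>A frame condition by array names: arrays that a program does not mention as targets keep
  their contents. Loops hand it to their invariants, which can then be confined to what
  changes.\<close>

definition agree :: "nat set \<Rightarrow> memory \<Rightarrow> memory \<Rightarrow> bool" where
  "agree A s s' \<longleftrightarrow> (\<forall>a. a \<notin> A \<longrightarrow> s' a = s a)"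

lemma agreeD: "agree A s s' \<Longrightarrow> a \<notin> A \<Longrightarrow> s' a = s a"
  unfolding agree_def by blast

lemma exec_agree: "exec B P s t s' \<Longrightarrow> agree (writes P) s s'"
  unfolding agree_def by (induction rule: exec.induct) auto

lemma tri_mono: "tri B P s T Q \<Longrightarrow> T \<le> T' \<Longrightarrow> (\<And>s'. agree (writes P) s s' \<Longrightarrow> Q s' \<Longrightarrow> Q' s') \<Longrightarrow> tri B P s T' Q'"
  unfolding tri_def using exec_agree le_trans by blast

lemma tri_Skip [simp]: "tri B Skip s T Q \<longleftrightarrow> 1 \<le> T \<and> Q s"
  unfolding tri_def by (auto intro!: exI[of _ 1] exec.Skip[unfolded One_nat_def] elim: exec.cases)

lemma tri_Write [simp]:
  "tri B (Write a e f) s T Q \<longleftrightarrow> eval_expr e s \<le> B \<and> eval_expr f s \<le> B \<and> 1 + cost_expr e + cost_expr f \<le> T \<and>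
     Q (s(a := (s a)(eval_expr e s := eval_expr f s)))"
  unfolding tri_def
  by (auto intro!: exec.Write exI[of _ "1 + cost_expr e + cost_expr f"] elim: exec.cases)

lemma tri_SeqI:
  assumes "tri B P s T1 R" "\<And>s'. agree (writes P) s s' \<Longrightarrow> R s' \<Longrightarrow> tri B P' s' T2 Q" "T1 + T2 \<le> T"
  shows "tri B (Seq P P') s T Q"
proof -
  obtain t s' where 1: "exec B P s t s'" "t \<le> T1" "R s'" using assms(1) unfolding tri_def by blast
  obtain u s'' where "exec B P' s' u s''" "u \<le> T2" "Q s''"
    using assms(2)[OF exec_agree[OF 1(1)] 1(3)] unfolding tri_def by blast
  then show ?thesis unfolding tri_def using 1 assms(3)
    by (intro exI[of _ "t + u"] exI[of _ s'']) (auto intro: exec.Seq)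
qed

text \<open>As an equivalence for the simplifier it executes a leading assignment symbolically and
  subtracts its cost from the remaining time.\<close>

lemma tri_Write_Seq [simp]:
  "tri B (Seq (Write a e f) P) s T Q \<longleftrightarrow> eval_expr e s \<le> B \<and> eval_expr f s \<le> B \<and>
     1 + cost_expr e + cost_expr f \<le> T \<and>
     tri B P (s(a := (s a)(eval_expr e s := eval_expr f s))) (T - (1 + cost_expr e + cost_expr f)) Q"
    (is "?l \<longleftrightarrow> ?r")
proof
  assume ?l
  then obtain t s' where t: "exec B (Seq (Write a e f) P) s t s'" "t \<le> T" "Q s'" unfolding tri_def by blast
  from t(1) obtain t1 s1 u where 1: "exec B (Write a e f) s t1 s1" "exec B P s1 u s'" "t = t1 + u"
    by (auto elim: exec.cases)
  from 1(1) have 2: "eval_expr e s \<le> B" "eval_expr f s \<le> B" "t1 = 1 + cost_expr e + cost_expr f"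
    "s1 = s(a := (s a)(eval_expr e s := eval_expr f s))"
    by (auto elim: exec.cases)
  have "u \<le> T - (1 + cost_expr e + cost_expr f)" using t(2) 1(3) 2(3) by simp
  then show ?r using 1 2 t unfolding tri_def by auto
next
  assume ?r
  then show ?l by (intro tri_SeqI[where R = "\<lambda>s'. s' = s(a := (s a)(eval_expr e s := eval_expr f s))"
    and ?T1.0 = "1 + cost_expr e + cost_expr f"]) auto
qed

lemma tri_Write_SeqI:
  assumes "eval_expr e s = i" "eval_expr f s = v" "i \<le> B" "v \<le> B"
    "tri B P (s(a := (s a)(i := v))) T Q" "T + 1 + cost_expr e + cost_expr f \<le> T'"
  shows "tri B (Seq (Write a e f) P) s T' Q"
  using assms tri_mono[of B P _ T Q "T' - (1 + cost_expr e + cost_expr f)" Q] by simp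

lemma tri_Cond [simp]:
  "tri B (Cond e P P') s T Q \<longleftrightarrow> 1 + cost_expr e \<le> T \<and>
     (if eval_expr e s \<noteq> 0 then tri B P s (T - (1 + cost_expr e)) Q
      else tri B P' s (T - (1 + cost_expr e)) Q)" (is "?l \<longleftrightarrow> ?r")
proof
  assume ?l
  then obtain t s' where t: "exec B (Cond e P P') s t s'" "t \<le> T" "Q s'" unfolding tri_def by blast
  from t(1) show ?r
  proof cases
    case (CondTrue u)
    then show ?thesis using t unfolding tri_def by (auto intro!: exI[of _ u])
  next
    case (CondFalse u)
    then show ?thesis using t unfolding tri_def by (auto intro!: exI[of _ u])
  qed
next
  assume r: ?r
  then obtain t s' where t: "exec B (if eval_expr e s \<noteq> 0 then P else P') s t s'" "t \<le> T - (1 + cost_expr e)" "Q s'"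
    unfolding tri_def by (auto split: if_splits)
  then have "exec B (Cond e P P') s (1 + cost_expr e + t) s'"
    using exec.CondTrue[of e s B P t s' P'] exec.CondFalse[of e s B P' t s' P] by (simp split: if_splits)
  then show ?l using t r unfolding tri_def by (intro exI[of _ "1 + cost_expr e + t"] exI[of _ s']) auto
qed

lemma tri_CondT: "eval_expr e s \<noteq> 0 \<Longrightarrow> tri B P s T Q \<Longrightarrow> T + 1 + cost_expr e \<le> T' \<Longrightarrow> tri B (Cond e P P') s T' Q"
  using tri_mono[of B P s T Q "T' - (1 + cost_expr e)" Q] by simp

abbreviation V :: "nat \<Rightarrow> expr" where "V x \<equiv> Read x (Num 0)"
abbreviation Set :: "nat \<Rightarrow> expr \<Rightarrow> prog" where "Set x e \<equiv> Write x (Num 0) e"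

text \<open>Subtraction truncates, so the two differences add up to 0 exactly for equal
  values.\<close>

definition Eq :: "expr \<Rightarrow> expr \<Rightarrow> expr" where
  "Eq e f = Sub (Num 1) (Add (Sub e f) (Sub f e))"

definition Mod :: "expr \<Rightarrow> expr \<Rightarrow> expr" where
  "Mod e f = Sub e (Mul (Div e f) f)"

lemma eval_Eq [simp]: "eval_expr (Eq e f) s = (if eval_expr e s = eval_expr f s then 1 else 0)"
  unfolding Eq_def by auto

lemma cost_Eq [simp]: "cost_expr (Eq e f) = 4 + 2 * cost_expr e + 2 * cost_expr f + 1"
  unfolding Eq_def by simp

lemma eval_Mod [simp]: "eval_expr (Mod e f) s = eval_expr e s mod eval_expr f s"
  unfolding Mod_def by (simp add: minus_div_mult_eq_mod)

lemma cost_Mod [simp]: "cost_expr (Mod e f) = 3 + 2 * cost_expr e + 2 * cost_expr f"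
  unfolding Mod_def by simp

definition For :: "nat \<Rightarrow> expr \<Rightarrow> prog \<Rightarrow> prog" where
  "For x e P = Seq (Set x (Num 0)) (While (Sub e (V x)) (Seq P (Set x (Add (V x) (Num 1)))))"

lemma writes_For [simp]: "writes (For x e P) = insert x (writes P)"
  unfolding For_def by auto

text \<open>\<open>k\<close> is the number of rounds that remain, so the induction runs backwards
  from the end of the loop.\<close>

lemma tri_While_count:
  assumes step: "\<And>i s'. i < N \<Longrightarrow> agree A s s' \<Longrightarrow> I i s' \<Longrightarrow>
      eval_expr e s' \<noteq> 0 \<and> tri B P s' T (\<lambda>s''. I (Suc i) s'')"
    and stop: "\<And>s'. agree A s s' \<Longrightarrow> I N s' \<Longrightarrow> eval_expr e s' = 0"
    and W: "writes P \<subseteq> A"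
  shows "k \<le> N \<Longrightarrow> agree A s s' \<Longrightarrow> I (N - k) s' \<Longrightarrow>
    tri B (While e P) s' (k * (1 + cost_expr e + T) + 1 + cost_expr e) (\<lambda>s''. I N s'' \<and> agree A s s'')"
proof (induction k arbitrary: s')
  case 0
  then have "exec B (While e P) s' (1 + cost_expr e) s'" using stop[of s'] by (intro exec.WhileFalse) simp
  then show ?case using 0 unfolding tri_def by (intro exI[of _ "1 + cost_expr e"] exI[of _ s']) auto
next
  case (Suc k)
  then have st: "eval_expr e s' \<noteq> 0" "tri B P s' T (\<lambda>s''. I (Suc (N - Suc k)) s'')"
    using step[of "N - Suc k" s'] by auto
  then obtain t s1 where 1: "exec B P s' t s1" "t \<le> T" "I (N - k) s1"
    using Suc.prems(1) unfolding tri_def by (auto simp: Suc_diff_Suc)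
  have "agree A s s1" using Suc.prems(2) exec_agree[OF 1(1)] W unfolding agree_def by (metis subsetD)
  from Suc.IH[OF _ this 1(3)] Suc.prems(1) obtain u s2 where
    2: "exec B (While e P) s1 u s2" "u \<le> k * (1 + cost_expr e + T) + 1 + cost_expr e" "I N s2" "agree A s s2"
    unfolding tri_def by auto
  have "exec B (While e P) s' (1 + cost_expr e + t + u) s2"
    by (rule exec.WhileTrue[OF st(1) 1(1) 2(1)])
  then show ?case unfolding tri_def using 1(2) 2
    by (intro exI[of _ "1 + cost_expr e + t + u"] exI[of _ s2]) auto
qed

text \<open>The counter is incremented after the body, so the body must establish the invariant for
  the memory in which the counter is already advanced. The constants 10 cover the test and the
  increment.\<close>

lemma tri_For:
  assumes x: "x \<notin> writes P" and N: "N \<le> B"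
    and e: "\<And>s'. agree (insert x (writes P)) s s' \<Longrightarrow> eval_expr e s' = N"
    and base: "I 0 (s(x := (s x)(0 := 0)))"
    and step: "\<And>i s'. i < N \<Longrightarrow> agree (insert x (writes P)) s s' \<Longrightarrow> s' x 0 = i \<Longrightarrow> I i s' \<Longrightarrow>
      tri B P s' T (\<lambda>s''. I (Suc i) (s''(x := (s'' x)(0 := Suc i))))"
    and post: "\<And>s'. agree (insert x (writes P)) s s' \<Longrightarrow> s' x 0 = N \<Longrightarrow> I N s' \<Longrightarrow> Q s'"
    and T: "N * (T + cost_expr e + 10) + cost_expr e + 10 \<le> T'"
  shows "tri B (For x e P) s T' Q"
proof -
  let ?A = "insert x (writes P)"
  let ?P = "Seq P (Set x (Add (V x) (Num 1)))"
  let ?s = "s(x := (s x)(0 := 0))"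
  let ?J = "\<lambda>i s'. s' x 0 = i \<and> I i s'"
  have ag: "agree ?A s ?s" unfolding agree_def by auto
  have tr: "agree ?A s s'" if "agree ?A ?s s'" for s' using that unfolding agree_def by auto
  have "tri B (While (Sub e (V x)) ?P) ?s (N * (1 + cost_expr (Sub e (V x)) + (T + 6)) + 1 + cost_expr (Sub e (V x)))
    (\<lambda>s''. ?J N s'' \<and> agree ?A ?s s'')"
  proof (rule tri_While_count[where A = ?A and I = ?J])
    fix i s' assume i: "i < N" "agree ?A ?s s'" "?J i s'"
    have "tri B ?P s' (T + 6) (?J (Suc i))"
    proof (rule tri_SeqI)
      show "tri B P s' T (\<lambda>s''. I (Suc i) (s''(x := (s'' x)(0 := Suc i))))"
        using step[OF i(1) tr[OF i(2)]] i(3) by simp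
      fix s'' assume "agree (writes P) s' s''" and I: "I (Suc i) (s''(x := (s'' x)(0 := Suc i)))"
      then have "s'' x 0 = i" using x i(3) by (simp add: agreeD)
      then show "tri B (Set x (Add (V x) (Num 1))) s'' 6 (?J (Suc i))" using I i(1) N by simp
    qed simp
    then show "eval_expr (Sub e (V x)) s' \<noteq> 0 \<and> tri B ?P s' (T + 6) (?J (Suc i))"
      using e[OF tr[OF i(2)]] i by simp
  next
    fix s' assume "agree ?A ?s s'" "?J N s'"
    then show "eval_expr (Sub e (V x)) s' = 0" using e[OF tr] by simp
  qed (use base in \<open>auto simp: agree_def\<close>)
  then have "tri B (While (Sub e (V x)) ?P) ?s (N * (1 + cost_expr (Sub e (V x)) + (T + 6)) + 1 + cost_expr (Sub e (V x))) Q"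
    by (rule tri_mono) (use post tr in auto)
  moreover have "N * (1 + cost_expr (Sub e (V x)) + (T + 6)) + 1 + cost_expr (Sub e (V x)) \<le> T' - 3" "3 \<le> T'"
    using T by (auto simp: algebra_simps)
  ultimately have "tri B (While (Sub e (V x)) ?P) ?s (T' - 3) Q" using tri_mono by blast
  then show ?thesis unfolding For_def using \<open>3 \<le> T'\<close> by (simp add: numeral_3_eq_3)
qed

section \<open>The program\<close>

text \<open>Names with \<open>a\<close> are arrays; names with \<open>v\<close> are scalars, each
  kept in cell 0 of an array of its own.\<close>

abbreviation (input) "aIn \<equiv> 0 :: nat"
abbreviation (input) "aOut \<equiv> 1 :: nat"
abbreviation (input) "vn \<equiv> 2 :: nat"
abbreviation (input) "vm \<equiv> 3 :: nat"
abbreviation (input) "vN \<equiv> 4 :: nat"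
abbreviation (input) "vW \<equiv> 5 :: nat"
abbreviation (input) "vq \<equiv> 6 :: nat"
abbreviation (input) "vS \<equiv> 7 :: nat"
abbreviation (input) "vBase \<equiv> 8 :: nat"
abbreviation (input) "vM \<equiv> 9 :: nat"
abbreviation (input) "aStart \<equiv> 10 :: nat"
abbreviation (input) "aDeg \<equiv> 11 :: nat"
abbreviation (input) "aNb \<equiv> 12 :: nat"
abbreviation (input) "aOrd \<equiv> 13 :: nat"
abbreviation (input) "aPrn \<equiv> 14 :: nat"
abbreviation (input) "aPos \<equiv> 15 :: nat"
abbreviation (input) "aTop \<equiv> 16 :: nat"
abbreviation (input) "aBag \<equiv> 17 :: nat"
abbreviation (input) "aPar \<equiv> 18 :: nat"
abbreviation (input) "aTid \<equiv> 19 :: nat"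
abbreviation (input) "aTab \<equiv> 20 :: nat"
abbreviation (input) "aLeft \<equiv> 21 :: nat"
abbreviation (input) "aRight \<equiv> 22 :: nat"
abbreviation (input) "aVal \<equiv> 23 :: nat"
abbreviation (input) "vCnt \<equiv> 24 :: nat"
abbreviation (input) "aL1 \<equiv> 25 :: nat"
abbreviation (input) "aD1 \<equiv> 26 :: nat"
abbreviation (input) "aL2 \<equiv> 27 :: nat"
abbreviation (input) "aD2 \<equiv> 28 :: nat"
abbreviation (input) "aRep \<equiv> 29 :: nat"
abbreviation (input) "vOk \<equiv> 30 :: nat"
abbreviation (input) "vTg \<equiv> 31 :: nat"
abbreviation (input) "vCode \<equiv> 32 :: nat"
abbreviation (input) "vPw \<equiv> 33 :: nat"
abbreviation (input) "aMark \<equiv> 34 :: nat"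
abbreviation (input) "aVm \<equiv> 35 :: nat"
abbreviation (input) "vBest \<equiv> 36 :: nat"
abbreviation (input) "vI \<equiv> 40 :: nat"
abbreviation (input) "vA \<equiv> 41 :: nat"
abbreviation (input) "vB \<equiv> 42 :: nat"
abbreviation (input) "vP \<equiv> 43 :: nat"
abbreviation (input) "vR \<equiv> 44 :: nat"
abbreviation (input) "vU \<equiv> 45 :: nat"
abbreviation (input) "vV \<equiv> 46 :: nat"
abbreviation (input) "vY \<equiv> 47 :: nat"
abbreviation (input) "vPtr \<equiv> 48 :: nat"
abbreviation (input) "vTail \<equiv> 49 :: nat"
abbreviation (input) "vTx \<equiv> 50 :: nat"
abbreviation (input) "vTy \<equiv> 51 :: nat"
abbreviation (input) "vLab1 \<equiv> 52 :: nat"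
abbreviation (input) "vLab2 \<equiv> 53 :: nat"
abbreviation (input) "vLo \<equiv> 54 :: nat"
abbreviation (input) "vHi \<equiv> 55 :: nat"
abbreviation (input) "vX \<equiv> 56 :: nat"

subsection \<open>Merging two states\<close>

definition decode :: "expr \<Rightarrow> nat \<Rightarrow> nat \<Rightarrow> prog" where
  "decode e L D = Seq (Set vU e) (For vP (V vW)
     (Seq (Set vV (Mod (V vU) (V vBase)))
     (Seq (Set vU (Div (V vU) (V vBase)))
     (Seq (Write L (V vP) (Div (V vV) (Num 4)))
          (Write D (V vP) (Mod (V vV) (Num 4)))))))"

lemma writes_decode [simp]: "writes (decode e L D) = {vP, vU, vV, L, D}"
  unfolding decode_def by auto

lemma tri_decode:
  assumes "s vW 0 = W" "s vBase 0 = 4 * W" "4 * W \<le> B" "eval_expr e s = a" "a \<le> B"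
    and LD: "distinct [L, D, vW, vBase, vP, vU, vV]" and T: "W * 60 + 30 + cost_expr e \<le> T"
    and W: "W > 0"
  shows "tri B (decode e L D) s T (\<lambda>s'. \<forall>p<W. s' L p = digL W a p \<and> s' D p = digD W a p)"
proof -
  define b where "b = 4 * W"
  let ?I = "\<lambda>i s'. s' vU 0 = a div b ^ i \<and> (\<forall>p<i. s' L p = digL W a p \<and> s' D p = digD W a p)"
  show ?thesis
    unfolding decode_def tri_Write_Seq
  proof (intro conjI, goal_cases)
    case 4
    show ?case
    proof (rule tri_For[where N = W and T = 45 and I = ?I], goal_cases)
      case (5 i s')
      have "s' vBase 0 = b" using LD by (simp add: agreeD[OF 5(2)] assms b_def)
      moreover have "a div b ^ i \<le> B" using assms(5) div_le_dividend order_trans by blast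
      moreover have "a div b ^ i mod b \<le> B"
        using assms(3) W unfolding b_def
        by (meson less_imp_le mod_less_divisor mult_pos_pos order_trans zero_less_numeral)
      moreover have "a div (b * b ^ i) = a div b ^ i div b"
        by (simp add: div_mult2_eq[symmetric] mult.commute)
      moreover have "i \<le> B" using 5(1) assms(3) by simp
      ultimately show ?case
        using 5 LD assms(3) unfolding digL_def digD_def b_def[symmetric]
        by (auto simp: less_Suc_eq intro: order_trans[OF div_le_dividend] order_trans[OF mod_less_eq_dividend])
    qed (use assms in \<open>auto simp: agreeD b_def\<close>)
  qed (use assms in auto)
qed

definition find :: prog where
  "find = Seq (Set vTg (Num 0)) (For vR (V vW)
     (Cond (Eq (Read aBag (Add (Mul (V vY) (V vW)) (V vR))) (Read aBag (Add (Mul (V vI) (V vW)) (V vP))))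
       (Set vTg (Add (V vR) (Num 1))) Skip))"

lemma writes_find [simp]: "writes find = {vR, vTg}"
  unfolding find_def by auto

lemma tri_find:
  assumes "s vW 0 = W" "W \<le> B"
  shows "tri B find s (W * 80 + 30)
    (\<lambda>s'. s' vTg 0 = find_pos (\<lambda>r. s aBag (s vY 0 * W + r)) (s aBag (s vI 0 * W + s vP 0)) W)"
  unfolding find_def tri_Write_Seq
proof (intro conjI, goal_cases)
  case 4
  show ?case
  proof (rule tri_For[where N = W and T = 60 and
        I = "\<lambda>i s'. s' vTg 0 = find_pos (\<lambda>r. s aBag (s vY 0 * W + r)) (s aBag (s vI 0 * W + s vP 0)) i"], goal_cases)
    case (5 i s')
    then show ?case using assms by (auto simp: agreeD[OF 5(2)])
  qed (use assms in \<open>auto simp: agreeD\<close>)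
qed auto

text \<open>Minimum and maximum of the labels are obtained from truncated subtraction. The
  assignment of \<open>vOk\<close> to itself lets both branches be described by one memory
  update.\<close>

definition unite :: prog where
  "unite =
     Seq (Set vLab1 (Read aL2 (Sub (Read aRep (Read aL1 (V vP))) (Num 1))))
     (Seq (Set vLab2 (Read aL2 (Sub (V vTg) (Num 1))))
     (Seq (Cond (Eq (V vLab1) (V vLab2)) (Set vOk (Num 0)) (Set vOk (V vOk)))
     (Seq (Set vLo (Sub (V vLab1) (Sub (V vLab1) (V vLab2))))
     (Seq (Set vHi (Add (V vLab2) (Sub (V vLab1) (V vLab2))))
     (For vR (V vW) (Cond (Eq (Read aL2 (V vR)) (V vHi)) (Write aL2 (V vR) (V vLo)) Skip))))))"

lemma writes_unite [simp]: "writes unite = {vLab1, vLab2, vOk, vLo, vHi, vR, aL2}"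
  unfolding unite_def by auto

lemma tri_unite:
  assumes "s vW 0 = W" "W \<le> B" and L: "\<And>r. r < W \<Longrightarrow> s aL2 r \<le> B" and ok: "s vOk 0 \<le> B"
    and ij: "s aRep (s aL1 (s vP 0)) - 1 = i" "s vTg 0 - 1 = j" "i < W" "j < W"
  shows "tri B unite s (W * 60 + 200) (\<lambda>s'. (\<forall>r<W. s' aL2 r = relabel (s aL2) i j r) \<and>
    s' vOk 0 = (if s aL2 i = s aL2 j then 0 else s vOk 0))"
proof -
  define s1 where "s1 = s(vLab1 := (s vLab1)(0 := s aL2 i), vLab2 := (s vLab2)(0 := s aL2 j),
    vOk := (s vOk)(0 := if s aL2 i = s aL2 j then 0 else s vOk 0),
    vLo := (s vLo)(0 := min (s aL2 i) (s aL2 j)), vHi := (s vHi)(0 := max (s aL2 i) (s aL2 j)))"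
  define Q where "Q = (\<lambda>s' :: memory. (\<forall>r<W. s' aL2 r = relabel (s aL2) i j r) \<and>
    s' vOk 0 = (if s aL2 i = s aL2 j then 0 else s vOk 0))"
  have loop: "tri B (For vR (V vW) (Cond (Eq (Read aL2 (V vR)) (V vHi)) (Write aL2 (V vR) (V vLo)) Skip)) s1
      (W * 60 + 40) Q"
    unfolding Q_def
  proof (rule tri_For[where N = W and T = 30 and
        I = "\<lambda>k s'. \<forall>r<W. s' aL2 r = (if r < k then relabel (s aL2) i j r else s aL2 r)"], goal_cases)
    case (5 k s')
    have "min (s aL2 i) (s aL2 j) \<le> B" using L[OF ij(3)] by simp
    then show ?case using 5 assms(2) by (auto simp: agreeD[OF 5(2)] s1_def relabel_def less_Suc_eq)
  qed (use assms in \<open>auto simp: agreeD s1_def\<close>)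
  have m: "a - (a - b) = min a b" "b + (a - b) = max a b" for a b :: nat by auto
  show ?thesis
    unfolding unite_def Q_def[symmetric]
    apply (simp add: ij[unfolded One_nat_def] m L)
    apply (rule tri_SeqI[where ?T1.0 = 20 and ?T2.0 = "W * 60 + 120" and R = "\<lambda>s'. s' = s(vLab1 := (s vLab1)(0 := s aL2 i), vLab2 := (s vLab2)(0 := s aL2 j),
    vOk := (s vOk)(0 := if s aL2 i = s aL2 j then 0 else s vOk 0))"])
    subgoal using ok by auto
    subgoal using tri_mono[OF loop] L[OF ij(3)] L[OF ij(4)] by (simp add: m s1_def)
    subgoal by simp
    done
qed

text \<open>The representative is consulted before it is overwritten, so \<open>unite\<close> links
  the current shared vertex to its predecessor in the class.\<close>

definition combine :: prog where
  "combine =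
     Seq (For vP (V vW) (Write aRep (V vP) (Num 0)))
     (Seq (Set vOk (Num 1))
     (Seq (For vP (V vW) (Seq find (Cond (V vTg)
        (Seq (Write aD2 (Sub (V vTg) (Num 1)) (Add (Read aD2 (Sub (V vTg) (Num 1))) (Read aD1 (V vP))))
        (Seq (Cond (Read aRep (Read aL1 (V vP))) unite Skip)
             (Write aRep (Read aL1 (V vP)) (V vTg)))) Skip)))
     (For vP (V vW)
        (Seq (Cond (Mul (Read aD1 (V vP)) (Eq (Read aRep (Read aL1 (V vP))) (Num 0))) (Set vOk (Num 0)) Skip)
             (Cond (Sub (Read aD2 (V vP)) (Num 3)) (Set vOk (Num 0)) Skip)))))"

lemma writes_combine [simp]:
  "writes combine = {vP, aRep, vOk, vR, vTg, aD2, vLab1, vLab2, vLo, vHi, aL2}"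
  unfolding combine_def by auto

lemma tri_combine:
  assumes W: "s vW 0 = W" and B: "4 * W + 8 \<le> B" "0 < W"
    and s1: "\<And>p. p < W \<Longrightarrow> s aL1 p = L1 p \<and> L1 p < W \<and> s aD1 p = D1 p \<and> D1 p \<le> 3"
    and s2: "\<And>p. p < W \<Longrightarrow> s aL2 p = L2 p \<and> L2 p < W \<and> s aD2 p = D2 p \<and> D2 p \<le> 3"
    and tg: "\<And>p. p < W \<Longrightarrow> tg p = find_pos (\<lambda>r. s aBag (s vY 0 * W + r)) (s aBag (s vI 0 * W + p)) W"
  shows "tri B combine s (W * (W * 150 + 600) + 200) (\<lambda>s'.
    s' vOk 0 = (if comb_ok tg L1 D1 L2 D2 W then 1 else 0) \<and>
    (\<forall>p<W. s' aL2 p = lab_fun tg L1 L2 W p \<and> s' aD2 p = deg_fun tg D1 D2 W p \<and> s' aL2 p < W))"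
proof -
  have tgW: "tg p \<le> W" if "p < W" for p using tg[OF that] find_pos_le by simp
  have repW: "rep_fun tg L1 p l \<le> W" if "p \<le> W" for p l
    using that rep_fun_nz[of tg L1 p l] tgW by (cases "rep_fun tg L1 p l = 0") auto
  \<comment> \<open>Degrees are compared with 3 only after the loop. Until then this crude bound
    keeps them within a word; it is one reason for requiring \<open>4 * W + 8 <= B\<close>.\<close>
  have degB: "deg_fun tg D1 D2 p r \<le> 3 + 3 * p" if "p \<le> W" "r < W" for p r
  proof -
    have "(\<Sum>i<p. if tg i = Suc r then D1 i else 0) \<le> (\<Sum>i<p. 3)" using that s1 by (intro sum_mono) auto
    then show ?thesis using deg_fun_eq[of tg D1 D2 p r] s2[of r] that by simp
  qed
  let ?I = "\<lambda>p s'. s' vOk 0 = (if ok_fun tg L1 L2 p then 1 else 0) \<and>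
    (\<forall>r<W. s' aL2 r = lab_fun tg L1 L2 p r \<and> lab_fun tg L1 L2 p r < W \<and> s' aD2 r = deg_fun tg D1 D2 p r \<and>
      s' aRep r = rep_fun tg L1 p r)"
  have body: "tri B (Seq find (Cond (V vTg)
        (Seq (Write aD2 (Sub (V vTg) (Num 1)) (Add (Read aD2 (Sub (V vTg) (Num 1))) (Read aD1 (V vP))))
        (Seq (Cond (Read aRep (Read aL1 (V vP))) unite Skip)
             (Write aRep (Read aL1 (V vP)) (V vTg)))) Skip)) s' (W * 145 + 400) (?I (Suc p))"
    if p: "p < W" "s' vP 0 = p" "?I p s'" and ag: "agree {vP, aRep, vOk, vR, vTg, aD2, vLab1, vLab2, vLo, vHi, aL2} s s'"
    for p s'
  proof (rule tri_SeqI[OF tri_find[where W = W]])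
    show "s' vW 0 = W" using W by (simp add: agreeD[OF ag])
    show "W \<le> B" using B by simp
    fix s'' assume ag2: "agree (writes find) s' s''"
      and t: "s'' vTg 0 = find_pos (\<lambda>r. s' aBag (s' vY 0 * W + r)) (s' aBag (s' vI 0 * W + s' vP 0)) W"
    note f1 = agreeD[OF ag] and f2 = agreeD[OF ag2]
    have t: "s'' vTg 0 = tg p" using t tg[OF p(1)] p(2) by (simp add: f1)
    have same: "s'' vOk = s' vOk" "s'' aL2 = s' aL2" "s'' aD2 = s' aD2" "s'' aRep = s' aRep"
      by (simp_all add: f2)
    have "?I p s''" unfolding same by (rule p(3))
    moreover have "s'' vW 0 = W" "s'' vP 0 = p" "s'' aL1 p = L1 p" "s'' aD1 p = D1 p" "L1 p < W" "D1 p \<le> 3"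
      using p(1,2) W s1[OF p(1)] by (simp_all add: f1 f2)
    ultimately have st: "s'' vW 0 = W" "s'' vP 0 = p" "?I p s''" "s'' aL1 p = L1 p" "s'' aD1 p = D1 p" "L1 p < W" "D1 p \<le> 3"
      by blast+
    show "tri B (Cond (V vTg)
        (Seq (Write aD2 (Sub (V vTg) (Num 1)) (Add (Read aD2 (Sub (V vTg) (Num 1))) (Read aD1 (V vP))))
        (Seq (Cond (Read aRep (Read aL1 (V vP))) unite Skip)
             (Write aRep (Read aL1 (V vP)) (V vTg)))) Skip) s'' (W * 60 + 350) (?I (Suc p))"
    proof (cases "tg p = 0")
      case True
      then show ?thesis using t st by simp
    next
      case False
      have tp: "tg p - 1 < W" using tgW[OF p(1)] False by simp
      let ?s = "s''(aD2 := (s'' aD2)(tg p - 1 := deg_fun tg D1 D2 p (tg p - 1) + D1 p))"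
      have bd: "deg_fun tg D1 D2 p (tg p - 1) + D1 p \<le> B"
      proof -
        have "3 * Suc p \<le> 3 * W" using p(1) by simp
        then show ?thesis using degB[OF _ tp, of p] st(7) p(1) B by simp
      qed
      have u: "tri B (Seq (Cond (Read aRep (Read aL1 (V vP))) unite Skip)
             (Write aRep (Read aL1 (V vP)) (V vTg))) ?s (W * 60 + 320) (?I (Suc p))"
      proof (cases "rep_fun tg L1 p (L1 p) = 0")
        case True
        show ?thesis
          apply (rule tri_SeqI[where ?T1.0 = 20 and ?T2.0 = 20 and R = "\<lambda>s'. s' = ?s"])
          subgoal using True st by simp
          subgoal using True False st t tp p(1) B tgW[OF p(1)] by (auto simp: less_trans)
          subgoal by simp
          done
      next
        case nz: False
        have rp: "rep_fun tg L1 p (L1 p) - 1 < W" using repW[of p "L1 p"] p(1) nz by simp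
        show ?thesis
        proof (rule tri_SeqI[where ?T1.0 = "W * 60 + 220" and ?T2.0 = 20])
          show "tri B (Cond (Read aRep (Read aL1 (V vP))) unite Skip) ?s (W * 60 + 220)
            (\<lambda>s'. (\<forall>r<W. s' aL2 r = relabel (s'' aL2) (rep_fun tg L1 p (L1 p) - 1) (tg p - 1) r) \<and>
              s' vOk 0 = (if s'' aL2 (rep_fun tg L1 p (L1 p) - 1) = s'' aL2 (tg p - 1) then 0 else s'' vOk 0))"
          proof -
            have "tri B unite ?s (W * 60 + 200)
             (\<lambda>s'. (\<forall>r<W. s' aL2 r = relabel (?s aL2) (rep_fun tg L1 p (L1 p) - 1) (tg p - 1) r) \<and>
              s' vOk 0 = (if ?s aL2 (rep_fun tg L1 p (L1 p) - 1) = ?s aL2 (tg p - 1) then 0 else ?s vOk 0))"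
              apply (rule tri_unite)
              using st t tp rp B p(1) by (auto intro: less_imp_le[OF less_le_trans])
            then have u: "tri B unite ?s (W * 60 + 200)
             (\<lambda>s'. (\<forall>r<W. s' aL2 r = relabel (s'' aL2) (rep_fun tg L1 p (L1 p) - 1) (tg p - 1) r) \<and>
              s' vOk 0 = (if s'' aL2 (rep_fun tg L1 p (L1 p) - 1) = s'' aL2 (tg p - 1) then 0 else s'' vOk 0))"
              by (rule tri_mono) (simp_all split: if_splits)
            show ?thesis by (rule tri_CondT[OF _ u]) (use nz st in simp_all)
          qed
          fix s3 assume ag3: "agree (writes (Cond (Read aRep (Read aL1 (V vP))) unite Skip)) ?s s3"
            and s3: "(\<forall>r<W. s3 aL2 r = relabel (s'' aL2) (rep_fun tg L1 p (L1 p) - 1) (tg p - 1) r) \<and>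
              s3 vOk 0 = (if s'' aL2 (rep_fun tg L1 p (L1 p) - 1) = s'' aL2 (tg p - 1) then 0 else s'' vOk 0)"
          have rl: "relabel (s'' aL2) (rep_fun tg L1 p (L1 p) - 1) (tg p - 1) r =
            relabel (lab_fun tg L1 L2 p) (rep_fun tg L1 p (L1 p) - 1) (tg p - 1) r" if "r < W" for r
            using st(3) rp tp that unfolding relabel_def by simp
          have rlW: "relabel (lab_fun tg L1 L2 p) (rep_fun tg L1 p (L1 p) - 1) (tg p - 1) r < W" if "r < W" for r
            using st(3) rp tp that unfolding relabel_def by (auto simp: min_def)
          show "tri B (Write aRep (Read aL1 (V vP)) (V vTg)) s3 20 (?I (Suc p))"
            using s3 st t False nz tp rp B p(1) tgW[OF p(1)] rl rlW
            by (auto simp: agreeD[OF ag3])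
        qed simp
      qed
      show ?thesis
        by (rule tri_CondT[OF _ tri_Write_SeqI[OF _ _ _ _ u order_refl]]) (use False t st tp bd B in simp_all)
    qed
  qed simp
  show ?thesis
    unfolding combine_def
  proof (rule tri_SeqI[where ?T1.0 = "W * 30 + 30" and ?T2.0 = "W * (W * 150 + 560) + 150"
        and R = "\<lambda>s'. \<forall>r<W. s' aRep r = 0"], goal_cases)
    case 1
    show ?case
      by (rule tri_For[where N = W and T = 10 and I = "\<lambda>i s'. \<forall>r<i. s' aRep r = 0"])
        (use W B in \<open>auto simp: agreeD less_Suc_eq\<close>)
  next
    case (2 s1)
    note f1 = agreeD[OF 2(1)]
    let ?s = "s1(vOk := (s1 vOk)(0 := 1))"
    have "tri B (Seq (For vP (V vW) (Seq find (Cond (V vTg)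
        (Seq (Write aD2 (Sub (V vTg) (Num 1)) (Add (Read aD2 (Sub (V vTg) (Num 1))) (Read aD1 (V vP))))
        (Seq (Cond (Read aRep (Read aL1 (V vP))) unite Skip)
             (Write aRep (Read aL1 (V vP)) (V vTg)))) Skip)))
     (For vP (V vW)
        (Seq (Cond (Mul (Read aD1 (V vP)) (Eq (Read aRep (Read aL1 (V vP))) (Num 0))) (Set vOk (Num 0)) Skip)
             (Cond (Sub (Read aD2 (V vP)) (Num 3)) (Set vOk (Num 0)) Skip)))) ?s (W * (W * 150 + 560) + 140)
      (\<lambda>s'. s' vOk 0 = (if comb_ok tg L1 D1 L2 D2 W then 1 else 0) \<and>
        (\<forall>p<W. s' aL2 p = lab_fun tg L1 L2 W p \<and> s' aD2 p = deg_fun tg D1 D2 W p \<and> s' aL2 p < W))"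
    proof (rule tri_SeqI[where ?T1.0 = "W * (W * 145 + 420) + 30" and ?T2.0 = "W * 120 + 30" and R = "?I W"], goal_cases)
      case 1
      show ?case
      proof (rule tri_For[where N = W and T = "W * 145 + 400" and I = ?I], goal_cases)
        case 4
        then show ?case using s2 2(2) by (simp add: f1)
      next
        case (5 p s')
        have "agree {vP, aRep, vOk, vR, vTg, aD2, vLab1, vLab2, vLo, vHi, aL2} s s'"
          using 5(2) 2(1) unfolding agree_def by simp
        from body[OF 5(1,3,4) this] show ?case by (rule tri_mono) auto
      qed (use W B in \<open>auto simp: agreeD f1 algebra_simps\<close>)
    next
      case (2 s2)
      note f2 = agreeD[OF 2(1)]
      let ?K = "\<lambda>k s'. s' vOk 0 = (if ok_fun tg L1 L2 W \<and>
        (\<forall>p<k. (D1 p > 0 \<longrightarrow> rep_fun tg L1 W (L1 p) \<noteq> 0) \<and> deg_fun tg D1 D2 W p \<le> 3) then 1 else 0)"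
      show ?case
      proof (rule tri_For[where N = W and T = "100" and I = ?K], goal_cases)
        case (5 p s')
        note f3 = agreeD[OF 5(2)]
        have "s' aD1 p = D1 p" "s' aL1 p = L1 p" "L1 p < W" "s' aD2 p = deg_fun tg D1 D2 W p"
          "s' aRep (L1 p) = rep_fun tg L1 W (L1 p)"
          using 5 s1 2(2) by (simp_all add: f1 f2 f3)
        then show ?case
          using 5 B
          apply (intro tri_SeqI[where ?T1.0 = 40 and ?T2.0 = 40 and R = "\<lambda>t. agree {vOk} s' t \<and>
            t vOk 0 = (if D1 p > 0 \<and> rep_fun tg L1 W (L1 p) = 0 then 0 else s' vOk 0)"])
          by (auto simp: agree_def less_Suc_eq)
      next
        case (6 s')
        then show ?case using 2(2) unfolding comb_ok_def by (simp add: agreeD[OF 6(1)])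
      qed (use W B 2(2) in \<open>auto simp: agreeD f1 f2\<close>)
    qed (simp add: algebra_simps)
    then show ?case using B(1,2) by (auto intro: tri_mono)
  qed (simp add: algebra_simps)
qed

definition encode :: prog where
  "encode = Seq (Set vCode (Num 0)) (Seq (Set vPw (Num 1)) (For vP (V vW)
     (Seq (Set vCode (Add (V vCode) (Mul (Add (Mul (Num 4) (Read aL2 (V vP))) (Read aD2 (V vP))) (V vPw))))
          (Set vPw (Mul (V vPw) (V vBase))))))"

lemma writes_encode [simp]: "writes encode = {vCode, vPw, vP}"
  unfolding encode_def by auto

lemma ncodes_mono: "p \<le> W \<Longrightarrow> 0 < W \<Longrightarrow> (4 * W) ^ p \<le> ncodes W"
  unfolding ncodes_def by (intro power_increasing) auto

lemma ncodes_ge: "0 < W \<Longrightarrow> 4 * W \<le> ncodes W"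
  using ncodes_mono[of 1 W] by simp

lemma tri_encode:
  assumes W: "s vW 0 = W" "s vBase 0 = 4 * W" "0 < W" and B: "ncodes W \<le> B"
    and LD: "\<And>p. p < W \<Longrightarrow> s aL2 p = L p \<and> L p < W \<and> s aD2 p = D p \<and> D p \<le> 3"
  shows "tri B encode s (W * 60 + 40) (\<lambda>s'. s' vCode 0 = code W L D)"
proof -
  define b where "b = 4 * W"
  have dig: "4 * L p + D p < b" if "p < W" for p using LD[OF that] unfolding b_def by simp
  \<comment> \<open>A sum over the lowest \<open>i\<close> digits is below \<open>b ^ i\<close>, so
    no intermediate value of the encoding exceeds \<open>ncodes W\<close>.\<close>
  have part: "(\<Sum>p<i. (4 * L p + D p) * b ^ p) \<le> B" if "i \<le> W" for i
  proof -
    have "(\<Sum>p<i. (4 * L p + D p) * b ^ p) < b ^ i" using dig that by (intro digit_sum_less) auto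
    then show ?thesis using ncodes_mono[OF that W(3)] B unfolding b_def by simp
  qed
  have pw: "b ^ i \<le> B" if "i \<le> W" for i using ncodes_mono[OF that W(3)] B unfolding b_def by simp
  have WB: "W \<le> B" using ncodes_ge[OF W(3)] B by simp
  show ?thesis
    unfolding encode_def code_def b_def[symmetric]
  proof (rule tri_Write_SeqI[where T = "W * 60 + 35"], simp, simp, simp, simp, rule tri_Write_SeqI[where T = "W * 60 + 30"], simp, simp, simp, goal_cases)
    case 2
    show ?case
    proof (rule tri_For[where N = W and T = 40 and
          I = "\<lambda>i s'. s' vCode 0 = (\<Sum>p<i. (4 * L p + D p) * b ^ p) \<and> s' vPw 0 = b ^ i"], goal_cases)
      case (5 i s')
      have "s' aL2 i = L i" "s' aD2 i = D i" "s' vBase 0 = b"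
        using LD[OF 5(1)] W by (simp_all add: agreeD[OF 5(2)] b_def)
      then show ?case using 5 part[of "Suc i"] pw[of "Suc i"] by (simp add: mult.commute)
    qed (use W WB in \<open>auto simp: agreeD\<close>)
  qed (use WB W(3) in auto)
qed

lemma lab_fun_less:
  assumes "\<And>r. r < W \<Longrightarrow> L2 r < W" "\<And>i. tg i \<le> W" "r < W" "0 < W"
  shows "lab_fun tg L1 L2 p r < W"
  using assms(3)
proof (induction p arbitrary: r)
  case (Suc p)
  have "rep_fun tg L1 p l \<le> W" for l
    using rep_fun_nz[of tg L1 p l] assms(2) by (cases "rep_fun tg L1 p l = 0") auto
  then have "rep_fun tg L1 p l - 1 < W" for l
    using assms(4) by (metis diff_less le_less_trans le_neq_implies_less less_imp_diff_less less_one)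
  moreover have "tg p - 1 < W" using assms(2)[of p] assms(4) by (cases "tg p") auto
  ultimately show ?case using Suc unfolding lab_fun.simps relabel_def by (auto simp: min_def)
qed (use assms in simp)

lemma digL_less: "0 < W \<Longrightarrow> digL W a p < W"
  unfolding digL_def by (simp add: less_mult_imp_div_less mult.commute)

lemma digD_le: "digD W a p \<le> 3"
  unfolding digD_def using mod_less_divisor[of 4 "a div (4 * W) ^ p mod (4 * W)"] by simp

text \<open>The digits of any number are legal labels, and \<open>comb_ok\<close> bounds the new
  degrees. So the claim holds for arbitrary codes, and the loop invariants need not know which
  forests the codes stand for.\<close>

lemma merge_code_less:
  assumes "merge_ok W vx vy a b" "0 < W"
  shows "merge_code W vx vy a b < ncodes W"
  unfolding merge_code_def
  using assms lab_fun_less[of W "digL W b" "\<lambda>p. find_pos vy (vx p) W" _ "digL W a" W] digL_less find_pos_le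
  by (intro code_less) (auto simp: merge_ok_def comb_ok_def)

text \<open>\<open>a * S + b\<close> numbers the pairs in the order of the two nested loops, so
  raising the bound by one admits exactly one further pair.\<close>

lemma pair_code_less_Suc:
  fixes a b :: nat
  assumes "b < S" "b' < S" "a' * S + b' < Suc (a * S + b)"
  shows "a' * S + b' < a * S + b \<or> a' = a \<and> b' = b"
proof -
  have "a' = a \<and> b' = b" if eq: "a' * S + b' = a * S + b"
  proof -
    have "(a' * S + b') div S = a'" "(a * S + b) div S = a" using assms by auto
    then show ?thesis using eq by auto
  qed
  then show ?thesis using assms(3) by linarith
qed

section \<open>Merging two tables\<close>

abbreviation (input) "cell1 \<equiv> Read aTab (Add (Mul (V vTx) (V vS)) (V vA))"
abbreviation (input) "cell2 \<equiv> Read aTab (Add (Mul (V vTy) (V vS)) (V vB))"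

text \<open>The result goes to the table with number \<open>M + i\<close>, which is still empty, and
  a strict improvement takes a new cell. Old tables and cells are never overwritten, so the
  solutions stored in them remain valid.\<close>

definition update :: prog where
  "update = Seq (Set vX (Add (Mul (Add (V vM) (V vI)) (V vS)) (V vCode)))
     (Seq (Set vU (Sub (Add (Read aVal cell1) (Read aVal cell2)) (Num 1)))
     (Cond (Sub (V vU) (Read aVal (Read aTab (V vX))))
       (Seq (Write aLeft (V vCnt) cell1)
       (Seq (Write aRight (V vCnt) cell2)
       (Seq (Write aVal (V vCnt) (V vU))
       (Seq (Write aTab (V vX) (V vCnt))
            (Set vCnt (Add (V vCnt) (Num 1)))))))
       Skip))"

lemma writes_update [simp]: "writes update = {vX, vU, aLeft, aRight, aVal, aTab, vCnt}"
  unfolding update_def by auto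

definition merge_pair :: prog where
  "merge_pair = Cond (Mul cell1 cell2)
     (Seq (decode (V vA) aL1 aD1) (Seq (decode (V vB) aL2 aD2) (Seq combine
       (Cond (V vOk) (Seq encode update) Skip)))) Skip"

lemma writes_merge_pair: "writes merge_pair = {vX, vU, aLeft, aRight, aVal, aTab, vCnt, vCode, vPw, vP,
    vV, aL1, aD1, aL2, aD2, aRep, vOk, vR, vTg, vLab1, vLab2, vLo, vHi}"
  unfolding merge_pair_def by auto

locale merging =
  fixes B W M i y tx ty c0 :: nat and s0 :: memory
  assumes W: "0 < W" "s0 vW 0 = W" "s0 vBase 0 = 4 * W" "s0 vS 0 = ncodes W"
    and regs: "s0 vM 0 = M" "s0 vI 0 = i" "s0 vY 0 = y" "s0 vTx 0 = tx" "s0 vTy 0 = ty" "s0 vCnt 0 = c0"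
    and c0: "0 < c0" "s0 aVal 0 = 0"
    and tid: "tx < M + i" "ty < M + i"
    and fresh: "\<And>j. (M + i) * ncodes W \<le> j \<Longrightarrow> s0 aTab j = 0"
    and entries: "\<And>j. s0 aTab j < c0" "\<And>j. s0 aTab j \<noteq> 0 \<Longrightarrow> 0 < s0 aVal (s0 aTab j)"
    and vals: "\<And>j j'. s0 aVal (s0 aTab j) + s0 aVal (s0 aTab j') \<le> B"
    and bounds: "(M + i + 1) * ncodes W \<le> B" "c0 + ncodes W * ncodes W \<le> B" "4 * W + 8 \<le> B"
begin

abbreviation "S \<equiv> ncodes W"
abbreviation "nt \<equiv> (M + i) * S"
abbreviation "T1 a \<equiv> s0 aTab (tx * S + a)"
abbreviation "T2 b \<equiv> s0 aTab (ty * S + b)"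
abbreviation "vx \<equiv> \<lambda>p. s0 aBag (i * W + p)"
abbreviation "vy \<equiv> \<lambda>p. s0 aBag (y * W + p)"
abbreviation "mok \<equiv> merge_ok W vx vy"
abbreviation "mcode \<equiv> merge_code W vx vy"
abbreviation "v0 \<equiv> s0 aVal"

text \<open>\<open>k\<close> counts the pairs processed so far. A cell whose entry is superseded is
  not reclaimed, hence \<open>cnt <= c0 + k\<close>. That new cells point to smaller ones makes
  \<open>sol\<close> well behaved and permits the final sweep.\<close>

definition minv :: "nat \<Rightarrow> (nat \<Rightarrow> nat) \<Rightarrow> (nat \<Rightarrow> nat) \<Rightarrow> (nat \<Rightarrow> nat) \<Rightarrow> (nat \<Rightarrow> nat) \<Rightarrow> nat \<Rightarrow> bool" where
  "minv k tab l r v cnt \<longleftrightarrow>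
     (\<forall>j. j < nt \<or> nt + S \<le> j \<longrightarrow> tab j = s0 aTab j) \<and> c0 \<le> cnt \<and> cnt \<le> c0 + k \<and>
     (\<forall>c<c0. l c = s0 aLeft c \<and> r c = s0 aRight c \<and> v c = v0 c) \<and>
     (\<forall>c. c0 \<le> c \<and> c < cnt \<longrightarrow> l c < c \<and> r c < c) \<and>
     (\<forall>d<S. tab (nt + d) \<noteq> 0 \<longrightarrow> c0 \<le> tab (nt + d) \<and> tab (nt + d) < cnt \<and>
        (\<exists>a<S. \<exists>b<S. a * S + b < k \<and> T1 a \<noteq> 0 \<and> T2 b \<noteq> 0 \<and> mok a b \<and> d = mcode a b \<and>
           l (tab (nt + d)) = T1 a \<and> r (tab (nt + d)) = T2 b \<and> v (tab (nt + d)) + 1 = v0 (T1 a) + v0 (T2 b))) \<and>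
     (\<forall>a<S. \<forall>b<S. a * S + b < k \<longrightarrow> T1 a \<noteq> 0 \<longrightarrow> T2 b \<noteq> 0 \<longrightarrow> mok a b \<longrightarrow>
        tab (nt + mcode a b) \<noteq> 0 \<and> v0 (T1 a) + v0 (T2 b) \<le> v (tab (nt + mcode a b)) + 1)"

lemma minv_init: "minv 0 (s0 aTab) (s0 aLeft) (s0 aRight) (s0 aVal) c0"
  unfolding minv_def using fresh by auto

lemma minvD:
  assumes "minv k tab l r v cnt"
  shows "j < nt \<or> nt + S \<le> j \<Longrightarrow> tab j = s0 aTab j" "c0 \<le> cnt" "cnt \<le> c0 + k"
    "c < c0 \<Longrightarrow> l c = s0 aLeft c \<and> r c = s0 aRight c \<and> v c = v0 c"
    "c0 \<le> c \<Longrightarrow> c < cnt \<Longrightarrow> l c < c \<and> r c < c"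
    "d < S \<Longrightarrow> tab (nt + d) \<noteq> 0 \<Longrightarrow> c0 \<le> tab (nt + d) \<and> tab (nt + d) < cnt \<and>
        (\<exists>a<S. \<exists>b<S. a * S + b < k \<and> T1 a \<noteq> 0 \<and> T2 b \<noteq> 0 \<and> mok a b \<and> d = mcode a b \<and>
           l (tab (nt + d)) = T1 a \<and> r (tab (nt + d)) = T2 b \<and> v (tab (nt + d)) + 1 = v0 (T1 a) + v0 (T2 b))"
    "a < S \<Longrightarrow> b < S \<Longrightarrow> a * S + b < k \<Longrightarrow> T1 a \<noteq> 0 \<Longrightarrow> T2 b \<noteq> 0 \<Longrightarrow> mok a b \<Longrightarrow>
        tab (nt + mcode a b) \<noteq> 0 \<and> v0 (T1 a) + v0 (T2 b) \<le> v (tab (nt + mcode a b)) + 1"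
  using assms unfolding minv_def by blast+

lemma minv_skip:
  assumes I: "minv (a * S + b) tab l r v cnt" and ab: "b < S"
    and no: "T1 a \<noteq> 0 \<Longrightarrow> T2 b \<noteq> 0 \<Longrightarrow> mok a b \<Longrightarrow>
      tab (nt + mcode a b) \<noteq> 0 \<and> v0 (T1 a) + v0 (T2 b) \<le> v (tab (nt + mcode a b)) + 1"
  shows "minv (Suc (a * S + b)) tab l r v cnt"
  unfolding minv_def
proof (intro conjI allI impI)
  fix d assume "d < S" "tab (nt + d) \<noteq> 0"
  from minvD(6)[OF I this]
  show "c0 \<le> tab (nt + d)" "tab (nt + d) < cnt"
    "\<exists>a'<S. \<exists>b'<S. a' * S + b' < Suc (a * S + b) \<and> T1 a' \<noteq> 0 \<and> T2 b' \<noteq> 0 \<and> mok a' b' \<and> d = mcode a' b' \<and>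
           l (tab (nt + d)) = T1 a' \<and> r (tab (nt + d)) = T2 b' \<and> v (tab (nt + d)) + 1 = v0 (T1 a') + v0 (T2 b')"
    using less_SucI by blast+
next
  fix a' b' assume p: "a' < S" "b' < S" "a' * S + b' < Suc (a * S + b)" "T1 a' \<noteq> 0" "T2 b' \<noteq> 0" "mok a' b'"
  from pair_code_less_Suc[OF ab p(2,3)] minvD(7)[OF I p(1,2) _ p(4-6)] no p(4-6)
  show "tab (nt + mcode a' b') \<noteq> 0" "v0 (T1 a') + v0 (T2 b') \<le> v (tab (nt + mcode a' b')) + 1" by blast+
qed (use minvD[OF I] in auto)

text \<open>The new value is strictly larger than the one it replaces, so earlier pairs with the
  same code remain dominated.\<close>

lemma minv_add:
  assumes I: "minv (a * S + b) tab l r v cnt" and ab: "a < S" "b < S" "T1 a \<noteq> 0" "T2 b \<noteq> 0" "mok a b"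
    and u: "v (tab (nt + mcode a b)) < u" "u + 1 = v0 (T1 a) + v0 (T2 b)"
  shows "minv (Suc (a * S + b)) (tab(nt + mcode a b := cnt)) (l(cnt := T1 a)) (r(cnt := T2 b)) (v(cnt := u)) (Suc cnt)"
proof -
  let ?d = "mcode a b" and ?tab = "tab(nt + mcode a b := cnt)"
  have d: "?d < S" using merge_code_less[OF ab(5) W(1)] .
  note D = minvD[OF I]
  have lt: "T1 a < cnt" "T2 b < cnt" using entries(1) D(2) less_le_trans by blast+
  have cnt0: "cnt \<noteq> 0" using D(2) c0 by simp
  show ?thesis
    unfolding minv_def
  proof (intro conjI allI impI)
    fix d' assume d': "d' < S" "?tab (nt + d') \<noteq> 0"
    have "c0 \<le> ?tab (nt + d') \<and> ?tab (nt + d') < Suc cnt \<and>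
      (\<exists>a'<S. \<exists>b'<S. a' * S + b' < Suc (a * S + b) \<and> T1 a' \<noteq> 0 \<and> T2 b' \<noteq> 0 \<and> mok a' b' \<and> d' = mcode a' b' \<and>
           (l(cnt := T1 a)) (?tab (nt + d')) = T1 a' \<and> (r(cnt := T2 b)) (?tab (nt + d')) = T2 b' \<and>
           (v(cnt := u)) (?tab (nt + d')) + 1 = v0 (T1 a') + v0 (T2 b'))"
    proof (cases "d' = ?d")
      case True
      then show ?thesis using D(2) ab u by auto
    next
      case False
      then have "tab (nt + d') \<noteq> 0" using d' by simp
      from D(6)[OF d'(1) this] show ?thesis using False by (auto intro: less_SucI)
    qed
    then show "c0 \<le> ?tab (nt + d')" "?tab (nt + d') < Suc cnt"
      "\<exists>a'<S. \<exists>b'<S. a' * S + b' < Suc (a * S + b) \<and> T1 a' \<noteq> 0 \<and> T2 b' \<noteq> 0 \<and> mok a' b' \<and> d' = mcode a' b' \<and>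
           (l(cnt := T1 a)) (?tab (nt + d')) = T1 a' \<and> (r(cnt := T2 b)) (?tab (nt + d')) = T2 b' \<and>
           (v(cnt := u)) (?tab (nt + d')) + 1 = v0 (T1 a') + v0 (T2 b')" by blast+
  next
    fix a' b' assume p: "a' < S" "b' < S" "a' * S + b' < Suc (a * S + b)" "T1 a' \<noteq> 0" "T2 b' \<noteq> 0" "mok a' b'"
    have "?tab (nt + mcode a' b') \<noteq> 0 \<and> v0 (T1 a') + v0 (T2 b') \<le> (v(cnt := u)) (?tab (nt + mcode a' b')) + 1"
    proof (cases "a' * S + b' < a * S + b")
      case True
      note q = D(7)[OF p(1,2) True p(4-6)]
      show ?thesis
      proof (cases "mcode a' b' = ?d")
        case True
        then show ?thesis using q u cnt0 by simp
      next
        case False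
        have "tab (nt + mcode a' b') < cnt"
          using D(6)[OF merge_code_less[OF p(6) W(1)]] q by blast
        then show ?thesis using q False by simp
      qed
    next
      case False
      then have "a' = a" "b' = b" using pair_code_less_Suc[OF ab(2) p(2,3)] by auto
      then show ?thesis using u cnt0 by simp
    qed
    then show "?tab (nt + mcode a' b') \<noteq> 0"
      "v0 (T1 a') + v0 (T2 b') \<le> (v(cnt := u)) (?tab (nt + mcode a' b')) + 1" by blast+
  next
    fix c assume "c0 \<le> c \<and> c < Suc cnt"
    then show "(l(cnt := T1 a)) c < c" "(r(cnt := T2 b)) c < c"
      using D(5)[of c] lt by (cases "c = cnt"; simp)+
  next
    fix c assume c: "c < c0"
    then have "c \<noteq> cnt" using D(2) by simp
    then show "(l(cnt := T1 a)) c = s0 aLeft c" "(r(cnt := T2 b)) c = s0 aRight c" "(v(cnt := u)) c = v0 c"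
      using D(4)[OF c] by auto
  next
    fix j assume j: "j < nt \<or> nt + S \<le> j"
    then have "j \<noteq> nt + ?d" using d by auto
    then show "?tab j = s0 aTab j" using D(1)[OF j] by simp
  qed (use D(2,3) in auto)
qed

abbreviation "Inv k s \<equiv> minv k (s aTab) (s aLeft) (s aRight) (s aVal) (s vCnt 0)"

lemma S_pos: "0 < S" "4 * W \<le> S"
  using ncodes_ge[OF W(1)] W(1) by auto

lemma table_bounds: "a < S \<Longrightarrow> tx * S + a < nt" "a < S \<Longrightarrow> ty * S + a < nt"
proof -
  have "t * S + a < nt" if "t < M + i" "a < S" for t
  proof -
    have "t * S + a < Suc t * S" using that by simp
    also have "\<dots> \<le> nt" using that by (intro mult_le_mono1) simp
    finally show ?thesis .
  qed
  then show "a < S \<Longrightarrow> tx * S + a < nt" "a < S \<Longrightarrow> ty * S + a < nt" using tid by auto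
qed

lemma tri_update:
  assumes ag: "agree (insert vA (insert vB (writes merge_pair))) s0 s"
    and ab: "s vA 0 = a" "s vB 0 = b" "a < S" "b < S" "T1 a \<noteq> 0" "T2 b \<noteq> 0" "mok a b"
    and d: "s vCode 0 = mcode a b" and I: "Inv (a * S + b) s"
  shows "tri B update s 150 (Inv (Suc (a * S + b)))"
proof -
  note f = agreeD[OF ag, unfolded writes_merge_pair]
  note D = minvD[OF I]
  have dS: "mcode a b < S" using merge_code_less[OF ab(7) W(1)] .
  have c: "s aTab (tx * S + a) = T1 a" "s aTab (ty * S + b) = T2 b"
    using D(1) table_bounds ab by auto
  have v: "s aVal (T1 a) = v0 (T1 a)" "s aVal (T2 b) = v0 (T2 b)" using D(4) entries(1) by auto
  have r: "s vM 0 = M" "s vI 0 = i" "s vS 0 = S" "s vTx 0 = tx" "s vTy 0 = ty"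
    using regs W by (simp_all add: f)
  have p: "0 < v0 (T1 a)" "0 < v0 (T2 b)" using entries(2) ab by auto
  have idx: "nt + mcode a b \<le> B" using dS bounds(1) by (simp add: algebra_simps)
  have "a * S + b < S * S"
  proof -
    have "a * S + b < Suc a * S" using ab by simp
    also have "\<dots> \<le> S * S" using ab by (intro mult_le_mono1) simp
    finally show ?thesis .
  qed
  then have cB: "s vCnt 0 + 1 \<le> B" using D(3) bounds(2) by simp
  have ne: "s vCnt 0 \<noteq> T1 a" "s vCnt 0 \<noteq> T2 b" using entries(1) D(2) by (metis leD)+
  have uB: "v0 (T1 a) + v0 (T2 b) - 1 \<le> B" using vals[of "tx * S + a" "ty * S + b"] by simp
  have eB: "T1 a \<le> B" "T2 b \<le> B" using entries(1) bounds(2) less_le_trans less_imp_le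
    by (meson le_add1 order_trans)+
  show ?thesis
  proof (cases "s aVal (s aTab (nt + mcode a b)) < v0 (T1 a) + v0 (T2 b) - 1")
    case True
    have "minv (Suc (a * S + b)) ((s aTab)(nt + mcode a b := s vCnt 0)) ((s aLeft)(s vCnt 0 := T1 a))
      ((s aRight)(s vCnt 0 := T2 b)) ((s aVal)(s vCnt 0 := v0 (T1 a) + v0 (T2 b) - 1)) (Suc (s vCnt 0))"
      by (rule minv_add[OF I ab(3-7) True]) (use p in simp)
    then show ?thesis
      unfolding update_def using True idx uB cB eB
      by (auto simp: r ab(1,2) c v d)
  next
    case False
    \<comment> \<open>An absent entry has value 0, while the new value is at least 1 because both
      summands are positive; so the comparison would have succeeded.\<close>
    have "s aTab (nt + mcode a b) \<noteq> 0"
    proof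
      assume "s aTab (nt + mcode a b) = 0"
      then have "s aVal (s aTab (nt + mcode a b)) = 0" using D(4)[of 0] c0 by simp
      then show False using False p by simp
    qed
    then have "Inv (Suc (a * S + b)) s" using False by (intro minv_skip[OF I ab(4)]) auto
    then show ?thesis
      unfolding update_def using False idx uB by (auto simp: r ab(1,2) c v d)
  qed
qed

lemma tri_merge_pair:
  assumes ag: "agree (insert vA (insert vB (writes merge_pair))) s0 s"
    and ab: "s vA 0 = a" "s vB 0 = b" "a < S" "b < S" and I: "Inv (a * S + b) s"
  shows "tri B merge_pair s (W * (W * 150 + 800) + 800) (Inv (Suc (a * S + b)))"
proof -
  note f = agreeD[OF ag, unfolded writes_merge_pair]
  note D = minvD[OF I]
  have c: "s aTab (tx * S + a) = T1 a" "s aTab (ty * S + b) = T2 b"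
    using D(1) table_bounds ab by auto
  have r: "s vM 0 = M" "s vI 0 = i" "s vS 0 = S" "s vTx 0 = tx" "s vTy 0 = ty" "s vW 0 = W"
    "s vBase 0 = 4 * W" "s aBag = s0 aBag" "s vY 0 = y"
    using regs W by (simp_all add: f)
  have aB: "a \<le> B" "b \<le> B"
  proof -
    have "S \<le> (M + i + 1) * S" by simp
    then show "a \<le> B" "b \<le> B" using ab bounds(1) by linarith+
  qed
  have SB: "S \<le> B" using bounds(1) by (simp add: algebra_simps)
  show ?thesis
  proof (cases "T1 a * T2 b = 0")
    case True
    then have "Inv (Suc (a * S + b)) s" by (intro minv_skip[OF I ab(4)]) auto
    then show ?thesis unfolding merge_pair_def using True by (simp add: r c ab)
  next
    case False
    let ?tg = "\<lambda>p. find_pos vy (vx p) W"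
    have "tri B (Seq (decode (V vA) aL1 aD1) (Seq (decode (V vB) aL2 aD2) (Seq combine
       (Cond (V vOk) (Seq encode update) Skip)))) s (W * (W * 150 + 800) + 700) (Inv (Suc (a * S + b)))"
    proof (rule tri_SeqI[where ?T2.0 = "W * (W * 150 + 740) + 600", OF tri_decode[where W = W and a = a and T = "W * 60 + 40"]], goal_cases)
      case (9 s1)
      note f1 = agreeD[OF 9(1)]
      show ?case
      proof (rule tri_SeqI[where ?T2.0 = "W * (W * 150 + 680) + 500", OF tri_decode[where W = W and a = b and T = "W * 60 + 40"]], goal_cases)
        case (9 s2)
        note f2 = agreeD[OF 9(1)]
        have l1: "s2 aL1 p = digL W a p" "s2 aD1 p = digD W a p" "s2 aL2 p = digL W b p" "s2 aD2 p = digD W b p" if "p < W" for p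
          using that 9(2) \<open>\<forall>p<W. s1 aL1 p = digL W a p \<and> s1 aD1 p = digD W a p\<close> by (simp_all add: f2)
        have r2: "s2 vW 0 = W" "s2 vBase 0 = 4 * W" "s2 aBag = s0 aBag" "s2 vY 0 = y" "s2 vI 0 = i" by (simp_all add: f2 f1 r)
        show ?case
        proof (rule tri_SeqI[where ?T2.0 = "W * 60 + 220", OF tri_combine[where W = W and tg = ?tg and ?L1.0 = "digL W a" and ?D1.0 = "digD W a"
                and ?L2.0 = "digL W b" and ?D2.0 = "digD W b"]], goal_cases)
          case (7 s3)
          note f3 = agreeD[OF 7(1)]
          have ok: "s3 vOk 0 = (if mok a b then 1 else 0)" using 7(2) unfolding merge_ok_def by blast
          have core: "s3 aTab = s aTab" "s3 aLeft = s aLeft" "s3 aRight = s aRight" "s3 aVal = s aVal" "s3 vCnt = s vCnt"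
            "s3 vA = s vA" "s3 vB = s vB" "s3 vW = s vW" "s3 vBase = s vBase"
            by (simp_all add: f3 f2 f1)
          have ag3: "agree (insert vA (insert vB (writes merge_pair))) s0 s3"
            unfolding writes_merge_pair agree_def by (simp add: f3 f2 f1 f)
          show ?case
          proof (cases "mok a b")
            case no: False
            then have "Inv (Suc (a * S + b)) s3"
              unfolding core by (intro minv_skip[OF I ab(4)]) auto
            then show ?thesis using no ok by simp
          next
            case yes: True
            have dg: "deg_fun ?tg (digD W a) (digD W b) W p \<le> 3" if "p < W" for p
              using yes that unfolding merge_ok_def comb_ok_def by blast
            have "tri B (Seq encode update) s3 (W * 60 + 190) (Inv (Suc (a * S + b)))"
            proof (rule tri_SeqI[where ?T2.0 = 150, OF tri_encode[where W = W and L = "lab_fun ?tg (digL W a) (digL W b) W"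
                  and D = "deg_fun ?tg (digD W a) (digD W b) W"]], goal_cases)
              case (5 p)
              then show ?case using 7(2) dg by auto
            next
              case (6 s4)
              note f4 = agreeD[OF 6(1)]
              have core4: "s4 aTab = s aTab" "s4 aLeft = s aLeft" "s4 aRight = s aRight" "s4 aVal = s aVal" "s4 vCnt = s vCnt"
                "s4 vA = s vA" "s4 vB = s vB" by (simp_all add: f4 core)
              show ?case
              proof (rule tri_update)
                show "agree (insert vA (insert vB (writes merge_pair))) s0 s4"
                  using ag3 unfolding writes_merge_pair agree_def by (simp add: f4)
                show "s4 vCode 0 = mcode a b" using 6(2) unfolding merge_code_def .
                show "Inv (a * S + b) s4" unfolding core4 by (rule I)
              qed (use ab False yes core4 in auto)
            qed (use r core W SB in simp_all)
            then show ?thesis by (rule tri_CondT[rotated]) (use ok yes in simp_all)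
          qed
        qed (use l1 digL_less[OF W(1)] digD_le bounds W r2 in \<open>auto simp: algebra_simps\<close>)
      qed (use r ab aB W bounds in \<open>auto simp: f1 algebra_simps\<close>)
    qed (use r ab aB W bounds in \<open>auto simp: algebra_simps\<close>)
    then show ?thesis unfolding merge_pair_def by (rule tri_CondT[rotated]) (use False in \<open>simp_all add: r c ab\<close>)
  qed
qed

end

definition merge_tables :: prog where
  "merge_tables = For vA (V vS) (For vB (V vS) merge_pair)"

lemma writes_merge_tables [simp]:
  "writes merge_tables = insert vA (insert vB (writes merge_pair))"
  unfolding merge_tables_def by auto

context merging
begin

lemma tri_merge_tables:
  "tri B merge_tables s0 (S * S * (W * (W * 150 + 800) + 900)) (Inv (S * S))"
proof -
  have SB: "S \<le> B" using bounds(1) by (simp add: algebra_simps)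
  have inner: "tri B (For vB (V vS) merge_pair) s (S * (W * (W * 150 + 800) + 830)) (Inv (Suc a * S))"
    if ag: "agree (insert vA (insert vB (writes merge_pair))) s0 s" and a: "s vA 0 = a" "a < S" and I: "Inv (a * S) s" for s a
  proof (rule tri_For[where N = S and T = "W * (W * 150 + 800) + 800" and I = "\<lambda>b s'. Inv (a * S + b) s'"], goal_cases)
    case (5 b s')
    have "tri B merge_pair s' (W * (W * 150 + 800) + 800) (Inv (Suc (a * S + b)))"
    proof (rule tri_merge_pair)
      show "agree (insert vA (insert vB (writes merge_pair))) s0 s'"
        using 5(2) ag unfolding agree_def by auto
      show "s' vA 0 = a" using a by (simp add: agreeD[OF 5(2)] writes_merge_pair)
    qed (use 5 a in auto)
    then show ?case by (rule tri_mono) auto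
  next
    case (3 s')
    then show ?case using ag W by (simp add: agreeD[OF 3] agreeD[OF ag] writes_merge_pair)
  next
    case 7
    have "S * 1 \<ge> 1" using S_pos by simp
    then show ?case by (simp add: algebra_simps)
  qed (use SB I in \<open>auto simp: writes_merge_pair algebra_simps\<close>)
  show ?thesis
    unfolding merge_tables_def
  proof (rule tri_For[where N = S and T = "S * (W * (W * 150 + 800) + 830)" and I = "\<lambda>a s'. Inv (a * S) s'"], goal_cases)
    case (5 a s')
    have "tri B (For vB (V vS) merge_pair) s' (S * (W * (W * 150 + 800) + 830)) (Inv (Suc a * S))"
      using 5 by (intro inner) auto
    then show ?case by (rule tri_mono) auto
  next
    case (3 s')
    then show ?case using W by (simp add: agreeD[OF 3] writes_merge_pair)
  next
    case 4
    then show ?case using minv_init regs by simp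
  next
    case 7
    obtain k where "S = Suc k" using S_pos by (cases S) auto
    then show ?case by (simp add: algebra_simps)
  qed (use SB in \<open>auto simp: writes_merge_pair\<close>)
qed

end

subsection \<open>Solution cells\<close>

text \<open>The numbers 0 (absent) and 1 (empty forest) stand for no edges, the next
  \<open>m\<close> cells for single edges, later cells for unions. The test that both references
  decrease makes the recursion terminate on arbitrary arrays.\<close>

function sol :: "nat \<Rightarrow> (nat \<Rightarrow> nat) \<Rightarrow> (nat \<Rightarrow> nat) \<Rightarrow> nat \<Rightarrow> nat set" where
  "sol m l r c = (if c < 2 then {} else if c < m + 2 then {c - 2}
     else if l c < c \<and> r c < c then sol m l r (l c) \<union> sol m l r (r c) else {})"
  by pat_completeness auto
termination by (relation "measure (\<lambda>(m, l, r, c). c)") auto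

declare sol.simps [simp del]

text \<open>Needed because cells are only appended: what a cell means depends on smaller cells
  alone.\<close>

lemma sol_cong:
  assumes "\<And>i. i < k \<Longrightarrow> l' i = l i \<and> r' i = r i" "c < k"
  shows "sol m l' r' c = sol m l r c"
  using assms(2)
proof (induction c rule: less_induct)
  case (less c)
  then show ?case using assms(1)[of c] by (subst (1 2) sol.simps) auto
qed

lemma node_order_cong:
  assumes "node_order W m M E bag par"
    "\<And>x p. x < M \<Longrightarrow> p < W \<Longrightarrow> bag' x p = bag x p" "\<And>x. x < M - 1 \<Longrightarrow> par' x = par x"
  shows "node_order W m M E bag' par'"
proof -
  interpret node_order W m M E bag par by (rule assms(1))
  have im: "bag' x ` {..<W} = bag x ` {..<W}" if "x < M" for x
    using assms(2)[OF that] by (intro image_cong) auto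
  have inj: "inj_on (bag' x) {..<W}" if "x < M" for x
    using bag_inj[OF that] assms(2)[OF that] by (simp add: inj_on_def)
  show ?thesis
  proof
    show "1 < W \<and> bag' k 0 = src (E k) \<and> bag' k 1 = dst (E k)" if "k < m" for k
      using E_bag[OF that] assms(2)[of k] that mM by auto
    fix x y z
    assume "x < M - 1" "x < y" "y < M" "z \<in> ends (E ` {..<m})" "z \<in> bag' x ` {..<W}" "z \<in> bag' y ` {..<W}"
    then show "z \<in> bag' (par' x) ` {..<W}"
      using rip[of x y z] par[of x] im[of x] im[of y] im[of "par x"] assms(3)[of x] by simp
  qed (use mM inj E_id par assms(3) in auto)
qed

subsection \<open>Processing all nodes\<close>

definition step :: prog where
  "step = Seq (Set vY (Read aPar (V vI))) (Seq (Set vTx (Read aTid (V vI))) (Seq (Set vTy (Read aTid (V vY)))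
     (Seq merge_tables (Write aTid (V vY) (Add (V vM) (V vI))))))"

definition steps :: prog where
  "steps = For vI (Sub (V vM) (Num 1)) step"

lemma writes_step: "writes step = {vY, vTx, vTy, aTid, vA, vB} \<union> writes merge_pair"
  unfolding step_def by auto

lemma writes_steps: "writes steps = {vI, vY, vTx, vTy, aTid, vA, vB} \<union> writes merge_pair"
  unfolding steps_def using writes_step by auto

text \<open>The bounds reflect the storage: fewer than \<open>2 * M\<close> tables, and at most one
  new cell per merge and pair of codes.\<close>

locale dp = node_order W m M E bag par for W m M E bag par +
  fixes B :: nat and sb :: memory
  assumes bag_mem: "bag = (\<lambda>x p. sb aBag (x * W + p))" and par_mem: "par = sb aPar"
    and regs: "sb vW 0 = W" "sb vBase 0 = 4 * W" "sb vS 0 = ncodes W" "sb vM 0 = M" "sb vm 0 = m" and W0: "0 < W"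
    and bounds: "2 * M * ncodes W \<le> B" "m + 2 + M * (ncodes W * ncodes W) \<le> B" "4 * W + 8 \<le> B" "2 * (m + 1) \<le> B"
begin

abbreviation "S \<equiv> ncodes W"
abbreviation "solm s \<equiv> sol m (s aLeft) (s aRight)"
abbreviation "table s x \<equiv> \<lambda>a. s aTab (s aTid x * S + a)"

text \<open>A node takes part in merges until its own turn; after that its table is frozen at stage
  \<open>x\<close>, which explains \<open>min i x\<close>. In the end every node has its table at
  stage \<open>x\<close>, as \<open>best_is_optimal\<close> requires.\<close>

definition dp_inv :: "nat \<Rightarrow> memory \<Rightarrow> bool" where
  "dp_inv i s \<longleftrightarrow>
     (\<forall>x<M. represents (min i x) x (table s x) (s aVal) (solm s)) \<and> (\<forall>x<M. s aTid x < M + i) \<and>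
     (\<forall>j. (M + i) * S \<le> j \<longrightarrow> s aTab j = 0) \<and> (\<forall>j. s aTab j < s vCnt 0) \<and>
     (\<forall>j. s aTab j \<noteq> 0 \<longrightarrow> 0 < s aVal (s aTab j)) \<and> (\<forall>j. s aVal (s aTab j) \<le> m + 1) \<and>
     s aVal 0 = 0 \<and> m + 2 \<le> s vCnt 0 \<and> s vCnt 0 \<le> m + 2 + i * (S * S) \<and>
     (\<forall>c. m + 2 \<le> c \<and> c < s vCnt 0 \<longrightarrow> s aLeft c < c \<and> s aRight c < c)"

lemma dp_invD:
  assumes "dp_inv i s"
  shows "x < M \<Longrightarrow> represents (min i x) x (table s x) (s aVal) (solm s)" "x < M \<Longrightarrow> s aTid x < M + i"
    "(M + i) * S \<le> j \<Longrightarrow> s aTab j = 0" "s aTab j < s vCnt 0" "s aTab j \<noteq> 0 \<Longrightarrow> 0 < s aVal (s aTab j)"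
    "s aVal (s aTab j) \<le> m + 1" "s aVal 0 = 0" "m + 2 \<le> s vCnt 0" "s vCnt 0 \<le> m + 2 + i * (S * S)"
    "m + 2 \<le> c \<Longrightarrow> c < s vCnt 0 \<Longrightarrow> s aLeft c < c \<and> s aRight c < c"
  using assms unfolding dp_inv_def by blast+

text \<open>Values count edges of the graph, so they stay within a word however many merges
  contribute to them.\<close>

lemma represents_val_le:
  assumes "represents i x T val so" "a < S" "T a \<noteq> 0"
  shows "val (T a) \<le> m + 1"
proof -
  have "so (T a) \<subseteq> {..<m}" "val (T a) = Suc (card (E ` so (T a)))"
    using assms unfolding represents_def by auto
  moreover have "card (E ` so (T a)) \<le> card {..<m}"
    using calculation(1) card_image_le[of "so (T a)" E] card_mono[of "{..<m}" "so (T a)"] finite_subset[of "so (T a)" "{..<m}"]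
    by simp
  ultimately show ?thesis by simp
qed

lemma tid_bound: "t < k \<Longrightarrow> a < S \<Longrightarrow> t * S + a < k * S"
proof -
  assume "t < k" "a < S"
  have "t * S + a < Suc t * S" using \<open>a < S\<close> by simp
  also have "\<dots> \<le> k * S" using \<open>t < k\<close> by (intro mult_le_mono1) simp
  finally show ?thesis .
qed

lemma tri_step:
  assumes ag: "agree (insert vI (writes step)) sb s" and i: "i < M - 1" "s vI 0 = i" and I: "dp_inv i s"
  shows "tri B step s (S * S * (W * (W * 150 + 800) + 900) + 50) (dp_inv (Suc i))"
proof -
  note f = agreeD[OF ag, unfolded writes_step writes_merge_pair]
  note D = dp_invD[OF I]
  define y where "y = par i"
  have y: "i < y" "y < M" using par[OF i(1)] unfolding y_def by auto
  have iM: "i < M" using i by simp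
  define tx ty where "tx = s aTid i" and "ty = s aTid y"
  define s1 where "s1 = s(vY := (s vY)(0 := y), vTx := (s vTx)(0 := tx), vTy := (s vTy)(0 := ty))"
  have S0: "0 < S" using ncodes_ge[OF W0] W0 by simp
  have vy: "s aPar i = y" unfolding y_def by (simp add: par_mem f)
  have b1: "(M + i + 1) * S \<le> B"
  proof -
    have "(M + i + 1) * S \<le> 2 * M * S" using i by (intro mult_le_mono1) simp
    then show ?thesis using bounds(1) by simp
  qed
  have MB: "M + i + 1 \<le> B"
  proof -
    have "(M + i + 1) * 1 \<le> (M + i + 1) * S" using S0 by (intro mult_le_mono2) simp
    also note b1
    finally show ?thesis by simp
  qed
  have b2: "s vCnt 0 + S * S \<le> B"
  proof -
    have "Suc i * (S * S) \<le> M * (S * S)" using iM by (intro mult_le_mono1) simp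
    then show ?thesis using D(9) bounds(2) by (simp add: algebra_simps)
  qed
  interpret mg: merging B W M i y tx ty "s vCnt 0" s1
  proof
    show "s1 aTab j < s vCnt 0" for j using D(4) by (simp add: s1_def)
    show "s1 aVal (s1 aTab j) + s1 aVal (s1 aTab j') \<le> B" for j j'
    proof -
      have "s aVal (s aTab j) + s aVal (s aTab j') \<le> 2 * (m + 1)" using D(6)[of j] D(6)[of j'] by simp
      then show ?thesis using bounds(4) by (simp add: s1_def)
    qed
    show "tx < M + i" "ty < M + i" using D(2) iM y unfolding tx_def ty_def by auto
    show "s1 aTab j = 0" if "(M + i) * S \<le> j" for j using D(3) that by (simp add: s1_def)
    show "(M + i + 1) * S \<le> B" "s vCnt 0 + S * S \<le> B" by fact+
  qed (use regs W0 i D(5,7,8) bounds in \<open>simp_all add: s1_def f\<close>)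
  have final: "dp_inv (Suc i) (s2(aTid := (s2 aTid)(y := M + i)))"
    if ag2: "agree (writes merge_tables) s1 s2" and J: "mg.Inv (S * S) s2" for s2
  proof -
    note f2 = agreeD[OF ag2, unfolded writes_merge_tables writes_merge_pair]
    note J = mg.minvD[OF J]
    let ?s = "s2(aTid := (s2 aTid)(y := M + i))"
    have s1': "s1 aTab = s aTab" "s1 aVal = s aVal" "s1 aLeft = s aLeft" "s1 aRight = s aRight" "s1 aTid = s aTid"
      "s1 vCnt = s vCnt" by (simp_all add: s1_def)
    have tid: "s2 aTid = s aTid" by (simp add: f2 s1')
    have vx: "mg.vx = bag i" "mg.vy = bag y"
      unfolding bag_mem by (simp_all add: s1_def f)
    have solE: "solm s2 c = solm s c" if "c < s vCnt 0" for c
      using J(4) by (intro sol_cong[OF _ that]) (simp add: s1')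
    have tabE: "s2 aTab (t * S + a) = s aTab (t * S + a)" if "t < M + i" "a < S" for t a
      using J(1) tid_bound[OF that] by (simp add: s1')
    \<comment> \<open>Neither the other tables nor the cells below the old counter were written, so
      a table whose part is unchanged represents the same solutions as before.\<close>
    have keep: "represents j x (\<lambda>a. s2 aTab (s aTid x * S + a)) (s2 aVal) (solm s2)"
      if "x < M" "part (min i x) x = part j x" for x j
      using D(1)[OF that(1)] that(2)
    proof (rule represents_cong)
      show "s2 aTab (s aTid x * S + a) = table s x a" if "a < S" for a
        using tabE[OF D(2)[OF \<open>x < M\<close>] that] .
      show "s2 aVal (table s x a) = s aVal (table s x a) \<and> solm s2 (table s x a) = solm s (table s x a)" for a
        using J(4)[OF D(4)] solE[OF D(4)] by (simp add: s1')
    qed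
    have new: "represents (Suc i) y (\<lambda>a. s2 aTab ((M + i) * S + a)) (s2 aVal) (solm s2)"
    proof (rule represents_merge[OF i(1), folded y_def, where ?T1.0 = "\<lambda>a. s2 aTab (tx * S + a)" and ?T2.0 = "\<lambda>a. s2 aTab (ty * S + a)"])
      show "represents i i (\<lambda>a. s2 aTab (tx * S + a)) (s2 aVal) (solm s2)"
        unfolding tx_def by (rule keep[OF iM]) simp
      show "represents i y (\<lambda>a. s2 aTab (ty * S + a)) (s2 aVal) (solm s2)"
        unfolding ty_def by (rule keep[OF y(2)]) (use y in simp)
      have T: "s2 aTab (tx * S + a) = s1 aTab (tx * S + a)" "s2 aTab (ty * S + a) = s1 aTab (ty * S + a)" if "a < S" for a
        using tabE that mg.tid by (simp_all add: s1')
      have V: "s2 aVal (s1 aTab j) = s1 aVal (s1 aTab j)" for j using J(4)[OF mg.entries(1)] by simp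
      fix d assume d: "d < S" "s2 aTab ((M + i) * S + d) \<noteq> 0"
      let ?c = "s2 aTab ((M + i) * S + d)"
      obtain a b where ab: "a < S" "b < S" "s1 aTab (tx * S + a) \<noteq> 0" "s1 aTab (ty * S + b) \<noteq> 0" "mg.mok a b"
        "d = mg.mcode a b" "s2 aLeft ?c = s1 aTab (tx * S + a)" "s2 aRight ?c = s1 aTab (ty * S + b)"
        "s2 aVal ?c + 1 = s1 aVal (s1 aTab (tx * S + a)) + s1 aVal (s1 aTab (ty * S + b))"
        and c: "s vCnt 0 \<le> ?c" "?c < s2 vCnt 0"
        using J(6)[OF d] by blast
      have "m + 2 \<le> ?c" using c D(8) by simp
      then have "solm s2 ?c = solm s2 (s2 aLeft ?c) \<union> solm s2 (s2 aRight ?c)"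
        using J(5)[OF c] by (subst sol.simps) auto
      then show "\<exists>a<S. \<exists>b<S. s2 aTab (tx * S + a) \<noteq> 0 \<and> s2 aTab (ty * S + b) \<noteq> 0 \<and>
        merge_ok W (bag i) (bag y) a b \<and> d = merge_code W (bag i) (bag y) a b \<and>
        solm s2 ?c = solm s2 (s2 aTab (tx * S + a)) \<union> solm s2 (s2 aTab (ty * S + b)) \<and>
        s2 aVal ?c + 1 = s2 aVal (s2 aTab (tx * S + a)) + s2 aVal (s2 aTab (ty * S + b))"
        using ab(1-4,7-9) ab(5,6)[unfolded vx] T V
        by (intro exI[of _ a] conjI[OF ab(1)] exI[of _ b] conjI[OF ab(2)]) simp
    next
      fix a b assume ab: "a < S" "b < S" "s2 aTab (tx * S + a) \<noteq> 0" "s2 aTab (ty * S + b) \<noteq> 0"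
        and ok: "merge_ok W (bag i) (bag y) a b"
      have T: "s2 aTab (tx * S + a) = s1 aTab (tx * S + a)" "s2 aTab (ty * S + b) = s1 aTab (ty * S + b)"
        using tabE ab mg.tid by (simp_all add: s1')
      have V: "s2 aVal (s1 aTab j) = s1 aVal (s1 aTab j)" for j using J(4)[OF mg.entries(1)] by simp
      have lt: "a * S + b < S * S" using tid_bound ab by blast
      show "s2 aTab ((M + i) * S + merge_code W (bag i) (bag y) a b) \<noteq> 0 \<and>
        s2 aVal (s2 aTab (tx * S + a)) + s2 aVal (s2 aTab (ty * S + b))
        \<le> s2 aVal (s2 aTab ((M + i) * S + merge_code W (bag i) (bag y) a b)) + 1"
        using J(7)[OF ab(1,2) lt, unfolded vx] ab(3,4) ok T V by simp
    qed
    have rep: "represents (min (Suc i) x) x (table ?s x) (?s aVal) (solm ?s)" if x: "x < M" for x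
    proof (cases "x = y")
      case True
      then show ?thesis using new y by simp
    next
      case False
      have "part (min i x) x = part (min (Suc i) x) x"
        using part_Suc_other[of i x] False unfolding y_def by (cases "x \<le> i") auto
      then show ?thesis using keep[OF x] False tid by simp
    qed
    have tab_lt: "s2 aTab j < s2 vCnt 0 \<and> (s2 aTab j \<noteq> 0 \<longrightarrow> 0 < s2 aVal (s2 aTab j)) \<and> s2 aVal (s2 aTab j) \<le> m + 1" for j
    proof (cases "j < (M + i) * S \<or> (M + i) * S + S \<le> j")
      case True
      then have "s2 aTab j = s aTab j" using J(1) by (simp add: s1')
      moreover have "s2 aVal (s aTab j) = s aVal (s aTab j)" using J(4)[OF D(4)] by (simp add: s1')
      moreover have "s aTab j < s2 vCnt 0" using D(4)[of j] J(2) by simp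
      ultimately show ?thesis using D(5,6)[of j] by simp
    next
      case False
      then obtain d where d: "d < S" "j = (M + i) * S + d"
        using less_diff_conv2[of "(M + i) * S" j S] by (metis add.commute add_diff_inverse_nat not_le)
      show ?thesis
      proof (cases "s2 aTab j = 0")
        case True
        then show ?thesis using D(7,8) J(2) J(4)[of 0] by (simp add: s1')
      next
        case nz: False
        then have lt: "s2 aTab j < s2 vCnt 0" using J(6)[OF d(1)] d(2) by blast
        have "s2 aVal (s2 aTab j) \<le> m + 1"
          using represents_val_le[OF new d(1)] nz d(2) by simp
        moreover have "0 < s2 aVal (s2 aTab j)"
          using new d nz unfolding represents_def by auto
        ultimately show ?thesis using lt by simp
      qed
    qed
    show ?thesis
      unfolding dp_inv_def
    proof (intro conjI allI impI)
      fix x assume x: "x < M"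
      show "represents (min (Suc i) x) x (table ?s x) (?s aVal) (solm ?s)" using rep[OF x] .
      show "?s aTid x < M + Suc i" using D(2)[OF x] by (simp add: tid)
    next
      fix j assume j: "(M + Suc i) * S \<le> j"
      then have "(M + i) * S + S \<le> j" by (simp add: algebra_simps)
      moreover have "(M + i) * S \<le> j" using calculation by simp
      ultimately show "?s aTab j = 0" using J(1)[of j] D(3)[of j] by (simp add: s1')
    next
      fix c assume c: "m + 2 \<le> c \<and> c < ?s vCnt 0"
      show "?s aLeft c < c" "?s aRight c < c"
        using c J(4)[of c] J(5)[of c] D(10)[of c] by (cases "c < s vCnt 0"; simp add: s1')+
    qed (use tab_lt D(7,8,9) J(2,3) J(4)[of 0] in \<open>auto simp: s1'\<close>)
  qed
  have "tri B (Seq merge_tables (Write aTid (V vY) (Add (V vM) (V vI)))) s1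
    (S * S * (W * (W * 150 + 800) + 900) + 10) (dp_inv (Suc i))"
  proof (rule tri_SeqI[OF mg.tri_merge_tables, where ?T2.0 = 10], goal_cases)
    case (1 s2)
    note f2 = agreeD[OF 1(1), unfolded writes_merge_tables writes_merge_pair]
    have "s2 vY 0 = y" "s2 vM 0 = M" "s2 vI 0 = i" using mg.regs by (simp_all add: f2)
    moreover have "M + i \<le> B" "y \<le> B" using MB y by simp_all
    ultimately show ?case using final[OF 1] by simp
  qed simp
  then have m: "tri B (Seq merge_tables (Write aTid (V vY) (Add (V vM) (V vI))))
     (s(vY := (s vY)(0 := y), vTx := (s vTx)(0 := tx), vTy := (s vTy)(0 := ty)))
    (S * S * (W * (W * 150 + 800) + 900) + 10) (dp_inv (Suc i))" unfolding s1_def .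
  have "y \<le> B" "tx \<le> B" "ty \<le> B" using MB y D(2)[OF iM] D(2)[OF y(2)] unfolding tx_def ty_def by simp_all
  then show ?thesis
    unfolding step_def by (simp add: vy i(2) tx_def[symmetric] ty_def[symmetric] tri_mono[OF m])
qed

lemma tri_steps:
  assumes ag: "agree (writes steps) sb s" and I: "dp_inv 0 s"
  shows "tri B steps s (M * (S * S * (W * (W * 150 + 800) + 900) + 80) + 30) (dp_inv (M - 1))"
  unfolding steps_def
proof (rule tri_For[where N = "M - 1" and I = dp_inv and T = "S * S * (W * (W * 150 + 800) + 900) + 50"], goal_cases)
  case (5 i s')
  have "agree (insert vI (writes step)) sb s'"
    using 5(2) ag unfolding agree_def writes_step writes_steps by auto
  from tri_step[OF this 5(1,3,4)] show ?case
    by (rule tri_mono) (simp_all add: dp_inv_def)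
next
  case (3 s')
  then show ?case using agreeD[OF 3] agreeD[OF ag] regs by (simp add: writes_step writes_steps writes_merge_pair)
next
  case 2
  have "M * 1 \<le> M * S" using ncodes_ge[OF W0] W0 by (intro mult_le_mono2) simp
  then show ?case using bounds(1) by linarith
next
  case 7
  have "(M - 1) * (S * S * (W * (W * 150 + 800) + 900) + 70) \<le> M * (S * S * (W * (W * 150 + 800) + 900) + 70)"
    by (intro mult_le_mono1) simp
  then show ?case by (simp add: algebra_simps)
qed (use I in \<open>auto simp: writes_step writes_merge_pair dp_inv_def\<close>)

end

subsection \<open>Initial tables\<close>

text \<open>One loop produces both \<open>ncodes W\<close>, as a power of the base, and the code of
  the empty forest. The code of a single edge is derived from the latter by
  \<open>edge_code_eq\<close>.\<close>

definition init_tables :: prog where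
  "init_tables =
     Seq (Set vS (Num 1)) (Seq (Set vCode (Num 0))
     (Seq (For vP (V vW) (Seq (Set vCode (Add (V vCode) (Mul (Mul (Num 4) (V vP)) (V vS)))) (Set vS (Mul (V vS) (V vBase)))))
     (Seq (Write aVal (Num 1) (Num 1))
     (Seq (For vI (V vM) (Seq (Write aTid (V vI) (V vI)) (Write aTab (Add (Mul (V vI) (V vS)) (V vCode)) (Num 1))))
     (Seq (For vI (V vm) (Seq
        (Write aTab (Add (Mul (V vI) (V vS)) (Sub (Add (V vCode) (Num 1)) (Mul (Num 3) (V vBase)))) (Add (V vI) (Num 2)))
        (Write aVal (Add (V vI) (Num 2)) (Num 2))))
     (Set vCnt (Add (V vm) (Num 2))))))))"

lemma writes_init_tables: "writes init_tables = {vS, vCode, vP, aVal, vI, aTid, aTab, vCnt}"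
  unfolding init_tables_def by auto

lemma pair_eq:
  fixes S :: nat
  assumes "a < S" "b < S"
  shows "x * S + a = y * S + b \<longleftrightarrow> x = y \<and> a = b"
proof
  assume eq: "x * S + a = y * S + b"
  have "(x * S + a) div S = x" "(y * S + b) div S = y" using assms by auto
  then show "x = y \<and> a = b" using eq by auto
qed simp

context node_order
begin

lemma empty_code_less: "empty_code < ncodes W"
  unfolding empty_code_def by (rule code_less) simp

lemma edge_code_less: "1 < W \<Longrightarrow> edge_code < ncodes W"
  unfolding edge_code_def by (rule code_less) (auto simp: relabel_def)

lemma tri_init_tables:
  assumes W: "s vW 0 = W" "0 < W" "s vBase 0 = 4 * W" and M: "s vM 0 = M" "s vm 0 = m"
    and zero: "\<And>j. s aTab j = 0" "\<And>j. s aVal j = 0"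
    and B: "M * ncodes W \<le> B" "m + 2 \<le> B" "2 \<le> B"
  shows "tri B init_tables s (W * 60 + M * 100 + 200) (\<lambda>s'. s' vS 0 = ncodes W \<and> s' vCnt 0 = m + 2 \<and>
    (\<forall>x<M. s' aTid x = x) \<and> (\<forall>j. M * ncodes W \<le> j \<longrightarrow> s' aTab j = 0) \<and>
    (\<forall>x<M. \<forall>a<ncodes W. s' aTab (x * ncodes W + a) =
      (if a = empty_code then 1 else if x < m \<and> a = edge_code then Suc (Suc x) else 0)) \<and>
    s' aVal 0 = 0 \<and> s' aVal 1 = 1 \<and> (\<forall>k<m. s' aVal (Suc (Suc k)) = 2))"
proof -
  define S where "S = ncodes W"
  define b where "b = 4 * W"
  have M0: "0 < M" using mM by simp
  have S0: "0 < S" "4 * W \<le> S" using ncodes_ge[OF W(2)] W(2) unfolding S_def by auto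
  have SM: "S \<le> M * S" using M0 by simp
  have SB: "S \<le> B" using SM B(1) unfolding S_def[symmetric] by linarith
  have MB: "M \<le> B"
  proof -
    have "M * 1 \<le> M * S" using S0 by (intro mult_le_mono2) simp
    then show ?thesis using B(1) unfolding S_def by linarith
  qed
  have WB: "W \<le> B" using S0 SB by simp
  note e0 = empty_code_less[folded S_def]
  have idx: "x * S + a \<le> B" "x * S + a < M * S" if "x < M" "a < S" for x a
  proof -
    have "x * S + a < Suc x * S" using that by simp
    also have "\<dots> \<le> M * S" using that by (intro mult_le_mono1) simp
    finally show "x * S + a < M * S" .
    then show "x * S + a \<le> B" using B(1) unfolding S_def by simp
  qed
  have part: "(\<Sum>p<i. 4 * p * b ^ p) < b ^ i" if "i \<le> W" for i
    using that unfolding b_def by (intro digit_sum_less) auto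
  have pw: "b ^ i \<le> B" if "i \<le> W" for i using ncodes_mono[OF that W(2)] SB unfolding b_def S_def by simp
  have e0_eq: "empty_code = (\<Sum>p<W. 4 * p * b ^ p)" unfolding empty_code_def code_def b_def by simp
  let ?Q1 = "\<lambda>s'. s' vCode 0 = empty_code \<and> s' vS 0 = S"
  let ?Q2 = "\<lambda>i s'. (\<forall>x<i. s' aTid x = x) \<and> (\<forall>j. M * S \<le> j \<longrightarrow> s' aTab j = 0) \<and>
    (\<forall>x<M. \<forall>a<S. s' aTab (x * S + a) = (if x < i \<and> a = empty_code then 1 else 0))"
  let ?Q3 = "\<lambda>i s'. (\<forall>j. M * S \<le> j \<longrightarrow> s' aTab j = 0) \<and>
    (\<forall>x<M. \<forall>a<S. s' aTab (x * S + a) = (if a = empty_code then 1 else if x < i \<and> a = edge_code then Suc (Suc x) else 0)) \<and>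
    s' aVal 0 = 0 \<and> s' aVal 1 = 1 \<and> (\<forall>k<i. s' aVal (Suc (Suc k)) = 2)"
  define QF where "QF = (\<lambda>s' :: memory. s' vS 0 = S \<and> s' vCnt 0 = m + 2 \<and>
    (\<forall>x<M. s' aTid x = x) \<and> (\<forall>j. M * S \<le> j \<longrightarrow> s' aTab j = 0) \<and>
    (\<forall>x<M. \<forall>a<S. s' aTab (x * S + a) =
      (if a = empty_code then 1 else if x < m \<and> a = edge_code then Suc (Suc x) else 0)) \<and>
    s' aVal 0 = 0 \<and> s' aVal 1 = 1 \<and> (\<forall>k<m. s' aVal (Suc (Suc k)) = 2))"
  have main: "tri B (Seq (For vP (V vW) (Seq (Set vCode (Add (V vCode) (Mul (Mul (Num 4) (V vP)) (V vS)))) (Set vS (Mul (V vS) (V vBase)))))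
     (Seq (Write aVal (Num 1) (Num 1))
     (Seq (For vI (V vM) (Seq (Write aTid (V vI) (V vI)) (Write aTab (Add (Mul (V vI) (V vS)) (V vCode)) (Num 1))))
     (Seq (For vI (V vm) (Seq
        (Write aTab (Add (Mul (V vI) (V vS)) (Sub (Add (V vCode) (Num 1)) (Mul (Num 3) (V vBase)))) (Add (V vI) (Num 2)))
        (Write aVal (Add (V vI) (Num 2)) (Num 2))))
     (Set vCnt (Add (V vm) (Num 2))))))) (s(vS := (s vS)(0 := 1), vCode := (s vCode)(0 := 0))) (W * 60 + M * 100 + 170) QF"
    (is "tri B _ ?s _ _")
  proof (rule tri_SeqI[where ?T1.0 = "W * 60 + 20" and R = ?Q1 and ?T2.0 = "M * 100 + 140"], goal_cases)
    case 1
    show ?case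
    proof (rule tri_For[where N = W and T = 40 and
          I = "\<lambda>i s'. s' vCode 0 = (\<Sum>p<i. 4 * p * b ^ p) \<and> s' vS 0 = b ^ i"], goal_cases)
      case (5 i s')
      have "s' vBase 0 = b" using W by (simp add: agreeD[OF 5(2)] b_def)
      then show ?case using 5 part[of "Suc i"] pw[of "Suc i"] by (simp add: mult.commute)
    next
      case (6 s')
      then show ?case unfolding e0_eq S_def ncodes_def b_def by blast
    qed (use W WB in \<open>auto simp: agreeD\<close>)
  next
    case (2 s1)
    note f1 = agreeD[OF 2(1)]
    have reg1: "s1 vW 0 = W" "s1 vM 0 = M" "s1 vm 0 = m" "s1 vBase 0 = b" "s1 vCode 0 = empty_code" "s1 vS 0 = S"
      "\<And>j. s1 aTab j = 0" "\<And>j. s1 aVal j = 0"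
      using W M zero 2(2) by (simp_all add: f1 b_def)
    have "tri B (Seq (For vI (V vM) (Seq (Write aTid (V vI) (V vI)) (Write aTab (Add (Mul (V vI) (V vS)) (V vCode)) (Num 1))))
     (Seq (For vI (V vm) (Seq
        (Write aTab (Add (Mul (V vI) (V vS)) (Sub (Add (V vCode) (Num 1)) (Mul (Num 3) (V vBase)))) (Add (V vI) (Num 2)))
        (Write aVal (Add (V vI) (Num 2)) (Num 2))))
     (Set vCnt (Add (V vm) (Num 2))))) (s1(aVal := (s1 aVal)(1 := 1))) (M * 100 + 120) QF"
    proof (rule tri_SeqI[where ?T1.0 = "M * 40 + 20" and R = "?Q2 M" and ?T2.0 = "M * 60 + 60"], goal_cases)
      case 1
      show ?case
      proof (rule tri_For[where N = M and T = 25 and I = ?Q2], goal_cases)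
        case (5 i s')
        have r: "s' vS 0 = S" "s' vCode 0 = empty_code" using reg1 by (simp_all add: agreeD[OF 5(2)])
        have ne: "j \<noteq> i * S + empty_code" if "M * S \<le> j" for j using idx(2)[OF 5(1) e0] that by simp
        show ?case using 5 r MB idx(1)[OF 5(1) e0] B(3) ne
          by (auto simp: pair_eq[OF _ e0] less_Suc_eq)
      qed (use MB reg1 in \<open>auto simp: agreeD\<close>)
    next
      case (2 s2)
      note f2 = agreeD[OF 2(1)]
      have reg2: "s2 vM 0 = M" "s2 vm 0 = m" "s2 vBase 0 = b" "s2 vCode 0 = empty_code" "s2 vS 0 = S"
        "s2 aVal 1 = 1" "s2 aVal 0 = 0"
        using reg1 by (simp_all add: f2)
      have mB: "m \<le> B" using mM MB by simp
      show ?case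
      proof (rule tri_SeqI[where ?T1.0 = "M * 60 + 20" and R = "?Q3 m" and ?T2.0 = 20], goal_cases)
        case 1
        show ?case
        proof (rule tri_For[where N = m and T = 45 and I = ?Q3], goal_cases)
          case (5 i s')
          \<comment> \<open>The loop body runs only if there is an edge, and then
            \<open>1 < W\<close>, as the formula for the code of an edge requires.\<close>
          have W1: "1 < W" using E_bag[OF 5(1)] by simp
          have iM: "i < M" using 5(1) mM by simp
          have r: "s' vS 0 = S" "s' vCode 0 = empty_code" "s' vBase 0 = b" using reg2 by (simp_all add: agreeD[OF 5(2)])
          have e1: "edge_code < S" using edge_code_less[OF W1] unfolding S_def .
          have c: "empty_code + 1 - 3 * b = edge_code" using edge_code_eq[OF W1] unfolding b_def by simp
          have ne: "j \<noteq> i * S + edge_code" if "M * S \<le> j" for j using idx(2)[OF iM e1] that by simp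
          show ?case
            using 5 r c[unfolded One_nat_def] idx(1)[OF iM e1] B codes_differ[OF W1] ne
            by (auto simp: pair_eq[OF _ e1] less_Suc_eq)
        next
          case 7
          show ?case using mM mult_le_mono1[of m M 60] by simp
        qed (use 2(2) reg2 mB in \<open>auto simp: agreeD\<close>)
      next
        case (2 s3)
        note f3 = agreeD[OF 2(1)]
        have "s3 aTid = s2 aTid" "s3 vS 0 = S" "s3 vm 0 = m" using reg2 by (simp_all add: f3)
        then show ?case using 2(2) \<open>?Q2 M s2\<close> B(2) unfolding QF_def by simp
      qed simp
    qed simp
    then show ?case using B(3) by (simp add: tri_mono)
  qed simp
  show ?thesis
    unfolding init_tables_def S_def[symmetric] QF_def[symmetric] using B(3) by (simp add: tri_mono[OF main[unfolded One_nat_def]])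
qed

end

context dp
begin

lemma dp_inv_init:
  assumes "sb vCnt 0 = m + 2" and tid: "\<And>x. x < M \<Longrightarrow> sb aTid x = x"
    and zero: "\<And>j. M * S \<le> j \<Longrightarrow> sb aTab j = 0"
    and tab: "\<And>x a. x < M \<Longrightarrow> a < S \<Longrightarrow> sb aTab (x * S + a) =
      (if a = empty_code then 1 else if x < m \<and> a = edge_code then Suc (Suc x) else 0)"
    and val: "sb aVal 0 = 0" "sb aVal 1 = 1" "\<And>k. k < m \<Longrightarrow> sb aVal (Suc (Suc k)) = 2"
  shows "dp_inv 0 sb"
proof -
  have S0: "0 < S" using ncodes_ge[OF W0] W0 by simp
  have any: "sb aTab j = 0 \<or> sb aTab j = 1 \<or> (\<exists>k<m. sb aTab j = Suc (Suc k))" for j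
  proof (cases "M * S \<le> j")
    case False
    then have "j div S < M" using S0 by (simp add: less_mult_imp_div_less)
    then show ?thesis using tab[of "j div S" "j mod S"] S0 by auto
  qed (use zero in simp)
  have rep: "represents 0 x (table sb x) (sb aVal) (solm sb)" if x: "x < M" for x
  proof (rule represents_init[OF x])
    show "solm sb 1 = {}" by (subst sol.simps) simp
    show "x < m \<Longrightarrow> sb aVal (Suc (Suc x)) = 2" using val by simp
    show "table sb x a = (if a = empty_code then 1 else if x < m \<and> a = edge_code then Suc (Suc x) else 0)" if "a < S" for a
      using tab[OF x that] tid[OF x] by simp
  next
    show "solm sb (Suc (Suc x)) = {x}" if "x < m" using that by (subst sol.simps) simp
  qed (use val in simp)
  have m1: "sb aVal (sb aTab j) \<le> m + 1 \<and> sb aTab j < m + 2 \<and> (sb aTab j \<noteq> 0 \<longrightarrow> 0 < sb aVal (sb aTab j))" for j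
    using any[of j] val by (auto simp del: One_nat_def)
  show ?thesis
    unfolding dp_inv_def using assms(1) rep tid zero m1 val(1) by auto
qed

end

subsection \<open>The best state\<close>

definition check_single :: prog where
  "check_single = Seq (Set vOk (Num 1)) (For vP (V vW) (For vR (V vW)
     (Cond (Mul (Mul (Read aD1 (V vP)) (Read aD1 (V vR))) (Sub (Num 1) (Eq (Read aL1 (V vP)) (Read aL1 (V vR)))))
       (Set vOk (Num 0)) Skip)))"

text \<open>\<open>vBest\<close> starts as cell 0, whose value is 0, so an absent entry never wins
  and the first connected solution does.\<close>

definition visit :: prog where
  "visit = Seq (Set vX (Read aTab (Add (Mul (Read aTid (V vI)) (V vS)) (V vA))))
     (Cond (Sub (Read aVal (V vX)) (Read aVal (V vBest)))
       (Seq (decode (V vA) aL1 aD1) (Seq check_single (Cond (V vOk) (Set vBest (V vX)) Skip))) Skip)"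

definition find_best :: prog where
  "find_best = Seq (Set vBest (Num 0)) (For vI (V vM) (For vA (V vS) visit))"

lemma writes_check_single [simp]: "writes check_single = {vOk, vP, vR}"
  unfolding check_single_def by auto

lemma writes_visit [simp]: "writes visit = {vX, vBest, vOk, vP, vR, vU, vV, aL1, aD1}"
  unfolding visit_def by auto

lemma writes_find_best: "writes find_best = {vX, vBest, vOk, vP, vR, vU, vV, aL1, aD1, vI, vA}"
  unfolding find_best_def by auto

lemma tri_check_single:
  assumes "s vW 0 = W" "W \<le> B" "1 \<le> B"
  shows "tri B check_single s (W * (W * 70 + 60) + 60) (\<lambda>s'. s' vOk 0 =
    (if \<forall>p<W. \<forall>q<W. s aD1 p > 0 \<longrightarrow> s aD1 q > 0 \<longrightarrow> s aL1 p = s aL1 q then 1 else 0))"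
proof -
  let ?C = "\<lambda>p q. s aD1 p > 0 \<longrightarrow> s aD1 q > 0 \<longrightarrow> s aL1 p = s aL1 q"
  let ?I = "\<lambda>i s' :: memory. s' vOk 0 = (if \<forall>p<i. \<forall>q<W. ?C p q then 1 else 0)"
  have main: "tri B (For vP (V vW) (For vR (V vW)
     (Cond (Mul (Mul (Read aD1 (V vP)) (Read aD1 (V vR))) (Sub (Num 1) (Eq (Read aL1 (V vP)) (Read aL1 (V vR)))))
       (Set vOk (Num 0)) Skip))) (s(vOk := (s vOk)(0 := 1))) (W * (W * 70 + 60) + 40) (?I W)"
  proof (rule tri_For[where N = W and I = ?I and T = "W * 70 + 30"], goal_cases)
    case (5 i s')
    have "tri B (For vR (V vW)
     (Cond (Mul (Mul (Read aD1 (V vP)) (Read aD1 (V vR))) (Sub (Num 1) (Eq (Read aL1 (V vP)) (Read aL1 (V vR)))))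
       (Set vOk (Num 0)) Skip)) s' (W * 70 + 30) (?I (Suc i))"
    proof (rule tri_For[where N = W and T = 50 and
        I = "\<lambda>j s'. s' vOk 0 = (if (\<forall>p<i. \<forall>q<W. ?C p q) \<and> (\<forall>q<j. ?C i q) then 1 else 0)"], goal_cases)
      case (5 j s'')
      note f = agreeD[OF 5(2)] agreeD[OF \<open>agree _ _ s'\<close>]
      have "s'' aD1 = s aD1" "s'' aL1 = s aL1" "s'' vP 0 = i" using \<open>s' vP 0 = i\<close> by (simp_all add: f)
      then show ?case using 5(1,3,4) by (auto simp: less_Suc_eq)
    next
      case (6 s'')
      then show ?case by (simp add: less_Suc_eq all_conj_distrib)
    qed (use assms 5 agreeD[OF \<open>agree _ _ s'\<close>] in \<open>auto simp: agreeD\<close>)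
    then show ?case by (rule tri_mono) auto
  qed (use assms in \<open>auto simp: agreeD algebra_simps\<close>)
  show ?thesis
    unfolding check_single_def
    by (rule tri_Write_SeqI[OF _ _ _ _ main]) (use assms in auto)
qed

context dp
begin

definition best_inv :: "memory \<Rightarrow> nat \<Rightarrow> nat \<Rightarrow> bool" where
  "best_inv s k best \<longleftrightarrow>
     (best = 0 \<or> (\<exists>x<M. \<exists>a<S. table s x a \<noteq> 0 \<and> single a \<and> best = table s x a)) \<and>
     (\<forall>x<M. \<forall>a<S. x * S + a < k \<longrightarrow> table s x a \<noteq> 0 \<longrightarrow> single a \<longrightarrow> s aVal (table s x a) \<le> s aVal best)"

lemma best_inv_step:
  assumes I: "best_inv s (x * S + a) best" and xa: "x < M" "a < S" and v0: "s aVal 0 = 0"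
  shows "best_inv s (Suc (x * S + a))
    (if s aVal best < s aVal (table s x a) \<and> single a then table s x a else best)"
proof -
  have *: "x' * S + a' < x * S + a \<or> x' = x \<and> a' = a" if "a' < S" "x' * S + a' < Suc (x * S + a)" for x' a'
    using pair_code_less_Suc[OF xa(2) that] .
  show ?thesis
  proof (cases "s aVal best < s aVal (table s x a) \<and> single a")
    case True
    have "table s x a \<noteq> 0"
    proof
      assume "table s x a = 0"
      then show False using True v0 by simp
    qed
    moreover have "s aVal (table s x' a') \<le> s aVal (table s x a)"
      if "x' < M" "a' < S" "x' * S + a' < Suc (x * S + a)" "table s x' a' \<noteq> 0" "single a'" for x' a'
    proof (cases "x' * S + a' < x * S + a")
      case lt: True
      then have "s aVal (table s x' a') \<le> s aVal best" using I that unfolding best_inv_def by blast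
      then show ?thesis using True by simp
    next
      case False
      then show ?thesis using *[OF that(2,3)] by simp
    qed
    ultimately show ?thesis using True xa unfolding best_inv_def by auto
  next
    case False
    have "s aVal (table s x' a') \<le> s aVal best"
      if "x' < M" "a' < S" "x' * S + a' < Suc (x * S + a)" "table s x' a' \<noteq> 0" "single a'" for x' a'
    proof (cases "x' * S + a' < x * S + a")
      case True
      then show ?thesis using I that unfolding best_inv_def by blast
    next
      case f: False
      then show ?thesis using *[OF that(2,3)] False that by auto
    qed
    then show ?thesis using I False unfolding best_inv_def by auto
  qed
qed

lemma tri_visit:
  assumes ag: "agree (insert vA (insert vI (writes visit))) s s'"
    and r: "s vW 0 = W" "s vBase 0 = 4 * W" "s vS 0 = S"
    and v0: "s aVal 0 = 0" and lt: "\<And>j. s aTab j \<le> B"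
    and x: "s' vI 0 = x" "s' vA 0 = a" "x < M" "a < S" and I: "best_inv s (x * S + a) (s' vBest 0)"
    and SB: "S \<le> B"
  shows "tri B visit s' (W * (W * 70 + 120) + 250) (\<lambda>t. best_inv s (Suc (x * S + a)) (t vBest 0))"
proof -
  note f = agreeD[OF ag]
  define c where "c = table s x a"
  have c: "s' aTab (s' aTid x * S + a) = c" unfolding c_def by (simp add: f)
  have r': "s' vW 0 = W" "s' vBase 0 = 4 * W" "s' vS 0 = S" "s' aVal = s aVal" using r by (simp_all add: f)
  note st = best_inv_step[OF I x(3,4) v0, folded c_def]
  have WB: "4 * W \<le> B" "a \<le> B" using bounds(3) x(4) SB by auto
  define Q where "Q = (\<lambda>t :: memory. best_inv s (Suc (x * S + a)) (t vBest 0))"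
  let ?s = "s'(vX := (s' vX)(0 := c))"
  have cB: "c \<le> B" unfolding c_def using lt .
  have main: "tri B (Cond (Sub (Read aVal (V vX)) (Read aVal (V vBest)))
       (Seq (decode (V vA) aL1 aD1) (Seq check_single (Cond (V vOk) (Set vBest (V vX)) Skip))) Skip) ?s (W * (W * 70 + 120) + 230) Q"
  proof (cases "s aVal (s' vBest 0) < s aVal c")
    case False
    then show ?thesis using st unfolding Q_def by (simp add: r')
  next
    case True
    have "tri B (Seq (decode (V vA) aL1 aD1) (Seq check_single (Cond (V vOk) (Set vBest (V vX)) Skip))) ?s (W * (W * 70 + 120) + 200) Q"
    proof (rule tri_SeqI[where ?T2.0 = "W * (W * 70 + 60) + 120", OF tri_decode[where W = W and a = a and T = "W * 60 + 40"]], goal_cases)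
      case (9 s1)
      note f1 = agreeD[OF 9(1)]
      show ?case
      proof (rule tri_SeqI[where ?T2.0 = 30, OF tri_check_single[where W = W]], goal_cases)
        case (4 s2)
        note f2 = agreeD[OF 4(1)]
        have "s2 vOk 0 = (if single a then 1 else 0)"
          using 4(2) 9(2) unfolding single_def by auto
        moreover have "s2 vX 0 = c" "s2 vBest 0 = s' vBest 0" by (simp_all add: f2 f1)
        ultimately show ?case using st True cB unfolding Q_def by auto
      qed (use r' WB W0 bounds in \<open>auto simp: f1\<close>)
    qed (use r' x WB W0 in \<open>auto simp: algebra_simps\<close>)
    then show ?thesis by (rule tri_CondT[rotated]) (use True r' in simp_all)
  qed
  show ?thesis
    unfolding visit_def Q_def[symmetric]
    by (rule tri_Write_SeqI[OF _ _ _ _ main]) (use c x r' cB in simp_all)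
qed

lemma tri_find_best:
  assumes I: "dp_inv (M - 1) s" and r: "s vW 0 = W" "s vBase 0 = 4 * W" "s vS 0 = S" "s vM 0 = M"
  shows "tri B find_best s (M * (S * (W * (W * 70 + 120) + 300)) + 60) (\<lambda>t.
    (\<exists>x<M. \<exists>a<S. table s x a \<noteq> 0 \<and> single a \<and> t vBest 0 = table s x a) \<and>
    (\<forall>x<M. \<forall>a<S. table s x a \<noteq> 0 \<longrightarrow> single a \<longrightarrow> s aVal (table s x a) \<le> s aVal (t vBest 0)))"
proof -
  note D = dp_invD[OF I]
  have S0: "0 < S" using ncodes_ge[OF W0] W0 by simp
  have M0: "0 < M" using mM by simp
  have SB: "S \<le> B" "M \<le> B"
  proof -
    have "1 * S \<le> M * S" "M * 1 \<le> M * S" using M0 S0 by (auto simp del: mult_1 mult_1_right intro: mult_le_mono1 mult_le_mono2)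
    then show "S \<le> B" "M \<le> B" using bounds(1) by linarith+
  qed
  have lt: "s aTab j \<le> B" for j
  proof -
    have "(M - 1) * (S * S) \<le> M * (S * S)" by (rule mult_le_mono1) simp
    then show ?thesis using D(4)[of j] D(9) bounds(2) by linarith
  qed
  let ?A = "insert vA (insert vI (writes visit))"
  have inner: "tri B (For vA (V vS) visit) s' (S * (W * (W * 70 + 120) + 270) + 20)
      (\<lambda>t. best_inv s (Suc x * S) (t vBest 0))"
    if ag: "agree ?A s s'" and x: "s' vI 0 = x" "x < M" and J: "best_inv s (x * S) (s' vBest 0)" for s' x
  proof (rule tri_For[where N = S and T = "W * (W * 70 + 120) + 250" and I = "\<lambda>a t. best_inv s (x * S + a) (t vBest 0)"], goal_cases)
    case (5 a s'')
    have "agree ?A s s''" using 5(2) ag unfolding agree_def by auto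
    moreover have "s'' vI 0 = x" using x by (simp add: agreeD[OF 5(2)])
    ultimately have "tri B visit s'' (W * (W * 70 + 120) + 250) (\<lambda>t. best_inv s (Suc (x * S + a)) (t vBest 0))"
      using r D(7) lt SB 5 x by (intro tri_visit) auto
    then show ?case by (rule tri_mono) auto
  next
    case (3 s'')
    then show ?case using agreeD[OF 3] agreeD[OF ag] r by simp
  qed (use SB J in \<open>auto simp: algebra_simps\<close>)
  have final: "(\<exists>x<M. \<exists>a<S. table s x a \<noteq> 0 \<and> single a \<and> best = table s x a) \<and>
    (\<forall>x<M. \<forall>a<S. table s x a \<noteq> 0 \<longrightarrow> single a \<longrightarrow> s aVal (table s x a) \<le> s aVal best)"
    if J: "best_inv s (M * S) best" for best
  proof -
    have max: "\<forall>x<M. \<forall>a<S. table s x a \<noteq> 0 \<longrightarrow> single a \<longrightarrow> s aVal (table s x a) \<le> s aVal best"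
      using J tid_bound unfolding best_inv_def by blast
    \<comment> \<open>The table of node 0 has an entry for the empty forest, which is connected and
      has value at least 1. So the search cannot end with cell 0.\<close>
    have "represents 0 0 (table s 0) (s aVal) (solm s)" using D(1)[OF M0] by simp
    moreover have g: "good W (bag 0) {}" unfolding good_def by (simp add: deg_def)
    ultimately obtain a where a: "a < S" "table s 0 a \<noteq> 0" "has_code W (bag 0) {} a" "Suc (card ({} :: edge set)) \<le> s aVal (table s 0 a)"
      unfolding represents_def by blast
    have "single a" using single_conn[OF g a(3)] unfolding conn_def by simp
    then have "0 < s aVal best" using max M0 a by fastforce
    then have "best \<noteq> 0" using D(7) by (metis less_irrefl)
    then show ?thesis using J max unfolding best_inv_def by blast
  qed
  have main: "tri B (For vI (V vM) (For vA (V vS) visit)) (s(vBest := (s vBest)(0 := 0)))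
     (M * (S * (W * (W * 70 + 120) + 270) + 40) + 20) (\<lambda>t. best_inv s (M * S) (t vBest 0))"
  proof (rule tri_For[where N = M and T = "S * (W * (W * 70 + 120) + 270) + 20" and I = "\<lambda>x t. best_inv s (x * S) (t vBest 0)"], goal_cases)
    case (5 x s')
    have "agree ?A s s'" using 5(2) unfolding agree_def by auto
    from inner[OF this 5(3,1,4)] show ?case by (rule tri_mono) auto
  next
    case 4
    then show ?case unfolding best_inv_def by simp
  qed (use SB r in \<open>auto simp: agreeD algebra_simps\<close>)
  have T: "M * (S * (W * (W * 70 + 120) + 270) + 40) + 20 \<le> M * (S * (W * (W * 70 + 120) + 300)) + 50"
  proof -
    define X where "X = W * (W * 70 + 120)"
    have "40 \<le> S * 30" using ncodes_ge[OF W0] W0 by simp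
    then have "S * (X + 270) + 40 \<le> S * (X + 300)" by (simp add: algebra_simps)
    then have "M * (S * (X + 270) + 40) \<le> M * (S * (X + 300))" by (rule mult_le_mono2)
    then show ?thesis unfolding X_def by linarith
  qed
  show ?thesis
    unfolding find_best_def
    by (rule tri_Write_SeqI[OF _ _ _ _ tri_mono[OF main order_refl]]) (use final T in auto)
qed

end

subsection \<open>Reading off the solution\<close>

definition sweep :: prog where
  "sweep = Seq (Write aMark (V vBest) (Num 1)) (For vI (Sub (V vCnt) (Add (V vm) (Num 2)))
     (Seq (Set vX (Sub (Sub (V vCnt) (Num 1)) (V vI)))
       (Cond (Read aMark (V vX)) (Seq (Write aMark (Read aLeft (V vX)) (Num 1)) (Write aMark (Read aRight (V vX)) (Num 1))) Skip)))"

lemma writes_sweep: "writes sweep = {aMark, vI, vX}"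
  unfolding sweep_def by auto

text \<open>Cells refer to smaller cells only, so one downward sweep reaches all parts of the best cell.\<close>

lemma tri_sweep:
  assumes r: "s vBest 0 = best" "s vCnt 0 = cnt" "s vm 0 = m" and zero: "\<And>j. s aMark j = 0"
    and best: "best < cnt" and cnt: "m + 2 \<le> cnt" "cnt \<le> B"
    and wf: "\<And>c. m + 2 \<le> c \<Longrightarrow> c < cnt \<Longrightarrow> s aLeft c < c \<and> s aRight c < c"
  shows "tri B sweep s (cnt * 50 + 50) (\<lambda>t. \<forall>k<m. t aMark (k + 2) \<noteq> 0 \<longleftrightarrow> k \<in> sol m (s aLeft) (s aRight) best)"
proof -
  let ?sol = "sol m (s aLeft) (s aRight)"
  let ?I = "\<lambda>i t. ?sol best = (\<Union>c\<in>{c. c < cnt - i \<and> t aMark c \<noteq> 0}. ?sol c)"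
  have main: "tri B (For vI (Sub (V vCnt) (Add (V vm) (Num 2)))
     (Seq (Set vX (Sub (Sub (V vCnt) (Num 1)) (V vI)))
       (Cond (Read aMark (V vX)) (Seq (Write aMark (Read aLeft (V vX)) (Num 1)) (Write aMark (Read aRight (V vX)) (Num 1))) Skip)))
       (s(aMark := (s aMark)(best := 1))) (cnt * 50 + 30)
       (\<lambda>t. \<forall>k<m. t aMark (k + 2) \<noteq> 0 \<longleftrightarrow> k \<in> sol m (s aLeft) (s aRight) best)"
  proof (rule tri_For[where N = "cnt - (m + 2)" and T = 30 and I = ?I], goal_cases)
    case (5 i t)
    note f = agreeD[OF 5(2)]
    define c where "c = cnt - 1 - i"
    have c: "m + 2 \<le> c" "c < cnt" "cnt - i = Suc c" "cnt - Suc i = c" using 5(1) unfolding c_def by auto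
    have lr: "s aLeft c < c" "s aRight c < c" using wf[OF c(1,2)] by auto
    have sc: "?sol c = ?sol (s aLeft c) \<union> ?sol (s aRight c)" using c(1) lr by (subst sol.simps) auto
    have regs: "t vCnt 0 = cnt" "t aLeft = s aLeft" "t aRight = s aRight" using r by (simp_all add: f)
    let ?m = "(t aMark)(s aLeft c := 1, s aRight c := 1)"
    have "?sol best = (\<Union>x\<in>{x. x < c \<and> ?m x \<noteq> 0}. ?sol x)" if "t aMark c \<noteq> 0"
    proof -
      have "{x. x < Suc c \<and> t aMark x \<noteq> 0} = insert c {x. x < c \<and> t aMark x \<noteq> 0}" using that by auto
      then have "?sol best = ?sol c \<union> (\<Union>x\<in>{x. x < c \<and> t aMark x \<noteq> 0}. ?sol x)" using 5(4) c(3) by simp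
      moreover have "{x. x < c \<and> ?m x \<noteq> 0} = {s aLeft c, s aRight c} \<union> {x. x < c \<and> t aMark x \<noteq> 0}"
        using lr by auto
      ultimately show ?thesis unfolding sc by auto
    qed
    moreover have "?sol best = (\<Union>x\<in>{x. x < c \<and> t aMark x \<noteq> 0}. ?sol x)" if "t aMark c = 0"
    proof -
      have "{x. x < Suc c \<and> t aMark x \<noteq> 0} = {x. x < c \<and> t aMark x \<noteq> 0}" using that by (auto simp: less_Suc_eq)
      then show ?thesis using 5(4) c(3) by simp
    qed
    moreover have "c \<le> B" "s aLeft c \<le> B" "s aRight c \<le> B" using c lr cnt by auto
    ultimately show ?case
      using 5(3) cnt by (simp add: regs c(4) c_def[unfolded One_nat_def, symmetric])
  next
    case 4
    have "{c. c < cnt - 0 \<and> (s(aMark := (s aMark)(best := 1), vI := (s vI)(0 := 0))) aMark c \<noteq> 0} = {best}"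
      using zero best by auto
    then show ?case by simp
  next
    case (6 t)
    have "cnt - (cnt - (m + 2)) = m + 2" using cnt by simp
    then have eq: "?sol best = (\<Union>c\<in>{c. c < m + 2 \<and> t aMark c \<noteq> 0}. ?sol c)" using 6(3) by simp
    have s: "?sol c = (if c < 2 then {} else {c - 2})" if "c < m + 2" for c using that by (subst sol.simps) auto
    show ?case
    proof (intro allI impI)
      fix k assume k: "k < m"
      show "t aMark (k + 2) \<noteq> 0 \<longleftrightarrow> k \<in> ?sol best"
      proof
        assume "t aMark (k + 2) \<noteq> 0"
        then show "k \<in> ?sol best" unfolding eq using k s[of "k + 2"] by (intro UN_I[of "k + 2"]) auto
      next
        assume "k \<in> ?sol best"
        then obtain c where c: "c < m + 2" "t aMark c \<noteq> 0" "k \<in> ?sol c" unfolding eq by blast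
        then have "c = k + 2" using s[OF c(1)] by (auto split: if_splits)
        then show "t aMark (k + 2) \<noteq> 0" using c by simp
      qed
    qed
  next
    case 7
    have "(cnt - (m + 2)) * 50 \<le> cnt * 50" by (rule mult_le_mono1) simp
    then show ?case by simp
  qed (use r cnt in \<open>auto simp: agreeD\<close>)
  show ?thesis
    unfolding sweep_def
    by (rule tri_Write_SeqI[OF _ _ _ _ main]) (use r best cnt in auto)
qed

subsection \<open>Writing the output\<close>

text \<open>A best value of 1 means that there is no edge; vertex 0 is then marked as the whole
  tree.\<close>

definition mark_ends :: prog where
  "mark_ends = Seq (For vI (V vm) (Cond (Read aMark (Add (V vI) (Num 2)))
       (Seq (Write aVm (Read aIn (Add (Num 2) (Mul (Num 2) (V vI)))) (Num 1))
            (Write aVm (Read aIn (Add (Num 3) (Mul (Num 2) (V vI)))) (Num 1))) Skip))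
     (Cond (Eq (Read aVal (V vBest)) (Num 1)) (Write aVm (Num 0) (Num 1)) Skip)"

lemma writes_mark_ends: "writes mark_ends = {aVm, vI}"
  unfolding mark_ends_def by auto

lemma tri_mark_ends:
  assumes m: "s vm 0 = m" "m = length es" "m \<le> B" "1 \<le> B"
    and edges: "\<And>k. k < m \<Longrightarrow> s aIn (2 + 2 * k) = fst (es ! k) \<and> s aIn (3 + 2 * k) = snd (es ! k) \<and>
      fst (es ! k) \<le> B \<and> snd (es ! k) \<le> B"
    and mark: "\<And>k. k < m \<Longrightarrow> s aMark (k + 2) \<noteq> 0 \<longleftrightarrow> k \<in> K" and K: "K \<subseteq> {..<m}"
    and val: "s aVal (s vBest 0) = 1 \<longleftrightarrow> K = {}" and zero: "\<And>u. s aVm u = 0"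
  shows "tri B mark_ends s (m * 60 + 60)
    (\<lambda>t. \<forall>u. t aVm u \<noteq> 0 \<longleftrightarrow> u \<in> (if K = {} then {0} else ends (edge_at es ` K)))"
  unfolding mark_ends_def
proof (rule tri_SeqI[where ?T1.0 = "m * 60 + 20" and ?T2.0 = 40 and
      R = "\<lambda>t. \<forall>u. t aVm u \<noteq> 0 \<longleftrightarrow> u \<in> ends (edge_at es ` K)"], goal_cases)
  case 1
  show ?case
  proof (rule tri_For[where N = m and T = 45 and
        I = "\<lambda>i t. \<forall>u. t aVm u \<noteq> 0 \<longleftrightarrow> u \<in> ends (edge_at es ` (K \<inter> {..<i}))"], goal_cases)
    case (5 i t)
    note f = agreeD[OF 5(2)]
    have t: "t aMark = s aMark" "t aIn = s aIn" by (simp_all add: f)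
    show ?case
    proof (cases "i \<in> K")
      case True
      then have "K \<inter> {..<Suc i} = insert i (K \<inter> {..<i})" by auto
      then have e: "ends (edge_at es ` (K \<inter> {..<Suc i})) = {fst (es ! i), snd (es ! i)} \<union> ends (edge_at es ` (K \<inter> {..<i}))"
        by (simp add: ends_insert)
      show ?thesis using 5(3,4) mark[OF 5(1)] edges[OF 5(1)] True m(4) unfolding e by (auto simp: t)
    next
      case False
      then have e: "K \<inter> {..<Suc i} = K \<inter> {..<i}" by (auto simp: less_Suc_eq)
      show ?thesis using 5(3,4) mark[OF 5(1)] False unfolding e by (simp add: t)
    qed
  next
    case (6 t)
    have "K \<inter> {..<m} = K" using K by blast
    then show ?case using 6(3) by simp
  qed (use m zero in \<open>auto simp: agreeD ends_def\<close>)
next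
  case (2 t)
  note f = agreeD[OF 2(1)]
  have "t aVal (t vBest 0) = s aVal (s vBest 0)" by (simp add: f)
  then show ?case using 2(2) val m(4) by (auto simp: ends_def)
qed simp

definition flat :: "(nat \<times> nat) list \<Rightarrow> nat list" where
  "flat fs = concat (map (\<lambda>(u, v). [u, v]) fs)"

lemma length_flat [simp]: "length (flat fs) = 2 * length fs"
  unfolding flat_def by (induction fs) auto

lemma nth_flat: "j < length fs \<Longrightarrow> flat fs ! (2 * j) = fst (fs ! j) \<and> flat fs ! Suc (2 * j) = snd (fs ! j)"
proof (induction fs arbitrary: j)
  case (Cons p fs)
  have c: "flat (p # fs) = fst p # snd p # flat fs" unfolding flat_def by (cases p) simp
  show ?case
  proof (cases j)
    case 0
    then show ?thesis unfolding c by simp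
  next
    case (Suc i)
    then show ?thesis using Cons unfolding c by simp
  qed
qed simp

lemma has_output_graph:
  assumes v: "s aOut 0 = length vs" "\<And>j. j < length vs \<Longrightarrow> s aOut (Suc j) = vs ! j"
    and e: "s aOut (Suc (length vs)) = length fs"
      "\<And>j. j < length fs \<Longrightarrow> s aOut (2 + length vs + 2 * j) = fst (fs ! j) \<and> s aOut (3 + length vs + 2 * j) = snd (fs ! j)"
  shows "has_output s (encode_graph vs fs)"
  unfolding has_output_def
proof (intro allI impI)
  fix i assume i: "i < length (encode_graph vs fs)"
  have enc: "encode_graph vs fs = length vs # vs @ length fs # flat fs"
    unfolding encode_graph_def encode_list_def encode_edges_def flat_def by simp
  consider "i = 0" | j where "i = Suc j" "j < length vs" | "i = Suc (length vs)"
    | j where "i = 2 + length vs + 2 * j" "j < length fs" | j where "i = 3 + length vs + 2 * j" "j < length fs"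
  proof -
    have "i = 0 \<or> (\<exists>j. i = Suc j \<and> j < length vs) \<or> i = Suc (length vs) \<or>
      (\<exists>r. i = 2 + length vs + r \<and> r < 2 * length fs)"
      using i unfolding enc by (cases i) (auto simp: less_iff_Suc_add not_less le_iff_add intro: exI[of _ "i - 2 - length vs"], presburger)
    moreover have "(\<exists>j<length fs. r = 2 * j) \<or> (\<exists>j<length fs. r = Suc (2 * j))" if "r < 2 * length fs" for r
      using that by presburger
    ultimately show ?thesis using that by (auto; metis add.assoc add_Suc_right)
  qed
  then show "s aOut i = encode_graph vs fs ! i"
  proof cases
    case (4 j)
    then show ?thesis using e(2)[of j] nth_flat[of j fs] unfolding enc by (simp add: nth_append)
  next
    case (5 j)
    then show ?thesis using e(2)[of j] nth_flat[of j fs] unfolding enc by (simp add: nth_append numeral_3_eq_3)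
  qed (use v e(1) in \<open>auto simp: enc nth_append\<close>)
qed

text \<open>Cell 0 of the output is filled last, since the number of vertices is known only after
  the loop.\<close>

definition write_verts :: prog where
  "write_verts = Seq (Set vU (Num 0)) (Seq (For vI (V vn) (Cond (Read aVm (V vI))
       (Seq (Write aOut (Add (V vU) (Num 1)) (V vI)) (Set vU (Add (V vU) (Num 1)))) Skip))
     (Write aOut (Num 0) (V vU)))"

definition write_edges :: prog where
  "write_edges = Seq (Set vV (Num 0)) (Seq (For vI (V vm) (Cond (Read aMark (Add (V vI) (Num 2)))
       (Seq (Write aOut (Add (Num 2) (Add (V vU) (Mul (Num 2) (V vV)))) (Read aIn (Add (Num 2) (Mul (Num 2) (V vI)))))
       (Seq (Write aOut (Add (Num 3) (Add (V vU) (Mul (Num 2) (V vV)))) (Read aIn (Add (Num 3) (Mul (Num 2) (V vI)))))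
            (Set vV (Add (V vV) (Num 1))))) Skip))
     (Write aOut (Add (V vU) (Num 1)) (V vV)))"

lemma writes_write_verts: "writes write_verts = {vU, vI, aOut}"
  unfolding write_verts_def by auto

lemma tri_write_verts:
  assumes n: "s vn 0 = n" "n + 1 \<le> B"
  defines "vs \<equiv> filter (\<lambda>u. s aVm u \<noteq> 0) [0..<n]"
  shows "tri B write_verts s (n * 60 + 50) (\<lambda>t. t vU 0 = length vs \<and> t aOut 0 = length vs \<and>
    (\<forall>j<length vs. t aOut (Suc j) = vs ! j))"
proof -
  let ?vs = "\<lambda>i. filter (\<lambda>u. s aVm u \<noteq> 0) [0..<i]"
  have len: "length (?vs i) \<le> i" for i using length_filter_le[of _ "[0..<i]"] by simp
  have main: "tri B (Seq (For vI (V vn) (Cond (Read aVm (V vI))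
       (Seq (Write aOut (Add (V vU) (Num 1)) (V vI)) (Set vU (Add (V vU) (Num 1)))) Skip))
     (Write aOut (Num 0) (V vU))) (s(vU := (s vU)(0 := 0))) (n * 60 + 40) (\<lambda>t. t vU 0 = length vs \<and> t aOut 0 = length vs \<and>
    (\<forall>j<length vs. t aOut (Suc j) = vs ! j))"
  proof (rule tri_SeqI[where ?T1.0 = "n * 60 + 20" and ?T2.0 = 10 and
        R = "\<lambda>t. t vU 0 = length vs \<and> (\<forall>j<length vs. t aOut (Suc j) = vs ! j)"], goal_cases)
    case 1
    show ?case
    proof (rule tri_For[where N = n and T = 40 and
        I = "\<lambda>i t. t vU 0 = length (?vs i) \<and> (\<forall>j<length (?vs i). t aOut (Suc j) = ?vs i ! j)"], goal_cases)
      case (5 i t)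
      have "t aVm = s aVm" by (simp add: agreeD[OF 5(2)])
      then show ?case using 5(1,3,4) len[of i] n by (auto simp: nth_append less_Suc_eq)
    qed (use n in \<open>auto simp: agreeD vs_def\<close>)
  next
    case (2 t)
    have "length vs \<le> n" unfolding vs_def by (rule len)
    then show ?case using 2(2) n by simp
  qed simp
  show ?thesis unfolding write_verts_def by (rule tri_Write_SeqI[OF _ _ _ _ main]) auto
qed

lemma tri_write_edges:
  assumes m: "s vm 0 = m" and B: "4 + s vU 0 + 2 * m \<le> B"
    and edges: "\<And>k. k < m \<Longrightarrow> s aIn (2 + 2 * k) = fst (es ! k) \<and> s aIn (3 + 2 * k) = snd (es ! k) \<and>
      fst (es ! k) \<le> B \<and> snd (es ! k) \<le> B"
  defines "ks \<equiv> filter (\<lambda>k. s aMark (k + 2) \<noteq> 0) [0..<m]"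
  shows "tri B write_edges s (m * 100 + 50) (\<lambda>t. t aOut (Suc (s vU 0)) = length ks \<and> (\<forall>j\<le>s vU 0. t aOut j = s aOut j) \<and>
    (\<forall>j<length ks. t aOut (2 + s vU 0 + 2 * j) = fst (es ! (ks ! j)) \<and> t aOut (3 + s vU 0 + 2 * j) = snd (es ! (ks ! j))))"
proof -
  let ?ks = "\<lambda>i. filter (\<lambda>k. s aMark (k + 2) \<noteq> 0) [0..<i]"
  define U where "U = s vU 0"
  have len: "length (?ks i) \<le> i" for i using length_filter_le[of _ "[0..<i]"] by simp
  let ?I = "\<lambda>i t. t vV 0 = length (?ks i) \<and> (\<forall>j\<le>U. t aOut j = s aOut j) \<and>
    (\<forall>j<length (?ks i). t aOut (2 + U + 2 * j) = fst (es ! (?ks i ! j)) \<and> t aOut (3 + U + 2 * j) = snd (es ! (?ks i ! j)))"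
  define J where "J = ?I"
  have main: "tri B (Seq (For vI (V vm) (Cond (Read aMark (Add (V vI) (Num 2)))
       (Seq (Write aOut (Add (Num 2) (Add (V vU) (Mul (Num 2) (V vV)))) (Read aIn (Add (Num 2) (Mul (Num 2) (V vI)))))
       (Seq (Write aOut (Add (Num 3) (Add (V vU) (Mul (Num 2) (V vV)))) (Read aIn (Add (Num 3) (Mul (Num 2) (V vI)))))
            (Set vV (Add (V vV) (Num 1))))) Skip))
     (Write aOut (Add (V vU) (Num 1)) (V vV))) (s(vV := (s vV)(0 := 0))) (m * 100 + 40)
     (\<lambda>t. t aOut (Suc U) = length ks \<and> (\<forall>j\<le>U. t aOut j = s aOut j) \<and>
    (\<forall>j<length ks. t aOut (2 + U + 2 * j) = fst (es ! (ks ! j)) \<and> t aOut (3 + U + 2 * j) = snd (es ! (ks ! j))))"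
  proof (rule tri_SeqI[where ?T1.0 = "m * 100 + 20" and ?T2.0 = 20 and R = "?I m"], goal_cases)
    case 1
    show ?case
    proof (rule tri_For[where N = m and T = 80 and I = J], goal_cases)
      case (5 i t)
      have t: "t aMark = s aMark" "t aIn = s aIn" "t vU 0 = U" by (simp_all add: agreeD[OF 5(2)] U_def)
      show ?case
      proof (cases "s aMark (i + 2) = 0")
        case True
        then show ?thesis using 5(3,4) by (simp add: t J_def)
      next
        case False
        define l where "l = length (?ks i)"
        have l: "l \<le> i" "t vV 0 = l" using len[of i] 5(4) unfolding l_def J_def by auto
        have ks: "?ks (Suc i) = ?ks i @ [i]" "length (?ks (Suc i)) = Suc l" using False unfolding l_def by auto
        have nth: "(?ks i @ [i]) ! j = (if j < l then ?ks i ! j else i)" if "j < Suc l" for j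
          using that unfolding l_def by (auto simp: nth_append less_Suc_eq)
        have old: "\<forall>j\<le>U. t aOut j = s aOut j"
          "\<And>j. j < l \<Longrightarrow> t aOut (2 + U + 2 * j) = fst (es ! (?ks i ! j)) \<and> t aOut (3 + U + 2 * j) = snd (es ! (?ks i ! j))"
          using 5(4) unfolding l_def J_def by auto
        have bd: "3 + (U + 2 * l) \<le> B" "Suc l \<le> B" using l 5(1) B unfolding U_def by auto
        note ed = edges[OF 5(1)]
        have post: "J (Suc i) (t(aOut := (t aOut)(2 + (U + 2 * l) := fst (es ! i), 3 + (U + 2 * l) := snd (es ! i)),
          vV := (t vV)(0 := Suc l), vI := (t vI)(0 := Suc i)))"
          unfolding J_def ks(2) unfolding ks(1)
          using old nth by (auto simp: less_Suc_eq)
        show ?thesis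
          using 5(3) False bd ed l(2) post by (simp add: t)
      qed
    qed (use m B in \<open>auto simp: agreeD J_def\<close>)
  next
    case (2 t)
    have "length ks \<le> m" unfolding ks_def by (rule len)
    moreover have "t vU 0 = U" by (simp add: agreeD[OF 2(1)] U_def)
    ultimately show ?case using 2(2) B unfolding ks_def[symmetric] U_def[symmetric] by auto
  qed simp
  show ?thesis unfolding write_edges_def U_def[symmetric] by (rule tri_Write_SeqI[OF _ _ _ _ main]) auto
qed

subsection \<open>Reading the input\<close>

lemma nth_concat_encode:
  assumes "j < length bs" "p \<le> length (bs ! j)"
  shows "(\<Sum>i<j. Suc (length (bs ! i))) + p < length (concat (map encode_list bs)) \<and>
    concat (map encode_list bs) ! ((\<Sum>i<j. Suc (length (bs ! i))) + p) = encode_list (bs ! j) ! p"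
  using assms
proof (induction bs arbitrary: j)
  case (Cons b bs)
  show ?case
  proof (cases j)
    case 0
    then show ?thesis using Cons.prems by (cases p) (auto simp: encode_list_def nth_append)
  next
    case (Suc i)
    have "(\<Sum>k<Suc i. Suc (length ((b # bs) ! k))) = Suc (length b) + (\<Sum>k<i. Suc (length (bs ! k)))"
      by (simp add: sum.lessThan_Suc_shift del: sum.lessThan_Suc)
    then show ?thesis using Cons.IH[of i] Cons.prems Suc by (simp add: encode_list_def nth_append)
  qed
qed simp

lemma max_insert_0: "finite A \<Longrightarrow> Max (insert 0 (insert x A)) = max x (Max (insert (0 :: nat) A))"
  by (subst insert_commute) (simp add: Max_insert)

section \<open>Programs that read the input and order the nodes\<close>

definition read_header :: prog where
  "read_header = Seq (Set vn (Read aIn (Num 0))) (Seq (Set vm (Read aIn (Num 1)))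
     (Seq (Set vN (Read aIn (Add (Num 2) (Mul (Num 2) (V vm)))))
     (Seq (Set vq (Read aIn (Add (Num 3) (Mul (Num 2) (V vm)))))
          (Set vPtr (Add (Num 4) (Add (Mul (Num 2) (V vm)) (Mul (Num 2) (V vq))))))))"

text \<open>The width is not part of the input, so the largest bag size is computed along with the
  start addresses of the bags.\<close>

definition scan_bags :: prog where
  "scan_bags = For vI (V vN) (Seq (Write aStart (V vI) (V vPtr))
     (Seq (Cond (Sub (Read aIn (V vPtr)) (V vW)) (Set vW (Read aIn (V vPtr))) (Set vW (V vW)))
          (Set vPtr (Add (V vPtr) (Add (Read aIn (V vPtr)) (Num 1))))))"

text \<open>Instead of adjacency lists, only the number of remaining neighbours and their sum modulo \<open>N\<close> are
  stored; when one neighbour is left, the sum is the parent.\<close>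

definition count_nbrs :: prog where
  "count_nbrs = For vI (V vq)
     (Seq (Set vU (Read aIn (Add (Num 4) (Add (Mul (Num 2) (V vm)) (Mul (Num 2) (V vI))))))
     (Seq (Set vV (Read aIn (Add (Num 5) (Add (Mul (Num 2) (V vm)) (Mul (Num 2) (V vI))))))
     (Seq (Write aDeg (V vU) (Add (Read aDeg (V vU)) (Num 1)))
     (Seq (Write aDeg (V vV) (Add (Read aDeg (V vV)) (Num 1)))
     (Seq (Write aNb (V vU) (Mod (Add (Read aNb (V vU)) (V vV)) (V vN)))
          (Write aNb (V vV) (Mod (Add (Read aNb (V vV)) (V vU)) (V vN))))))))"

text \<open>The test is positive for degrees 0 and 1; degree 0 occurs if the decomposition has a
  single node.\<close>

definition find_leaves :: prog where
  "find_leaves = For vI (V vN) (Cond (Sub (Num 2) (Read aDeg (V vI)))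
     (Seq (Write aOrd (V vTail) (V vI)) (Set vTail (Add (V vTail) (Num 1)))) Skip)"

definition strip_leaves :: prog where
  "strip_leaves = For vI (Sub (V vN) (Num 1))
     (Seq (Set vU (Read aOrd (V vI))) (Seq (Set vV (Read aNb (V vU)))
     (Seq (Write aPrn (V vU) (V vV))
     (Seq (Write aDeg (V vV) (Sub (Read aDeg (V vV)) (Num 1)))
     (Seq (Write aNb (V vV) (Mod (Add (Read aNb (V vV)) (Sub (V vN) (V vU))) (V vN)))
          (Cond (Eq (Read aDeg (V vV)) (Num 1))
            (Seq (Write aOrd (V vTail) (V vV)) (Set vTail (Add (V vTail) (Num 1)))) Skip))))))"

definition positions :: prog where
  "positions = For vI (V vN) (Write aPos (Read aOrd (V vI)) (V vI))"

definition copy_bag :: prog where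
  "copy_bag = For vP (V vW) (Cond (Sub (V vX) (V vP))
     (Write aBag (Add (Mul (V vY) (V vW)) (V vP)) (Read aIn (Add (V vPtr) (V vP))))
     (Write aBag (Add (Mul (V vY) (V vW)) (V vP)) (Add (V vn) (V vP))))"

text \<open>Nodes are visited in removal order and later ones overwrite \<open>aTop\<close>, so it
  ends up with the last bag of every vertex.\<close>

definition tree_nodes :: prog where
  "tree_nodes = For vI (V vN)
     (Seq (Set vU (Read aOrd (V vI))) (Seq (Set vX (Read aIn (Read aStart (V vU))))
     (Seq (Set vPtr (Add (Read aStart (V vU)) (Num 1))) (Seq (Set vY (Add (V vm) (V vI)))
     (Seq copy_bag
     (Seq (For vP (V vX) (Write aTop (Read aIn (Add (V vPtr) (V vP))) (V vI)))
          (Write aPar (V vY) (Add (V vm) (Read aPos (Read aPrn (V vU)))))))))))"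

text \<open>An edge is treated as a bag of size 2 that is read directly from the edge list. The
  parent is found from \<open>aTop\<close>, so the tree nodes must be complete.\<close>

definition edge_nodes :: prog where
  "edge_nodes = For vI (V vm)
     (Seq (Set vX (Num 2)) (Seq (Set vPtr (Add (Num 2) (Mul (Num 2) (V vI)))) (Seq (Set vY (V vI))
     (Seq copy_bag
     (Seq (Set vU (Read aTop (Read aIn (V vPtr)))) (Seq (Set vV (Read aTop (Read aIn (Add (V vPtr) (Num 1)))))
          (Write aPar (V vY) (Add (V vm) (Sub (V vU) (Sub (V vU) (V vV)))))))))))"

lemma writes_input [simp]:
  "writes read_header = {vn, vm, vN, vq, vPtr}" "writes scan_bags = {vI, aStart, vW, vPtr}"
  "writes count_nbrs = {vI, vU, vV, aDeg, aNb}" "writes find_leaves = {vI, aOrd, vTail}"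
  "writes strip_leaves = {vI, vU, vV, aPrn, aDeg, aNb, aOrd, vTail}" "writes positions = {vI, aPos}"
  "writes copy_bag = {vP, aBag}" "writes tree_nodes = {vI, vU, vX, vPtr, vY, vP, aBag, aTop, aPar}"
  "writes edge_nodes = {vI, vX, vPtr, vY, vP, aBag, vU, vV, aPar}"
  unfolding read_header_def scan_bags_def count_nbrs_def find_leaves_def strip_leaves_def positions_def
  by (auto simp: copy_bag_def tree_nodes_def edge_nodes_def)

section \<open>Correctness of the reading phase within the word bound\<close>

locale bounded_decomposition = decomposition +
  fixes B :: nat
  assumes big: "10 * ((n + m + N + 1) * (W + 1)) \<le> B"
begin

lemma bound_lemmas: "n + W + 10 \<le> B" "4 + 2 * m + 2 * q + N * (W + 1) \<le> B" "(m + N) * W + W \<le> B" "N + m + 4 \<le> B"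
proof -
  define a b c where "a = n * W" and "b = m * W" and "c = N * W"
  have "(n + m + N + 1) * (W + 1) = a + b + c + W + n + m + N + 1"
    unfolding a_def b_def c_def by (simp add: algebra_simps)
  then have big': "10 * (a + b + c + W + n + m + N + 1) \<le> B" using big by metis
  have e: "(m + N) * W = b + c" "N * (W + 1) = c + N" unfolding b_def c_def by (simp_all add: algebra_simps)
  have q: "q \<le> N" using q_eq by linarith
  show "n + W + 10 \<le> B" using big' by simp
  show "4 + 2 * m + 2 * q + N * (W + 1) \<le> B" unfolding e using big' q by simp
  show "(m + N) * W + W \<le> B" unfolding e using big' by simp
  show "N + m + 4 \<le> B" using big' by simp
qed

definition start :: "nat \<Rightarrow> nat" where
  "start j = 4 + 2 * m + 2 * q + (\<Sum>i<j. Suc (length (bs ! i)))"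

definition inp :: "memory \<Rightarrow> bool" where
  "inp s \<longleftrightarrow> s aIn = input_memory (encode_input n es ts bs) 0"

lemma enc: "encode_input n es ts bs = n # m # flat es @ N # q # flat ts @ concat (map encode_list bs)"
  unfolding encode_input_def encode_edges_def flat_def by simp

lemma inp_header:
  assumes "inp s"
  shows "s aIn 0 = n" "s aIn 1 = m" "s aIn (2 + 2 * m) = N" "s aIn (3 + 2 * m) = q"
  using assms unfolding inp_def input_memory_def enc by (auto simp: nth_append numeral_3_eq_3)

lemma inp_edge:
  assumes "inp s" "k < m"
  shows "s aIn (2 + 2 * k) = fst (es ! k)" "s aIn (3 + 2 * k) = snd (es ! k)"
  using assms nth_flat[OF assms(2)] unfolding inp_def input_memory_def enc
  by (auto simp: nth_append numeral_3_eq_3)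

lemma inp_tree:
  assumes "inp s" "k < q"
  shows "s aIn (4 + (2 * m + 2 * k)) = fst (ts ! k)" "s aIn (5 + (2 * m + 2 * k)) = snd (ts ! k)"
proof -
  have "(n # m # flat es @ N # q # flat ts @ concat (map encode_list bs)) ! (4 + (2 * m + r)) = flat ts ! r" if "r < 2 * q" for r
    using that by (simp add: nth_append numeral_eq_Suc)
  from this[of "2 * k"] this[of "Suc (2 * k)"] assms nth_flat[OF assms(2)]
  show "s aIn (4 + (2 * m + 2 * k)) = fst (ts ! k)" "s aIn (5 + (2 * m + 2 * k)) = snd (ts ! k)"
    unfolding inp_def input_memory_def enc by (auto simp: numeral_eq_Suc)
qed

lemma inp_bag:
  assumes "inp s" "j < N"
  shows "s aIn (start j) = length (bs ! j)" "p < length (bs ! j) \<Longrightarrow> s aIn (start j + 1 + p) = bs ! j ! p"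
proof -
  have *: "s aIn (start j + p) = encode_list (bs ! j) ! p" if "p \<le> length (bs ! j)" for p
  proof -
    let ?o = "(\<Sum>i<j. Suc (length (bs ! i))) + p"
    have "(n # m # flat es @ N # q # flat ts @ concat (map encode_list bs)) ! (4 + (2 * m + (2 * q + r))) = concat (map encode_list bs) ! r" for r
      by (simp add: nth_append numeral_eq_Suc)
    from this[of ?o] nth_concat_encode[OF assms(2) that] show ?thesis
      using assms(1) unfolding inp_def input_memory_def enc start_def by (simp add: add.assoc)
  qed
  show "s aIn (start j) = length (bs ! j)" using *[of 0] by (simp add: encode_list_def)
  show "p < length (bs ! j) \<Longrightarrow> s aIn (start j + 1 + p) = bs ! j ! p"
    using *[of "Suc p"] by (simp add: encode_list_def)
qed

lemma start_le: "j \<le> N \<Longrightarrow> start j \<le> B"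
proof -
  assume j: "j \<le> N"
  have "(\<Sum>i<j. Suc (length (bs ! i))) \<le> (\<Sum>i<j. W + 1)"
    using bag_size j by (intro sum_mono) auto
  also have "\<dots> = j * (W + 1)" by simp
  also have "\<dots> \<le> N * (W + 1)" using j by (rule mult_le_mono1)
  finally show ?thesis using bound_lemmas(2) unfolding start_def by linarith
qed

lemma tri_read_header:
  assumes "inp s"
  shows "tri B read_header s 80 (\<lambda>t. t vn 0 = n \<and> t vm 0 = m \<and> t vN 0 = N \<and> t vq 0 = q \<and> t vPtr 0 = start 0)"
proof -
  have "n \<le> B" "m \<le> B" "N \<le> B" "q \<le> B" "start 0 \<le> B" using bound_lemmas start_le[of 0] q_eq by auto
  then show ?thesis
    unfolding read_header_def using inp_header[OF assms] by (simp add: start_def)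
qed

lemma tri_scan_bags:
  assumes inp: "inp s" and r: "s vN 0 = N" "s vPtr 0 = start 0" "s vW 0 = 0"
  shows "tri B scan_bags s (N * 80 + 20) (\<lambda>t. (\<forall>j<N. t aStart j = start j) \<and> t vW 0 = W)"
  unfolding scan_bags_def
proof (rule tri_For[where N = N and T = 50 and I = "\<lambda>i t. (\<forall>j<i. t aStart j = start j) \<and> t vPtr 0 = start i \<and>
      t vW 0 = Max (insert 0 ((\<lambda>j. length (bs ! j)) ` {..<i}))"], goal_cases)
  case (5 i t)
  have t: "t aIn (start i) = length (bs ! i)"
    using inp_bag(1)[OF inp 5(1)] by (simp add: agreeD[OF 5(2)])
  have st: "start (Suc i) = start i + (length (bs ! i) + 1)" unfolding start_def by simp
  have b: "start i \<le> B" "start (Suc i) \<le> B" "i \<le> B" "length (bs ! i) \<le> B" "Max (insert 0 ((\<lambda>j. length (bs ! j)) ` {..<i})) \<le> B"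
  proof -
    show "start i \<le> B" "start (Suc i) \<le> B" using start_le 5(1) by auto
    show "i \<le> B" using 5(1) bound_lemmas(4) by simp
    have l: "length (bs ! j) \<le> B" if "j < N" for j using bag_size[OF that] bound_lemmas(1) by simp
    show "length (bs ! i) \<le> B" by (rule l[OF 5(1)])
    show "Max (insert 0 ((\<lambda>j. length (bs ! j)) ` {..<i})) \<le> B"
      using l 5(1) by (subst Max_le_iff) auto
  qed
  define X where "X = Max (insert 0 ((\<lambda>j. length (bs ! j)) ` {..<i}))"
  have X: "Max (insert 0 ((\<lambda>j. length (bs ! j)) ` {..<Suc i})) = max (length (bs ! i)) X"
    unfolding X_def lessThan_Suc image_insert by (rule max_insert_0) simp
  have main: "tri B (Seq (Cond (Sub (Read aIn (V vPtr)) (V vW)) (Set vW (Read aIn (V vPtr))) (Set vW (V vW)))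
          (Set vPtr (Add (V vPtr) (Add (Read aIn (V vPtr)) (Num 1)))))
      (t(aStart := (t aStart)(i := start i))) 40
      (\<lambda>s''. (\<forall>j<Suc i. s'' aStart j = start j) \<and> s'' vPtr 0 = start (Suc i) \<and> s'' vW 0 = max (length (bs ! i)) X)"
    apply (rule tri_SeqI[where ?T1.0 = 20 and ?T2.0 = 20 and
      R = "\<lambda>u. u = t(aStart := (t aStart)(i := start i), vW := (t vW)(0 := max (length (bs ! i)) X))"])
    using 5(3,4) t b st unfolding X_def[symmetric] by (auto simp: less_Suc_eq max_def)
  show ?case
    unfolding X by (rule tri_Write_SeqI[OF _ _ _ _ tri_mono[OF main order_refl]]) (use 5(3,4) b in auto)
next
  case (6 t)
  have "{..<N} \<noteq> {}" using N_pos by auto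
  then have "Max (insert 0 ((\<lambda>j. length (bs ! j)) ` {..<N})) = W"
    using Max_bag by (subst Max_insert) auto
  then show ?case using 6(3) by simp
qed (use r bound_lemmas in \<open>auto simp: agreeD\<close>)

lemma tri_count_nbrs:
  assumes inp: "inp s" and r: "s vN 0 = N" "s vq 0 = q" "s vm 0 = m"
    and zero: "\<And>j. s aDeg j = 0" "\<And>j. s aNb j = 0"
  shows "tri B count_nbrs s (N * 150 + 20)
    (\<lambda>t. \<forall>j. t aDeg j = card (nbrs TE j) \<and> t aNb j = \<Sum>(nbrs TE j) mod N)"
  unfolding count_nbrs_def
proof (rule tri_For[where N = q and T = 130 and I = "\<lambda>i t. \<forall>j. t aDeg j = card (nbrs (edge_at ts ` {..<i}) j) \<and>
      t aNb j = \<Sum>(nbrs (edge_at ts ` {..<i}) j) mod N"], goal_cases)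
  case (5 i t)
  note f = agreeD[OF 5(2)]
  define u v where "u = fst (ts ! i)" and "v = snd (ts ! i)"
  let ?F = "edge_at ts ` {..<i}"
  have F: "edge_at ts ` {..<Suc i} = insert (edge_at ts i) ?F" unfolding lessThan_Suc by simp
  have s: "simple (insert (edge_at ts i) ?F)" unfolding F[symmetric]
    using 5(1) by (intro valid_simple[OF valid_ts]) auto
  have new: "edge_at ts i \<notin> ?F" by (auto dest: arg_cong[of _ _ fst])
  note nw = simple_insert_new[OF s new, simplified, folded u_def v_def]
  have sF: "simple ?F" by (rule simple_mono[OF s]) auto
  note fin = finite_nbrs[OF sF]
  have uv: "u < N" "v < N" using valid_edge[OF valid_ts 5(1)] unfolding u_def v_def by auto
  \<comment> \<open>The tree is simple, so a new edge adds a genuinely new neighbour at both of its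
    ends; this is why counting and summing edge by edge gives the numbers for neighbour
    sets.\<close>
  have nin: "v \<notin> nbrs ?F u" "u \<notin> nbrs ?F v" using nw(1) adj_sym unfolding nbrs_def by auto
  have nb: "nbrs (edge_at ts ` {..<Suc i}) j = (if j = u then insert v (nbrs ?F u) else if j = v then insert u (nbrs ?F v) else nbrs ?F j)" for j
    unfolding F nbrs_insert using nw(2) by (auto simp: u_def[symmetric] v_def[symmetric])
  have C: "card (nbrs (edge_at ts ` {..<Suc i}) j) = card (nbrs ?F j) + (if j = u \<or> j = v then 1 else 0)" for j
    unfolding nb using fin nin nw(2) by simp
  have Sm: "\<Sum>(nbrs (edge_at ts ` {..<Suc i}) j) mod N =
    (if j = u then (\<Sum>(nbrs ?F u) mod N + v) mod N else if j = v then (\<Sum>(nbrs ?F v) mod N + u) mod N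
     else \<Sum>(nbrs ?F j) mod N)" for j
    unfolding nb using fin nin nw(2) by (simp add: mod_add_right_eq mod_add_left_eq add.commute)
  have cB: "card (nbrs ?F j) + 1 \<le> B" for j
  proof -
    have "nbrs ?F j \<subseteq> {..<N}"
      using nbrs_ends[of ?F j] valid_ends[OF valid_ts, of "{..<i}"] 5(1) by auto
    then have "card (nbrs ?F j) \<le> N" using card_mono[of "{..<N}"] by fastforce
    then show ?thesis using bound_lemmas(4) by simp
  qed
  have inr: "t aIn (4 + (2 * m + 2 * i)) = u" "t aIn (5 + (2 * m + 2 * i)) = v" "t vm 0 = m" "t vN 0 = N"
    using inp_tree[OF inp 5(1)] r by (simp_all add: f u_def v_def)
  have B1: "u \<le> B" "v \<le> B" "\<And>x. x mod N \<le> B"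
    using uv bound_lemmas(4) N_pos by (auto intro: less_imp_le[OF less_le_trans[OF mod_less_divisor]])
  show ?case
    unfolding C Sm
    using 5(3,4) B1 cB[of u] cB[of v] nw(2) by (simp add: inr)
next
  case 4
  have "nbrs (edge_at ts ` {..<0}) j = {}" for j unfolding nbrs_def adj_def by simp
  then show ?case using zero by simp
next
  case 7
  show ?case using q_eq by simp
qed (use r bound_lemmas q_eq in \<open>auto simp: agreeD\<close>)

lemma tri_find_leaves:
  assumes r: "s vN 0 = N" "s vTail 0 = 0" and dg: "\<And>j. s aDeg j = card (nbrs TE j)"
  shows "tri B find_leaves s (N * 50 + 20) (\<lambda>t. t vTail 0 \<le> N \<and> inj_on (t aOrd) {..<t vTail 0} \<and>
    t aOrd ` {..<t vTail 0} = {j. j < N \<and> card (nbrs TE j) \<le> 1})"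
  unfolding find_leaves_def
proof (rule tri_For[where N = N and T = 30 and I = "\<lambda>i t. t vTail 0 \<le> i \<and> inj_on (t aOrd) {..<t vTail 0} \<and>
    t aOrd ` {..<t vTail 0} = {j. j < i \<and> card (nbrs TE j) \<le> 1}"], goal_cases)
  case (5 i t)
  have d: "t aDeg i = card (nbrs TE i)" using dg by (simp add: agreeD[OF 5(2)])
  define tl where "tl = t vTail 0"
  have tl: "tl \<le> i" "inj_on (t aOrd) {..<tl}" "t aOrd ` {..<tl} = {j. j < i \<and> card (nbrs TE j) \<le> 1}"
    using 5(4) unfolding tl_def by auto
  have B: "i \<le> B" "Suc tl \<le> B" using 5(1) tl(1) bound_lemmas(4) by auto
  show ?case
  proof (cases "card (nbrs TE i) \<le> 1")
    case True
    have im: "(t aOrd)(tl := i) ` {..<Suc tl} = insert i (t aOrd ` {..<tl})"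
      by (auto simp: less_Suc_eq)
    have "i \<notin> t aOrd ` {..<tl}" using tl(3) by simp
    then have "inj_on ((t aOrd)(tl := i)) {..<Suc tl}"
      using tl(2) by (auto simp: inj_on_def lessThan_Suc)
    moreover have "(t aOrd)(tl := i) ` {..<Suc tl} = {j. j < Suc i \<and> card (nbrs TE j) \<le> 1}"
      unfolding im tl(3) using True by (auto simp: less_Suc_eq)
    ultimately show ?thesis using True tl(1) B 5(3) d by (simp add: tl_def[symmetric])
  next
    case False
    then have "{j. j < Suc i \<and> card (nbrs TE j) \<le> 1} = {j. j < i \<and> card (nbrs TE j) \<le> 1}"
      by (auto simp: less_Suc_eq)
    then show ?thesis using False tl 5(3) d by (simp add: tl_def[symmetric])
  qed
qed (use r bound_lemmas in \<open>auto simp: agreeD\<close>)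

lemma tri_strip_leaves:
  assumes r: "s vN 0 = N" and init: "strip_inv 0 (s vTail 0) (s aOrd) (s aDeg) (s aNb) (s aPrn)"
    and dg: "\<And>j. s aDeg j \<le> N"
  shows "tri B strip_leaves s (N * 150 + 20) (\<lambda>t. strip_inv (N - 1) (t vTail 0) (t aOrd) (t aDeg) (t aNb) (t aPrn))"
  unfolding strip_leaves_def
proof (rule tri_For[where N = "N - 1" and T = 120 and I = "\<lambda>i t. strip_inv i (t vTail 0) (t aOrd) (t aDeg) (t aNb) (t aPrn) \<and>
      (\<forall>j. t aDeg j \<le> N)"], goal_cases)
  case (5 i t)
  define p where "p = t aNb (t aOrd i)"
  have inv: "strip_inv i (t vTail 0) (t aOrd) (t aDeg) (t aNb) (t aPrn)" and dgN: "\<And>j. t aDeg j \<le> N"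
    using 5(4) by auto
  have i: "Suc i < N" using 5(1) by simp
  note st = strip_step[OF inv i, folded p_def]
  have tN: "t vN 0 = N" using r by (simp add: agreeD[OF 5(2)])
  have tail: "t vTail 0 \<le> N" using inv unfolding strip_inv_def by blast
  have NB: "N + 4 \<le> B" using bound_lemmas(4) by simp
  have md: "x mod N \<le> B" for x using mod_less_divisor[OF N_pos, of x] NB by simp
  have dB: "t aDeg p - 1 \<le> B" "t aDeg j - 1 \<le> N" for j using dgN[of p] dgN[of j] NB by auto
  show ?case
  proof (cases "t aDeg p - 1 = 1")
    case True
    then show ?thesis
      using st NB md dB dgN tail 5(3) by (simp add: tN p_def[symmetric])
  next
    case False
    then show ?thesis
      using st NB md dB dgN tail 5(3) by (simp add: tN p_def[symmetric])
  qed
next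
  case 7
  have "(N - 1) * 150 \<le> N * 150" by simp
  then show ?case by simp
qed (use r init dg bound_lemmas in \<open>auto simp: agreeD\<close>)

lemma tri_positions:
  assumes r: "s vN 0 = N" and inj: "inj_on (s aOrd) {..<N}" and im: "s aOrd ` {..<N} = {..<N}" and zero: "\<And>j. s aPos j = 0"
  shows "tri B positions s (N * 30 + 20) (\<lambda>t. (\<forall>i<N. t aPos (s aOrd i) = i) \<and> (\<forall>j. t aPos j \<le> N))"
  unfolding positions_def
proof (rule tri_For[where N = N and T = 10 and I = "\<lambda>i t. (\<forall>j<i. t aPos (s aOrd j) = j) \<and> (\<forall>j. t aPos j \<le> N)"], goal_cases)
  case (5 i t)
  have "t aOrd = s aOrd" by (simp add: agreeD[OF 5(2)])
  moreover have "s aOrd i < N" using im 5(1) by blast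
  moreover have "s aOrd j \<noteq> s aOrd i" if "j < i" for j using inj_onD[OF inj, of j i] that 5(1) by auto
  ultimately show ?case using 5(1,3,4) bound_lemmas(4) by (auto simp: less_Suc_eq)
qed (use r zero bound_lemmas in \<open>auto simp: agreeD\<close>)

end

lemma tri_copy_bag:
  assumes r: "s vW 0 = W" "s vn 0 = n" "s vY 0 = y" "s vX 0 = sz" "s vPtr 0 = ptr"
    and B: "y * W + W \<le> B" "n + W \<le> B" "\<And>p. p < W \<Longrightarrow> p < sz \<Longrightarrow> s aIn (ptr + p) \<le> B"
  shows "tri B copy_bag s (W * 60 + 20) (\<lambda>t. \<forall>x p. p < W \<longrightarrow> t aBag (x * W + p) =
    (if x = y then (if p < sz then s aIn (ptr + p) else n + p) else s aBag (x * W + p)))"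
  unfolding copy_bag_def
proof (rule tri_For[where N = W and T = 40 and I = "\<lambda>i t. \<forall>x p. p < W \<longrightarrow> t aBag (x * W + p) =
    (if x = y \<and> p < i then (if p < sz then s aIn (ptr + p) else n + p) else s aBag (x * W + p))"], goal_cases)
  case (5 i t)
  have t: "t vW 0 = W" "t vn 0 = n" "t vY 0 = y" "t vX 0 = sz" "t vPtr 0 = ptr" "t aIn = s aIn"
    using r by (simp_all add: agreeD[OF 5(2)])
  have "y * W + i \<le> B" "n + i \<le> B" using B 5(1) by auto
  then show ?case
    using 5(1,3,4) B(3)[OF 5(1)] by (auto simp: t pair_eq[OF _ 5(1)] less_Suc_eq)
qed (use r B in \<open>auto simp: agreeD\<close>)

context bounded_decomposition
begin

text \<open>Vertices that have not occurred in the bags seen so far are left unconstrained, as their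
  entries are arbitrary.\<close>

definition topok :: "(nat \<Rightarrow> nat) \<Rightarrow> nat \<Rightarrow> (nat \<Rightarrow> nat) \<Rightarrow> bool" where
  "topok ord i f \<longleftrightarrow> (\<forall>z<n. (\<exists>j<i. z \<in> set (bs ! ord j)) \<longrightarrow>
     f z < i \<and> z \<in> set (bs ! ord (f z)) \<and> (\<forall>j<i. z \<in> set (bs ! ord j) \<longrightarrow> j \<le> f z))"

lemma topok_Suc:
  assumes "topok ord i f"
  shows "topok ord (Suc i) (\<lambda>z. if z \<in> set (bs ! ord i) then i else f z)"
  unfolding topok_def
proof (intro allI impI)
  fix z assume z: "z < n" "\<exists>j<Suc i. z \<in> set (bs ! ord j)"
  show "(if z \<in> set (bs ! ord i) then i else f z) < Suc i \<and>
    z \<in> set (bs ! ord (if z \<in> set (bs ! ord i) then i else f z)) \<and>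
    (\<forall>j<Suc i. z \<in> set (bs ! ord j) \<longrightarrow> j \<le> (if z \<in> set (bs ! ord i) then i else f z))"
  proof (cases "z \<in> set (bs ! ord i)")
    case False
    then have "\<exists>j<i. z \<in> set (bs ! ord j)" using z(2) less_Suc_eq by auto
    then have "f z < i \<and> z \<in> set (bs ! ord (f z)) \<and> (\<forall>j<i. z \<in> set (bs ! ord j) \<longrightarrow> j \<le> f z)"
      using assms z(1) unfolding topok_def by blast
    then show ?thesis using False by (auto simp: less_Suc_eq)
  qed auto
qed

lemma tri_tree_nodes:
  assumes inp: "inp s" and r: "s vN 0 = N" "s vm 0 = m" "s vn 0 = n" "s vW 0 = W"
    and im: "s aOrd ` {..<N} = {..<N}" and st: "\<And>j. j < N \<Longrightarrow> s aStart j = start j" and pos: "\<And>j. s aPos j \<le> N"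
  shows "tri B tree_nodes s (N * (W * 100 + 200) + 20) (\<lambda>t.
    (\<forall>x<N. \<forall>p<W. t aBag ((m + x) * W + p) = bagf (s aOrd) (m + x) p) \<and>
    (\<forall>x<N. t aPar (m + x) = m + s aPos (s aPrn (s aOrd x))) \<and> topok (s aOrd) N (t aTop))"
proof -
  define J where "J = (\<lambda>i (t :: memory). (\<forall>x<i. \<forall>p<W. t aBag ((m + x) * W + p) = bagf (s aOrd) (m + x) p) \<and>
    (\<forall>x<i. t aPar (m + x) = m + s aPos (s aPrn (s aOrd x))) \<and> topok (s aOrd) i (t aTop))"
  show ?thesis
  unfolding tree_nodes_def
proof (rule tri_For[where N = N and T = "W * 100 + 180" and I = J], goal_cases)
  case (5 i t)
  note f = agreeD[OF 5(2)]
  define nd where "nd = s aOrd i"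
  define b where "b = bs ! nd"
  have oN: "nd < N" using im 5(1) unfolding nd_def by blast
  have lb: "length b \<le> W" using bag_size[OF oN] unfolding b_def .
  have I: "\<And>x p. x < i \<Longrightarrow> p < W \<Longrightarrow> t aBag ((m + x) * W + p) = bagf (s aOrd) (m + x) p"
    "\<And>x. x < i \<Longrightarrow> t aPar (m + x) = m + s aPos (s aPrn (s aOrd x))" "topok (s aOrd) i (t aTop)"
    using 5(4) unfolding J_def by auto
  have regs: "t aOrd = s aOrd" "t aStart = s aStart" "t aIn = s aIn" "t vm 0 = m" "t vW 0 = W" "t vn 0 = n" "t aPos = s aPos" "t aPrn = s aPrn"
    using r by (simp_all add: f)
  have len: "s aIn (start nd) = length b" and nth: "\<And>p. p < length b \<Longrightarrow> s aIn (start nd + 1 + p) = b ! p"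
    using inp_bag[OF inp oN] unfolding b_def by auto
  have bn: "b ! p < n" if "p < length b" for p using bag_less[OF oN] that unfolding b_def by simp
  have stB: "start nd + 1 \<le> B"
  proof -
    have "start (Suc nd) \<le> B" using start_le[of "Suc nd"] oN by simp
    then show ?thesis unfolding start_def by simp
  qed
  have bagB: "(m + i) * W + W \<le> B"
  proof -
    have "(m + i) * W + W = (m + Suc i) * W" by simp
    also have "\<dots> \<le> (m + N) * W" using 5(1) by (intro mult_le_mono1) simp
    finally show ?thesis using bound_lemmas(3) by simp
  qed
  define s1 where "s1 = t(vU := (t vU)(0 := nd), vX := (t vX)(0 := length b), vPtr := (t vPtr)(0 := start nd + 1), vY := (t vY)(0 := m + i))"
  have s1: "s1 aIn = s aIn" "s1 vW 0 = W" "s1 vn 0 = n" "s1 vY 0 = m + i" "s1 vX 0 = length b" "s1 vPtr 0 = start nd + 1" "s1 vm 0 = m"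
    "s1 aPos = s aPos" "s1 aPrn = s aPrn" "s1 vU 0 = nd" "s1 aTop = t aTop" "s1 aPar = t aPar" "s1 aBag = t aBag" "s1 vI 0 = i"
    using regs 5(3) by (simp_all add: s1_def)
  have main: "tri B (Seq copy_bag (Seq (For vP (V vX) (Write aTop (Read aIn (Add (V vPtr) (V vP))) (V vI)))
          (Write aPar (V vY) (Add (V vm) (Read aPos (Read aPrn (V vU))))))) s1 (W * 100 + 120)
      (J (Suc i))"
  proof (rule tri_SeqI[where ?T2.0 = "W * 40 + 80", OF tri_copy_bag[where W = W and n = n and y = "m + i" and sz = "length b" and ptr = "start nd + 1"]], goal_cases)
    case (9 s2)
    note f2 = agreeD[OF 9(1)]
    have s2: "s2 aIn = s aIn" "s2 vX 0 = length b" "s2 vPtr 0 = start nd + 1" "s2 vY 0 = m + i" "s2 vm 0 = m" "s2 vU 0 = nd"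
      "s2 aPos = s aPos" "s2 aPrn = s aPrn" "s2 aTop = t aTop" "s2 aPar = t aPar" "s2 vI 0 = i"
      using s1 by (simp_all add: f2)
    show ?case
    proof (rule tri_SeqI[where ?T1.0 = "W * 40 + 20" and ?T2.0 = 40 and R = "\<lambda>u. u aTop = (\<lambda>z. if z \<in> set b then i else t aTop z)"], goal_cases)
      case 1
      show ?case
      proof (rule tri_For[where N = "length b" and T = 20 and I = "\<lambda>p u. u aTop = (\<lambda>z. if z \<in> set (take p b) then i else t aTop z)"], goal_cases)
        case (5 p u)
        have u: "u aIn (start nd + 1 + p) = b ! p" "u vPtr 0 = start nd + 1" "u vI 0 = i"
          using nth[OF 5(1)] s2 by (simp_all add: agreeD[OF 5(2)])
        have bd: "b ! p \<le> B" "i \<le> B" using bn[OF 5(1)] bound_lemmas \<open>i < N\<close> by auto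
        have "(\<lambda>z. if z \<in> set (take (Suc p) b) then i else t aTop z) = (u aTop)(b ! p := i)"
          using 5(1,4) by (auto simp: take_Suc_conv_app_nth fun_eq_iff)
        then show ?case using 5(3) u bd by simp
      next
        case 2
        then show ?case using lb bound_lemmas(1) by simp
      next
        case 7
        have "length b * 32 \<le> W * 32" using lb by simp
        then show ?case by simp
      qed (use s2 in \<open>auto simp: agreeD\<close>)
    next
      case (2 s3)
      note f3 = agreeD[OF 2(1)]
      have s3: "s3 vY 0 = m + i" "s3 vm 0 = m" "s3 vU 0 = nd" "s3 aPos = s aPos" "s3 aPrn = s aPrn" "s3 aPar = t aPar" "s3 aBag = s2 aBag"
        using s2 by (simp_all add: f3)
      \<comment> \<open>The last node of the order has no parent, so its entry in
        \<open>aPrn\<close> is meaningless. It is read nevertheless, which is why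
        \<open>aPos\<close> is assumed to be bounded everywhere.\<close>
      have wB: "m + i \<le> B" "m + s aPos (s aPrn nd) \<le> B"
        using \<open>i < N\<close> pos[of "s aPrn nd"] bound_lemmas(4) by auto
      have "J (Suc i) (s3(aPar := (s3 aPar)(m + i := m + s aPos (s aPrn nd))))"
        unfolding J_def
      proof (intro conjI allI impI)
        fix x p assume x: "x < Suc i" "p < W"
        show "(s3(aPar := (s3 aPar)(m + i := m + s aPos (s aPrn nd)))) aBag ((m + x) * W + p) = bagf (s aOrd) (m + x) p"
        proof (cases "x = i")
          case True
          then show ?thesis using 9(2) x nth s1 unfolding bagf_def by (simp add: s3 nd_def[symmetric] b_def[symmetric])
        next
          case False
          then show ?thesis using 9(2) x I(1)[of x p] s1 by (simp add: s3)
        qed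
      next
        fix x assume "x < Suc i"
        then show "(s3(aPar := (s3 aPar)(m + i := m + s aPos (s aPrn nd)))) aPar (m + x) = m + s aPos (s aPrn (s aOrd x))"
          using I(2)[of x] by (cases "x = i") (auto simp: s3 nd_def)
      next
        show "topok (s aOrd) (Suc i) ((s3(aPar := (s3 aPar)(m + i := m + s aPos (s aPrn nd)))) aTop)"
          using topok_Suc[OF I(3)] 2(2) by (simp add: b_def nd_def)
      qed
      then show ?case using wB by (simp add: s3)
    qed simp
  next
    case (8 p)
    then show ?case using nth[of p] bn[of p] bound_lemmas(1) by (simp add: s1)
  qed (use s1 bagB bound_lemmas(1) in auto)
  have bd: "nd \<le> B" "length b \<le> B" "start nd + 1 \<le> B" "m + i \<le> B"
    using oN lb stB 5(1) bound_lemmas by auto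
  have JI: "J k (u(vI := v)) = J k u" for k u v unfolding J_def by simp
  show ?case
    using bd len 5(3) st[OF oN] tri_mono[OF main[unfolded s1_def]]
    by (simp add: regs nd_def[symmetric] JI)
next
  case 7
  show ?case by (simp add: algebra_simps)
qed (use r bound_lemmas in \<open>auto simp: agreeD topok_def J_def\<close>)
qed

lemma tri_edge_nodes:
  assumes inp: "inp s" and r: "s vm 0 = m" "s vn 0 = n" "s vW 0 = W"
    and topn: "\<And>z. z < n \<Longrightarrow> s aTop z < N"
  shows "tri B edge_nodes s (m * (W * 60 + 200) + 20) (\<lambda>t.
    (\<forall>x p. p < W \<longrightarrow> t aBag (x * W + p) = (if x < m then bagf ord x p else s aBag (x * W + p))) \<and>
    (\<forall>x. t aPar x = (if x < m then m + min (s aTop (fst (es ! x))) (s aTop (snd (es ! x))) else s aPar x)))"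
proof -
  define J where "J = (\<lambda>i (t :: memory).
    (\<forall>x p. p < W \<longrightarrow> t aBag (x * W + p) = (if x < i then bagf ord x p else s aBag (x * W + p))) \<and>
    (\<forall>x. t aPar x = (if x < i then m + min (s aTop (fst (es ! x))) (s aTop (snd (es ! x))) else s aPar x)))"
  show ?thesis
    unfolding edge_nodes_def
  proof (rule tri_For[where N = m and T = "W * 60 + 180" and I = J], goal_cases)
    case (5 i t)
    note f = agreeD[OF 5(2)]
    note ie = inp_edge[OF inp 5(1)]
    have ie3: "s aIn (Suc (Suc (Suc (2 * i)))) = snd (es ! i)" using ie(2) by (simp add: numeral_3_eq_3)
    note ve = valid_edge[OF valid_es 5(1)]
    have W2: "2 \<le> W" by (rule two_le_W[OF 5(1)])
    have regs: "t aIn = s aIn" "t vm 0 = m" "t vW 0 = W" "t vn 0 = n" "t aTop = s aTop" using r by (simp_all add: f)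
    have I: "\<And>x p. p < W \<Longrightarrow> t aBag (x * W + p) = (if x < i then bagf ord x p else s aBag (x * W + p))"
      "\<And>x. t aPar x = (if x < i then m + min (s aTop (fst (es ! x))) (s aTop (snd (es ! x))) else s aPar x)"
      using 5(4) unfolding J_def by auto
    have bagB: "i * W + W \<le> B"
    proof -
      have "i * W + W = Suc i * W" by simp
      also have "\<dots> \<le> (m + N) * W" using 5(1) by (intro mult_le_mono1) simp
      finally show ?thesis using bound_lemmas(3) by simp
    qed
    have nB: "n \<le> B" "N + m + 4 \<le> B" "2 \<le> B" "2 + 2 * i \<le> B" using bound_lemmas 5(1) by auto
    have tB: "s aTop (fst (es ! i)) < N" "s aTop (snd (es ! i)) < N" using topn ve by auto
    define s1 where "s1 = t(vX := (t vX)(0 := 2), vPtr := (t vPtr)(0 := 2 + 2 * i), vY := (t vY)(0 := i))"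
    have s1: "s1 aIn = s aIn" "s1 vW 0 = W" "s1 vn 0 = n" "s1 vY 0 = i" "s1 vX 0 = 2" "s1 vPtr 0 = 2 + 2 * i" "s1 vm 0 = m"
      "s1 aTop = s aTop" "s1 aPar = t aPar" "s1 aBag = t aBag"
      using regs by (simp_all add: s1_def)
    have inB: "s1 aIn (2 + 2 * i + p) \<le> B" if "p < 2" for p
    proof -
      have "p = 0 \<or> p = 1" using that by auto
      then show ?thesis using ie ve nB by (auto simp: s1 numeral_3_eq_3)
    qed
    have main: "tri B (Seq copy_bag
     (Seq (Set vU (Read aTop (Read aIn (V vPtr)))) (Seq (Set vV (Read aTop (Read aIn (Add (V vPtr) (Num 1)))))
          (Write aPar (V vY) (Add (V vm) (Sub (V vU) (Sub (V vU) (V vV)))))))) s1 (W * 60 + 100) (J (Suc i))"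
    proof (rule tri_SeqI[where ?T2.0 = 60, OF tri_copy_bag[where W = W and n = n and y = i and sz = 2 and ptr = "2 + 2 * i"]], goal_cases)
      case (9 s2)
      note f2 = agreeD[OF 9(1)]
      have s2: "s2 aIn = s aIn" "s2 vPtr 0 = 2 + 2 * i" "s2 vY 0 = i" "s2 vm 0 = m" "s2 aTop = s aTop" "s2 aPar = t aPar"
        using s1 by (simp_all add: f2)
      have mn: "a - (a - b) = min a b" for a b :: nat by auto
      have "J (Suc i) (s2(vU := u, vV := v, aPar := (s2 aPar)(i := m + min (s aTop (fst (es ! i))) (s aTop (snd (es ! i))))))" for u v
        unfolding J_def
      proof (intro conjI allI impI)
        fix x p assume p: "p < W"
        show "(s2(vU := u, vV := v, aPar := (s2 aPar)(i := m + min (s aTop (fst (es ! i))) (s aTop (snd (es ! i)))))) aBag (x * W + p) =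
          (if x < Suc i then bagf ord x p else s aBag (x * W + p))"
        proof -
          have b: "s2 aBag (x * W + p) = (if x = i then (if p < 2 then s1 aIn (2 + 2 * i + p) else n + p)
            else s1 aBag (x * W + p))" using 9(2) p by blast
          show ?thesis
          proof (cases "x = i")
            case True
            consider "p = 0" | "p = 1" | "2 \<le> p" by linarith
            then show ?thesis using b True ie s1(1) 5(1) unfolding bagf_def by cases (auto simp: numeral_3_eq_3)
          next
            case False
            then show ?thesis using b I(1)[OF p, of x] s1 by (simp add: less_Suc_eq)
          qed
        qed
      next
        fix x
        show "(s2(vU := u, vV := v, aPar := (s2 aPar)(i := m + min (s aTop (fst (es ! i))) (s aTop (snd (es ! i)))))) aPar x =
          (if x < Suc i then m + min (s aTop (fst (es ! x))) (s aTop (snd (es ! x))) else s aPar x)"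
          using I(2)[of x] by (auto simp: s2 less_Suc_eq)
      qed
      moreover have "m + min (s aTop (fst (es ! i))) (s aTop (snd (es ! i))) \<le> B" "s aTop (fst (es ! i)) \<le> B" "s aTop (snd (es ! i)) \<le> B" "i \<le> B"
        using tB nB 5(1) by (auto simp: min_def)
      ultimately show ?case
        using ie(1) ie3 by (simp add: s2 mn)
    qed (use s1 bagB bound_lemmas(1) inB in auto)
    have JI: "J k (u(vI := v)) = J k u" for k u v unfolding J_def by simp
    show ?case
      using nB 5(1,3) tri_mono[OF main[unfolded s1_def]]
      by (simp add: regs JI)
  next
    case 7
    show ?case by (simp add: algebra_simps)
  qed (use r bound_lemmas in \<open>auto simp: agreeD J_def\<close>)
qed

end

definition prepare :: prog where
  "prepare = Seq read_header (Seq scan_bags (Seq count_nbrs (Seq find_leaves (Seq strip_leaves (Seq positions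
     (Seq tree_nodes (Seq edge_nodes (Seq (Set vBase (Mul (Num 4) (V vW))) (Set vM (Add (V vm) (V vN)))))))))))"

lemma writes_prepare: "writes prepare = {vn, vm, vN, vq, vPtr, vI, aStart, vW, vU, vV, aDeg, aNb, aOrd, vTail,
    aPrn, aPos, vX, vY, vP, aBag, aTop, aPar, vBase, vM}"
  unfolding prepare_def by auto

context bounded_decomposition
begin

lemma tri_prepare:
  assumes s0: "s0 = input_memory (encode_input n es ts bs)" and B: "4 * W \<le> B"
  shows "tri B prepare s0 (2000 * ((n + m + N + 1) * (W + 1))) (\<lambda>t. inp t \<and> t vn 0 = n \<and> t vm 0 = m \<and> t vW 0 = W \<and>
    t vBase 0 = 4 * W \<and> t vM 0 = m + N \<and>
    node_order W m (m + N) (edge_at es) (\<lambda>x p. t aBag (x * W + p)) (t aPar))"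
proof -
  let ?Q = "\<lambda>t :: memory. inp t \<and> t vn 0 = n \<and> t vm 0 = m \<and> t vW 0 = W \<and>
    t vBase 0 = 4 * W \<and> t vM 0 = m + N \<and>
    node_order W m (m + N) (edge_at es) (\<lambda>x p. t aBag (x * W + p)) (t aPar)"
  define Q where "Q = ?Q"
  have z: "s0 a = (\<lambda>_. 0)" if "a \<noteq> 0" for a using that unfolding s0 input_memory_def by auto
  have i0: "inp s0" unfolding inp_def s0 ..
  have M: "m + N \<le> B" using bound_lemmas(4) by simp
  have "tri B prepare s0 (80 + ((N * 80 + 20) + ((N * 150 + 20) + ((N * 50 + 20) + ((N * 150 + 20) + ((N * 30 + 20) +
    ((N * (W * 100 + 200) + 20) + ((m * (W * 60 + 200) + 20) + 50)))))))) Q"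
    unfolding prepare_def
  proof (rule tri_SeqI[OF tri_read_header[OF i0] _ order_refl], goal_cases)
    case (1 s1)
    note f1 = agreeD[OF 1(1)]
    have i1: "inp s1" using i0 unfolding inp_def by (simp add: f1)
    show ?case
    proof (rule tri_SeqI[OF tri_scan_bags[OF i1] _ order_refl], goal_cases)
      case (4 s2)
      note f2 = agreeD[OF 4(1)]
      note p2 = 4(2)
      have i2: "inp s2" using i1 unfolding inp_def by (simp add: f2)
      show ?case
      proof (rule tri_SeqI[OF tri_count_nbrs[OF i2] _ order_refl], goal_cases)
        case (6 s3)
        note f3 = agreeD[OF 6(1)]
        note p3 = 6(2)
        show ?case
        proof (rule tri_SeqI[OF tri_find_leaves _ order_refl], goal_cases)
          case (4 s4)
          note f4 = agreeD[OF 4(1)]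
          have p4: "s4 aDeg j = card (nbrs TE j)" "s4 aNb j = \<Sum>(nbrs TE j) mod N" for j using p3 by (simp_all add: f4)
          have st: "strip_inv 0 (s4 vTail 0) (s4 aOrd) (s4 aDeg) (s4 aNb) (s4 aPrn)"
            using 4(2) p4 by (intro strip_init) auto
          have dN: "s4 aDeg j \<le> N" for j
            unfolding p4 using nbrs_ends[of TE j] TE_ends card_mono[of "{..<N}" "nbrs TE j"] by auto
          show ?case
          proof (rule tri_SeqI[OF tri_strip_leaves[where s = s4, OF _ st dN] _ order_refl], goal_cases)
            case (2 s5)
            note f5 = agreeD[OF 2(1)]
            note p5 = 2(2)
            note sf = strip_final[OF p5]
            show ?case
            proof (rule tri_SeqI[OF tri_positions[where s = s5, OF _ sf] _ order_refl], goal_cases)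
              case (3 s6)
              note f6 = agreeD[OF 3(1)]
              note p6 = 3(2)
              have i6: "inp s6" using i2 unfolding inp_def by (simp add: f6 f5 f4 f3)
              have ord6: "s6 aOrd = s5 aOrd" "s6 aPrn = s5 aPrn" by (simp_all add: f6)
              have im6: "s6 aOrd ` {..<N} = {..<N}" using sf(2) ord6 by simp
              show ?case
              proof (rule tri_SeqI[OF tri_tree_nodes[where s = s6, OF i6 _ _ _ _ im6] _ order_refl], goal_cases)
                case (7 s7)
                note f7 = agreeD[OF 7(1)]
                note p7 = 7(2)
                have i7: "inp s7" using i6 unfolding inp_def by (simp add: f7)
                \<comment> \<open>Every vertex occurs in some bag, so after all \<open>N\<close>
                  bags \<open>topok\<close> determines its entry completely.\<close>
                have top7: "s7 aTop z < N \<and> z \<in> set (bs ! s6 aOrd (s7 aTop z)) \<and>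
                  (\<forall>i<N. z \<in> set (bs ! s6 aOrd i) \<longrightarrow> i \<le> s7 aTop z)" if z: "z < n" for z
                proof -
                  obtain i where "i < N" "z \<in> set (bs ! i)" using cover z by blast
                  moreover from this obtain j where "j < N" "i = s6 aOrd j" using im6 by blast
                  ultimately show ?thesis using p7 z unfolding topok_def by blast
                qed
                have ordered: "ordered (s6 aOrd) (s6 aPrn) (s6 aPos) (s7 aTop)"
                  unfolding ordered_def using sf p5 p6 top7 ord6 unfolding strip_inv_def by auto
                show ?case
                proof (rule tri_SeqI[OF tri_edge_nodes[OF i7, where ord = "s6 aOrd"] _ order_refl], goal_cases)
                  case (5 s8)
                  note f8 = agreeD[OF 5(1)]
                  have i8: "inp s8" using i7 unfolding inp_def by (simp add: f8)
                  have r8: "s8 vn 0 = n" "s8 vm 0 = m" "s8 vN 0 = N" "s8 vW 0 = W"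
                    using 1(2) p2 by (simp_all add: f8 f7 f6 f5 f4 f3 f2)
                  have no: "node_order W m (m + N) (edge_at es) (\<lambda>x p. s8 aBag (x * W + p)) (s8 aPar)"
                  proof (rule node_order_cong[OF ordered_node_order[OF ordered]])
                    fix x p assume xp: "x < m + N" "p < W"
                    show "s8 aBag (x * W + p) = bagf (s6 aOrd) x p"
                    proof (cases "x < m")
                      case True
                      then show ?thesis using 5(2) xp by simp
                    next
                      case False
                      then have "x = m + (x - m)" "x - m < N" using xp by auto
                      then obtain k where k: "x = m + k" "k < N" by blast
                      have "s8 aBag (x * W + p) = s7 aBag (x * W + p)" using 5(2) xp(2) False by auto
                      then show ?thesis using p7 k xp(2) by auto
                    qed
                  next
                    fix x assume x: "x < m + N - 1"
                    show "s8 aPar x = parf (s6 aOrd) (s6 aPrn) (s6 aPos) (s7 aTop) x"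
                    proof (cases "x < m")
                      case True
                      then show ?thesis using 5(2) unfolding parf_def by simp
                    next
                      case False
                      then have "x = m + (x - m)" "x - m < N" using x by auto
                      then obtain k where k: "x = m + k" "k < N" by blast
                      have "s8 aPar x = s7 aPar x" using 5(2) False by simp
                      then show ?thesis using p7 k unfolding parf_def by simp
                    qed
                  qed
                  show ?case
                    using r8 B M no i8 unfolding Q_def inp_def by simp
                qed (use 1(2) p2 top7 in \<open>simp_all add: f7 f6 f5 f4 f3 f2\<close>)
              qed (use 1(2) p2 p6 in \<open>simp_all add: f6 f5 f4 f3 f2\<close>)
            qed (use 1(2) z in \<open>simp_all add: f5 f4 f3 f2 f1\<close>)
          qed (use 1(2) in \<open>simp_all add: f4 f3 f2\<close>)
        qed (use 1(2) z p3 in \<open>simp_all add: f3 f2 f1\<close>)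
      qed (use 1(2) z in \<open>simp_all add: f2 f1\<close>)
    qed (use 1(2) z in \<open>simp_all add: f1\<close>)
  qed
  moreover have "80 + ((N * 80 + 20) + ((N * 150 + 20) + ((N * 50 + 20) + ((N * 150 + 20) + ((N * 30 + 20) +
    ((N * (W * 100 + 200) + 20) + ((m * (W * 60 + 200) + 20) + 50)))))))  \<le> 2000 * ((n + m + N + 1) * (W + 1))"
  proof -
    define b c where "b = m * W" and "c = N * W"
    have "N * (W * 100 + 200) = 100 * c + 200 * N" "m * (W * 60 + 200) = 60 * b + 200 * m"
      unfolding b_def c_def by (simp_all add: algebra_simps)
    moreover have "(n + m + N + 1) * (W + 1) = n * W + b + c + W + n + m + N + 1"
      unfolding b_def c_def by (simp add: algebra_simps)
    ultimately show ?thesis by simp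
  qed
  ultimately show ?thesis unfolding Q_def by (rule tri_mono)
qed

end

section \<open>Running time and correctness\<close>

definition solve :: prog where
  "solve = Seq init_tables (Seq steps (Seq find_best (Seq sweep (Seq mark_ends (Seq write_verts write_edges)))))"

definition max_tree_program :: prog where
  "max_tree_program = Seq prepare solve"

context bounded_decomposition
begin

abbreviation "M \<equiv> m + N"
abbreviation "NC \<equiv> ncodes W"

text \<open>The number of nodes times the pairs of codes times the quadratic cost of merging one
  pair; every phase is bounded by a constant multiple of it.\<close>

definition unit_time :: nat where
  "unit_time = (n + m + N + 1) * (NC * NC * (W * W))"

lemma unit_time_ge:
  "n + m + N + 1 \<le> unit_time" "W \<le> unit_time" "(n + m + N + 1) * W \<le> unit_time"
  "M * (NC * NC * (W * W)) \<le> unit_time" "M * (NC * (W * W)) \<le> unit_time" "M * (NC * NC) \<le> unit_time" "M * NC \<le> unit_time"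
proof -
  have NC: "NC \<ge> 1" using ncodes_ge[of W] by simp
  have W: "W \<ge> 1" by simp
  have SS: "NC \<le> NC * NC" "1 \<le> NC * NC" using NC by auto
  have WW: "W \<le> W * W" "1 \<le> W * W" using W by auto
  have x: "1 \<le> NC * NC * (W * W)" "W \<le> NC * NC * (W * W)"
    using mult_le_mono[OF SS(2) WW(2)] mult_le_mono[OF SS(2) WW(1)] by (simp_all del: mult_Suc mult_Suc_right)
  have M: "M \<le> n + m + N + 1" by simp
  show "n + m + N + 1 \<le> unit_time" unfolding unit_time_def using mult_le_mono2[OF x(1), of "n + m + N + 1"] by simp
  show "(n + m + N + 1) * W \<le> unit_time" unfolding unit_time_def by (rule mult_le_mono2[OF x(2)])
  moreover have "1 * W \<le> (n + m + N + 1) * W" by (rule mult_le_mono1) simp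
  ultimately show "W \<le> unit_time" unfolding mult_1 by (rule order_trans[rotated])
  show "M * (NC * NC * (W * W)) \<le> unit_time" unfolding unit_time_def by (rule mult_le_mono1[OF M])
  show "M * (NC * (W * W)) \<le> unit_time" unfolding unit_time_def
    by (intro mult_le_mono[OF M] mult_le_mono1 SS)
  show "M * (NC * NC) \<le> unit_time" unfolding unit_time_def
    using mult_le_mono[OF M mult_le_mono2[OF WW(2), of "NC * NC"]] by simp
  show "M * NC \<le> unit_time" unfolding unit_time_def
    using mult_le_mono[OF M mult_le_mono[OF SS(1) WW(2)]] by simp
qed

lemma square_bound: "W * (W * 150 + 800) + 900 \<le> 1850 * (W * W)" "W * (W * 70 + 120) + 300 \<le> 490 * (W * W)"
proof -
  define v where "v = W * W"
  have v: "W \<le> v" "1 \<le> v" unfolding v_def by auto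
  have e: "W * (W * 150 + 800) + 900 = 150 * v + 800 * W + 900" "W * (W * 70 + 120) + 300 = 70 * v + 120 * W + 300"
    unfolding v_def by (simp_all add: algebra_simps)
  show "W * (W * 150 + 800) + 900 \<le> 1850 * (W * W)" "W * (W * 70 + 120) + 300 \<le> 490 * (W * W)"
    unfolding e v_def[symmetric] using v by simp_all
qed

lemma tri_solve:
  assumes B: "10000 * unit_time \<le> B"
    and inp: "inp s" and r: "s vn 0 = n" "s vm 0 = m" "s vW 0 = W" "s vBase 0 = 4 * W" "s vM 0 = M"
    and no: "node_order W m M (edge_at es) (\<lambda>x p. s aBag (x * W + p)) (s aPar)"
    and zero: "\<And>a j. a \<in> {aTab, aVal, aMark, aVm} \<Longrightarrow> s a j = 0"
  shows "tri B solve s (4000 * unit_time) (\<lambda>t. \<exists>vs fs. valid_graph_lists vs fs \<and> has_output t (encode_graph vs fs) \<and>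
    max_binary_tree_in (graph_of [0..<n] es) (graph_of vs fs))"
proof -
  define Y where "Y = unit_time"
  note u = unit_time_ge[folded Y_def]
  have BY: "10000 * Y \<le> B" using B unfolding Y_def .
  define bag where "bag = (\<lambda>x p. s aBag (x * W + p))"
  interpret no: node_order W m M "edge_at es" bag "s aPar" unfolding bag_def by (rule no)
  have bnd: "2 * M * NC \<le> B" "m + 2 + M * (NC * NC) \<le> B" "4 * W + 8 \<le> B" "2 * (m + 1) \<le> B" "M * NC \<le> B" "4 + n + 2 * m \<le> B"
  proof -
    have "1 \<le> Y" "m \<le> Y" "n + 2 * m \<le> 2 * Y" using u(1) by simp_all
    then show "m + 2 + M * (NC * NC) \<le> B" "4 * W + 8 \<le> B" "2 * (m + 1) \<le> B" "M * NC \<le> B" "4 + n + 2 * m \<le> B"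
      using u(2,6,7) BY by simp_all
    have "2 * M * NC = 2 * (M * NC)" by (simp only: mult.assoc)
    also have "\<dots> \<le> 2 * Y" by (rule mult_le_mono2[OF u(7)])
    also have "\<dots> \<le> B" using BY by simp
    finally show "2 * M * NC \<le> B" .
  qed
  have edges: "s aIn (2 + 2 * k) = fst (es ! k) \<and> s aIn (3 + 2 * k) = snd (es ! k) \<and> fst (es ! k) \<le> B \<and> snd (es ! k) \<le> B" if "k < m" for k
    using inp_edge[OF inp that] valid_edge[OF valid_es that] bnd(6) by auto
  define Q where "Q = (\<lambda>t. \<exists>vs fs. valid_graph_lists vs fs \<and> has_output t (encode_graph vs fs) \<and>
    max_binary_tree_in (graph_of [0..<n] es) (graph_of vs fs))"
  let ?T2 = "M * (NC * NC * (W * (W * 150 + 800) + 900) + 80) + 30"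
  let ?T3 = "M * (NC * (W * (W * 70 + 120) + 300)) + 60"
  let ?T4 = "(m + 2 + M * (NC * NC)) * 50 + 50"
  have "tri B solve s ((W * 60 + M * 100 + 200) + (?T2 + (?T3 + (?T4 + ((m * 60 + 60) + ((n * 60 + 50) + (m * 100 + 50))))))) Q"
    unfolding solve_def
  proof (rule tri_SeqI[OF no.tri_init_tables _ order_refl], goal_cases)
    case (11 s1)
    note f1 = agreeD[OF 11(1), unfolded writes_init_tables]
    interpret dp W m M "edge_at es" bag "s aPar" B s1
      using 11(2) r bnd by unfold_locales (auto simp: f1 bag_def)
    have inv0: "dp_inv 0 s1" using 11(2) by (intro dp_inv_init) auto
    have ag1: "agree (writes steps) s1 s1" unfolding agree_def by simp
    show ?case
    proof (rule tri_SeqI[OF tri_steps[OF ag1 inv0] _ order_refl], goal_cases)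
      case (1 s2)
      note f2 = agreeD[OF 1(1), unfolded writes_steps writes_merge_pair]
      note inv = 1(2)
      note D = dp_invD[OF inv]
      have r2: "s2 vW 0 = W" "s2 vBase 0 = 4 * W" "s2 vS 0 = NC" "s2 vM 0 = M" "s2 vm 0 = m" "s2 vn 0 = n" "s2 aIn = s aIn"
        using regs r by (simp_all add: f2 f1)
      show ?case
      proof (rule tri_SeqI[OF tri_find_best[OF inv r2(1-4)] _ order_refl], goal_cases)
        case (1 s3)
        note f3 = agreeD[OF 1(1), unfolded writes_find_best]
        define best where "best = s3 vBest 0"
        define K where "K = solm s2 best"
        have ex: "\<exists>x<M. \<exists>a<NC. table s2 x a \<noteq> 0 \<and> no.single a \<and> best = table s2 x a"
          and mx: "\<And>x a. x < M \<Longrightarrow> a < NC \<Longrightarrow> table s2 x a \<noteq> 0 \<Longrightarrow> no.single a \<Longrightarrow> s2 aVal (table s2 x a) \<le> s2 aVal best"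
          using 1(2) unfolding best_def by auto
        \<comment> \<open>Only \<open>M - 1\<close> merges take place, but all nodes satisfy
          \<open>x <= M - 1\<close>, so each table has reached its own stage.\<close>
        have rep: "no.represents x x (table s2 x) (s2 aVal) (solm s2)" if "x < M" for x
        proof -
          have "min (M - 1) x = x" using that by simp
          then show ?thesis using D(1)[OF that] by simp
        qed
        note opt = no.best_is_optimal[where T = "table s2" and val = "s2 aVal" and sol = "solm s2", OF rep ex mx, folded K_def]
        have finK: "finite K" using opt(1) finite_subset by blast
        have best: "best < s2 vCnt 0" using ex D(4) by auto
        have cnt: "s2 vCnt 0 \<le> m + 2 + M * (NC * NC)"
        proof -
          have "(M - 1) * (NC * NC) \<le> M * (NC * NC)" by (rule mult_le_mono1) simp
          then show ?thesis using order_trans[OF D(9) add_left_mono] by blast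
        qed
        have cells: "s3 aLeft = s2 aLeft" "s3 aRight = s2 aRight" "s3 vCnt = s2 vCnt" "s3 aVal = s2 aVal"
          by (simp_all add: f3)
        have z3: "s3 aMark j = 0" "s3 aVm j = 0" for j
          using zero by (simp_all add: f3 f2 f1)
        have r3: "s3 vm 0 = m" "s3 vn 0 = n" "s3 aIn = s aIn" using r2 by (simp_all add: f3)
        have sw: "tri B sweep s3 ?T4 (\<lambda>t. \<forall>k<m. t aMark (k + 2) \<noteq> 0 \<longleftrightarrow> k \<in> K)"
        proof -
          have "tri B sweep s3 (s2 vCnt 0 * 50 + 50) (\<lambda>t. \<forall>k<m. t aMark (k + 2) \<noteq> 0 \<longleftrightarrow> k \<in> sol m (s3 aLeft) (s3 aRight) best)"
            using best D(8,10) cnt bnd(2) r3 z3 by (intro tri_sweep) (auto simp: best_def cells)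
          then show ?thesis by (rule tri_mono) (use cnt in \<open>auto simp: K_def cells\<close>)
        qed
        show ?case
        proof (rule tri_SeqI[OF sw _ order_refl], goal_cases)
          case (1 s4)
          note f4 = agreeD[OF 1(1), unfolded writes_sweep]
          have r4: "s4 vm 0 = m" "s4 vn 0 = n" "s4 aIn = s aIn" "s4 aVal (s4 vBest 0) = Suc (card K)"
            using r3 opt(5) by (simp_all add: f4 cells best_def)
          have mk: "tri B mark_ends s4 (m * 60 + 60)
            (\<lambda>t. \<forall>u. t aVm u \<noteq> 0 \<longleftrightarrow> u \<in> (if K = {} then {0} else ends (edge_at es ` K)))"
          proof (rule tri_mark_ends)
            show "s4 aVal (s4 vBest 0) = 1 \<longleftrightarrow> K = {}" using r4 finK by simp
            show "s4 aVm u = 0" for u using z3 by (simp add: f4)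
            show "m \<le> B" "1 \<le> B" using bnd(4) by simp_all
            show "s4 aMark (k + 2) \<noteq> 0 \<longleftrightarrow> k \<in> K" if "k < m" for k using 1(2) that by blast
          qed (use r4 edges opt(1) in auto)
          show ?case
          proof (rule tri_SeqI[OF mk _ order_refl], goal_cases)
            case (1 s5)
            note f5 = agreeD[OF 1(1), unfolded writes_mark_ends]
            define vs where "vs = filter (\<lambda>u. s5 aVm u \<noteq> 0) [0..<n]"
            have s5: "s5 vn 0 = n" "n + 1 \<le> B" using r4 bnd(6) by (simp_all add: f5)
            show ?case
            proof (rule tri_SeqI[OF tri_write_verts[where s = s5, OF s5, folded vs_def] _ order_refl], goal_cases)
              case (1 s6)
              note f6 = agreeD[OF 1(1), unfolded writes_write_verts]
              define ks where "ks = filter (\<lambda>k. s6 aMark (k + 2) \<noteq> 0) [0..<m]"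
              have s6: "s6 vm 0 = m" "s6 aIn = s aIn" using r4 by (simp_all add: f6 f5)
              have lv: "length vs \<le> n" unfolding vs_def using length_filter_le[of _ "[0..<n]"] by simp
              have U: "s6 vU 0 = length vs" "s6 aOut 0 = length vs" "\<And>j. j < length vs \<Longrightarrow> s6 aOut (Suc j) = vs ! j"
                using 1(2) by auto
              have b6: "4 + s6 vU 0 + 2 * m \<le> B" using bnd(6) lv U by simp
              have ks: "distinct ks" "set ks = K"
              proof -
                have "s6 aMark = s4 aMark" by (simp add: f6 f5)
                then show "distinct ks" "set ks = K"
                  using \<open>\<forall>k<m. s4 aMark (k + 2) \<noteq> 0 \<longleftrightarrow> k \<in> K\<close> opt(1) unfolding ks_def by auto
              qed
              have vs: "distinct vs" "set vs = (if K = {} then {0} else ends (edge_at es ` K))"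
              proof -
                show "distinct vs" unfolding vs_def by simp
                define Z where "Z = (if K = {} then {0} else ends (edge_at es ` K))"
                have "Z \<subseteq> {..<n}" unfolding Z_def using n valid_ends[OF valid_es opt(1)] by simp
                moreover have "s5 aVm u \<noteq> 0 \<longleftrightarrow> u \<in> Z" for u
                  using \<open>\<forall>u. s5 aVm u \<noteq> 0 \<longleftrightarrow> u \<in> (if K = {} then {0} else ends (edge_at es ` K))\<close>
                  unfolding Z_def by blast
                ultimately have "set vs = Z" unfolding vs_def by auto
                then show "set vs = (if K = {} then {0} else ends (edge_at es ` K))" unfolding Z_def .
              qed
              have res: "valid_graph_lists vs (map ((!) es) ks)"
                "max_binary_tree_in (graph_of [0..<n] es) (graph_of vs (map ((!) es) ks))"
              proof -
                have c: "con (edge_at es ` K) u v" if "u \<in> ends (edge_at es ` K)" "v \<in> ends (edge_at es ` K)" for u v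
                  using opt(4) that no.conn_iff_ends by blast
                have m: "card K' \<le> card K" if "K' \<subseteq> {..<m}" "forest (edge_at es ` K')" "\<And>z. deg (edge_at es ` K') z \<le> 3"
                  "\<And>u v. u \<in> ends (edge_at es ` K') \<Longrightarrow> v \<in> ends (edge_at es ` K') \<Longrightarrow> con (edge_at es ` K') u v" for K'
                proof -
                  have "card (edge_at es ` K') \<le> card K"
                    using that no.conn_iff_ends by (intro opt(6)) auto
                  moreover have "card (edge_at es ` K') = card K'"
                    by (intro card_image inj_onI) (metis edge_at_sel(1))
                  ultimately show ?thesis by simp
                qed
                show "valid_graph_lists vs (map ((!) es) ks)"
                  "max_binary_tree_in (graph_of [0..<n] es) (graph_of vs (map ((!) es) ks))"
                  using max_binary_treeI[OF valid_es n opt(1,2,3) c m vs ks] by blast+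
              qed
              have "tri B write_edges s6 (m * 100 + 50) (\<lambda>t. t aOut (Suc (s6 vU 0)) = length ks \<and> (\<forall>j\<le>s6 vU 0. t aOut j = s6 aOut j) \<and>
                (\<forall>j<length ks. t aOut (2 + s6 vU 0 + 2 * j) = fst (es ! (ks ! j)) \<and> t aOut (3 + s6 vU 0 + 2 * j) = snd (es ! (ks ! j))))"
                unfolding ks_def by (rule tri_write_edges[where s = s6, OF s6(1) b6]) (use edges s6 in auto)
              then show ?case
              proof (rule tri_mono[OF _ order_refl], goal_cases)
                case (1 s7)
                have "has_output s7 (encode_graph vs (map ((!) es) ks))"
                  using 1(2) U by (intro has_output_graph) auto
                then show ?case using res unfolding Q_def by blast
              qed
            qed
          qed
        qed
      qed
    qed
  qed (use r zero bnd in auto)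
  moreover have "(W * 60 + M * 100 + 200) + (?T2 + (?T3 + (?T4 + ((m * 60 + 60) + ((n * 60 + 50) + (m * 100 + 50)))))) \<le> 4000 * Y"
  proof -
    have "M * (NC * NC * (W * (W * 150 + 800) + 900) + 80) \<le> 1850 * Y + 80 * M"
    proof -
      have "M * (NC * NC * (W * (W * 150 + 800) + 900)) \<le> M * (NC * NC * (1850 * (W * W)))"
        by (intro mult_le_mono2 square_bound(1))
      also have "\<dots> = 1850 * (M * (NC * NC * (W * W)))" by (simp only: mult.left_commute mult.assoc)
      also have "\<dots> \<le> 1850 * Y" using u(4) by (rule mult_le_mono2)
      finally show ?thesis by (simp add: add_mult_distrib2 del: mult_Suc mult_Suc_right)
    qed
    moreover have "M * (NC * (W * (W * 70 + 120) + 300)) \<le> 490 * Y"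
    proof -
      have "M * (NC * (W * (W * 70 + 120) + 300)) \<le> M * (NC * (490 * (W * W)))"
        by (intro mult_le_mono2 square_bound(2))
      also have "\<dots> = 490 * (M * (NC * (W * W)))" by (simp only: mult.left_commute mult.assoc)
      also have "\<dots> \<le> 490 * Y" using u(5) by (rule mult_le_mono2)
      finally show ?thesis .
    qed
    moreover have "n + m + N + 1 \<le> Y" "W \<le> Y" "M * (NC * NC) \<le> Y" using u by simp_all
    ultimately show ?thesis by simp
  qed
  ultimately show ?thesis unfolding Q_def Y_def by (rule tri_mono)
qed

end

text \<open>\<open>B\<close> bounds both the words and the time. The two phases take at most 4000
  units of \<open>unit_time\<close> each; the constant 10000 leaves room for the largest
  intermediate values.\<close>

theorem (in decomposition) max_tree_program_correct:
  assumes B: "10000 * ((n + m + N + 1) * (ncodes W * ncodes W * (W * W))) \<le> B"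
  shows "\<exists>t s vs fs. exec B max_tree_program (input_memory (encode_input n es ts bs)) t s \<and> t \<le> B \<and>
    valid_graph_lists vs fs \<and> has_output s (encode_graph vs fs) \<and>
    max_binary_tree_in (graph_of [0..<n] es) (graph_of vs fs)"
proof -
  define Y where "Y = (n + m + N + 1) * (ncodes W * ncodes W * (W * W))"
  have "10 * ((n + m + N + 1) * (W + 1)) \<le> B"
  proof -
    have NC: "1 \<le> ncodes W * ncodes W" using ncodes_ge[of W] by simp
    have "W + 1 \<le> 2 * (W * W)" by simp
    also have "\<dots> \<le> 2 * (ncodes W * ncodes W * (W * W))" using mult_le_mono1[OF NC, of "W * W"] by simp
    finally have "(n + m + N + 1) * (W + 1) \<le> (n + m + N + 1) * (2 * (ncodes W * ncodes W * (W * W)))" by (rule mult_le_mono2)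
    also have "\<dots> = 2 * Y" unfolding Y_def by (simp only: mult.left_commute)
    finally have "10 * ((n + m + N + 1) * (W + 1)) \<le> 20 * Y" by simp
    then show ?thesis using B unfolding Y_def[symmetric] by simp
  qed
  then interpret bounded_decomposition n es ts bs w B by unfold_locales
  have Y: "unit_time = Y" unfolding unit_time_def Y_def ..
  note u = unit_time_ge[unfolded Y]
  have BY: "10000 * Y \<le> B" using B unfolding Y_def .
  let ?s = "input_memory (encode_input n es ts bs)"
  have W4: "4 * W \<le> B" using u(2) BY by simp
  have T: "2000 * ((n + m + N + 1) * (W + 1)) \<le> 4000 * Y"
  proof -
    have "(n + m + N + 1) * (W + 1) = (n + m + N + 1) * W + (n + m + N + 1)" by simp
    then show ?thesis using u(1,3) by simp
  qed
  have "tri B max_tree_program ?s (8000 * Y) (\<lambda>t. \<exists>vs fs. valid_graph_lists vs fs \<and> has_output t (encode_graph vs fs) \<and>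
    max_binary_tree_in (graph_of [0..<n] es) (graph_of vs fs))"
    unfolding max_tree_program_def
  proof (rule tri_SeqI[OF tri_prepare[OF refl W4], where ?T2.0 = "4000 * Y"], goal_cases)
    case (1 s')
    note f = agreeD[OF 1(1), unfolded writes_prepare]
    have z: "s' a j = 0" if "a \<in> {aTab, aVal, aMark, aVm}" for a j
      using that by (auto simp: f input_memory_def)
    show ?case using 1(2) z BY by (intro tri_solve[unfolded Y]) auto
  qed (use T in simp)
  then obtain t s vs fs where t: "exec B max_tree_program ?s t s" "t \<le> 8000 * Y" "valid_graph_lists vs fs"
    "has_output s (encode_graph vs fs)" "max_binary_tree_in (graph_of [0..<n] es) (graph_of vs fs)"
    unfolding tri_def by blast
  have "t \<le> B" using t(2) BY by simp
  then show ?thesis using t by blast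
qed

text \<open>For \<open>w >= 2\<close> one has \<open>4 * (w + 1) <= 8 * w <= w ^ 4\<close>, and
  \<open>4 * (2 * w + 6) <= 20 * w\<close>. The factor \<open>8 ^ 8\<close> is the exact value of
  the left-hand side at \<open>w = 1\<close>, where the power on the right is 1, and it also covers
  \<open>w = 0\<close>.\<close>

lemma power_bound: "(4 * Suc w) ^ (2 * w + 6) \<le> 8 ^ 8 * w ^ (20 * w)" for w :: nat
proof -
  consider "w = 0" | "w = 1" | "2 \<le> w" by linarith
  then show ?thesis
  proof cases
    case 3
    have "4 * Suc w \<le> w ^ 4"
    proof -
      have "4 * Suc w \<le> 2 * 2 * 2 * w" using 3 by simp
      also have "\<dots> \<le> w * w * w * w" using 3 by (intro mult_le_mono) auto
      finally show ?thesis unfolding power4_eq_xxxx .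
    qed
    then have "(4 * Suc w) ^ (2 * w + 6) \<le> (w ^ 4) ^ (2 * w + 6)" by (rule power_mono) simp
    also have "\<dots> = w ^ (4 * (2 * w + 6))" by (simp only: power_mult)
    also have "\<dots> \<le> w ^ (20 * w)" using 3 by (intro power_increasing) auto
    also have "\<dots> \<le> 8 ^ 8 * w ^ (20 * w)" by simp
    finally show ?thesis .
  qed auto
qed

text \<open>The two factors \<open>ncodes\<close> contribute exponent \<open>2 * w + 2\<close>. One
  square of \<open>W\<close> comes from the number of edges and one from the cost of a merge,
  together exponent 4, hence \<open>2 * w + 6\<close>. In the constant,
  \<open>40000 * (K + 1) * 8 ^ 8\<close> bounds the factor, while \<open>K + 20\<close> bounds the
  exponent, with \<open>K\<close> inherited from the size of the decomposition.\<close>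

lemma unit_time_fpt:
  fixes n m N w K :: nat
  assumes n: "0 < n" and N: "N \<le> fpt_bound K w n" and m: "m \<le> N * (Suc w * Suc w)"
  shows "10000 * ((n + m + N + 1) * (ncodes (Suc w) * ncodes (Suc w) * (Suc w * Suc w)))
    \<le> fpt_bound (40000 * (K + 1) * 8 ^ 8 + K + 20) w n"
proof -
  define W where "W = Suc w"
  define P where "P = w ^ (K * w)"
  define v where "v = W * W"
  let ?c = "40000 * (K + 1) * 8 ^ 8 + K + 20"
  have P: "1 \<le> P" unfolding P_def by (cases "w = 0") auto
  have v: "1 \<le> v" unfolding v_def W_def by simp
  have N': "N \<le> K * (P * n)" using N unfolding fpt_bound_def P_def by (simp add: mult.assoc)
  have "n + m + N + 1 \<le> 4 * (K + 1) * (v * (P * n))"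
  proof -
    define z where "z = v * (P * n)"
    have Pz: "P * n \<le> z" unfolding z_def using mult_le_mono1[OF v, of "P * n"] by simp
    have "1 * n \<le> P * n" using P by (rule mult_le_mono1)
    then have nz: "n \<le> z" using Pz unfolding mult_1 by (rule order_trans)
    have "m \<le> K * (P * n) * v" using m mult_le_mono1[OF N', of v] unfolding v_def W_def by (rule order_trans)
    also have "\<dots> = K * z" unfolding z_def by (simp only: mult.assoc mult.commute mult.left_commute)
    finally have mz: "m \<le> K * z" .
    have Nz: "N \<le> K * z" using N' mult_le_mono2[OF Pz, of K] by (rule order_trans)
    have "4 * (K + 1) * z = 4 * (K * z) + 4 * z" by (simp add: algebra_simps)
    then show ?thesis unfolding z_def[symmetric] using nz mz Nz n by simp
  qed
  then have "(n + m + N + 1) * (ncodes W * ncodes W * v) \<le> 4 * (K + 1) * (v * (P * n)) * (ncodes W * ncodes W * v)"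
    by (rule mult_le_mono1)
  also have "\<dots> = 4 * (K + 1) * (P * n) * (ncodes W * ncodes W * (v * v))"
    by (simp only: mult.assoc mult.commute mult.left_commute)
  also have "\<dots> \<le> 4 * (K + 1) * (P * n) * (4 * W) ^ (2 * w + 6)"
  proof (rule mult_le_mono2)
    have "v * v = W ^ 4" unfolding v_def by (simp add: power4_eq_xxxx)
    also have "\<dots> \<le> (4 * W) ^ 4" by (rule power_mono) auto
    finally have "ncodes W * ncodes W * (v * v) \<le> (4 * W) ^ W * (4 * W) ^ W * (4 * W) ^ 4"
      unfolding ncodes_def by (rule mult_le_mono2)
    also have "\<dots> = (4 * W) ^ (2 * w + 6)"
      unfolding power_add[symmetric] by (rule arg_cong[where f = "(^) (4 * W)"]) (simp add: W_def)
    finally show "ncodes W * ncodes W * (v * v) \<le> (4 * W) ^ (2 * w + 6)" .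
  qed
  also have "\<dots> \<le> 4 * (K + 1) * (P * n) * (8 ^ 8 * w ^ (20 * w))"
    unfolding W_def by (intro mult_le_mono2 power_bound)
  also have "\<dots> = 4 * (K + 1) * 8 ^ 8 * (P * w ^ (20 * w)) * n" by (simp only: mult.assoc mult.commute mult.left_commute)
  finally have "10000 * ((n + m + N + 1) * (ncodes W * ncodes W * v)) \<le> 10000 * (4 * (K + 1) * 8 ^ 8 * (P * w ^ (20 * w)) * n)"
    by (rule mult_le_mono2)
  also have "\<dots> = 40000 * (K + 1) * 8 ^ 8 * (P * w ^ (20 * w)) * n" by simp
  also have "\<dots> \<le> ?c * w ^ (?c * w) * n"
  proof (intro mult_le_mono1 mult_le_mono)
    show "40000 * (K + 1) * 8 ^ 8 \<le> ?c" by simp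
    have "P * w ^ (20 * w) = w ^ ((K + 20) * w)" unfolding P_def by (simp add: power_add[symmetric] add_mult_distrib)
    also have "\<dots> \<le> w ^ (?c * w)"
    proof (cases "w = 0")
      case False
      then show ?thesis by (intro power_increasing mult_le_mono1) auto
    qed simp
    finally show "P * w ^ (20 * w) \<le> w ^ (?c * w)" .
  qed
  finally show ?thesis unfolding fpt_bound_def W_def v_def .
qed

theorem theorem4:
  shows "\<exists>P. \<forall>K. \<exists>c. \<forall>n w es ts bs.
    n > 0 \<and>
    valid_graph_lists [0..<n] es \<and>
    valid_graph_lists [0..<length bs] ts \<and>
    (\<forall>b\<in>set bs. distinct b) \<and>
    tree_decomposition (graph_of [0..<n] es) (graph_of [0..<length bs] ts) (\<lambda>i. set (bs ! i)) \<and>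
    width (graph_of [0..<length bs] ts) (\<lambda>i. set (bs ! i)) = w \<and>
    treewidth (graph_of [0..<n] es) = w \<and>
    length bs \<le> fpt_bound K w n
    \<longrightarrow> (\<exists>t s vs fs.
          exec (fpt_bound c w n) P (input_memory (encode_input n es ts bs)) t s \<and>
          t \<le> fpt_bound c w n \<and>
          valid_graph_lists vs fs \<and>
          has_output s (encode_graph vs fs) \<and>
          max_binary_tree_in (graph_of [0..<n] es) (graph_of vs fs))"
\<comment> \<open>The program is fixed before \<open>K\<close>; the constant is left open here and
  becomes the one of \<open>unit_time_fpt\<close>, which depends on \<open>K\<close> alone.\<close>
proof (rule exI[of _ max_tree_program], rule allI, rule exI, intro allI impI)
  fix K n w :: nat and es ts :: "(nat \<times> nat) list" and bs :: "nat list list"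
  assume a: "n > 0 \<and> valid_graph_lists [0..<n] es \<and> valid_graph_lists [0..<length bs] ts \<and>
    (\<forall>b\<in>set bs. distinct b) \<and>
    tree_decomposition (graph_of [0..<n] es) (graph_of [0..<length bs] ts) (\<lambda>i. set (bs ! i)) \<and>
    width (graph_of [0..<length bs] ts) (\<lambda>i. set (bs ! i)) = w \<and>
    treewidth (graph_of [0..<n] es) = w \<and> length bs \<le> fpt_bound K w n"
  interpret decomposition n es ts bs w using a by unfold_locales auto
  show "\<exists>t s vs fs.
          exec (fpt_bound (40000 * (K + 1) * 8 ^ 8 + K + 20) w n) max_tree_program (input_memory (encode_input n es ts bs)) t s \<and>
          t \<le> fpt_bound (40000 * (K + 1) * 8 ^ 8 + K + 20) w n \<and>
          valid_graph_lists vs fs \<and>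
          has_output s (encode_graph vs fs) \<and>
          max_binary_tree_in (graph_of [0..<n] es) (graph_of vs fs)"
    using max_tree_program_correct unit_time_fpt[OF n _ m_bound] a by blast
qed

end
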